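(* Let $\Gamma = SU_3(3)$ be the simple group of order $6048$ and $\Gamma.2 = \mathrm{Aut}(\Gamma) \cong G_2(2)$, of order $12096$. Consider quadruples $C=(C_1,C_2,C_3,C_4)$ of non-identity conjugacy classes in $G$, for $G=\Gamma.2$ or $G=\Gamma$. (1) There are no strictly rigid quadruples in $G=\Gamma.2$. (2) Up to reordering and up to conjugation by the outer involution of $\Gamma$, there are exactly five strictly rigid quadruples in $G=\Gamma$, namely $$(3A,3A,3A,4B),\quad (4A,4A,4A,4B),\quad (2A,2A,3A,4A),\quad (4A,4A,4A,2A),\quad (4A,4A,3A,3A),$$ and the corresponding degree $28$ covers of the projective line have genus $9$, $9$, $3$, $6$, $9$ respectively. (3) Moreover, for $G = \Gamma$ or $G=\Gamma.2$, there are no other rigid quadruples $C$ with $\overline{\mu}(C) < 4$.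
   Context: **Groups and classes.** $\Gamma=SU_3(3)\subset SL_3(\mathbb{F}_9)$ is the special unitary group of a nondegenerate Hermitian form on $\mathbb{F}_9^3$ (its centre is trivial). $\Gamma.2=\mathrm{Aut}(\Gamma)$ is generated by $\Gamma$ and the involution induced by the Frobenius automorphism of $\mathbb{F}_9/\mathbb{F}_3$ in an orthonormal basis (the "outer involution"). Both groups act faithfully and transitively on the $28$ isotropic points of $\mathbb{P}^2(\mathbb{F}_9)$, giving $\Gamma\subset\Gamma.2\subset A_{28}$. Conjugacy classes of $\Gamma$ (Atlas names) used here, with cardinality and cycle type in degree $28$: - $2A$: the involutions, size $63$, cycle type $2^{12}1^4$. - $3A$: the unitary transvections, size $56$, cycle type $3^9 1$. - $4A$ and $4B$: the two classes of size $63$ of elements of order $4$, cycle type $4^6 1^4$. They are inverse to each other and interchanged by the outer involution. With $i\in\mathbb{F}_9$, $i^2=-1$, they are the classes of $\mathrm{diag}(i,i,-1)$ and $\mathrm{diag}(-i,-i,-1)$ in an orthonormal basis. **Rigidity.** For a finite centreless group $G$ and a list $C=(C_1,\dots,C_z)$ of conjugacy classes of $G$, let $$\overline{\Sigma}(C)=\{(g_1,\dots,g_z)\in C_1\times\cdots\times C_z : g_1\cdots g_z=1\},$$ $$\Sigma(C)=\{(g_1,\dots,g_z)\in\overline{\Sigma}(C):\langle g_1,\dots,g_z\rangle=G\},$$ and put $\overline{\mu}(C)=|\overline{\Sigma}(C)|/|G|$ and $\mu(C)=|\Sigma(C)|/|G|$. The list $C$ is *rigid* if $\mu(C)=1$,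 and *strictly rigid* if moreover $\overline{\mu}(C)=1$. **Genus.** For $G\subseteq S_n$ transitive and $(g_1,\dots,g_z)\in\Sigma(C)$, the associated degree $n$ cover of the complex projective line with local monodromies $g_i$ has genus $g$ given by $\sum_{i=1}^z|\lambda_i| = (z-2)n+2-2g$, where $|\lambda_i|$ is the number of cycles (fixed points included) of $g_i$ on $n$ points. Here $n=28$. *)

theory Defs
  imports
    "HOL-Analysis.Analysis"
    "HOL-Algebra.Bij"
    "HOL-Algebra.Generated_Groups"
    "HOL-Combinatorics.Orbits"
    "HOL-Library.Multiset"
begin

section \<open>Rigidity of lists of conjugacy classes\<close>

definition conjugacy_class :: "('a, 'b) monoid_scheme \<Rightarrow> 'a \<Rightarrow> 'a set" where
  "conjugacy_class G x = {h \<otimes>\<^bsub>G\<^esub> x \<otimes>\<^bsub>G\<^esub> inv\<^bsub>G\<^esub> h | h. h \<in> carrier G}"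

definition class_quadruple :: "('a, 'b) monoid_scheme \<Rightarrow> 'a set list \<Rightarrow> bool" where
  "class_quadruple G Cs \<longleftrightarrow> length Cs = 4 \<and>
     (\<forall>C\<in>set Cs. \<exists>x\<in>carrier G. x \<noteq> \<one>\<^bsub>G\<^esub> \<and> C = conjugacy_class G x)"

definition Sigma_bar :: "('a, 'b) monoid_scheme \<Rightarrow> 'a set list \<Rightarrow> 'a list set" where
  "Sigma_bar G Cs =
     {gs. list_all2 (\<in>) gs Cs \<and> foldr (\<lambda>x y. x \<otimes>\<^bsub>G\<^esub> y) gs \<one>\<^bsub>G\<^esub> = \<one>\<^bsub>G\<^esub>}"

definition Sigma_gen :: "('a, 'b) monoid_scheme \<Rightarrow> 'a set list \<Rightarrow> 'a list set" where
  "Sigma_gen G Cs = {gs \<in> Sigma_bar G Cs. generate G (set gs) = carrier G}"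

definition mu_bar :: "('a, 'b) monoid_scheme \<Rightarrow> 'a set list \<Rightarrow> real" where
  "mu_bar G Cs = real (card (Sigma_bar G Cs)) / real (card (carrier G))"

definition mu :: "('a, 'b) monoid_scheme \<Rightarrow> 'a set list \<Rightarrow> real" where
  "mu G Cs = real (card (Sigma_gen G Cs)) / real (card (carrier G))"

definition rigid :: "('a, 'b) monoid_scheme \<Rightarrow> 'a set list \<Rightarrow> bool" where
  "rigid G Cs \<longleftrightarrow> mu G Cs = 1"

definition strictly_rigid :: "('a, 'b) monoid_scheme \<Rightarrow> 'a set list \<Rightarrow> bool" where
  "strictly_rigid G Cs \<longleftrightarrow> rigid G Cs \<and> mu_bar G Cs = 1"

section \<open>Genus of the cover with given local monodromies\<close>

text \<open>For a permutation \<open>p\<close> of a finite set \<open>X\<close>, the orbits below are the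
  cycles of \<open>p\<close> on \<open>X\<close>, fixed points included.\<close>

definition num_cycles :: "'p set \<Rightarrow> ('p \<Rightarrow> 'p) \<Rightarrow> nat" where
  "num_cycles X p = card (orbit p ` X)"

text \<open>Riemann--Hurwitz for the degree \<open>card X\<close> cover of the projective line whose
  local monodromies are the permutations \<open>ps\<close> of \<open>X\<close>.\<close>

definition cover_has_genus :: "'p set \<Rightarrow> ('p \<Rightarrow> 'p) list \<Rightarrow> nat \<Rightarrow> bool" where
  "cover_has_genus X ps g \<longleftrightarrow>
     (\<Sum>p\<leftarrow>ps. int (num_cycles X p)) = (int (length ps) - 2) * int (card X) + 2 - 2 * int g"

section \<open>The special unitary group\<close>

text \<open>The type \<open>'k\<close> is meant to be a field with 9 elements, so that cubing is the
  Frobenius automorphism over the prime field, and the standard basis is orthonormal for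
  the Hermitian form.\<close>

definition hermitian_form :: "'k::field ^ 3 \<Rightarrow> 'k ^ 3 \<Rightarrow> 'k" where
  "hermitian_form v w = (\<Sum>j\<in>UNIV. v $ j * (w $ j) ^ 3)"

definition SU3 :: "('k::field ^ 3 ^ 3) monoid" where
  "SU3 = \<lparr>carrier = {A. det A = 1 \<and>
              (\<forall>v w. hermitian_form (A *v v) (A *v w) = hermitian_form v w)},
          mult = (**), one = mat 1\<rparr>"

definition outer_involution :: "'k::field ^ 3 ^ 3 \<Rightarrow> 'k ^ 3 ^ 3" where
  "outer_involution A = (\<chi> r s. (A $ r $ s) ^ 3)"

text \<open>Points of the projective plane are represented as one-dimensional subspaces.\<close>

definition isotropic_points :: "('k::field ^ 3) set set" where
  "isotropic_points = {vec.span {v} | v. v \<noteq> 0 \<and> hermitian_form v v = 0}"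

definition point_action :: "'k::field ^ 3 ^ 3 \<Rightarrow> ('k ^ 3) set \<Rightarrow> ('k ^ 3) set" where
  "point_action A P = (\<lambda>v. A *v v) ` P"

text \<open>A transvection is a map \<open>v \<mapsto> v + f(v) u\<close> with \<open>u \<noteq> 0\<close> and \<open>f\<close> a nonzero linear
  form vanishing at \<open>u\<close>; here \<open>w\<close> is the coefficient vector of \<open>f\<close>.\<close>

definition transvection :: "'k::field ^ 3 ^ 3 \<Rightarrow> bool" where
  "transvection A \<longleftrightarrow> (\<exists>u w. u \<noteq> 0 \<and> w \<noteq> 0 \<and> (\<Sum>j\<in>UNIV. w $ j * u $ j) = 0 \<and>
     (\<forall>v. A *v v = v + (\<Sum>j\<in>UNIV. w $ j * v $ j) *s u))"

definition diag3 :: "'k::field \<Rightarrow> 'k \<Rightarrow> 'k \<Rightarrow> 'k ^ 3 ^ 3" where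
  "diag3 a b c = vector [vector [a, 0, 0], vector [0, b, 0], vector [0, 0, c]]"

definition class_2A :: "('k::field ^ 3 ^ 3) set" where
  "class_2A = {A \<in> carrier SU3. A \<noteq> mat 1 \<and> A ** A = mat 1}"

definition class_3A :: "('k::field ^ 3 ^ 3) set" where
  "class_3A = {A \<in> carrier SU3. transvection A}"

text \<open>The parameter \<open>ii\<close> is a square root of \<open>-1\<close>; replacing it by its
  negative interchanges the next two classes.\<close>

definition class_4A :: "'k::field \<Rightarrow> ('k ^ 3 ^ 3) set" where
  "class_4A ii = conjugacy_class SU3 (diag3 ii ii (-1))"

definition class_4B :: "'k::field \<Rightarrow> ('k ^ 3 ^ 3) set" where
  "class_4B ii = conjugacy_class SU3 (diag3 (- ii) (- ii) (-1))"

text \<open>Equality of lists of classes up to reordering and up to applying the outer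
  involution simultaneously to all entries.\<close>

definition same_up_to_outer :: "('k::field ^ 3 ^ 3) set list \<Rightarrow> ('k ^ 3 ^ 3) set list \<Rightarrow> bool" where
  "same_up_to_outer Cs Ds \<longleftrightarrow>
     mset Cs = mset Ds \<or> mset (map ((`) outer_involution) Cs) = mset Ds"

end

theory Submission
  imports Defs
begin

text \<open>
  Everything is reduced to an explicit model: matrices over an explicit field with 9 elements, together with
  a flag for the Frobenius map. Conjugacy classes are recognised by traces and polynomial relations.
  The class multiplication coefficients of a few small classes are counted; those of the other classes follow
  by associativity of the class algebra. They yield \<mu>-bar for all quadruples of classes.

  A quadruple with \<mu>-bar below 1 is not rigid. In the remaining cases with \<mu>-bar below 4, either Scott's
  lemma (three of the elements are reflections up to scalars) or an invariant configuration of points shows that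
  no tuple generates, or two generating tuples are exhibited that are not conjugate, so that \<open>\<mu> \<ge> 2\<close> as the group
  is centreless. The quadruples that survive have \<mu>-bar equal to 1 and a generating tuple, whose orbit then
  exhausts all tuples.

  The automorphism group is the model with the Frobenius map: an automorphism is determined by the images of two
  generators of order 2 and 7 with product of order 6, and there are only 12096 pairs of this kind.
\<close>

section \<open>Class products and rigidity in finite groups\<close>

text \<open>All finite checks are evaluated by rewriting, so nothing may range over pairs of the
  6048 elements. The group is met only as products of 63 coset representatives with the 96 elements
  of a point stabiliser. Class sizes need no classification: the centraliser order of one
  representative bounds each labelled orbit from below, the orbits are disjoint and the bounds add
  up to 12096, so every bound is sharp and every element has a label. Both groups share one list of
  orbits under the simple group; a class of the extension is a union of one or two of them. Only 1A,
  2A, 3A, 4A, 4B, 4C and 7A are counted element by element. The last one is among them because 7A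
  and 7B occur with equal coefficients in every product of two other classes, so solving for a
  single unknown class never isolates one of them. Products of two outer classes are obtained from
  products of an inner and an outer class by rotating triples.\<close>

definition prod_count :: "('a, 'b) monoid_scheme \<Rightarrow> 'a set \<Rightarrow> 'a set \<Rightarrow> 'a \<Rightarrow> nat" where
  "prod_count G A B z = card {(x, y). x \<in> A \<and> y \<in> B \<and> x \<otimes>\<^bsub>G\<^esub> y = z}"

definition conj_invariant :: "('a, 'b) monoid_scheme \<Rightarrow> 'a set \<Rightarrow> bool" where
  "conj_invariant G A \<longleftrightarrow> A \<subseteq> carrier G \<and>
     (\<forall>g\<in>carrier G. \<forall>x\<in>A. g \<otimes>\<^bsub>G\<^esub> x \<otimes>\<^bsub>G\<^esub> inv\<^bsub>G\<^esub> g \<in> A)"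

definition centreless :: "('a, 'b) monoid_scheme \<Rightarrow> bool" where
  "centreless G \<longleftrightarrow> (\<forall>z\<in>carrier G.
     (\<forall>x\<in>carrier G. z \<otimes>\<^bsub>G\<^esub> x = x \<otimes>\<^bsub>G\<^esub> z) \<longrightarrow> z = \<one>\<^bsub>G\<^esub>)"

text \<open>A predicate on the generated subgroup covers \<open>Sigma_bar\<close> (always true) and
  \<open>Sigma_gen\<close> at once, so that invariance under reordering is proved a single
  time.\<close>

definition Sigma_where ::
    "('a, 'b) monoid_scheme \<Rightarrow> ('a set \<Rightarrow> bool) \<Rightarrow> 'a set list \<Rightarrow> 'a list set" where
  "Sigma_where G P Cs = {gs \<in> Sigma_bar G Cs. P (generate G (set gs))}"

lemma Sigma_bar_eq_where: "Sigma_bar G Cs = Sigma_where G (\<lambda>_. True) Cs"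
  and Sigma_gen_eq_where: "Sigma_gen G Cs = Sigma_where G (\<lambda>S. S = carrier G) Cs"
  by (auto simp: Sigma_where_def Sigma_gen_def)

lemma Sigma_gen_subset: "Sigma_gen G Cs \<subseteq> Sigma_bar G Cs"
  by (auto simp: Sigma_gen_def)

lemma list_all2_mem_lists: "list_all2 (\<in>) gs Cs \<Longrightarrow> gs \<in> lists (\<Union>(set Cs)) \<and> length gs = length Cs"
  by (induction rule: list_all2_induct) auto

lemma finite_Sigma_bar: "(\<And>C. C \<in> set Cs \<Longrightarrow> finite C) \<Longrightarrow> finite (Sigma_bar G Cs)"
proof -
  assume a: "\<And>C. C \<in> set Cs \<Longrightarrow> finite C"
  have "Sigma_bar G Cs \<subseteq> {gs. set gs \<subseteq> \<Union>(set Cs) \<and> length gs = length Cs}"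
    using list_all2_mem_lists by (fastforce simp: Sigma_bar_def)
  moreover have "finite (\<Union>(set Cs))" using a by auto
  ultimately show ?thesis using finite_lists_length_eq finite_subset by blast
qed

lemma card_le_fibres:
  assumes "finite A" "\<And>y. y \<in> f ` A \<Longrightarrow> card {x \<in> A. f x = y} \<le> c"
  shows "card A \<le> c * card (f ` A)"
proof -
  have "card A = (\<Sum>y\<in>f ` A. card {x \<in> A. f x = y})"
    using sum.image_gen[OF assms(1), of "\<lambda>_. 1::nat" f] by simp
  also have "\<dots> \<le> (\<Sum>y\<in>f ` A. c)" using assms(2) by (rule sum_mono)
  finally show ?thesis by (simp add: mult.commute)
qed

context group
begin

lemma inv_mult_cancel: "g \<in> carrier G \<Longrightarrow> w \<in> carrier G \<Longrightarrow> inv g \<otimes> (g \<otimes> w) = w"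
  by (metis inv_closed l_inv l_one m_assoc)

lemma mult_inv_cancel: "g \<in> carrier G \<Longrightarrow> w \<in> carrier G \<Longrightarrow> g \<otimes> (inv g \<otimes> w) = w"
  by (metis inv_closed r_inv l_one m_assoc)

lemma conj_conj:
  "g \<in> carrier G \<Longrightarrow> h \<in> carrier G \<Longrightarrow> x \<in> carrier G \<Longrightarrow>
   g \<otimes> (h \<otimes> x \<otimes> inv h) \<otimes> inv g = (g \<otimes> h) \<otimes> x \<otimes> inv (g \<otimes> h)"
  by (simp add: inv_mult_group m_assoc)

lemma conj_mult:
  "g \<in> carrier G \<Longrightarrow> x \<in> carrier G \<Longrightarrow> y \<in> carrier G \<Longrightarrow>
   g \<otimes> (x \<otimes> y) \<otimes> inv g = (g \<otimes> x \<otimes> inv g) \<otimes> (g \<otimes> y \<otimes> inv g)"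
  by (simp add: m_assoc inv_mult_cancel)

lemma conj_inj:
  "g \<in> carrier G \<Longrightarrow> x \<in> carrier G \<Longrightarrow> y \<in> carrier G \<Longrightarrow>
   g \<otimes> x \<otimes> inv g = g \<otimes> y \<otimes> inv g \<longleftrightarrow> x = y"
  by simp

lemma conj_cancel:
  "g \<in> carrier G \<Longrightarrow> x \<in> carrier G \<Longrightarrow> inv g \<otimes> (g \<otimes> x \<otimes> inv g) \<otimes> g = x"
  by (simp add: m_assoc inv_mult_cancel)

lemma conj_eq_self_iff:
  "g \<in> carrier G \<Longrightarrow> x \<in> carrier G \<Longrightarrow> g \<otimes> x \<otimes> inv g = x \<longleftrightarrow> g \<otimes> x = x \<otimes> g"
  by (metis inv_solve_right m_closed)

lemma conjugacy_class_conj_invariant: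
  assumes "x \<in> carrier G"
  shows "conj_invariant G (conjugacy_class G x)"
  unfolding conj_invariant_def conjugacy_class_def using assms
  by (auto simp: conj_conj)

lemma prod_count_left:
  assumes "A \<subseteq> carrier G" "B \<subseteq> carrier G" "z \<in> carrier G"
  shows "prod_count G A B z = card {x \<in> A. inv x \<otimes> z \<in> B}"
proof -
  have "{(x, y). x \<in> A \<and> y \<in> B \<and> x \<otimes> y = z} = (\<lambda>x. (x, inv x \<otimes> z)) ` {x \<in> A. inv x \<otimes> z \<in> B}"
  proof (intro subset_antisym subsetI)
    fix p assume "p \<in> {(x, y). x \<in> A \<and> y \<in> B \<and> x \<otimes> y = z}"
    then obtain x y where p: "p = (x, y)" "x \<in> A" "y \<in> B" "x \<otimes> y = z" by auto
    then have "inv x \<otimes> z = y" using assms inv_mult_cancel[of x y] by blast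
    then show "p \<in> (\<lambda>x. (x, inv x \<otimes> z)) ` {x \<in> A. inv x \<otimes> z \<in> B}" using p by auto
  next
    fix p assume "p \<in> (\<lambda>x. (x, inv x \<otimes> z)) ` {x \<in> A. inv x \<otimes> z \<in> B}"
    then obtain x where "p = (x, inv x \<otimes> z)" "x \<in> A" "inv x \<otimes> z \<in> B" by auto
    then show "p \<in> {(x, y). x \<in> A \<and> y \<in> B \<and> x \<otimes> y = z}"
      using assms mult_inv_cancel[of x z] by auto
  qed
  then show ?thesis unfolding prod_count_def by (simp add: card_image inj_on_def)
qed

lemma prod_count_right:
  assumes "A \<subseteq> carrier G" "B \<subseteq> carrier G" "z \<in> carrier G"
  shows "prod_count G A B z = card {y \<in> B. z \<otimes> inv y \<in> A}"
proof -
  have "{(x, y). x \<in> A \<and> y \<in> B \<and> x \<otimes> y = z} = (\<lambda>y. (z \<otimes> inv y, y)) ` {y \<in> B. z \<otimes> inv y \<in> A}"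
  proof (intro subset_antisym subsetI)
    fix p assume "p \<in> {(x, y). x \<in> A \<and> y \<in> B \<and> x \<otimes> y = z}"
    then obtain x y where p: "p = (x, y)" "x \<in> A" "y \<in> B" "x \<otimes> y = z" by auto
    then have "z \<otimes> inv y = x" using assms by (metis inv_solve_right subsetD)
    then show "p \<in> (\<lambda>y. (z \<otimes> inv y, y)) ` {y \<in> B. z \<otimes> inv y \<in> A}" using p by auto
  next
    fix p assume "p \<in> (\<lambda>y. (z \<otimes> inv y, y)) ` {y \<in> B. z \<otimes> inv y \<in> A}"
    then obtain y where p: "p = (z \<otimes> inv y, y)" "y \<in> B" "z \<otimes> inv y \<in> A" by auto
    then have "(z \<otimes> inv y) \<otimes> y = z" using assms by (metis inv_closed l_inv m_assoc r_one subsetD)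
    then show "p \<in> {(x, y). x \<in> A \<and> y \<in> B \<and> x \<otimes> y = z}" using p by auto
  qed
  then show ?thesis unfolding prod_count_def by (simp add: card_image inj_on_def)
qed

text \<open>Invariance is asked for the one element \<open>g\<close> only, because the orbits to
  which this is applied are invariant under the simple group but not under its extension. The
  inverse of \<open>g\<close> gives the opposite inequality.\<close>

lemma prod_count_conj:
  assumes "A \<subseteq> carrier G" "B \<subseteq> carrier G" "z \<in> carrier G" "g \<in> carrier G"
    and "\<And>x. x \<in> A \<Longrightarrow> g \<otimes> x \<otimes> inv g \<in> A" "\<And>x. x \<in> B \<Longrightarrow> g \<otimes> x \<otimes> inv g \<in> B"
    and fin: "finite (carrier G)"
  shows "prod_count G A B z \<le> prod_count G A B (g \<otimes> z \<otimes> inv g)"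
proof -
  let ?f = "\<lambda>(x, y). (g \<otimes> x \<otimes> inv g, g \<otimes> y \<otimes> inv g)"
  let ?S = "\<lambda>z. {(x, y). x \<in> A \<and> y \<in> B \<and> x \<otimes> y = z}"
  have "?f ` ?S z \<subseteq> ?S (g \<otimes> z \<otimes> inv g)" using assms by (auto simp: conj_mult subset_iff)
  moreover have "inj_on ?f (?S z)"
  proof (rule inj_onI, clarify)
    fix x y x' y' assume "x \<in> A" "y \<in> B" "x' \<in> A" "y' \<in> B"
      "g \<otimes> x \<otimes> inv g = g \<otimes> x' \<otimes> inv g" "g \<otimes> y \<otimes> inv g = g \<otimes> y' \<otimes> inv g"
    then show "x = x' \<and> y = y'" using assms(1,2,4) conj_inj by (meson subsetD)
  qed
  moreover have "finite (?S (g \<otimes> z \<otimes> inv g))"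
    by (rule finite_subset[of _ "carrier G \<times> carrier G"]) (use assms fin in auto)
  ultimately show ?thesis unfolding prod_count_def by (metis (no_types, lifting) card_inj_on_le)
qed

text \<open>From a b c d = 1 follows a b = d^-1 c^-1, and the tuples are sorted by this common value
  \<open>z\<close>. This reduces quadruples to class products of two factors.\<close>

lemma card_Sigma_bar_4:
  assumes fin: "finite (carrier G)"
    and sub: "A \<subseteq> carrier G" "B \<subseteq> carrier G" "C \<subseteq> carrier G" "D \<subseteq> carrier G"
  shows "card (Sigma_bar G [A, B, C, D]) =
    (\<Sum>z\<in>carrier G. prod_count G A B z * prod_count G (m_inv G ` D) (m_inv G ` C) z)"
proof -
  let ?P = "\<lambda>A B z. {(x, y). x \<in> A \<and> y \<in> B \<and> x \<otimes> y = z}"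
  let ?T = "SIGMA z:carrier G. ?P A B z \<times> ?P (m_inv G ` D) (m_inv G ` C) z"
  let ?f = "\<lambda>(z, (a, b), (d, c)). [a, b, inv c, inv d]"
  have fP: "finite (?P A B z)" if "A \<subseteq> carrier G" "B \<subseteq> carrier G" for A B z
    by (rule finite_subset[of _ "carrier G \<times> carrier G"]) (use that fin in auto)
  have i: "m_inv G ` D \<subseteq> carrier G" "m_inv G ` C \<subseteq> carrier G" using sub by auto
  have "Sigma_bar G [A, B, C, D] = ?f ` ?T"
  proof (intro subset_antisym subsetI)
    fix gs assume "gs \<in> Sigma_bar G [A, B, C, D]"
    then obtain a b c d where gs: "gs = [a, b, c, d]" "a \<in> A" "b \<in> B" "c \<in> C" "d \<in> D"
      and e: "a \<otimes> (b \<otimes> (c \<otimes> (d \<otimes> \<one>))) = \<one>"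
      by (auto simp: Sigma_bar_def list_all2_Cons2)
    have car: "a \<in> carrier G" "b \<in> carrier G" "c \<in> carrier G" "d \<in> carrier G" using gs sub by auto
    have "(a \<otimes> b) \<otimes> (c \<otimes> d) = \<one>" using e car by (simp add: m_assoc)
    then have "a \<otimes> b = inv (c \<otimes> d)" using car by (metis inv_equality inv_inv m_closed)
    then have "a \<otimes> b = inv d \<otimes> inv c" using car by (simp add: inv_mult_group)
    then have "(a \<otimes> b, (a, b), (inv d, inv c)) \<in> ?T" using gs car by auto
    moreover have "?f (a \<otimes> b, (a, b), (inv d, inv c)) = gs" using gs car by simp
    ultimately show "gs \<in> ?f ` ?T" by (metis (no_types, lifting) imageI)
  next
    fix gs assume "gs \<in> ?f ` ?T"
    then obtain a b c d where g: "a \<in> A" "b \<in> B" "c \<in> C" "d \<in> D" "a \<otimes> b = inv d \<otimes> inv c"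
      and gs: "gs = [a, b, inv (inv c), inv (inv d)]" by auto
    have car: "a \<in> carrier G" "b \<in> carrier G" "c \<in> carrier G" "d \<in> carrier G" using g sub by auto
    have "a \<otimes> (b \<otimes> (c \<otimes> (d \<otimes> \<one>))) = (a \<otimes> b) \<otimes> (c \<otimes> d)" using car by (simp add: m_assoc)
    also have "\<dots> = inv (c \<otimes> d) \<otimes> (c \<otimes> d)" using car g(5) by (simp add: inv_mult_group)
    also have "\<dots> = \<one>" using car by simp
    finally show "gs \<in> Sigma_bar G [A, B, C, D]" using g car by (simp add: gs Sigma_bar_def)
  qed
  moreover have "inj_on ?f ?T"
    using sub i by (auto intro!: inj_onI simp: subset_iff)
  ultimately have "card (Sigma_bar G [A, B, C, D]) = card ?T" by (simp add: card_image)
  also have "\<dots> = (\<Sum>z\<in>carrier G. prod_count G A B z * prod_count G (m_inv G ` D) (m_inv G ` C) z)"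
    using fP sub i fin by (subst card_SigmaI) (auto simp: prod_count_def card_cartesian_product)
  finally show ?thesis .
qed

text \<open>Both sides count the triples (a, b, d) with product \<open>w\<close>, sorted by the
  value of a b on the left and by the value of b d on the right.\<close>

lemma prod_count_assoc:
  assumes fin: "finite (carrier G)" and w: "w \<in> carrier G"
    and sub: "A \<subseteq> carrier G" "B \<subseteq> carrier G" "D \<subseteq> carrier G"
  shows "(\<Sum>z\<in>carrier G. prod_count G A B z * (if inv z \<otimes> w \<in> D then 1 else 0)) =
         (\<Sum>y\<in>carrier G. prod_count G B D y * (if w \<otimes> inv y \<in> A then 1 else 0))"
proof -
  let ?P = "\<lambda>A B z. {(x, y). x \<in> A \<and> y \<in> B \<and> x \<otimes> y = z}"
  have fP: "finite (?P A B z)" if "A \<subseteq> carrier G" "B \<subseteq> carrier G" for A B z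
    by (rule finite_subset[of _ "carrier G \<times> carrier G"]) (use that fin in auto)
  let ?L = "SIGMA z:{z\<in>carrier G. inv z \<otimes> w \<in> D}. ?P A B z"
  let ?R = "SIGMA y:{y\<in>carrier G. w \<otimes> inv y \<in> A}. ?P B D y"
  let ?T = "{(a, b, d). a \<in> A \<and> b \<in> B \<and> d \<in> D \<and> a \<otimes> (b \<otimes> d) = w}"
  have "(\<Sum>z\<in>carrier G. prod_count G A B z * (if inv z \<otimes> w \<in> D then 1 else 0)) = card ?L"
    using fP sub fin by (subst card_SigmaI) (auto simp: prod_count_def sum.inter_filter intro!: sum.cong)
  moreover have "(\<Sum>y\<in>carrier G. prod_count G B D y * (if w \<otimes> inv y \<in> A then 1 else 0)) = card ?R"
    using fP sub fin by (subst card_SigmaI) (auto simp: prod_count_def sum.inter_filter intro!: sum.cong)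
  moreover have "?L = (\<lambda>(a, b, d). (a \<otimes> b, (a, b))) ` ?T"
  proof (intro subset_antisym subsetI)
    fix p assume "p \<in> ?L"
    then obtain z a b where p: "p = (z, (a, b))" and h: "a \<in> A" "b \<in> B" "a \<otimes> b = z" "inv z \<otimes> w \<in> D"
      by auto
    have c: "a \<in> carrier G" "b \<in> carrier G" using h sub by auto
    have "a \<otimes> (b \<otimes> (inv z \<otimes> w)) = w"
      using c w mult_inv_cancel[of "a \<otimes> b" w] by (simp add: h(3)[symmetric] m_assoc)
    then have "(a, b, inv z \<otimes> w) \<in> ?T" using h by simp
    then show "p \<in> (\<lambda>(a, b, d). (a \<otimes> b, (a, b))) ` ?T" using p h(3) by force
  next
    fix p assume "p \<in> (\<lambda>(a, b, d). (a \<otimes> b, (a, b))) ` ?T"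
    then obtain a b d where p: "p = (a \<otimes> b, (a, b))" and h: "a \<in> A" "b \<in> B" "d \<in> D" "a \<otimes> (b \<otimes> d) = w"
      by auto
    have c: "a \<in> carrier G" "b \<in> carrier G" "d \<in> carrier G" using h sub by auto
    have "inv (a \<otimes> b) \<otimes> w = d"
      using c inv_mult_cancel[of "a \<otimes> b" d] by (simp add: h(4)[symmetric] m_assoc)
    then show "p \<in> ?L" using p h c by simp
  qed
  moreover have "?R = (\<lambda>(a, b, d). (b \<otimes> d, (b, d))) ` ?T"
  proof (intro subset_antisym subsetI)
    fix p assume "p \<in> ?R"
    then obtain y b d where p: "p = (y, (b, d))" and h: "b \<in> B" "d \<in> D" "b \<otimes> d = y" "w \<otimes> inv y \<in> A"
      by auto
    have c: "b \<in> carrier G" "d \<in> carrier G" using h sub by auto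
    have "(w \<otimes> inv y) \<otimes> y = w" using c w h(3) by (metis inv_solve_right' m_closed inv_closed)
    then have "(w \<otimes> inv y, b, d) \<in> ?T" using h by simp
    then show "p \<in> (\<lambda>(a, b, d). (b \<otimes> d, (b, d))) ` ?T" using p h(3) by force
  next
    fix p assume "p \<in> (\<lambda>(a, b, d). (b \<otimes> d, (b, d))) ` ?T"
    then obtain a b d where p: "p = (b \<otimes> d, (b, d))" and h: "a \<in> A" "b \<in> B" "d \<in> D" "a \<otimes> (b \<otimes> d) = w"
      by auto
    have c: "a \<in> carrier G" "b \<in> carrier G" "d \<in> carrier G" using h sub by auto
    have "w \<otimes> inv (b \<otimes> d) = a"
      using c w h(4) by (metis inv_solve_right m_closed)
    then show "p \<in> ?R" using p h c by simp
  qed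
  moreover have "inj_on (\<lambda>(a, b, d). (a \<otimes> b, (a, b))) ?T" "inj_on (\<lambda>(a, b, d). (b \<otimes> d, (b, d))) ?T"
  proof -
    have eq: "d = d'" if "a \<otimes> (b \<otimes> d) = w" "a \<otimes> (b \<otimes> d') = w" "a \<in> A" "b \<in> B" "d \<in> D" "d' \<in> D" for a b d d'
    proof -
      have "a \<in> carrier G" "b \<in> carrier G" "d \<in> carrier G" "d' \<in> carrier G" using that sub by auto
      then show ?thesis using that(1,2) by (metis Units_eq Units_l_cancel m_closed)
    qed
    then show "inj_on (\<lambda>(a, b, d). (a \<otimes> b, (a, b))) ?T" by (force intro!: inj_onI)
    have "a = a'" if "a \<otimes> (b \<otimes> d) = w" "a' \<otimes> (b \<otimes> d) = w" "a \<in> A" "a' \<in> A" "b \<in> B" "d \<in> D" for a a' b d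
    proof -
      have "a \<in> carrier G" "b \<in> carrier G" "d \<in> carrier G" "a' \<in> carrier G" using that sub by auto
      then show ?thesis using that(1,2) by (metis right_cancel m_closed)
    qed
    then show "inj_on (\<lambda>(a, b, d). (b \<otimes> d, (b, d))) ?T" by (force intro!: inj_onI)
  qed
  ultimately show ?thesis by (simp add: card_image)
qed

section \<open>Reordering a list of classes by braid moves\<close>

lemma Sigma_where_swap_le:
  assumes fin: "finite (carrier G)"
    and ci: "\<And>C. C \<in> set (pre @ A # B # post) \<Longrightarrow> conj_invariant G C"
  shows "card (Sigma_where G P (pre @ A # B # post)) \<le> card (Sigma_where G P (pre @ B # A # post))"
proof -
  let ?n = "length pre"
  \<comment> \<open>The braid move from (a, b) to (a b a^-1, a) interchanges the two classes and
    keeps both the product and the generated subgroup.\<close>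
  let ?f = "\<lambda>gs. take ?n gs @ [gs ! ?n \<otimes> gs ! Suc ?n \<otimes> inv (gs ! ?n), gs ! ?n] @ drop (?n + 2) gs"
  let ?S = "Sigma_where G P (pre @ A # B # post)"
  let ?S' = "Sigma_where G P (pre @ B # A # post)"
  have split: "\<exists>us a b vs. gs = us @ a # b # vs \<and> length us = ?n \<and> a \<in> A \<and> b \<in> B \<and>
      list_all2 (\<in>) us pre \<and> list_all2 (\<in>) vs post"
    if "gs \<in> ?S" for gs
  proof -
    have "list_all2 (\<in>) gs (pre @ A # B # post)" using that by (simp add: Sigma_where_def Sigma_bar_def)
    then show ?thesis by (auto simp: list_all2_append2 list_all2_Cons2 dest: list_all2_lengthD)
  qed
  have f: "?f (us @ a # b # vs) = us @ (a \<otimes> b \<otimes> inv a) # a # vs" if "length us = ?n" for us a b vs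
    using that[symmetric] by (simp add: nth_append)
  have cA: "\<And>x. x \<in> A \<Longrightarrow> x \<in> carrier G" and cB: "\<And>x. x \<in> B \<Longrightarrow> x \<in> carrier G"
    and cBi: "\<And>x g. x \<in> B \<Longrightarrow> g \<in> carrier G \<Longrightarrow> g \<otimes> x \<otimes> inv g \<in> B"
    using ci[of A] ci[of B] unfolding conj_invariant_def by auto
  have carr: "set us \<subseteq> carrier G" if "list_all2 (\<in>) us Cs" "\<And>C. C \<in> set Cs \<Longrightarrow> C \<subseteq> carrier G" for us Cs
    using that by (induction rule: list_all2_induct) auto
  have fc: "set us \<subseteq> carrier G \<Longrightarrow> foldr (\<otimes>) us \<one> \<in> carrier G" for us by (induction us) auto
  have fa: "foldr (\<otimes>) us w = foldr (\<otimes>) us v" if "w = v" for us and w v :: 'a using that by simp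
  have img: "?f ` ?S \<subseteq> ?S'"
  proof
    fix hs assume "hs \<in> ?f ` ?S"
    then obtain gs where gs: "gs \<in> ?S" "hs = ?f gs" by blast
    from split[OF gs(1)] obtain us a b vs where d: "gs = us @ a # b # vs" "length us = ?n" "a \<in> A" "b \<in> B"
      "list_all2 (\<in>) us pre" "list_all2 (\<in>) vs post" by blast
    have hs: "hs = us @ (a \<otimes> b \<otimes> inv a) # a # vs" using gs(2) d(1) f[OF d(2)] by simp
    have a: "a \<in> carrier G" and b: "b \<in> carrier G" using d cA cB by auto
    have vs: "set vs \<subseteq> carrier G" "set us \<subseteq> carrier G"
      using carr[OF d(6)] carr[OF d(5)] ci unfolding conj_invariant_def by auto
    have "(a \<otimes> b \<otimes> inv a) \<otimes> (a \<otimes> foldr (\<otimes>) vs \<one>) = a \<otimes> (b \<otimes> foldr (\<otimes>) vs \<one>)"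
      using a b fc[OF vs(1)] by (simp add: m_assoc inv_mult_cancel)
    then have fold: "foldr (\<otimes>) hs \<one> = foldr (\<otimes>) gs \<one>" by (simp add: hs d)
    have sub: "set gs \<subseteq> carrier G" "set hs \<subseteq> carrier G" using a b vs by (auto simp: hs d)
    have "generate G (set hs) \<subseteq> generate G (set gs)"
    proof (rule generate_subgroup_incl[OF _ generate_is_subgroup[OF sub(1)]])
      have "a \<in> generate G (set gs)" "b \<in> generate G (set gs)"
        by (auto intro: generate.incl simp: d)
      then have "a \<otimes> b \<otimes> inv a \<in> generate G (set gs)"
        using generate_is_subgroup[OF sub(1)] by (simp add: subgroup.m_closed subgroup.m_inv_closed)
      then show "set hs \<subseteq> generate G (set gs)" by (auto simp: hs d intro: generate.incl)
    qed
    moreover have "generate G (set gs) \<subseteq> generate G (set hs)"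
    proof (rule generate_subgroup_incl[OF _ generate_is_subgroup[OF sub(2)]])
      have "a \<in> generate G (set hs)" "a \<otimes> b \<otimes> inv a \<in> generate G (set hs)"
        by (auto intro: generate.incl simp: hs)
      then have "inv a \<otimes> (a \<otimes> b \<otimes> inv a) \<otimes> a \<in> generate G (set hs)"
        using generate_is_subgroup[OF sub(2)] by (meson subgroup.m_closed subgroup.m_inv_closed)
      then have "b \<in> generate G (set hs)" using a b by (simp add: conj_cancel)
      then show "set gs \<subseteq> generate G (set hs)" by (auto simp: hs d intro: generate.incl)
    qed
    ultimately have "generate G (set hs) = generate G (set gs)" by blast
    moreover have "list_all2 (\<in>) hs (pre @ B # A # post)"
      using d cBi[OF d(4) a] by (auto simp: hs list_all2_append)
    ultimately show "hs \<in> ?S'" using gs(1) fold by (simp add: Sigma_where_def Sigma_bar_def)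
  qed
  have inj: "inj_on ?f ?S"
  proof (rule inj_onI)
    fix gs hs assume g: "gs \<in> ?S" "hs \<in> ?S" and e: "?f gs = ?f hs"
    from split[OF g(1)] obtain us a b vs where d: "gs = us @ a # b # vs" "length us = ?n" "a \<in> A" "b \<in> B"
      by blast
    from split[OF g(2)] obtain us' a' b' vs' where d': "hs = us' @ a' # b' # vs'" "length us' = ?n" "a' \<in> A" "b' \<in> B"
      by blast
    show "gs = hs" using e f[OF d(2)] f[OF d'(2)] d d' cA cB by auto
  qed
  have "finite ?S'"
  proof -
    have "finite C" if "C \<in> set (pre @ B # A # post)" for C
      using ci[of C] that fin finite_subset unfolding conj_invariant_def by auto
    then have "finite (Sigma_bar G (pre @ B # A # post))" by (rule finite_Sigma_bar)
    then show ?thesis unfolding Sigma_where_def by (rule rev_finite_subset) auto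
  qed
  then show ?thesis by (rule card_inj_on_le[OF inj img])
qed

lemma Sigma_where_move:
  assumes fin: "finite (carrier G)"
    and ci: "\<And>C. C \<in> set (pre @ A # mid @ post) \<Longrightarrow> conj_invariant G C"
  shows "card (Sigma_where G P (pre @ A # mid @ post)) = card (Sigma_where G P (pre @ mid @ A # post))"
  using ci
proof (induction mid arbitrary: pre)
  case (Cons B mid)
  have "card (Sigma_where G P (pre @ A # B # mid @ post)) = card (Sigma_where G P (pre @ B # A # mid @ post))"
    by (intro antisym Sigma_where_swap_le fin Cons.prems) auto
  also have "\<dots> = card (Sigma_where G P ((pre @ [B]) @ A # mid @ post))" by simp
  also have "\<dots> = card (Sigma_where G P ((pre @ [B]) @ mid @ A # post))"
    by (rule Cons.IH) (use Cons.prems in auto)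
  finally show ?case by simp
qed simp

text \<open>The prefix \<open>pre\<close> collects the entries already in place, so that the
  induction settles one position at a time.\<close>

lemma Sigma_where_mset:
  assumes fin: "finite (carrier G)" and "mset Cs = mset Ds"
    and ci: "\<And>C. C \<in> set (pre @ Cs) \<Longrightarrow> conj_invariant G C"
  shows "card (Sigma_where G P (pre @ Cs)) = card (Sigma_where G P (pre @ Ds))"
  using assms(2,3)
proof (induction Cs arbitrary: Ds pre)
  case (Cons A Cs)
  then have "A \<in> set Ds" by (metis list.set_intros(1) set_mset_mset)
  then obtain D1 D2 where Ds: "Ds = D1 @ A # D2" by (meson split_list)
  have m: "mset Cs = mset (D1 @ D2)" using Cons.prems(1) by (simp add: Ds)
  have "card (Sigma_where G P (pre @ A # Cs)) = card (Sigma_where G P ((pre @ [A]) @ D1 @ D2))"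
    using Cons.IH[OF m, of "pre @ [A]"] Cons.prems(2) by simp
  also have "\<dots> = card (Sigma_where G P (pre @ D1 @ A # D2))"
    using Sigma_where_move[OF fin, of pre A D1 D2 P] Cons.prems(2) mset_eq_setD[OF m] by auto
  finally show ?case by (simp add: Ds)
qed simp

lemma mu_mset:
  assumes "finite (carrier G)" "mset Cs = mset Ds" "\<forall>C\<in>set Cs. conj_invariant G C"
  shows "mu G Cs = mu G Ds" "mu_bar G Cs = mu_bar G Ds"
  using Sigma_where_mset[OF assms(1,2), of "[]"] assms(3)
  unfolding mu_def mu_bar_def Sigma_bar_eq_where Sigma_gen_eq_where by simp_all

section \<open>Simultaneous conjugation of generating tuples\<close>

lemma Sigma_gen_conj:
  assumes gs: "gs \<in> Sigma_gen G Cs" and ci: "\<forall>C\<in>set Cs. conj_invariant G C"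
    and g: "g \<in> carrier G"
  shows "map (\<lambda>x. g \<otimes> x \<otimes> inv g) gs \<in> Sigma_gen G Cs"
proof -
  let ?c = "\<lambda>x. g \<otimes> x \<otimes> inv g"
  have l: "list_all2 (\<in>) gs Cs" and f: "foldr (\<otimes>) gs \<one> = \<one>" and gen: "generate G (set gs) = carrier G"
    using gs by (auto simp: Sigma_gen_def Sigma_bar_def)
  have sub: "set gs \<subseteq> carrier G" and l': "list_all2 (\<in>) (map ?c gs) Cs"
    using l ci g by (induction rule: list_all2_induct) (auto simp: conj_invariant_def)
  have "foldr (\<otimes>) us \<one> \<in> carrier G \<and> foldr (\<otimes>) (map ?c us) \<one> = ?c (foldr (\<otimes>) us \<one>)"
    if "set us \<subseteq> carrier G" for us
    using that g by (induction us) (auto simp: conj_mult)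
  then have f': "foldr (\<otimes>) (map ?c gs) \<one> = \<one>" using sub f g by simp
  have hom: "group_hom G G ?c"
    by unfold_locales (use g in \<open>auto simp: hom_def conj_mult\<close>)
  have "generate G (?c ` set gs) = ?c ` generate G (set gs)"
    using group_hom.generate_img[OF hom sub] by simp
  also have "\<dots> = carrier G"
  proof (intro subset_antisym subsetI)
    fix x assume x: "x \<in> carrier G"
    then have "x = ?c (inv g \<otimes> x \<otimes> g)" using g by (simp add: m_assoc mult_inv_cancel)
    then show "x \<in> ?c ` generate G (set gs)" using gen g x by blast
  qed (use g gen in auto)
  finally show ?thesis using l' f' by (simp add: Sigma_gen_def Sigma_bar_def)
qed

text \<open>If g and h act alike on the entries, then h^-1 g commutes with a generating set, hence
  is central, hence trivial.\<close>

lemma conj_map_inj: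
  assumes "generate G (set gs) = carrier G" "set gs \<subseteq> carrier G"
    and centre: "centreless G"
  shows "inj_on (\<lambda>g. map (\<lambda>x. g \<otimes> x \<otimes> inv g) gs) (carrier G)"
proof (rule inj_onI)
  fix g h assume g: "g \<in> carrier G" "h \<in> carrier G"
    and e: "map (\<lambda>x. g \<otimes> x \<otimes> inv g) gs = map (\<lambda>x. h \<otimes> x \<otimes> inv h) gs"
  let ?z = "inv h \<otimes> g"
  have z: "?z \<in> carrier G" using g by simp
  have sg: "subgroup {x \<in> carrier G. ?z \<otimes> x = x \<otimes> ?z} G"
  proof (rule subgroupI)
    fix a assume "a \<in> {x \<in> carrier G. ?z \<otimes> x = x \<otimes> ?z}"
    then have a: "a \<in> carrier G" "?z \<otimes> a = a \<otimes> ?z" by auto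
    then have "?z \<otimes> inv a = inv a \<otimes> ?z" using z by (metis inv_closed inv_solve_left inv_solve_right m_assoc m_closed)
    then show "inv a \<in> {x \<in> carrier G. ?z \<otimes> x = x \<otimes> ?z}" using a by simp
  next
    fix a b assume "a \<in> {x \<in> carrier G. ?z \<otimes> x = x \<otimes> ?z}" "b \<in> {x \<in> carrier G. ?z \<otimes> x = x \<otimes> ?z}"
    then have a: "a \<in> carrier G" "?z \<otimes> a = a \<otimes> ?z" "b \<in> carrier G" "?z \<otimes> b = b \<otimes> ?z" by auto
    have "?z \<otimes> (a \<otimes> b) = a \<otimes> b \<otimes> ?z" using a z by (metis m_assoc)
    then show "a \<otimes> b \<in> {x \<in> carrier G. ?z \<otimes> x = x \<otimes> ?z}" using a by simp
  qed (use z in auto)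
  have "x \<in> {x \<in> carrier G. ?z \<otimes> x = x \<otimes> ?z}" if "x \<in> set gs" for x
  proof -
    have x: "x \<in> carrier G" using that assms(2) by auto
    have "g \<otimes> x \<otimes> inv g = h \<otimes> x \<otimes> inv h" using e that by (simp add: map_eq_conv)
    then have "inv h \<otimes> (g \<otimes> x \<otimes> inv g) \<otimes> g = inv h \<otimes> (h \<otimes> x \<otimes> inv h) \<otimes> g" by simp
    then show ?thesis using x g by (simp add: m_assoc inv_mult_cancel)
  qed
  then have "generate G (set gs) \<subseteq> {x \<in> carrier G. ?z \<otimes> x = x \<otimes> ?z}"
    using generate_subgroup_incl[OF _ sg] by blast
  then have "?z = \<one>" using assms(1) using centre z by (auto simp: centreless_def)
  then show "g = h" using g by (metis inv_closed inv_equality inv_inv)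
qed

lemma Sigma_gen_carrier:
  assumes "gs \<in> Sigma_gen G Cs" "\<forall>C\<in>set Cs. conj_invariant G C"
  shows "set gs \<subseteq> carrier G"
proof -
  have "list_all2 (\<in>) gs Cs" using assms(1) by (auto simp: Sigma_gen_def Sigma_bar_def)
  then show ?thesis using assms(2) by (induction rule: list_all2_induct) (auto simp: conj_invariant_def)
qed

text \<open>Generating tuples have regular orbits, so each orbit contributes exactly 1 to
  \<open>mu\<close>.\<close>

lemma Sigma_gen_orbit:
  assumes gs: "gs \<in> Sigma_gen G Cs" and ci: "\<forall>C\<in>set Cs. conj_invariant G C"
    and centre: "centreless G"
  shows "card ((\<lambda>g. map (\<lambda>x. g \<otimes> x \<otimes> inv g) gs) ` carrier G) = card (carrier G)"
    "(\<lambda>g. map (\<lambda>x. g \<otimes> x \<otimes> inv g) gs) ` carrier G \<subseteq> Sigma_gen G Cs"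
  using Sigma_gen_conj[OF gs ci] Sigma_gen_carrier[OF gs ci] gs centre
  by (auto intro!: card_image conj_map_inj simp: Sigma_gen_def)

lemma strictly_rigidI:
  assumes fin: "finite (carrier G)" and gs: "gs \<in> Sigma_gen G Cs"
    and ci: "\<forall>C\<in>set Cs. conj_invariant G C"
    and centre: "centreless G"
    and c: "card (Sigma_bar G Cs) = card (carrier G)"
  shows "strictly_rigid G Cs"
proof -
  have fC: "finite C" if "C \<in> set Cs" for C
    using ci that fin by (meson conj_invariant_def finite_subset)
  have fS: "finite (Sigma_bar G Cs)" using fC by (rule finite_Sigma_bar)
  have "card (carrier G) \<le> card (Sigma_gen G Cs)"
    using card_mono[OF finite_subset[OF Sigma_gen_subset fS] Sigma_gen_orbit(2)[OF gs ci centre]]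
    unfolding Sigma_gen_orbit(1)[OF gs ci centre] .
  moreover have "card (Sigma_gen G Cs) \<le> card (Sigma_bar G Cs)"
    using fS Sigma_gen_subset by (rule card_mono)
  ultimately have "card (Sigma_gen G Cs) = card (carrier G)" using c by simp
  moreover have "card (carrier G) > 0" using fin card_gt_0_iff by blast
  ultimately show ?thesis using c by (simp add: strictly_rigid_def rigid_def mu_def mu_bar_def)
qed

lemma two_orbits_not_rigid:
  assumes fin: "finite (carrier G)" and gs: "gs \<in> Sigma_gen G Cs" and hs: "hs \<in> Sigma_gen G Cs"
    and ci: "\<forall>C\<in>set Cs. conj_invariant G C"
    and centre: "centreless G"
    and nc: "\<And>g. g \<in> carrier G \<Longrightarrow> map (\<lambda>x. g \<otimes> x \<otimes> inv g) gs \<noteq> hs"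
  shows "\<not> rigid G Cs"
proof
  assume r: "rigid G Cs"
  have fC: "finite C" if "C \<in> set Cs" for C
    using ci that fin by (meson conj_invariant_def finite_subset)
  have fS: "finite (Sigma_gen G Cs)"
    using finite_Sigma_bar fC finite_subset[OF Sigma_gen_subset] by blast
  let ?O = "\<lambda>gs. (\<lambda>g. map (\<lambda>x. g \<otimes> x \<otimes> inv g) gs) ` carrier G"
  have "hs \<notin> ?O gs"
  proof
    assume "hs \<in> ?O gs"
    then obtain g where "g \<in> carrier G" "hs = map (\<lambda>x. g \<otimes> x \<otimes> inv g) gs" by (rule imageE) simp
    then show False using nc[of g] by metis
  qed
  then have "?O gs \<noteq> Sigma_gen G Cs" using hs by metis
  then have "?O gs \<subset> Sigma_gen G Cs" using Sigma_gen_orbit(2)[OF gs ci centre] by (rule psubsetI[rotated])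
  then have "card (?O gs) < card (Sigma_gen G Cs)" by (rule psubset_card_mono[OF fS])
  then have "card (Sigma_gen G Cs) \<noteq> card (carrier G)"
    using Sigma_gen_orbit(1)[OF gs ci centre] by simp
  moreover have "card (carrier G) > 0" using fin card_gt_0_iff by blast
  ultimately show False using r by (simp add: rigid_def mu_def)
qed

end

section \<open>The unitary group over an explicit field\<close>

text \<open>\<open>Fab\<close> stands for the element \<open>a + b i\<close> of the field with 9 elements, where \<open>i\<^sup>2 = -1\<close>.\<close>

datatype f9 = F00 | F01 | F02 | F10 | F11 | F12 | F20 | F21 | F22

instantiation f9 :: field
begin

definition zero_f9 :: f9 where "0 = F00"
definition one_f9 :: f9 where "1 = F10"

fun plus_f9 :: "f9 \<Rightarrow> f9 \<Rightarrow> f9" where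
  "F00 + F00 = F00" | "F00 + F01 = F01" | "F00 + F02 = F02" | "F00 + F10 = F10" | "F00 + F11 = F11" | "F00 + F12 = F12" | "F00 + F20 = F20" | "F00 + F21 = F21" | "F00 + F22 = F22" |
  "F01 + F00 = F01" | "F01 + F01 = F02" | "F01 + F02 = F00" | "F01 + F10 = F11" | "F01 + F11 = F12" | "F01 + F12 = F10" | "F01 + F20 = F21" | "F01 + F21 = F22" | "F01 + F22 = F20" |
  "F02 + F00 = F02" | "F02 + F01 = F00" | "F02 + F02 = F01" | "F02 + F10 = F12" | "F02 + F11 = F10" | "F02 + F12 = F11" | "F02 + F20 = F22" | "F02 + F21 = F20" | "F02 + F22 = F21" |
  "F10 + F00 = F10" | "F10 + F01 = F11" | "F10 + F02 = F12" | "F10 + F10 = F20" | "F10 + F11 = F21" | "F10 + F12 = F22" | "F10 + F20 = F00" | "F10 + F21 = F01" | "F10 + F22 = F02" |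
  "F11 + F00 = F11" | "F11 + F01 = F12" | "F11 + F02 = F10" | "F11 + F10 = F21" | "F11 + F11 = F22" | "F11 + F12 = F20" | "F11 + F20 = F01" | "F11 + F21 = F02" | "F11 + F22 = F00" |
  "F12 + F00 = F12" | "F12 + F01 = F10" | "F12 + F02 = F11" | "F12 + F10 = F22" | "F12 + F11 = F20" | "F12 + F12 = F21" | "F12 + F20 = F02" | "F12 + F21 = F00" | "F12 + F22 = F01" |
  "F20 + F00 = F20" | "F20 + F01 = F21" | "F20 + F02 = F22" | "F20 + F10 = F00" | "F20 + F11 = F01" | "F20 + F12 = F02" | "F20 + F20 = F10" | "F20 + F21 = F11" | "F20 + F22 = F12" |
  "F21 + F00 = F21" | "F21 + F01 = F22" | "F21 + F02 = F20" | "F21 + F10 = F01" | "F21 + F11 = F02" | "F21 + F12 = F00" | "F21 + F20 = F11" | "F21 + F21 = F12" | "F21 + F22 = F10" |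
  "F22 + F00 = F22" | "F22 + F01 = F20" | "F22 + F02 = F21" | "F22 + F10 = F02" | "F22 + F11 = F00" | "F22 + F12 = F01" | "F22 + F20 = F12" | "F22 + F21 = F10" | "F22 + F22 = F11"

fun times_f9 :: "f9 \<Rightarrow> f9 \<Rightarrow> f9" where
  "F00 * F00 = F00" | "F00 * F01 = F00" | "F00 * F02 = F00" | "F00 * F10 = F00" | "F00 * F11 = F00" | "F00 * F12 = F00" | "F00 * F20 = F00" | "F00 * F21 = F00" | "F00 * F22 = F00" |
  "F01 * F00 = F00" | "F01 * F01 = F20" | "F01 * F02 = F10" | "F01 * F10 = F01" | "F01 * F11 = F21" | "F01 * F12 = F11" | "F01 * F20 = F02" | "F01 * F21 = F22" | "F01 * F22 = F12" |
  "F02 * F00 = F00" | "F02 * F01 = F10" | "F02 * F02 = F20" | "F02 * F10 = F02" | "F02 * F11 = F12" | "F02 * F12 = F22" | "F02 * F20 = F01" | "F02 * F21 = F11" | "F02 * F22 = F21" |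
  "F10 * F00 = F00" | "F10 * F01 = F01" | "F10 * F02 = F02" | "F10 * F10 = F10" | "F10 * F11 = F11" | "F10 * F12 = F12" | "F10 * F20 = F20" | "F10 * F21 = F21" | "F10 * F22 = F22" |
  "F11 * F00 = F00" | "F11 * F01 = F21" | "F11 * F02 = F12" | "F11 * F10 = F11" | "F11 * F11 = F02" | "F11 * F12 = F20" | "F11 * F20 = F22" | "F11 * F21 = F10" | "F11 * F22 = F01" |
  "F12 * F00 = F00" | "F12 * F01 = F11" | "F12 * F02 = F22" | "F12 * F10 = F12" | "F12 * F11 = F20" | "F12 * F12 = F01" | "F12 * F20 = F21" | "F12 * F21 = F02" | "F12 * F22 = F10" |
  "F20 * F00 = F00" | "F20 * F01 = F02" | "F20 * F02 = F01" | "F20 * F10 = F20" | "F20 * F11 = F22" | "F20 * F12 = F21" | "F20 * F20 = F10" | "F20 * F21 = F12" | "F20 * F22 = F11" |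
  "F21 * F00 = F00" | "F21 * F01 = F22" | "F21 * F02 = F11" | "F21 * F10 = F21" | "F21 * F11 = F10" | "F21 * F12 = F02" | "F21 * F20 = F12" | "F21 * F21 = F01" | "F21 * F22 = F20" |
  "F22 * F00 = F00" | "F22 * F01 = F12" | "F22 * F02 = F21" | "F22 * F10 = F22" | "F22 * F11 = F01" | "F22 * F12 = F10" | "F22 * F20 = F11" | "F22 * F21 = F20" | "F22 * F22 = F02"

fun uminus_f9 :: "f9 \<Rightarrow> f9" where
  "- F00 = F00" | "- F01 = F02" | "- F02 = F01" | "- F10 = F20" | "- F11 = F22" | "- F12 = F21" | "- F20 = F10" | "- F21 = F12" | "- F22 = F11"

definition minus_f9 :: "f9 \<Rightarrow> f9 \<Rightarrow> f9" where "x - y = x + - y" for x y :: f9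

fun inverse_f9 :: "f9 \<Rightarrow> f9" where
  "inverse F00 = F00" | "inverse F01 = F02" | "inverse F02 = F01" | "inverse F10 = F10" | "inverse F11 = F21" | "inverse F12 = F22" | "inverse F20 = F20" | "inverse F21 = F11" | "inverse F22 = F12"

definition divide_f9 :: "f9 \<Rightarrow> f9 \<Rightarrow> f9" where "x div y = x * inverse y" for x y :: f9

instance
proof
  fix a b c :: f9
  show "a + b + c = a + (b + c)" by (cases a; cases b; cases c; simp)
  show "a * b * c = a * (b * c)" by (cases a; cases b; cases c; simp)
  show "(a + b) * c = a * c + b * c" by (cases a; cases b; cases c; simp)
  show "a + b = b + a" by (cases a; cases b; simp)
  show "a * b = b * a" by (cases a; cases b; simp)
  show "a - b = a + - b" by (simp add: minus_f9_def)
  show "0 + a = a" by (cases a; simp add: zero_f9_def)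
  show "1 * a = a" by (cases a; simp add: one_f9_def)
  show "- a + a = 0" by (cases a; simp add: zero_f9_def)
  show "(0::f9) \<noteq> 1" by (simp add: zero_f9_def one_f9_def)
  show "a \<noteq> 0 \<Longrightarrow> inverse a * a = 1" by (cases a; simp add: zero_f9_def one_f9_def)
  show "a div b = a * inverse b" by (simp add: divide_f9_def)
  show "inverse (0::f9) = 0" by (simp add: zero_f9_def)
qed

end

text \<open>The Frobenius map, tabulated so that it is evaluated in one rewrite step;
  \<open>cnj9_power3\<close> identifies it with cubing.\<close>

fun cnj9 :: "f9 \<Rightarrow> f9" where
  "cnj9 F00 = F00" | "cnj9 F01 = F02" | "cnj9 F02 = F01" | "cnj9 F10 = F10" | "cnj9 F11 = F12" | "cnj9 F12 = F11" | "cnj9 F20 = F20" | "cnj9 F21 = F22" | "cnj9 F22 = F21"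

lemma cnj9_add [simp]: "cnj9 (x + y) = cnj9 x + cnj9 y" by (cases x; cases y; simp)
lemma cnj9_mult [simp]: "cnj9 (x * y) = cnj9 x * cnj9 y" by (cases x; cases y; simp)
lemma cnj9_cnj9 [simp]: "cnj9 (cnj9 x) = x" by (cases x; simp)
lemma cnj9_minus [simp]: "cnj9 (- x) = - cnj9 x" by (cases x; simp)
lemma cnj9_diff [simp]: "cnj9 (x - y) = cnj9 x - cnj9 y"
  unfolding diff_conv_add_uminus by (simp only: cnj9_add cnj9_minus)
lemma cnj9_0 [simp]: "cnj9 0 = 0" and cnj9_1 [simp]: "cnj9 1 = 1" by (simp_all add: zero_f9_def one_f9_def)
lemma cnj9_eq_0 [simp]: "cnj9 x = 0 \<longleftrightarrow> x = 0" by (cases x; simp add: zero_f9_def)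
lemma cnj9_inj: "cnj9 x = cnj9 y \<longleftrightarrow> x = y" by (metis cnj9_cnj9)
lemma cnj9_power3: "cnj9 x = x ^ 3" by (cases x; simp add: power3_eq_cube)

definition f9s :: "f9 list" where "f9s = [F00, F01, F02, F10, F11, F12, F20, F21, F22]"

lemma f9s [simp]: "x \<in> set f9s" by (cases x; simp add: f9s_def)

section \<open>Matrices and vectors over the explicit field\<close>

datatype v9 = V f9 f9 f9
datatype m9 = M f9 f9 f9 f9 f9 f9 f9 f9 f9

fun mm :: "m9 \<Rightarrow> m9 \<Rightarrow> m9" where
  "mm (M a11 a12 a13 a21 a22 a23 a31 a32 a33) (M b11 b12 b13 b21 b22 b23 b31 b32 b33) = M
     (a11 * b11 + a12 * b21 + a13 * b31) (a11 * b12 + a12 * b22 + a13 * b32) (a11 * b13 + a12 * b23 + a13 * b33)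
     (a21 * b11 + a22 * b21 + a23 * b31) (a21 * b12 + a22 * b22 + a23 * b32) (a21 * b13 + a22 * b23 + a23 * b33)
     (a31 * b11 + a32 * b21 + a33 * b31) (a31 * b12 + a32 * b22 + a33 * b32) (a31 * b13 + a32 * b23 + a33 * b33)"

fun mct :: "m9 \<Rightarrow> m9" where
  "mct (M a11 a12 a13 a21 a22 a23 a31 a32 a33) = M (cnj9 a11) (cnj9 a21) (cnj9 a31) (cnj9 a12) (cnj9 a22) (cnj9 a32) (cnj9 a13) (cnj9 a23) (cnj9 a33)"

fun mcj :: "m9 \<Rightarrow> m9" where
  "mcj (M a11 a12 a13 a21 a22 a23 a31 a32 a33) = M (cnj9 a11) (cnj9 a12) (cnj9 a13) (cnj9 a21) (cnj9 a22) (cnj9 a23) (cnj9 a31) (cnj9 a32) (cnj9 a33)"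

text \<open>The adjugate matrix, which is the inverse as soon as the determinant is 1.\<close>

fun cof :: "m9 \<Rightarrow> m9" where
  "cof (M a11 a12 a13 a21 a22 a23 a31 a32 a33) = M
     (a22 * a33 - a23 * a32) (a13 * a32 - a12 * a33) (a12 * a23 - a13 * a22)
     (a23 * a31 - a21 * a33) (a11 * a33 - a13 * a31) (a13 * a21 - a11 * a23)
     (a21 * a32 - a22 * a31) (a12 * a31 - a11 * a32) (a11 * a22 - a12 * a21)"

fun mdet :: "m9 \<Rightarrow> f9" where
  "mdet (M a11 a12 a13 a21 a22 a23 a31 a32 a33) = a11 * (a22 * a33 - a23 * a32) - a12 * (a21 * a33 - a23 * a31) + a13 * (a21 * a32 - a22 * a31)"

fun mtr :: "m9 \<Rightarrow> f9" where "mtr (M a11 a12 a13 a21 a22 a23 a31 a32 a33) = a11 + a22 + a33"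

fun mv :: "m9 \<Rightarrow> v9 \<Rightarrow> v9" where
  "mv (M a11 a12 a13 a21 a22 a23 a31 a32 a33) (V x y z) = V (a11 * x + a12 * y + a13 * z) (a21 * x + a22 * y + a23 * z) (a31 * x + a32 * y + a33 * z)"

fun vcj :: "v9 \<Rightarrow> v9" where "vcj (V x y z) = V (cnj9 x) (cnj9 y) (cnj9 z)"
fun sv :: "f9 \<Rightarrow> v9 \<Rightarrow> v9" where "sv c (V x y z) = V (c * x) (c * y) (c * z)"
fun hf :: "v9 \<Rightarrow> v9 \<Rightarrow> f9" where
  "hf (V x y z) (V x' y' z') = x * cnj9 x' + y * cnj9 y' + z * cnj9 z'"
fun col3 :: "m9 \<Rightarrow> v9" where "col3 (M a11 a12 a13 a21 a22 a23 a31 a32 a33) = V a13 a23 a33"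

definition mid :: m9 where "mid = M F10 F00 F00 F00 F10 F00 F00 F00 F10"
text \<open>Unitarity, with the inverse written as the adjugate. This gives polynomial equations in
  the entries, from which closure properties and the shape of the point stabiliser are read
  off.\<close>

definition su :: "m9 \<Rightarrow> bool" where "su A \<longleftrightarrow> mct A = cof A \<and> mdet A = 1"

lemma mid_eq: "mid = M 1 0 0 0 1 0 0 0 1"
  by (simp add: mid_def zero_f9_def one_f9_def)

lemma mm_assoc: "mm (mm A B) C = mm A (mm B C)"
  by (cases A; cases B; cases C; simp add: algebra_simps)

lemma mm_mid [simp]: "mm mid A = A" "mm A mid = A"
  by (cases A; simp add: mid_eq)+

lemma mv_mm: "mv (mm A B) v = mv A (mv B v)"
  by (cases A; cases B; cases v; simp add: algebra_simps)

lemma mv_mid [simp]: "mv mid v = v"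
  by (cases v; simp add: mid_eq)

lemma mct_mm: "mct (mm A B) = mm (mct B) (mct A)"
  by (cases A; cases B; simp add: algebra_simps)

lemma mcj_mm: "mcj (mm A B) = mm (mcj A) (mcj B)"
  by (cases A; cases B; simp)

lemma mcj_mcj [simp]: "mcj (mcj A) = A" and mct_mct [simp]: "mct (mct A) = A"
  and mct_mcj: "mct (mcj A) = mcj (mct A)"
  by (cases A; simp)+

lemma mcj_mid [simp]: "mcj mid = mid" and mct_mid [simp]: "mct mid = mid"
  by (simp_all add: mid_eq)

lemma cof_mm: "cof (mm A B) = mm (cof B) (cof A)"
  by (cases A; cases B; simp add: algebra_simps)

lemma mdet_mm: "mdet (mm A B) = mdet A * mdet B"
  by (cases A; cases B; simp add: algebra_simps)

lemma mdet_mid [simp]: "mdet mid = 1" and cof_mid [simp]: "cof mid = mid"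
  by (simp_all add: mid_eq)

lemma mm_cof: "mdet A = 1 \<Longrightarrow> mm A (cof A) = mid" "mdet A = 1 \<Longrightarrow> mm (cof A) A = mid"
  by (cases A; simp add: mid_eq algebra_simps)+

lemma mcj_cof: "mcj (cof A) = cof (mcj A)" and mdet_mcj: "mdet (mcj A) = cnj9 (mdet A)"
  and cof_mct: "cof (mct A) = mct (cof A)" and mdet_mct: "mdet (mct A) = cnj9 (mdet A)"
  by (cases A; simp add: algebra_simps)+

lemma su_mct: "su A \<Longrightarrow> mm A (mct A) = mid" "su A \<Longrightarrow> mm (mct A) A = mid"
  by (simp_all add: su_def mm_cof)

lemma su_iff_mct: "su A \<longleftrightarrow> mm A (mct A) = mid \<and> mdet A = 1"
proof
  assume a: "mm A (mct A) = mid \<and> mdet A = 1"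
  then have "mct A = mm (mm (cof A) A) (mct A)" using mm_cof(2)[of A] by simp
  also have "\<dots> = cof A" using a by (simp only: mm_assoc mm_mid)
  finally have "mct A = cof A" .
  then show "su A" using a by (simp add: su_def)
qed (simp add: su_mct, simp add: su_def)

lemma su_closed: "su A \<Longrightarrow> su B \<Longrightarrow> su (mm A B)" "su A \<Longrightarrow> su (mct A)" "su A \<Longrightarrow> su (mcj A)" "su mid"
  unfolding su_def by (metis mct_mm cof_mm mdet_mm mult_1, metis cof_mct mdet_mct cnj9_1,
    metis mct_mcj mcj_cof mdet_mcj cnj9_1, simp)

lemma mm_left_cancel: "su A \<Longrightarrow> mm A B = mm A C \<longleftrightarrow> B = C"
  by (metis mm_assoc mm_mid(1) su_mct(2))

text \<open>The pair \<open>(A, e)\<close> stands for the semilinear map \<open>v \<mapsto> A v\<close> or \<open>v \<mapsto> A \<sigma>(v)\<close>, so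
  that \<open>HH\<close> is the group \<open>SU\<^sub>3(3)\<close> extended by the Frobenius map.\<close>

fun hm :: "m9 \<times> bool \<Rightarrow> m9 \<times> bool \<Rightarrow> m9 \<times> bool" where
  "hm (A, True) (B, f) = (mm A (mcj B), \<not> f)" |
  "hm (A, False) (B, f) = (mm A B, f)"

fun hinv :: "m9 \<times> bool \<Rightarrow> m9 \<times> bool" where
  "hinv (A, True) = (mcj (mct A), True)" |
  "hinv (A, False) = (mct A, False)"

definition HH :: "(m9 \<times> bool) monoid" where
  "HH = \<lparr>carrier = {(A, e). su A}, mult = hm, one = (mid, False)\<rparr>"

definition Gam :: "(m9 \<times> bool) set" where "Gam = {(A, False) | A. su A}"

lemma HH_simps [simp]: "mult HH = hm" "one HH = (mid, False)" "(A, e) \<in> carrier HH \<longleftrightarrow> su A"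
  by (simp_all add: HH_def)

lemma Gam_iff: "(A, e) \<in> Gam \<longleftrightarrow> su A \<and> \<not> e" by (auto simp: Gam_def)

lemma hm_assoc: "hm (hm x y) z = hm x (hm y z)"
proof -
  obtain A e B f C g where "x = (A, e)" "y = (B, f)" "z = (C, g)" by (metis surj_pair)
  then show ?thesis by (cases e; cases f; simp add: mm_assoc mcj_mm)
qed

lemma hm_closed: "x \<in> carrier HH \<Longrightarrow> y \<in> carrier HH \<Longrightarrow> hm x y \<in> carrier HH"
  by (cases x; cases y; cases "snd x") (simp_all add: su_closed)

lemma hinv_closed: "x \<in> carrier HH \<Longrightarrow> hinv x \<in> carrier HH"
  by (cases x; cases "snd x") (simp_all add: su_closed)

lemma hinv_left: "x \<in> carrier HH \<Longrightarrow> hm (hinv x) x = (mid, False)"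
proof -
  assume x: "x \<in> carrier HH"
  obtain A e where e: "x = (A, e)" by force
  have "mm (mcj (mct A)) (mcj A) = mid" if "su A" using that by (simp add: mcj_mm[symmetric] su_mct)
  then show ?thesis using x e by (cases e) (simp_all add: su_mct)
qed

interpretation HH: group HH
  by (rule groupI)
     (auto simp: su_closed hm_assoc hm_closed intro!: bexI[of _ "hinv _"] hinv_left hinv_closed)

lemma inv_HH: "x \<in> carrier HH \<Longrightarrow> inv\<^bsub>HH\<^esub> x = hinv x"
  using HH.inv_equality[of "hinv x" x] hinv_left hinv_closed by simp

text \<open>\<open>Tlist\<close> contains one matrix for each nonisotropic point, which it maps the third
  basis vector to; \<open>Klist\<close> is the stabiliser of the line through the third basis vector.\<close>

definition Tlist :: "m9 list" where
  "Tlist = [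
    M F10 F00 F00 F00 F10 F00 F00 F00 F10, M F00 F11 F11 F12 F02 F01 F11 F20 F10,
    M F00 F11 F11 F21 F02 F01 F11 F10 F20, M F00 F11 F11 F12 F10 F20 F12 F20 F10,
    M F01 F12 F01 F20 F22 F20 F11 F00 F22, M F00 F11 F11 F21 F10 F20 F12 F10 F20,
    M F00 F11 F11 F01 F00 F00 F00 F22 F11, M F01 F21 F01 F20 F11 F20 F22 F00 F11,
    M F01 F21 F01 F01 F12 F01 F12 F00 F21, M F01 F22 F01 F10 F12 F10 F12 F00 F21,
    M F00 F11 F11 F02 F00 F00 F00 F11 F22, M F00 F01 F00 F21 F00 F11 F22 F00 F12,
    M F00 F11 F11 F00 F11 F22 F01 F00 F00, M F01 F12 F01 F01 F21 F01 F21 F00 F12,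
    M F00 F11 F11 F00 F21 F12 F10 F00 F00, M F01 F11 F01 F10 F21 F10 F21 F00 F12,
    M F00 F11 F11 F11 F01 F02 F22 F01 F02, M F00 F00 F01 F00 F01 F00 F10 F00 F00,
    M F00 F01 F00 F12 F00 F11 F22 F00 F21, M F01 F21 F01 F11 F00 F22 F20 F11 F20,
    M F01 F11 F01 F20 F12 F20 F12 F00 F21, M F01 F22 F01 F20 F21 F20 F21 F00 F12,
    M F01 F12 F01 F10 F11 F10 F22 F00 F11, M F00 F11 F11 F22 F01 F02 F22 F02 F01,
    M F01 F22 F01 F21 F00 F12 F10 F12 F10, M F00 F11 F11 F21 F01 F02 F22 F10 F20,
    M F01 F12 F01 F02 F12 F02 F12 F00 F21, M F01 F12 F01 F11 F00 F22 F10 F11 F10,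
    M F01 F12 F01 F12 F00 F21 F01 F21 F01, M F00 F11 F11 F21 F20 F10 F21 F10 F20,
    M F01 F21 F01 F12 F00 F21 F02 F21 F02, M F01 F21 F01 F10 F22 F10 F11 F00 F22,
    M F00 F11 F11 F10 F00 F00 F00 F12 F21, M F00 F11 F11 F11 F02 F01 F11 F01 F02,
    M F01 F11 F01 F21 F00 F12 F20 F12 F20, M F00 F11 F11 F12 F01 F02 F22 F20 F10,
    M F01 F21 F01 F21 F00 F12 F01 F12 F01, M F01 F21 F01 F02 F21 F02 F21 F00 F12,
    M F01 F22 F01 F01 F11 F01 F22 F00 F11, M F00 F11 F11 F12 F20 F10 F21 F20 F10,
    M F01 F11 F01 F11 F00 F22 F02 F11 F02, M F00 F11 F11 F20 F00 F00 F00 F21 F12,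
    M F00 F11 F11 F11 F20 F10 F21 F01 F02, M F00 F11 F11 F22 F02 F01 F11 F02 F01,
    M F01 F11 F01 F01 F22 F01 F11 F00 F22, M F01 F22 F01 F02 F22 F02 F11 F00 F22,
    M F01 F12 F01 F21 F00 F12 F02 F12 F02, M F00 F01 F00 F00 F00 F01 F20 F00 F00,
    M F01 F11 F01 F22 F00 F11 F01 F22 F01, M F00 F11 F11 F00 F12 F21 F20 F00 F00,
    M F01 F22 F01 F11 F00 F22 F01 F11 F01, M F00 F11 F11 F11 F10 F20 F12 F01 F02,
    M F00 F11 F11 F22 F10 F20 F12 F02 F01, M F00 F11 F11 F22 F20 F10 F21 F02 F01,
    M F01 F22 F01 F12 F00 F21 F20 F21 F20, M F01 F11 F01 F02 F11 F02 F22 F00 F11,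
    M F01 F22 F01 F22 F00 F11 F02 F22 F02, M F00 F01 F00 F22 F00 F11 F22 F00 F22,
    M F01 F21 F01 F22 F00 F11 F10 F22 F10, M F00 F01 F00 F11 F00 F11 F22 F00 F11,
    M F01 F12 F01 F22 F00 F11 F20 F22 F20, M F00 F11 F11 F00 F22 F11 F02 F00 F00,
    M F01 F11 F01 F12 F00 F21 F10 F21 F10]"

definition u4 :: "f9 list" where "u4 = [F10, F20, F01, F02]"

text \<open>An element with eigenvalue \<open>l\<close> on the third axis. Its upper block has a
  first column (a, d) of norm 1 and a determinant equal to the conjugate of \<open>l\<close>, which
  forces the second column. Four values of \<open>l\<close> and 24 columns give 96 matrices.\<close>

fun kmat :: "f9 \<Rightarrow> f9 \<Rightarrow> f9 \<Rightarrow> m9" where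
  "kmat l a d = M a (- (cnj9 l * cnj9 d)) F00 d (cnj9 l * cnj9 a) F00 F00 F00 l"

definition Klist :: "m9 list" where
  "Klist = concat (map (\<lambda>l. concat (map (\<lambda>a. map (kmat l a)
     (filter (\<lambda>d. a * cnj9 a + d * cnj9 d = F10) f9s)) f9s)) u4)"

fun on_axis :: "v9 \<Rightarrow> bool" where "on_axis (V x y z) \<longleftrightarrow> x = F00 \<and> y = F00"

definition vecs :: "v9 list" where
  "vecs = concat (map (\<lambda>x. concat (map (\<lambda>y. map (V x y) f9s) f9s)) f9s)"

lemma vecs [simp]: "v \<in> set vecs"
proof (cases v)
  case (V x y z)
  have c: "a \<in> set xs \<Longrightarrow> b \<in> set (f a) \<Longrightarrow> b \<in> set (concat (map f xs))" for a b xs and f :: "f9 \<Rightarrow> v9 list"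
    by auto
  have "V x y z \<in> set (map (V x y) f9s)" by simp
  then show ?thesis unfolding vecs_def V by (intro c[of x] c[of y] f9s)
qed

text \<open>The checks below use \<open>if\<close> instead of connectives, and partially applied constants instead of
  abstractions, because the simplifier evaluates all arguments of a connective and rewrites below
  abstractions.\<close>

definition moves_to_axis :: "v9 \<Rightarrow> m9 \<Rightarrow> bool" where "moves_to_axis v t \<longleftrightarrow> on_axis (mv (mct t) v)"
definition movable :: "m9 list \<Rightarrow> v9 \<Rightarrow> bool" where
  "movable T v \<longleftrightarrow> (if hf v v = F10 then list_ex (moves_to_axis v) T else True)"

lemma Tlist_transitive_check: "list_all (movable Tlist) vecs"
  by code_simp

lemma TK_su_check: "list_all (\<lambda>t. mm t (mct t) = mid \<and> mdet t = F10) Tlist"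
    "list_all (\<lambda>t. mm t (mct t) = mid \<and> mdet t = F10) Klist"
  by code_simp+

text \<open>Columns of norm 1 span the same line only if they differ by a scalar of norm 1, so it is
  enough to try the four scalars in \<open>u4\<close>.\<close>

definition same_point_eq :: "m9 \<Rightarrow> m9 \<Rightarrow> f9 \<Rightarrow> bool" where
  "same_point_eq t t' l \<longleftrightarrow> (if sv l (col3 t') = col3 t then t = t' else True)"
definition points_differ :: "m9 list \<Rightarrow> m9 \<Rightarrow> bool" where
  "points_differ T t \<longleftrightarrow> list_all (\<lambda>t'. list_all (same_point_eq t t') u4) T"

lemma Tlist_points_check: "list_all (points_differ Tlist) Tlist"
  by code_simp

lemma distinct_Klist: "distinct Klist" and length_Klist: "length Klist = 96" by code_simp+
lemma distinct_Tlist: "distinct Tlist" and length_Tlist: "length Tlist = 63" by code_simp+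

lemma su_TK: "t \<in> set Tlist \<Longrightarrow> su t" "t \<in> set Klist \<Longrightarrow> su t"
  using TK_su_check by (auto simp: list_all_iff su_iff_mct one_f9_def)

lemma u4_iff: "l \<in> set u4 \<longleftrightarrow> l * cnj9 l = 1" by (cases l; simp add: u4_def one_f9_def)

lemma Klist_iff: "A \<in> set Klist \<longleftrightarrow>
    (\<exists>l a d. l * cnj9 l = 1 \<and> a * cnj9 a + d * cnj9 d = 1 \<and> A = kmat l a d)"
  unfolding Klist_def
  by (simp add: image_iff u4_iff one_f9_def[symmetric] del: kmat.simps) (metis f9s u4_iff)

text \<open>Comparing entries in \<open>mct B = cof B\<close> expresses the second column by the
  first column and the corner entry, which is the shape of \<open>kmat\<close>.\<close>

lemma on_axis_imp_Klist:
  assumes "su B" "on_axis (col3 B)"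
  shows "B \<in> set Klist"
proof -
  obtain a b d e g h l where B: "B = M a b 0 d e 0 g h l"
    using assms(2) by (cases B) (auto simp: zero_f9_def)
  have m: "cnj9 g = 0" "cnj9 h = 0" "cnj9 b = - (d * l)" "cnj9 e = a * l" "cnj9 l = a * e - b * d"
    and det: "l * (a * e - b * d) = 1"
    using assms(1) unfolding su_def B by (auto simp: algebra_simps)
  have l: "l * cnj9 l = 1" using det m by simp
  have b: "b = - (cnj9 l * cnj9 d)" "e = cnj9 l * cnj9 a"
    using arg_cong[OF m(3), of cnj9] arg_cong[OF m(4), of cnj9] by (simp_all add: mult.commute)
  have "cnj9 l * (a * cnj9 a + d * cnj9 d) = cnj9 l * 1" using m(5) b by (simp add: algebra_simps)
  then have "a * cnj9 a + d * cnj9 d = 1" using l by (metis mult_cancel_left mult_zero_right zero_neq_one)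
  moreover have "B = kmat l a d" using m(1,2) by (simp add: B b zero_f9_def[symmetric])
  ultimately show ?thesis using l unfolding Klist_iff by blast
qed

text \<open>Orbit and stabiliser: the third column of \<open>A\<close> has norm 1, so some
  \<open>t\<close> carries the third axis to its line, and t^-1 A stabilises the axis.\<close>

lemma su_decomp:
  assumes "su A"
  shows "\<exists>t\<in>set Tlist. \<exists>k\<in>set Klist. A = mm t k"
proof -
  obtain x y z where v: "col3 A = V x y z" by (cases "col3 A")
  have "mm (mct A) A = mid" using assms by (rule su_mct)
  then have "hf (V x y z) (V x y z) = F10"
    using v by (cases A) (auto simp: mid_def mult.commute)
  then obtain t where t: "t \<in> set Tlist" "on_axis (mv (mct t) (V x y z))"
    using Tlist_transitive_check vecs unfolding list_all_iff list_ex_iff movable_def moves_to_axis_def by metis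
  have c: "col3 (mm B A) = mv B (col3 A)" for B by (cases A; cases B; simp)
  have "mm (mct t) A \<in> set Klist"
    using t assms by (intro on_axis_imp_Klist) (auto simp: su_closed su_TK c v)
  moreover have "A = mm t (mm (mct t) A)" using t(1) by (simp add: mm_assoc[symmetric] su_mct su_TK)
  ultimately show ?thesis using t(1) by blast
qed

text \<open>The third column of \<open>mm t k\<close> is that of \<open>t\<close> up to a scalar of
  norm 1. So the product determines \<open>t\<close>, and then \<open>k\<close> by
  cancellation.\<close>

lemma TK_inj: "inj_on (\<lambda>(t, k). mm t k) (set Tlist \<times> set Klist)"
proof (rule inj_onI, clarify)
  fix t k t' k' assume t: "t \<in> set Tlist" "t' \<in> set Tlist" and k: "k \<in> set Klist" "k' \<in> set Klist"
    and e: "mm t k = mm t' k'"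
  have c: "\<exists>l. l * cnj9 l = 1 \<and> col3 (mm t k) = sv l (col3 t)" if "k \<in> set Klist" for t k
    using that unfolding Klist_iff
    by (cases t) (auto simp: zero_f9_def[symmetric] mult.commute)
  obtain l l' where l: "l * cnj9 l = 1" "l' * cnj9 l' = 1" "sv l (col3 t) = sv l' (col3 t')"
    using c[OF k(1), of t] c[OF k(2), of t'] e by metis
  have n: "l * (inverse l * x) = x" "inverse l * (l * x) = x" for x
    using l(1) by (auto simp: field_simps)
  have "sv (inverse l) (sv l (col3 t)) = col3 t" by (cases "col3 t") (simp add: n)
  then have "col3 t = sv (inverse l * l') (col3 t')" using l(3) by (cases "col3 t'") (simp add: mult.assoc)
  moreover have "inverse l * l' \<in> set u4"
    unfolding u4_iff using l(1,2) by (cases l; cases l'; simp add: one_f9_def)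
  ultimately have "t = t'" using Tlist_points_check t
    unfolding list_all_iff points_differ_def same_point_eq_def by metis
  then show "t = t' \<and> k = k'" using e mm_left_cancel su_TK(1) t by blast
qed

lemma su_eq: "{A. su A} = (\<lambda>(t, k). mm t k) ` (set Tlist \<times> set Klist)"
  using su_decomp su_TK su_closed by (auto simp: image_iff)

lemma card_su: "card {A. su A} = 6048" and finite_su: "finite {A. su A}"
  unfolding su_eq by (simp_all add: card_image[OF TK_inj] card_cartesian_product
    distinct_card[OF distinct_Tlist] distinct_card[OF distinct_Klist] length_Tlist length_Klist)

lemma Gam_eq: "Gam = (\<lambda>A. (A, False)) ` {A. su A}" by (auto simp: Gam_def)
lemma carrier_HH_eq: "carrier HH = {A. su A} \<times> UNIV" by (auto simp: HH_def)

lemma card_Gam: "card Gam = 6048" and card_HH: "card (carrier HH) = 12096"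
  and finite_Gam: "finite Gam" and finite_HH: "finite (carrier HH)"
  unfolding Gam_eq carrier_HH_eq
  by (simp_all add: card_image inj_on_def card_su finite_su card_cartesian_product UNIV_bool)

lemma subgroup_Gam: "subgroup Gam HH"
  by (rule HH.subgroupI) (auto simp: Gam_def inv_HH su_closed intro: exI[of _ mid])

section \<open>Labels of the conjugacy classes\<close>

text \<open>Atlas names of the orbits of \<open>SU\<^sub>3(3)\<close> on its extension by the Frobenius map: 14 inner and 6 outer ones.\<close>

datatype lab = L1A | L2A | L3A | L3B | L4A | L4B | L4C | L6A | L7A | L7B | L8A | L8B | L12A | L12B | L2B | L4D | L6B | L8C | L12C | L12D

definition inns :: "lab list" where "inns = [L1A, L2A, L3A, L3B, L4A, L4B, L4C, L6A, L7A, L7B, L8A, L8B, L12A, L12B]"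
definition outs :: "lab list" where "outs = [L2B, L4D, L6B, L8C, L12C, L12D]"

lemma labs_exhaust: "l \<in> set inns \<or> l \<in> set outs" by (cases l; simp add: inns_def outs_def)

primrec rep :: "lab \<Rightarrow> m9 \<times> bool" where
  "rep L1A = (M F10 F00 F00 F00 F10 F00 F00 F00 F10, False)" |
  "rep L2A = (M F20 F00 F00 F00 F20 F00 F00 F00 F10, False)" |
  "rep L3A = (M F10 F00 F00 F00 F11 F11 F00 F21 F12, False)" |
  "rep L3B = (M F00 F00 F10 F10 F00 F00 F00 F10 F00, False)" |
  "rep L4A = (M F01 F00 F00 F00 F01 F00 F00 F00 F20, False)" |
  "rep L4B = (M F02 F00 F00 F00 F02 F00 F00 F00 F20, False)" |
  "rep L4C = (M F01 F00 F00 F00 F02 F00 F00 F00 F10, False)" |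
  "rep L6A = (M F10 F00 F00 F00 F21 F11 F00 F21 F22, False)" |
  "rep L7A = (M F00 F00 F10 F11 F11 F00 F21 F12 F00, False)" |
  "rep L7B = (M F00 F00 F10 F11 F12 F00 F22 F12 F00, False)" |
  "rep L8A = (M F00 F00 F01 F00 F01 F00 F10 F00 F00, False)" |
  "rep L8B = (M F00 F00 F02 F00 F02 F00 F10 F00 F00, False)" |
  "rep L12A = (M F00 F00 F10 F11 F21 F00 F11 F12 F00, False)" |
  "rep L12B = (M F00 F00 F10 F11 F22 F00 F12 F12 F00, False)" |
  "rep L2B = (M F10 F00 F00 F00 F10 F00 F00 F00 F10, True)" |
  "rep L4D = (M F00 F00 F10 F00 F10 F00 F20 F00 F00, True)" |
  "rep L6B = (M F00 F00 F10 F10 F00 F00 F00 F10 F00, True)" |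
  "rep L8C = (M F00 F00 F01 F00 F01 F00 F10 F00 F00, True)" |
  "rep L12C = (M F10 F00 F00 F00 F11 F12 F00 F22 F12, True)" |
  "rep L12D = (M F10 F00 F00 F00 F11 F11 F00 F21 F12, True)"

primrec osize :: "lab \<Rightarrow> int" where
  "osize L1A = 1" | "osize L2A = 63" | "osize L3A = 56" | "osize L3B = 672" | "osize L4A = 63" |
  "osize L4B = 63" | "osize L4C = 378" | "osize L6A = 504" | "osize L7A = 864" |
  "osize L7B = 864" | "osize L8A = 756" | "osize L8B = 756" | "osize L12A = 504" |
  "osize L12B = 504" | "osize L2B = 252" | "osize L4D = 252" | "osize L6B = 2016" |
  "osize L8C = 1512" | "osize L12C = 1008" | "osize L12D = 1008"

primrec linv :: "lab \<Rightarrow> lab" where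
  "linv L1A = L1A" | "linv L2A = L2A" | "linv L3A = L3A" | "linv L3B = L3B" | "linv L4A = L4B" |
  "linv L4B = L4A" | "linv L4C = L4C" | "linv L6A = L6A" | "linv L7A = L7B" | "linv L7B = L7A" |
  "linv L8A = L8B" | "linv L8B = L8A" | "linv L12A = L12B" | "linv L12B = L12A" |
  "linv L2B = L2B" | "linv L4D = L4D" | "linv L6B = L6B" | "linv L8C = L8C" | "linv L12C = L12D" |
  "linv L12D = L12C"

primrec lsig :: "lab \<Rightarrow> lab" where
  "lsig L1A = L1A" | "lsig L2A = L2A" | "lsig L3A = L3A" | "lsig L3B = L3B" | "lsig L4A = L4B" |
  "lsig L4B = L4A" | "lsig L4C = L4C" | "lsig L6A = L6A" | "lsig L7A = L7B" | "lsig L7B = L7A" |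
  "lsig L8A = L8B" | "lsig L8B = L8A" | "lsig L12A = L12B" | "lsig L12B = L12A" |
  "lsig L2B = L2B" | "lsig L4D = L4D" | "lsig L6B = L6B" | "lsig L8C = L8C" | "lsig L12C = L12C" |
  "lsig L12D = L12D"

text \<open>Conjugation by a linear element. Moving the Frobenius part of an outer element past the
  inverse of \<open>G\<close> conjugates the entries of that inverse.\<close>

fun hcj :: "m9 \<Rightarrow> m9 \<times> bool \<Rightarrow> m9 \<times> bool" where
  "hcj G (A, e) = (mm (mm G A) (if e then mcj (mct G) else mct G), e)"

text \<open>Outer elements too are conjugated by the simple group only. The resulting structure
  constants then serve the simple group and its extension alike.\<close>

definition orb :: "lab \<Rightarrow> (m9 \<times> bool) set" where "orb l = {hcj G (rep l) | G. su G}"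

lemma hcj_HH: "su G \<Longrightarrow> x \<in> carrier HH \<Longrightarrow> hcj G x = hm (hm (G, False) x) (inv\<^bsub>HH\<^esub> (G, False))"
  by (cases x; cases "snd x") (simp_all add: inv_HH)

lemma hcj_mid: "hcj mid x = x" by (cases x) simp

lemma hcj_hcj: "hcj G (hcj H x) = hcj (mm G H) x"
  by (cases x) (simp add: mm_assoc mct_mm mcj_mm)

lemma hcj_closed: "su G \<Longrightarrow> x \<in> carrier HH \<Longrightarrow> hcj G x \<in> carrier HH"
  by (cases x) (auto simp: su_closed)

lemma hcj_inverse: "su G \<Longrightarrow> hcj (mct G) (hcj G x) = x" "su G \<Longrightarrow> hcj G (hcj (mct G) x) = x"
  by (simp_all add: hcj_hcj su_mct hcj_mid)

lemma snd_hcj [simp]: "snd (hcj G x) = snd x" by (cases x) simp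

section \<open>Invariants that recognise the orbits\<close>

fun madd :: "m9 \<Rightarrow> m9 \<Rightarrow> m9" where
  "madd (M a b c d e f g h i) (M a' b' c' d' e' f' g' h' i') =
     M (a + a') (b + b') (c + c') (d + d') (e + e') (f + f') (g + g') (h + h') (i + i')"
fun mneg :: "m9 \<Rightarrow> m9" where "mneg (M a b c d e f g h i) = M (-a) (-b) (-c) (-d) (-e) (-f) (-g) (-h) (-i)"
fun msub_id :: "m9 \<Rightarrow> m9" where "msub_id (M a b c d e f g h i) = M (a + F20) b c d (e + F20) f g h (i + F20)"

text \<open>The trace determines the characteristic polynomial; the polynomial relations tested below
  separate the classes that share it.\<close>

definition ilab :: "m9 \<Rightarrow> lab" where
  "ilab A = (case mtr A of
     F00 \<Rightarrow> if A = mid then L1A else if mm A A = mneg (madd A mid) then L3A else L3B |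
     F20 \<Rightarrow> if mm A A = mid then L2A else L6A |
     F22 \<Rightarrow> if mm (mm A A) (mm A A) = mid then L4A else L12B |
     F21 \<Rightarrow> if mm (mm A A) (mm A A) = mid then L4B else L12A |
     F10 \<Rightarrow> L4C | F01 \<Rightarrow> L8A | F02 \<Rightarrow> L8B | F11 \<Rightarrow> L7A | F12 \<Rightarrow> L7B)"

text \<open>An outer element squares to the inner matrix \<open>A\<close> times
  \<open>mcj A\<close>. The class of the square separates the outer orbits except 12C from 12D,
  which \<open>base\<close> merges. For outer elements \<open>L1A\<close> marks failure.\<close>

definition lab0 :: "m9 \<times> bool \<Rightarrow> lab" where
  "lab0 x = (if snd x
     then case ilab (mm (fst x) (mcj (fst x))) of
       L1A \<Rightarrow> L2B | L2A \<Rightarrow> L4D | L3B \<Rightarrow> L6B | L4C \<Rightarrow> L8C | L6A \<Rightarrow> L12C | _ \<Rightarrow> L1A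
     else ilab (fst x))"

definition base :: "lab \<Rightarrow> lab" where "base l = (if l = L12D then L12C else l)"

fun op1 :: "f9 \<Rightarrow> v9 \<Rightarrow> m9" where
  "op1 k (V x y z) = M (k * (x * cnj9 x)) (k * (x * cnj9 y)) (k * (x * cnj9 z))
     (k * (y * cnj9 x)) (k * (y * cnj9 y)) (k * (y * cnj9 z))
     (k * (z * cnj9 x)) (k * (z * cnj9 y)) (k * (z * cnj9 z))"

text \<open>For an outer element \<open>x\<close> of order 12, \<open>x\<^sup>4 = 1 + c v v\<^sup>*\<close> is a transvection whose centre is preserved:
  \<open>x v = a v\<close>. Replacing \<open>v\<close> by a multiple does not change \<open>c a\<^sup>2\<close>, which separates 12C from 12D.\<close>

definition has_kap :: "m9 \<Rightarrow> f9 \<Rightarrow> bool" where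
  "has_kap A k \<longleftrightarrow> (\<exists>c v a. c \<noteq> 0 \<and> v \<noteq> V 0 0 0 \<and>
     mm (mm A (mcj A)) (mm A (mcj A)) = madd mid (op1 c v) \<and> mv A (vcj v) = sv a v \<and> k = c * (a * a))"

definition kap_test :: "m9 \<Rightarrow> m9 \<Rightarrow> v9 \<Rightarrow> f9 \<Rightarrow> f9 \<Rightarrow> lab" where
  "kap_test A C v c a = (if c = F00 then L1A else if v = V F00 F00 F00 then L1A
     else if C = madd mid (op1 c v)
     then if mv A (vcj v) = sv a v
       then case c * (a * a) of F10 \<Rightarrow> L12C | F20 \<Rightarrow> L12D | _ \<Rightarrow> L1A
       else L1A
     else L1A)"

fun fst_ratio :: "v9 \<Rightarrow> v9 \<Rightarrow> f9" where
  "fst_ratio (V x y z) (V x' y' z') = (if x' = F00 then y * inverse y' else x * inverse x')"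

text \<open>Write H for the conjugate transpose. If C - 1 is a multiple of w w^H, its first column v
  is a multiple of w, and C - 1 = c v v^H with c the inverse of the conjugate of the corner entry.
  An isotropic w has at most one zero coordinate, so the second column serves when the corner entry
  vanishes. A wrong guess does no harm, since \<open>kap_test\<close> verifies the data.\<close>

fun kap_lab2 :: "m9 \<Rightarrow> m9 \<Rightarrow> m9 \<Rightarrow> lab" where
  "kap_lab2 A C (M a b c d e f g h i) = (if a = F00
     then kap_test A C (V b e h) (inverse (cnj9 e)) (fst_ratio (mv A (V (cnj9 b) (cnj9 e) (cnj9 h))) (V b e h))
     else kap_test A C (V a d g) (inverse (cnj9 a)) (fst_ratio (mv A (V (cnj9 a) (cnj9 d) (cnj9 g))) (V a d g)))"

definition kap_lab1 :: "m9 \<Rightarrow> m9 \<Rightarrow> lab" where "kap_lab1 A C = kap_lab2 A C (msub_id C)"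
definition kap_lab :: "m9 \<Rightarrow> m9 \<Rightarrow> lab" where "kap_lab A B = kap_lab1 A (mm B B)"

definition olab :: "m9 \<Rightarrow> m9 \<Rightarrow> lab" where
  "olab A B = (case ilab B of
       L1A \<Rightarrow> L2B | L2A \<Rightarrow> L4D | L3B \<Rightarrow> L6B | L4C \<Rightarrow> L8C | L6A \<Rightarrow> kap_lab A B | _ \<Rightarrow> L1A)"

text \<open>Evaluated on concrete elements only. Invariance under conjugation is proved for
  \<open>lab0\<close> and \<open>has_kap\<close>, and \<open>lab_base\<close> connects them with
  \<open>label\<close>.\<close>

fun label :: "m9 \<times> bool \<Rightarrow> lab" where
  "label (A, e) = (if e then olab A (mm A (mcj A)) else ilab A)"

lemma mm_madd: "mm G (madd A B) = madd (mm G A) (mm G B)" "mm (madd A B) G = madd (mm A G) (mm B G)"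
  and mm_mneg: "mm G (mneg A) = mneg (mm G A)" "mm (mneg A) G = mneg (mm A G)"
  by (cases G; cases A; cases B; simp add: algebra_simps)+

lemma mtr_mm: "mtr (mm A B) = mtr (mm B A)"
  by (cases A; cases B; simp add: algebra_simps)

context
  fixes G assumes G: "su G"
begin

lemma mconj_mm: "mm (mm (mm G A) (mct G)) (mm (mm G B) (mct G)) = mm (mm G (mm A B)) (mct G)"
  using G by (metis mm_assoc mm_mid(1) su_mct(2))

lemma mconj_inj: "mm (mm G A) (mct G) = mm (mm G B) (mct G) \<longleftrightarrow> A = B"
  using G by (metis mm_assoc mm_mid su_mct(2))

lemma mconj_mid: "mm (mm G A) (mct G) = mid \<longleftrightarrow> A = mid"
  using mconj_inj[of A mid] G by (simp add: su_mct)

lemma ilab_mconj: "ilab (mm (mm G A) (mct G)) = ilab A"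
proof -
  have "mtr (mm (mm G A) (mct G)) = mtr A" using G by (metis mm_assoc mm_mid(1) mtr_mm su_mct(2))
  moreover have "mneg (madd (mm (mm G A) (mct G)) mid) = mm (mm G (mneg (madd A mid))) (mct G)"
    using G by (simp add: mm_madd mm_mneg su_mct)
  ultimately show ?thesis
    unfolding ilab_def by (simp only: mconj_mm mconj_inj mconj_mid)
qed

text \<open>The twisted inverse cancels against the conjugate of \<open>G\<close>, so twisted
  conjugation of an outer element becomes ordinary conjugation of its square.\<close>

lemma frob_square_hcj:
  "mm (mm (mm G A) (mcj (mct G))) (mcj (mm (mm G A) (mcj (mct G)))) = mm (mm G (mm A (mcj A))) (mct G)"
proof -
  have e: "mm (mcj (mct G)) (mcj G) = mid" using G by (metis mcj_mm mcj_mid su_mct(2))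
  have "mm (mm (mm G A) (mcj (mct G))) (mcj (mm (mm G A) (mcj (mct G)))) =
    mm (mm (mm G A) (mm (mcj (mct G)) (mcj G))) (mm (mcj A) (mct G))"
    by (simp add: mm_assoc mcj_mm)
  then show ?thesis by (simp only: e mm_mid mm_assoc)
qed

lemma lab0_hcj: "lab0 (hcj G x) = lab0 x"
  by (cases x; cases "snd x") (simp_all add: lab0_def frob_square_hcj ilab_mconj)

lemma op1_mv: "op1 c (mv G v) = mm (mm G (op1 c v)) (mct G)"
  by (cases G; cases v; simp add: algebra_simps)

lemma has_kap_hcj:
  assumes "has_kap A k"
  shows "has_kap (mm (mm G A) (mcj (mct G))) k"
proof -
  let ?A = "mm (mm G A) (mcj (mct G))"
  obtain c v a where k: "c \<noteq> 0" "v \<noteq> V 0 0 0" "mm (mm A (mcj A)) (mm A (mcj A)) = madd mid (op1 c v)"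
    "mv A (vcj v) = sv a v" "k = c * (a * a)"
    using assms unfolding has_kap_def by blast
  have inv: "mv (mct G) (mv G w) = w" for w using G by (simp add: mv_mm[symmetric] su_mct)
  have "mv G v \<noteq> V 0 0 0"
  proof
    assume "mv G v = V 0 0 0"
    then have "v = mv (mct G) (V 0 0 0)" using inv by metis
    then show False using k(2) by (cases G) simp
  qed
  moreover have "mm (mm ?A (mcj ?A)) (mm ?A (mcj ?A)) = madd mid (op1 c (mv G v))"
    unfolding frob_square_hcj mconj_mm op1_mv k(3) using G by (simp add: mm_madd su_mct)
  moreover have "mv ?A (vcj (mv G v)) = sv a (mv G v)"
  proof -
    have "vcj (mv G v) = mv (mcj G) (vcj v)" by (cases G; cases v; simp)
    moreover have "mm (mcj (mct G)) (mcj G) = mid" using G by (metis mcj_mm mcj_mid su_mct(2))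
    then have "mv (mcj (mct G)) (mv (mcj G) (vcj v)) = vcj v" by (simp add: mv_mm[symmetric])
    ultimately have "mv ?A (vcj (mv G v)) = mv G (mv A (vcj v))" by (simp add: mv_mm)
    also have "\<dots> = sv a (mv G v)" unfolding k(4) by (cases G; cases v; simp add: algebra_simps)
    finally show ?thesis .
  qed
  ultimately show ?thesis using k(1,5) unfolding has_kap_def by blast
qed

end

lemma op1_eqD:
  assumes "op1 c v = op1 c' v'" "c \<noteq> 0" "v \<noteq> V 0 0 0"
  shows "\<exists>m. m \<noteq> 0 \<and> v = sv m v' \<and> c' = c * (m * cnj9 m)"
proof -
  obtain x y z x' y' z' where v: "v = V x y z" "v' = V x' y' z'" by (cases v; cases v')
  have e: "c * (p * cnj9 q) = c' * (p' * cnj9 q')"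
    if "(p, p') \<in> {(x, x'), (y, y'), (z, z')}" "(q, q') \<in> {(x, x'), (y, y'), (z, z')}" for p p' q q'
    using assms(1) that unfolding v by auto
  obtain q q' where q: "(q, q') \<in> {(x, x'), (y, y'), (z, z')}" "q \<noteq> 0" using assms(3) v by auto
  have q': "q' \<noteq> 0" "c' \<noteq> 0" using e[OF q(1) q(1)] q(2) assms(2) by auto
  define m where "m = c' * cnj9 q' / (c * cnj9 q)"
  have p: "p = m * p'" if "(p, p') \<in> {(x, x'), (y, y'), (z, z')}" for p p'
    using e[OF that q(1)] q(2) assms(2) unfolding m_def by (simp add: field_simps)
  have m: "m \<noteq> 0" unfolding m_def using q(2) q' assms(2) by simp
  have "c * (m * cnj9 m) * (q' * cnj9 q') = c' * (q' * cnj9 q')"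
    using e[OF q(1) q(1)] unfolding p[OF q(1)] by (simp add: mult_ac)
  then have "c' = c * (m * cnj9 m)" using q' by simp
  moreover have "v = sv m v'" unfolding v using p by simp
  ultimately show ?thesis using m by blast
qed

lemma has_kap_unique:
  assumes "has_kap A k" "has_kap A k'"
  shows "k = k'"
proof -
  obtain c v a where k: "c \<noteq> 0" "v \<noteq> V 0 0 0" "mm (mm A (mcj A)) (mm A (mcj A)) = madd mid (op1 c v)"
    "mv A (vcj v) = sv a v" "k = c * (a * a)"
    using assms(1) unfolding has_kap_def by blast
  obtain c' v' a' where k': "c' \<noteq> 0" "v' \<noteq> V 0 0 0" "mm (mm A (mcj A)) (mm A (mcj A)) = madd mid (op1 c' v')"
    "mv A (vcj v') = sv a' v'" "k' = c' * (a' * a')"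
    using assms(2) unfolding has_kap_def by blast
  have "madd mid x = madd mid y \<Longrightarrow> x = y" for x y by (cases x; cases y; simp add: mid_eq)
  then have "op1 c v = op1 c' v'" using k(3) k'(3) by metis
  then obtain m where m: "m \<noteq> 0" "v = sv m v'" "c' = c * (m * cnj9 m)" using op1_eqD k(1,2) by blast
  have "mv A (vcj (sv m v')) = sv (cnj9 m) (mv A (vcj v'))" by (cases A; cases v'; simp add: algebra_simps)
  then have "sv (cnj9 m * a') v' = sv (a * m) v'"
    using k(4) k'(4) unfolding m(2) by (cases v') (simp add: mult_ac)
  then have a: "cnj9 m * a' = a * m" using k'(2) by (cases v') auto
  \<comment> \<open>Conjugation is cubing, so both sides are the sixth power of
    \<open>m\<close>.\<close>
  have m3: "cnj9 m * cnj9 m = m * m * (m * cnj9 m)" using m(1) by (cases m; simp add: zero_f9_def)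
  have "k * (m * m) = c * ((a * m) * (a * m))" unfolding k(5) by (simp add: mult_ac)
  also have "\<dots> = c * (cnj9 m * cnj9 m) * (a' * a')" unfolding a[symmetric] by (simp add: mult_ac)
  also have "\<dots> = k' * (m * m)" unfolding k'(5) m(3) m3 by (simp add: mult_ac)
  finally show ?thesis using m(1) by simp
qed

lemma kap_test_has_kap:
  assumes "kap_test A (mm (mm A (mcj A)) (mm A (mcj A))) v c a = l" "l \<noteq> L1A"
  shows "l = L12C \<and> has_kap A F10 \<or> l = L12D \<and> has_kap A F20"
  using assms unfolding kap_test_def has_kap_def
  by (force split: if_splits f9.splits simp: zero_f9_def)

lemma kap_lab_has_kap:
  assumes "kap_lab A (mm A (mcj A)) = l" "l \<noteq> L1A"
  shows "l = L12C \<and> has_kap A F10 \<or> l = L12D \<and> has_kap A F20"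
proof -
  have "\<exists>v c a. kap_test A (mm (mm A (mcj A)) (mm A (mcj A))) v c a = l"
    using assms(1) unfolding kap_lab_def kap_lab1_def
    by (cases "msub_id (mm (mm A (mcj A)) (mm A (mcj A)))") (auto split: if_splits)
  then show ?thesis using kap_test_has_kap assms(2) by blast
qed

text \<open>Here \<open>L1A\<close> serves as the failure value of \<open>label\<close> on outer elements.\<close>

lemma lab_base:
  assumes "label x = l" "snd x \<longrightarrow> l \<noteq> L1A"
  shows "lab0 x = base l" "l = L12C \<Longrightarrow> snd x \<and> has_kap (fst x) F10" "l = L12D \<Longrightarrow> snd x \<and> has_kap (fst x) F20"
proof -
  obtain A e where x: "x = (A, e)" by force
  have i: "ilab A \<noteq> L12C" "ilab A \<noteq> L12D" for A by (auto simp: ilab_def split: f9.splits)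
  show "lab0 x = base l" "l = L12C \<Longrightarrow> snd x \<and> has_kap (fst x) F10" "l = L12D \<Longrightarrow> snd x \<and> has_kap (fst x) F20"
    using assms kap_lab_has_kap[of A l] i unfolding x
    by (auto simp: lab0_def base_def olab_def split: lab.splits if_splits)
qed

lemma reps_check: "list_all (\<lambda>l. label (rep l) = l) (inns @ outs)"
  "list_all (\<lambda>l. label (hinv (rep l)) = linv l) (inns @ outs)"
  "list_all (\<lambda>l. label (hm (hm (mid, True) (rep l)) (mid, True)) = lsig l) (inns @ outs)"
  by code_simp+

section \<open>Orders of centralisers\<close>

fun meq :: "m9 \<Rightarrow> m9 \<Rightarrow> bool" where
  "meq (M a b c d e f g h i) (M a' b' c' d' e' f' g' h' i') =
    (if a = a' then if b = b' then if c = c' then if d = d' then if e = e' then if f = f'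
       then if g = g' then if h = h' then i = i' else False else False else False else False
       else False else False else False else False)"

lemma meq_iff: "meq A B \<longleftrightarrow> A = B" by (cases A; cases B; auto)

primrec mcount :: "m9 \<Rightarrow> m9 list \<Rightarrow> int" where
  "mcount A [] = 0" | "mcount A (B # Bs) = (if meq A B then 1 + mcount A Bs else mcount A Bs)"

definition fhcj :: "m9 \<times> bool \<Rightarrow> m9 \<Rightarrow> m9" where "fhcj x G = fst (hcj G x)"
definition fhcj' :: "m9 \<times> bool \<Rightarrow> m9 \<Rightarrow> m9" where "fhcj' x G = fst (hcj (mct G) x)"

primrec mcounts :: "m9 list \<Rightarrow> m9 list \<Rightarrow> int" where
  "mcounts [] Bs = 0" | "mcounts (A # As) Bs = mcount A Bs + mcounts As Bs"

text \<open>A product t k fixes \<open>x\<close> exactly when \<open>k\<close> and the inverse of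
  \<open>t\<close> conjugate \<open>x\<close> to the same element. Comparing 63 conjugates with 96
  others gives the order of the centraliser without forming 6048 products.\<close>

definition cent :: "m9 list \<Rightarrow> m9 list \<Rightarrow> m9 \<times> bool \<Rightarrow> int" where
  "cent T K x = mcounts (map (fhcj' x) T) (map (fhcj x) K)"

definition cent_ok :: "m9 list \<Rightarrow> m9 list \<Rightarrow> lab \<Rightarrow> bool" where
  "cent_ok T K l \<longleftrightarrow> cent T K (rep l) * osize l = 6048"

lemma cent_check: "list_all (cent_ok Tlist Klist) (inns @ outs)"
  by code_simp

section \<open>Class multiplication coefficients\<close>

lemma UNIV_lab: "(UNIV :: lab set) = set (inns @ outs)"
  using labs_exhaust by auto

lemma distinct_labs: "distinct (inns @ outs)" by (simp add: inns_def outs_def)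

lemma linv_linv [simp]: "linv (linv l) = l" by (cases l) simp_all
lemma lsig_lsig [simp]: "lsig (lsig l) = l" by (cases l) simp_all

lemma osize_pos: "osize l > 0" by (cases l) simp_all
lemma osize_linv [simp]: "osize (linv l) = osize l" by (cases l) simp_all
lemma sum_osize: "(\<Sum>l\<in>UNIV. osize l) = 12096"
  unfolding UNIV_lab by (subst sum.distinct_set_conv_list[OF distinct_labs]) (simp add: inns_def outs_def)

lemma all_labs: "list_all P (inns @ outs) \<Longrightarrow> P l"
  using labs_exhaust[of l] by (auto simp: list_all_iff)

lemma label_rep [simp]: "label (rep l) = l" and label_hinv_rep [simp]: "label (hinv (rep l)) = linv l"
  and label_frob_rep: "label (hm (hm (mid, True) (rep l)) (mid, True)) = lsig l"
  using all_labs[OF reps_check(1)] all_labs[OF reps_check(2)] all_labs[OF reps_check(3)] by simp_all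

lemma snd_rep: "snd (rep l) \<longleftrightarrow> l \<in> set outs" by (cases l) (simp_all add: outs_def)

lemma rep_HH: "rep l \<in> carrier HH"
proof -
  have "list_all (\<lambda>l. mm (fst (rep l)) (mct (fst (rep l))) = mid \<and> mdet (fst (rep l)) = F10) (inns @ outs)"
    by code_simp
  then have "su (fst (rep l))" using all_labs by (auto simp: su_iff_mct one_f9_def)
  then show ?thesis by (simp add: carrier_HH_eq mem_Times_iff)
qed

lemma rep_in_orb: "rep l \<in> orb l"
  unfolding orb_def by (rule CollectI, rule exI[of _ mid]) (simp add: hcj_mid su_closed)

lemma orb_HH: "orb l \<subseteq> carrier HH"
  unfolding orb_def by (intro subsetI, elim CollectE exE conjE) (simp only: hcj_closed rep_HH)

lemma orb_hcj: "su G \<Longrightarrow> x \<in> orb l \<Longrightarrow> hcj G x \<in> orb l"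
  unfolding orb_def using su_closed(1) by (auto simp: hcj_hcj)

lemma snd_orb: "x \<in> orb l \<Longrightarrow> snd x \<longleftrightarrow> l \<in> set outs"
  unfolding orb_def by (auto simp: snd_rep)

lemma lab0_rep: "lab0 (rep l) = base l"
  by (rule lab_base(1)[OF label_rep]) (auto simp: snd_rep outs_def)

lemma orb_invariants:
  assumes "x \<in> orb l"
  shows "lab0 x = base l" "l = L12C \<Longrightarrow> has_kap (fst x) F10" "l = L12D \<Longrightarrow> has_kap (fst x) F20"
proof -
  obtain G where G: "su G" "x = hcj G (rep l)" using assms by (auto simp: orb_def)
  show "lab0 x = base l" using G lab0_hcj lab0_rep by simp
  have f: "has_kap (fst x) k" if "has_kap (fst (rep l)) k" "snd (rep l)" for k
    using has_kap_hcj[OF G(1) that(1)] that(2) unfolding G(2) by (cases "rep l") auto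
  show "l = L12C \<Longrightarrow> has_kap (fst x) F10" "l = L12D \<Longrightarrow> has_kap (fst x) F20"
    using f lab_base(2,3)[OF label_rep[of l]] by (auto simp: snd_rep outs_def)
qed

lemma label_unique:
  assumes "x \<in> orb j" "lab0 x = base l" "l = L12C \<Longrightarrow> has_kap (fst x) F10" "l = L12D \<Longrightarrow> has_kap (fst x) F20"
  shows "j = l"
proof (rule ccontr)
  assume "j \<noteq> l"
  moreover have "base j = base l" using orb_invariants(1) assms(1,2) by metis
  ultimately have "j = L12C \<and> l = L12D \<or> j = L12D \<and> l = L12C" by (auto simp: base_def split: if_splits)
  then have "has_kap (fst x) F10 \<and> has_kap (fst x) F20"
    using orb_invariants(2,3)[OF assms(1)] assms(3,4) by auto
  then show False using has_kap_unique by blast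
qed

lemma orb_disjoint: "x \<in> orb j \<Longrightarrow> x \<in> orb l \<Longrightarrow> j = l"
  using label_unique orb_invariants by metis

lemma mcount_eq: "mcount A Bs = int (length (filter ((=) A) Bs))"
  by (induction Bs) (auto simp: meq_iff)

lemma mcounts_eq:
  assumes "distinct As" "distinct Bs"
  shows "mcounts (map f As) (map g Bs) = int (card {(a, b). a \<in> set As \<and> b \<in> set Bs \<and> f a = g b})"
  using assms(1)
proof (induction As)
  case (Cons a As)
  let ?S = "\<lambda>As. {(a, b). a \<in> set As \<and> b \<in> set Bs \<and> f a = g b}"
  have "?S (a # As) = (Pair a ` {b \<in> set Bs. f a = g b}) \<union> ?S As" by auto
  moreover have "(Pair a ` {b \<in> set Bs. f a = g b}) \<inter> ?S As = {}" using Cons.prems by auto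
  moreover have "finite (?S As)" by (rule finite_subset[of _ "set As \<times> set Bs"]) auto
  ultimately have "card (?S (a # As)) = card {b \<in> set Bs. f a = g b} + card (?S As)"
    by (simp add: card_Un_disjoint card_image inj_on_def)
  moreover have "length (filter ((=) (f a)) (map g Bs)) = card {b \<in> set Bs. f a = g b}"
    using distinct_card[OF distinct_filter[OF assms(2), of "\<lambda>b. f a = g b"]]
    by (simp add: filter_map comp_def)
  ultimately show ?case using Cons by (simp add: mcount_eq)
qed simp

lemma card_stabiliser:
  "int (card {G. su G \<and> hcj G (rep l) = rep l}) \<le> cent Tlist Klist (rep l)"
proof -
  let ?P = "{(t, k). t \<in> set Tlist \<and> k \<in> set Klist \<and> fhcj' (rep l) t = fhcj (rep l) k}"
  have "{G. su G \<and> hcj G (rep l) = rep l} \<subseteq> (\<lambda>(t, k). mm t k) ` ?P"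
  proof
    fix G assume "G \<in> {G. su G \<and> hcj G (rep l) = rep l}"
    then obtain t k where t: "t \<in> set Tlist" "k \<in> set Klist" "G = mm t k" "hcj (mm t k) (rep l) = rep l"
      using su_decomp by blast
    have "hcj k (rep l) = hcj (mct t) (hcj t (hcj k (rep l)))"
      using t(1) hcj_inverse(1) su_TK(1) by simp
    then have "hcj k (rep l) = hcj (mct t) (rep l)" using t(4) by (simp add: hcj_hcj)
    then have "(t, k) \<in> ?P" using t(1,2) by (simp add: fhcj_def fhcj'_def)
    then show "G \<in> (\<lambda>(t, k). mm t k) ` ?P" using t(3) by blast
  qed
  moreover have "finite ?P" by (rule finite_subset[of _ "set Tlist \<times> set Klist"]) auto
  ultimately have "card {G. su G \<and> hcj G (rep l) = rep l} \<le> card ?P"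
    by (meson card_image_le card_mono finite_imageI le_trans)
  then show ?thesis
    unfolding cent_def mcounts_eq[OF distinct_Tlist distinct_Klist] by simp
qed

text \<open>Orbit and stabiliser as an inequality: translating by the inverse of one of its members
  moves a fibre into the stabiliser, whose order is bounded by the count in
  \<open>cent\<close>.\<close>

lemma card_orb_ge: "osize l \<le> int (card (orb l))"
proof -
  let ?f = "\<lambda>G. hcj G (rep l)"
  let ?c = "card {G. su G \<and> hcj G (rep l) = rep l}"
  have o: "orb l = ?f ` {G. su G}" by (auto simp: orb_def)
  have "card {G. su G} \<le> ?c * card (?f ` {G. su G})"
  proof (rule card_le_fibres[OF finite_su])
    fix y assume "y \<in> ?f ` {G. su G}"
    then obtain G0 where G0: "su G0" "y = ?f G0" by blast
    have img: "mm (mct G0) ` {G \<in> {G. su G}. ?f G = y} \<subseteq> {G. su G \<and> hcj G (rep l) = rep l}"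
    proof
      fix H assume "H \<in> mm (mct G0) ` {G \<in> {G. su G}. ?f G = y}"
      then obtain G where "H = mm (mct G0) G" "su G" "hcj G (rep l) = hcj G0 (rep l)" using G0(2) by auto
      then show "H \<in> {G. su G \<and> hcj G (rep l) = rep l}"
        using G0(1) hcj_inverse(1) by (simp add: hcj_hcj[symmetric] su_closed)
    qed
    have inj: "inj_on (mm (mct G0)) {G \<in> {G. su G}. ?f G = y}"
      using mm_left_cancel su_closed(2)[OF G0(1)] by (auto intro: inj_onI)
    have "finite {G. su G \<and> hcj G (rep l) = rep l}" using finite_su by simp
    then show "card {G \<in> {G. su G}. ?f G = y} \<le> ?c" by (rule card_inj_on_le[OF inj img])
  qed
  then have "6048 \<le> int ?c * int (card (orb l))" unfolding card_su o by (simp flip: of_nat_mult)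
  also have "\<dots> \<le> cent Tlist Klist (rep l) * int (card (orb l))"
    using card_stabiliser by (intro mult_right_mono) auto
  finally have "cent Tlist Klist (rep l) * osize l \<le> cent Tlist Klist (rep l) * int (card (orb l))"
    using all_labs[OF cent_check, of l] by (simp add: cent_ok_def)
  moreover have "cent Tlist Klist (rep l) > 0"
    using all_labs[OF cent_check, of l] osize_pos[of l] unfolding cent_ok_def
    by (metis zero_less_mult_pos2 zero_less_numeral)
  ultimately show ?thesis by simp
qed

text \<open>Disjoint orbits whose lower bounds add up to the group order 12096 leave no room: every
  bound is sharp and the orbits cover the group.\<close>

lemma orb_partition: "(\<Union>l. orb l) = carrier HH" and card_orb: "int (card (orb l)) = osize l"
proof -
  have fin: "finite (UNIV :: lab set)" by (simp add: UNIV_lab)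
  have u: "card (\<Union>l. orb l) = (\<Sum>l\<in>UNIV. card (orb l))"
    using orb_disjoint finite_subset[OF orb_HH finite_HH] fin by (intro card_UN_disjoint) auto
  have sub: "(\<Union>l. orb l) \<subseteq> carrier HH" using orb_HH by auto
  have "(\<Sum>l\<in>UNIV. int (card (orb l))) \<le> 12096"
    using card_mono[OF finite_HH sub] unfolding u card_HH by (metis of_nat_le_iff of_nat_numeral of_nat_sum)
  then have s: "(\<Sum>l\<in>UNIV. int (card (orb l)) - osize l) \<le> 0"
    by (simp add: sum_subtractf sum_osize)
  have z: "\<forall>l\<in>UNIV. int (card (orb l)) - osize l = 0"
  proof -
    have "(\<Sum>l\<in>UNIV. int (card (orb l)) - osize l) = 0"
      using s card_orb_ge by (intro antisym sum_nonneg) auto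
    then show ?thesis using card_orb_ge by (subst (asm) sum_nonneg_eq_0_iff[OF fin]) auto
  qed
  then show "int (card (orb l)) = osize l" by simp
  have "int (card (\<Union>l. orb l)) = (\<Sum>l\<in>UNIV. osize l)" unfolding u using z by simp
  then have "card (\<Union>l. orb l) = card (carrier HH)" unfolding sum_osize card_HH by simp
  then show "(\<Union>l. orb l) = carrier HH" using sub finite_HH by (metis card_subset_eq)
qed

text \<open>The element lies in some orbit because the orbits cover the group, and the invariants
  behind \<open>label\<close> then decide which one. The premise on \<open>snd x\<close> excludes
  the failure value.\<close>

lemma in_orb_iff:
  assumes "x \<in> carrier HH" "label x = l" "snd x \<longrightarrow> l \<noteq> L1A"
  shows "x \<in> orb k \<longleftrightarrow> k = l"
proof -
  obtain j where j: "x \<in> orb j" using assms(1) orb_partition by blast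
  have "j = l" using label_unique[OF j] lab_base[OF assms(2,3)] by blast
  then show ?thesis using j orb_disjoint by blast
qed

lemma hinv_hcj: "su G \<Longrightarrow> hinv (hcj G x) = hcj G (hinv x)"
proof -
  assume "su G"
  obtain A e where x: "x = (A, e)" by force
  show ?thesis unfolding x by (cases e) (simp_all add: mct_mm mcj_mm mct_mcj mm_assoc)
qed

lemma orb_linv: "hinv ` orb l = orb (linv l)"
proof -
  have "hinv x \<in> orb (linv l)" if x: "x \<in> orb l" for x l
  proof -
    obtain G where G: "su G" "x = hcj G (rep l)" using x by (auto simp: orb_def)
    have "snd (hinv (rep l)) \<longrightarrow> linv l \<noteq> L1A" by (cases l) simp_all
    then have "hinv (rep l) \<in> orb (linv l)"
      by (simp only: in_orb_iff[OF hinv_closed[OF rep_HH] label_hinv_rep])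
    then show ?thesis using G orb_hcj hinv_hcj by simp
  qed
  moreover have "hinv (hinv x) = x" if "x \<in> orb l" for x l
    using that orb_HH HH.inv_inv[of x] inv_HH hinv_closed by (metis subsetD)
  ultimately show ?thesis by (metis (no_types, lifting) image_eqI image_subsetI linv_linv subsetI subset_antisym)
qed

lemma inv_image_orb: "(m_inv HH) ` orb l = orb (linv l)"
  unfolding orb_linv[symmetric] using orb_HH inv_HH by (intro image_cong) auto

definition nn :: "lab \<Rightarrow> lab \<Rightarrow> lab \<Rightarrow> nat" where
  "nn i k l = prod_count HH (orb i) (orb k) (rep l)"

text \<open>Conjugation by \<open>G\<close> and by its inverse gives the two inequalities.\<close>

lemma prod_count_orb:
  assumes "z \<in> orb l"
  shows "prod_count HH (orb i) (orb k) z = nn i k l"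
proof -
  obtain G where G: "su G" "z = hcj G (rep l)" using assms by (auto simp: orb_def)
  have G': "(G, False) \<in> carrier HH" "(mct G, False) \<in> carrier HH" using G by (simp_all add: su_closed)
  have le: "prod_count HH (orb i) (orb k) z \<le> prod_count HH (orb i) (orb k) (hcj H z)"
    if "z \<in> carrier HH" "su H" for z H
  proof -
    have "(H, False) \<in> carrier HH" using that by simp
    moreover have "hm (hm (H, False) x) (inv\<^bsub>HH\<^esub> (H, False)) \<in> orb j" if "x \<in> orb j" for x j
      using that orb_hcj[OF \<open>su H\<close>] hcj_HH[OF \<open>su H\<close>] orb_HH by (metis subsetD)
    ultimately show ?thesis
      using HH.prod_count_conj[OF orb_HH orb_HH that(1), of "(H, False)" i k] finite_HH hcj_HH that by simp
  qed
  have "z \<in> carrier HH" using assms orb_HH by auto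
  then have "prod_count HH (orb i) (orb k) z \<le> prod_count HH (orb i) (orb k) (rep l)"
    using le[of z "mct G"] G by (simp add: su_closed hcj_inverse)
  moreover have "prod_count HH (orb i) (orb k) (rep l) \<le> prod_count HH (orb i) (orb k) z"
    using le[OF rep_HH G(1), of l] G by simp
  ultimately show ?thesis by (simp add: nn_def)
qed

lemma sum_orbits:
  fixes f :: "m9 \<times> bool \<Rightarrow> nat"
  assumes "\<And>l z. z \<in> orb l \<Longrightarrow> f z = g l"
  shows "(\<Sum>z\<in>carrier HH. f z) = (\<Sum>l\<in>UNIV. card (orb l) * g l)"
proof -
  have "(\<Sum>z\<in>carrier HH. f z) = (\<Sum>l\<in>UNIV. \<Sum>z\<in>orb l. f z)"
    unfolding orb_partition[symmetric]
    using orb_disjoint finite_subset[OF orb_HH finite_HH]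
    by (intro sum.UNION_disjoint) (auto simp: UNIV_lab)
  then show ?thesis using assms by simp
qed

lemma card_inter_orbits:
  fixes f :: "m9 \<times> bool \<Rightarrow> nat"
  assumes "\<And>l z. z \<in> orb l \<Longrightarrow> f z = g l"
  shows "(\<Sum>z\<in>carrier HH. f z * (if P z then 1 else 0)) = (\<Sum>l\<in>UNIV. g l * card {z \<in> orb l. P z})"
proof -
  have "(\<Sum>z\<in>carrier HH. f z * (if P z then 1 else 0)) = (\<Sum>l\<in>UNIV. \<Sum>z\<in>orb l. f z * (if P z then 1 else 0))"
    unfolding orb_partition[symmetric]
    using orb_disjoint finite_subset[OF orb_HH finite_HH]
    by (intro sum.UNION_disjoint) (auto simp: UNIV_lab)
  also have "\<dots> = (\<Sum>l\<in>UNIV. g l * card {z \<in> orb l. P z})"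
  proof (rule sum.cong[OF refl])
    fix l
    have "(\<Sum>z\<in>orb l. f z * (if P z then 1 else 0)) = g l * (\<Sum>z\<in>orb l. if P z then 1 else 0)"
      using assms by (simp add: sum_distrib_left)
    then show "(\<Sum>z\<in>orb l. f z * (if P z then 1 else 0)) = g l * card {z \<in> orb l. P z}"
      using finite_subset[OF orb_HH finite_HH] by (simp add: sum.inter_filter[symmetric])
  qed
  finally show ?thesis .
qed

text \<open>Both sides count the factorisations of \<open>rep l\<close> into three factors from the
  orbits \<open>i\<close>, \<open>j\<close>, \<open>k\<close>. This is associativity in the algebra
  spanned by the sums over orbits of the simple group.\<close>

lemma nn_assoc: "(\<Sum>m\<in>UNIV. nn i j m * nn m k l) = (\<Sum>m\<in>UNIV. nn j k m * nn i m l)"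
proof -
  let ?P = "\<lambda>z. inv\<^bsub>HH\<^esub> z \<otimes>\<^bsub>HH\<^esub> rep l \<in> orb k"
  let ?Q = "\<lambda>y. rep l \<otimes>\<^bsub>HH\<^esub> inv\<^bsub>HH\<^esub> y \<in> orb i"
  have "(\<Sum>m\<in>UNIV. nn i j m * nn m k l) = (\<Sum>m\<in>UNIV. nn i j m * card {z \<in> orb m. ?P z})"
    unfolding nn_def[of _ k l] by (simp only: HH.prod_count_left[OF orb_HH orb_HH rep_HH])
  also have "\<dots> = (\<Sum>z\<in>carrier HH. prod_count HH (orb i) (orb j) z * (if ?P z then 1 else 0))"
    by (rule card_inter_orbits[symmetric]) (rule prod_count_orb)
  also have "\<dots> = (\<Sum>y\<in>carrier HH. prod_count HH (orb j) (orb k) y * (if ?Q y then 1 else 0))"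
    by (rule HH.prod_count_assoc[OF finite_HH rep_HH orb_HH orb_HH orb_HH])
  also have "\<dots> = (\<Sum>m\<in>UNIV. nn j k m * card {z \<in> orb m. ?Q z})"
    by (rule card_inter_orbits) (rule prod_count_orb)
  also have "\<dots> = (\<Sum>m\<in>UNIV. nn j k m * nn i m l)"
    unfolding nn_def[of i _ l] by (simp only: HH.prod_count_right[OF orb_HH orb_HH rep_HH])
  finally show ?thesis .
qed

lemma parity: "hm x y = z \<Longrightarrow> snd z \<longleftrightarrow> snd x \<noteq> snd y"
  by (cases x; cases y; cases "snd x") auto

lemma nn_parity:
  assumes "(l \<in> set outs) \<noteq> ((i \<in> set outs) \<noteq> (k \<in> set outs))"
  shows "nn i k l = 0"
proof -
  have "{(x, y). x \<in> orb i \<and> y \<in> orb k \<and> hm x y = rep l} = {}"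
    using assms parity snd_orb snd_rep by fast
  then show ?thesis unfolding nn_def prod_count_def by (simp only: HH_simps card.empty)
qed

lemma inns_outs: "l \<in> set inns \<longleftrightarrow> l \<notin> set outs"
  by (cases l) (simp_all add: inns_def outs_def)

text \<open>Every \<open>y\<close> in orbit \<open>k\<close> has exactly one left factor that
  completes it to \<open>rep l\<close>, and this factor is inner because \<open>k\<close> and
  \<open>l\<close> have the same parity.\<close>

lemma sum_nn_left: "(\<Sum>m\<in>set inns. nn m k l) = card (orb k)" if par: "(k \<in> set outs) = (l \<in> set outs)"
proof -
  have fin: "finite {y \<in> orb k. hm (rep l) (inv\<^bsub>HH\<^esub> y) \<in> orb m}" for m
    using finite_subset[OF orb_HH finite_HH] by simp
  have "(\<Sum>m\<in>set inns. nn m k l) = (\<Sum>m\<in>set inns. card {y \<in> orb k. hm (rep l) (inv\<^bsub>HH\<^esub> y) \<in> orb m})"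
    unfolding nn_def by (simp add: HH.prod_count_right[OF orb_HH orb_HH rep_HH])
  also have "\<dots> = card (\<Union>m\<in>set inns. {y \<in> orb k. hm (rep l) (inv\<^bsub>HH\<^esub> y) \<in> orb m})"
  proof (rule card_UN_disjoint[symmetric])
    show "\<forall>m\<in>set inns. \<forall>j\<in>set inns. m \<noteq> j \<longrightarrow>
        {y \<in> orb k. hm (rep l) (inv\<^bsub>HH\<^esub> y) \<in> orb m} \<inter> {y \<in> orb k. hm (rep l) (inv\<^bsub>HH\<^esub> y) \<in> orb j} = {}"
    proof (intro ballI impI)
      fix m j :: lab assume "m \<noteq> j"
      then have "hm (rep l) (inv\<^bsub>HH\<^esub> y) \<in> orb m \<Longrightarrow> hm (rep l) (inv\<^bsub>HH\<^esub> y) \<notin> orb j" for y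
        using orb_disjoint by metis
      then show "{y \<in> orb k. hm (rep l) (inv\<^bsub>HH\<^esub> y) \<in> orb m} \<inter> {y \<in> orb k. hm (rep l) (inv\<^bsub>HH\<^esub> y) \<in> orb j} = {}"
        by (intro equals0I, elim IntE CollectE conjE) simp
    qed
  qed (use fin in simp_all)
  also have "(\<Union>m\<in>set inns. {y \<in> orb k. hm (rep l) (inv\<^bsub>HH\<^esub> y) \<in> orb m}) = orb k"
  proof -
    have "\<exists>m\<in>set inns. hm (rep l) (inv\<^bsub>HH\<^esub> y) \<in> orb m" if y: "y \<in> orb k" for y
    proof -
      have c: "y \<in> carrier HH" using y orb_HH by auto
      have "hm (rep l) (inv\<^bsub>HH\<^esub> y) \<in> carrier HH" using hm_closed rep_HH HH.inv_closed[OF c] by simp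
      then obtain m where m: "hm (rep l) (inv\<^bsub>HH\<^esub> y) \<in> orb m" using orb_partition by blast
      have "hm (hm (rep l) (inv\<^bsub>HH\<^esub> y)) y = rep l"
        using HH.m_assoc[OF rep_HH HH.inv_closed[OF c] c] HH.l_inv[OF c] HH.r_one[OF rep_HH] by simp
      then have "snd (rep l) \<longleftrightarrow> (m \<in> set outs) \<noteq> snd y" using parity snd_orb[OF m] by metis
      then have "m \<notin> set outs" using par snd_orb[OF y] snd_rep[of l] by argo
      then have "m \<in> set inns" using inns_outs[of m] by simp
      then show ?thesis using m by (rule bexI[rotated])
    qed
    then show ?thesis by auto
  qed
  finally show ?thesis .
qed

section \<open>Tables of structure constants and their verification by counting\<close>

primrec look :: "lab list \<Rightarrow> 'a list \<Rightarrow> lab \<Rightarrow> 'a" where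
  "look (x # xs) vs k = (if k = x then hd vs else look xs (tl vs) k)"

lemma look_map: "k \<in> set ks \<Longrightarrow> look ks (map f ks) k = f k"
  by (induction ks) auto

primrec lcount :: "lab \<Rightarrow> lab list \<Rightarrow> int" where
  "lcount k [] = 0" | "lcount k (l # ls) = (if k = l then 1 + lcount k ls else lcount k ls)"

primrec counts :: "lab list \<Rightarrow> lab list \<Rightarrow> int list" where
  "counts [] ls = []" | "counts (k # ks) ls = lcount k ls # counts ks ls"

lemma counts_eq: "counts ks ls = map (\<lambda>k. lcount k ls) ks" by (induction ks) auto

lemma lcount_eq: "lcount k ls = int (length (filter (\<lambda>l. l = k) ls))" by (induction ls) auto

lemma lcount_total:
  assumes "distinct ks"
  shows "sum_list (counts ks ls) \<le> int (length ls)"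
    "sum_list (counts ks ls) = int (length ls) \<Longrightarrow> set ls \<subseteq> set ks"
proof -
  have s: "sum_list (counts ks (l # ls)) = (if l \<in> set ks then 1 else 0) + sum_list (counts ks ls)" for l ls
    using assms by (induction ks) auto
  have s0: "sum_list (counts ks []) = 0" by (induction ks) auto
  show le: "sum_list (counts ks ls) \<le> int (length ls)" for ls
    by (induction ls) (auto simp: s s0)
  show "sum_list (counts ks ls) = int (length ls) \<Longrightarrow> set ls \<subseteq> set ks"
  proof (induction ls)
    case (Cons l ls)
    then show ?case using le[of ls] by (auto simp: s split: if_splits)
  qed simp
qed

text \<open>Row \<open>l\<close> and column \<open>k\<close> of the matrix at \<open>i\<close> give the number of pairs in class \<open>i\<close> times class \<open>k\<close> whose
  product is a fixed element of class \<open>l\<close>.\<close>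

primrec tabi :: "lab \<Rightarrow> int list list" where
  "tabi L1A = [
     [1,0,0,0,0,0,0,0,0,0,0,0,0,0], [0,1,0,0,0,0,0,0,0,0,0,0,0,0], [0,0,1,0,0,0,0,0,0,0,0,0,0,0],
     [0,0,0,1,0,0,0,0,0,0,0,0,0,0], [0,0,0,0,1,0,0,0,0,0,0,0,0,0], [0,0,0,0,0,1,0,0,0,0,0,0,0,0],
     [0,0,0,0,0,0,1,0,0,0,0,0,0,0], [0,0,0,0,0,0,0,1,0,0,0,0,0,0], [0,0,0,0,0,0,0,0,1,0,0,0,0,0],
     [0,0,0,0,0,0,0,0,0,1,0,0,0,0], [0,0,0,0,0,0,0,0,0,0,1,0,0,0], [0,0,0,0,0,0,0,0,0,0,0,1,0,0],
     [0,0,0,0,0,0,0,0,0,0,0,0,1,0], [0,0,0,0,0,0,0,0,0,0,0,0,0,1]]" |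
  "tabi L2A = [
     [0,63,0,0,0,0,0,0,0,0,0,0,0,0], [1,6,0,32,0,0,24,0,0,0,0,0,0,0],
     [0,0,0,0,0,0,0,9,0,0,0,0,27,27], [0,3,0,9,0,0,9,6,9,9,9,9,0,0],
     [0,0,0,0,0,1,6,0,0,0,0,24,32,0], [0,0,0,0,1,0,6,0,0,0,24,0,0,32],
     [0,4,0,16,1,1,1,0,16,16,4,4,0,0], [0,0,1,8,0,0,0,0,12,12,12,12,3,3],
     [0,0,0,7,0,0,7,7,7,7,7,7,7,7], [0,0,0,7,0,0,7,7,7,7,7,7,7,7], [0,0,0,8,0,2,2,8,8,8,17,2,0,8],
     [0,0,0,8,2,0,2,8,8,8,2,17,8,0], [0,0,3,0,4,0,0,3,12,12,0,12,12,5],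
     [0,0,3,0,0,4,0,3,12,12,12,0,5,12]]" |
  "tabi L3A = [
     [0,0,56,0,0,0,0,0,0,0,0,0,0,0], [0,0,0,0,0,0,0,8,0,0,0,0,24,24],
     [1,0,1,0,0,0,27,27,0,0,0,0,0,0], [0,0,0,2,0,0,0,0,9,9,9,9,9,9],
     [0,0,0,0,0,0,24,0,0,0,24,0,0,8], [0,0,0,0,0,0,24,0,0,0,0,24,8,0],
     [0,0,4,0,4,4,0,4,16,16,4,4,0,0], [0,1,3,0,0,0,3,1,12,12,12,12,0,0],
     [0,0,0,7,0,0,7,7,0,7,7,7,7,7], [0,0,0,7,0,0,7,7,7,0,7,7,7,7], [0,0,0,8,2,0,2,8,8,8,4,8,8,0],
     [0,0,0,8,0,2,2,8,8,8,8,4,0,8], [0,3,0,12,0,1,0,0,12,12,12,0,1,3],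
     [0,3,0,12,1,0,0,0,12,12,0,12,3,1]]" |
  "tabi L3B = [
     [0,0,0,672,0,0,0,0,0,0,0,0,0,0], [0,32,0,96,0,0,96,64,96,96,96,96,0,0],
     [0,0,0,24,0,0,0,0,108,108,108,108,108,108], [1,9,2,102,9,9,54,72,99,99,72,72,36,36],
     [0,0,0,96,32,0,0,96,96,96,0,96,96,64], [0,0,0,96,0,32,0,96,96,96,96,0,64,96],
     [0,16,0,96,0,0,48,32,96,96,96,96,48,48], [0,8,0,96,12,12,24,88,96,96,60,60,60,60],
     [0,7,7,77,7,7,42,56,84,105,84,84,56,56], [0,7,7,77,7,7,42,56,105,84,84,84,56,56],
     [0,8,8,64,0,8,48,40,96,96,120,72,40,72], [0,8,8,64,8,0,48,40,96,96,72,120,72,40],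
     [0,0,12,48,12,8,36,60,96,96,60,108,88,48], [0,0,12,48,8,12,36,60,96,96,108,60,48,88]]" |
  "tabi L4A = [
     [0,0,0,0,0,63,0,0,0,0,0,0,0,0], [0,0,0,0,1,0,6,0,0,0,24,0,0,32],
     [0,0,0,0,0,0,27,0,0,0,0,27,9,0], [0,0,0,9,0,3,0,9,9,9,9,0,6,9],
     [1,0,0,32,0,0,6,24,0,0,0,0,0,0], [0,1,0,0,6,0,0,32,0,0,0,0,24,0],
     [0,1,4,0,0,1,1,0,16,16,16,4,0,4], [0,0,0,12,4,3,0,12,12,12,0,3,0,5],
     [0,0,0,7,0,0,7,7,7,7,7,7,7,7], [0,0,0,7,0,0,7,7,7,7,7,7,7,7], [0,0,2,0,0,0,2,2,8,8,8,17,8,8],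
     [0,2,0,8,0,0,8,0,8,8,17,8,2,2], [0,4,0,12,0,0,3,5,12,12,3,12,0,0],
     [0,0,1,8,3,0,0,0,12,12,3,12,12,0]]" |
  "tabi L4B = [
     [0,0,0,0,63,0,0,0,0,0,0,0,0,0], [0,0,0,0,0,1,6,0,0,0,0,24,32,0],
     [0,0,0,0,0,0,27,0,0,0,27,0,0,9], [0,0,0,9,3,0,0,9,9,9,0,9,9,6],
     [0,1,0,0,0,6,0,32,0,0,0,0,0,24], [1,0,0,32,0,0,6,24,0,0,0,0,0,0],
     [0,1,4,0,1,0,1,0,16,16,4,16,4,0], [0,0,0,12,3,4,0,12,12,12,3,0,5,0],
     [0,0,0,7,0,0,7,7,7,7,7,7,7,7], [0,0,0,7,0,0,7,7,7,7,7,7,7,7], [0,2,0,8,0,0,8,0,8,8,8,17,2,2],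
     [0,0,2,0,0,0,2,2,8,8,17,8,8,8], [0,0,1,8,0,3,0,0,12,12,12,3,0,12],
     [0,4,0,12,0,0,3,5,12,12,12,3,0,0]]" |
  "tabi L4C = [
     [0,0,0,0,0,0,378,0,0,0,0,0,0,0], [0,24,0,96,6,6,6,0,96,96,24,24,0,0],
     [0,0,27,0,27,27,0,27,108,108,27,27,0,0], [0,9,0,54,0,0,27,18,54,54,54,54,27,27],
     [0,6,24,0,6,0,6,0,96,96,24,96,24,0], [0,6,24,0,0,6,6,0,96,96,96,24,0,24],
     [1,1,0,48,1,1,70,72,16,16,40,40,36,36], [0,0,3,24,0,0,54,27,36,36,63,63,36,36],
     [0,7,7,42,7,7,7,21,70,70,49,49,21,21], [0,7,7,42,7,7,7,21,70,70,49,49,21,21],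
     [0,2,2,48,2,8,20,42,56,56,50,32,18,42], [0,2,2,48,8,2,20,42,56,56,32,50,42,18],
     [0,0,0,36,3,0,27,36,36,36,27,63,63,51], [0,0,0,36,0,3,27,36,36,36,63,27,51,63]]" |
  "tabi L6A = [
     [0,0,0,0,0,0,0,504,0,0,0,0,0,0], [0,0,8,64,0,0,0,0,96,96,96,96,24,24],
     [0,9,27,0,0,0,27,9,108,108,108,108,0,0], [0,6,0,72,9,9,18,66,72,72,45,45,45,45],
     [0,0,0,96,24,32,0,96,96,96,24,0,40,0], [0,0,0,96,32,24,0,96,96,96,0,24,0,40],
     [0,0,4,32,0,0,72,36,48,48,84,84,48,48], [1,0,1,88,12,12,27,99,60,60,24,24,48,48],
     [0,7,7,56,7,7,21,35,84,84,63,63,35,35], [0,7,7,56,7,7,21,35,84,84,63,63,35,35],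
     [0,8,8,40,2,0,42,16,72,72,84,72,48,40], [0,8,8,40,0,2,42,16,72,72,72,84,40,48],
     [0,3,0,60,5,0,36,48,60,60,72,60,51,49], [0,3,0,60,0,5,36,48,60,60,60,72,49,51]]" |
  "tabi L7A = [
     [0,0,0,0,0,0,0,0,0,864,0,0,0,0], [0,0,0,96,0,0,96,96,96,96,96,96,96,96],
     [0,0,0,108,0,0,108,108,108,0,108,108,108,108], [0,9,9,99,9,9,54,72,135,108,108,108,72,72],
     [0,0,0,96,0,0,96,96,96,96,96,96,96,96], [0,0,0,96,0,0,96,96,96,96,96,96,96,96],
     [0,16,16,96,16,16,16,48,160,160,112,112,48,48],
     [0,12,12,96,12,12,36,60,144,144,108,108,60,60], [1,7,0,84,7,7,70,84,106,106,112,112,84,84],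
     [0,7,7,105,7,7,70,84,79,106,112,112,84,84], [0,8,8,96,8,8,56,72,128,128,104,104,72,72],
     [0,8,8,96,8,8,56,72,128,128,104,104,72,72], [0,12,12,96,12,12,36,60,144,144,108,108,60,60],
     [0,12,12,96,12,12,36,60,144,144,108,108,60,60]]" |
  "tabi L7B = [
     [0,0,0,0,0,0,0,0,864,0,0,0,0,0], [0,0,0,96,0,0,96,96,96,96,96,96,96,96],
     [0,0,0,108,0,0,108,108,0,108,108,108,108,108], [0,9,9,99,9,9,54,72,108,135,108,108,72,72],
     [0,0,0,96,0,0,96,96,96,96,96,96,96,96], [0,0,0,96,0,0,96,96,96,96,96,96,96,96],
     [0,16,16,96,16,16,16,48,160,160,112,112,48,48],
     [0,12,12,96,12,12,36,60,144,144,108,108,60,60], [0,7,7,105,7,7,70,84,106,79,112,112,84,84],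
     [1,7,0,84,7,7,70,84,106,106,112,112,84,84], [0,8,8,96,8,8,56,72,128,128,104,104,72,72],
     [0,8,8,96,8,8,56,72,128,128,104,104,72,72], [0,12,12,96,12,12,36,60,144,144,108,108,60,60],
     [0,12,12,96,12,12,36,60,144,144,108,108,60,60]]" |
  "tabi L8A = [
     [0,0,0,0,0,0,0,0,0,0,0,756,0,0], [0,0,0,96,24,0,24,96,96,96,24,204,96,0],
     [0,0,0,108,0,27,27,108,108,108,108,54,0,108], [0,9,9,72,9,0,54,45,108,108,81,135,81,45],
     [0,0,24,0,0,0,24,24,96,96,204,96,96,96], [0,24,0,96,0,0,96,0,96,96,204,96,24,24],
     [0,4,4,96,16,4,40,84,112,112,64,100,84,36], [0,12,12,60,0,3,63,24,108,108,108,126,60,72],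
     [0,7,7,84,7,7,49,63,112,112,91,91,63,63], [0,7,7,84,7,7,49,63,112,112,91,91,63,63],
     [1,17,4,120,8,8,50,84,104,104,80,80,48,48], [0,2,8,72,17,17,32,72,104,104,80,80,84,84],
     [0,0,12,60,3,12,27,72,108,108,126,72,60,96], [0,12,0,108,3,12,63,60,108,108,126,72,24,60]]" |
  "tabi L8B = [
     [0,0,0,0,0,0,0,0,0,0,756,0,0,0], [0,0,0,96,0,24,24,96,96,96,204,24,0,96],
     [0,0,0,108,27,0,27,108,108,108,54,108,108,0], [0,9,9,72,0,9,54,45,108,108,135,81,45,81],
     [0,24,0,96,0,0,96,0,96,96,96,204,24,24], [0,0,24,0,0,0,24,24,96,96,96,204,96,96],
     [0,4,4,96,4,16,40,84,112,112,100,64,36,84], [0,12,12,60,3,0,63,24,108,108,126,108,72,60],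
     [0,7,7,84,7,7,49,63,112,112,91,91,63,63], [0,7,7,84,7,7,49,63,112,112,91,91,63,63],
     [0,2,8,72,17,17,32,72,104,104,80,80,84,84], [1,17,4,120,8,8,50,84,104,104,80,80,48,48],
     [0,12,0,108,12,3,63,60,108,108,72,126,60,24], [0,0,12,60,12,3,27,72,108,108,72,126,96,60]]" |
  "tabi L12A = [
     [0,0,0,0,0,0,0,0,0,0,0,0,0,504], [0,0,24,0,0,32,0,24,96,96,96,0,40,96],
     [0,27,0,108,9,0,0,0,108,108,0,108,27,9], [0,0,9,36,6,9,27,45,72,72,81,45,36,66],
     [0,32,0,96,0,0,24,40,96,96,96,24,0,0], [0,0,8,64,24,0,0,0,96,96,24,96,96,0],
     [0,0,0,48,0,4,36,48,48,48,84,36,68,84], [0,3,0,60,0,5,36,48,60,60,60,72,49,51],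
     [0,7,7,56,7,7,21,35,84,84,63,63,35,35], [0,7,7,56,7,7,21,35,84,84,63,63,35,35],
     [0,0,8,40,8,2,18,48,72,72,48,84,64,40], [0,8,0,72,2,8,42,40,72,72,84,48,16,40],
     [1,12,1,88,0,0,63,51,60,60,60,60,24,24], [0,5,3,48,12,0,51,49,60,60,24,96,72,24]]" |
  "tabi L12B = [
     [0,0,0,0,0,0,0,0,0,0,0,0,504,0], [0,0,24,0,32,0,0,24,96,96,0,96,96,40],
     [0,27,0,108,0,9,0,0,108,108,108,0,9,27], [0,0,9,36,9,6,27,45,72,72,45,81,66,36],
     [0,0,8,64,0,24,0,0,96,96,96,24,0,96], [0,32,0,96,0,0,24,40,96,96,24,96,0,0],
     [0,0,0,48,4,0,36,48,48,48,36,84,84,68], [0,3,0,60,5,0,36,48,60,60,72,60,51,49],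
     [0,7,7,56,7,7,21,35,84,84,63,63,35,35], [0,7,7,56,7,7,21,35,84,84,63,63,35,35],
     [0,8,0,72,8,2,42,40,72,72,48,84,40,16], [0,0,8,40,2,8,18,48,72,72,84,48,40,64],
     [0,5,3,48,0,12,51,49,60,60,96,24,24,72], [1,12,1,88,0,0,63,51,60,60,60,60,24,24]]" |
  "tabi L2B = []" |
  "tabi L4D = []" |
  "tabi L6B = []" |
  "tabi L8C = []" |
  "tabi L12C = []" |
  "tabi L12D = []"

text \<open>Same layout as \<open>tabi\<close>, but with rows and columns indexed by
  \<open>outs\<close>: products of an inner with an outer class. Products of two outer classes are
  derived later through \<open>noo\<close>.\<close>

primrec tabo :: "lab \<Rightarrow> int list list" where
  "tabo L1A = [
     [1,0,0,0,0,0], [0,1,0,0,0,0], [0,0,1,0,0,0], [0,0,0,1,0,0], [0,0,0,0,1,0], [0,0,0,0,0,1]]" |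
  "tabo L2A = [
     [9,6,24,24,0,0], [6,1,24,0,16,16], [3,3,15,18,12,12], [4,0,24,19,8,8], [0,4,24,12,1,22],
     [0,4,24,12,22,1]]" |
  "tabo L3A = [
     [8,0,0,24,12,12], [0,0,48,0,4,4], [0,6,20,18,6,6], [4,0,24,12,8,8], [3,1,12,12,0,28],
     [3,1,12,12,28,0]]" |
  "tabo L3B = [
     [24,24,288,144,96,96], [24,56,96,240,128,128], [36,12,240,144,120,120],
     [24,40,192,192,112,112], [24,32,240,168,104,104], [24,32,240,168,104,104]]" |
  "tabo L4A = [
     [9,0,24,6,12,12], [0,17,0,30,8,8], [3,0,33,9,9,9], [1,5,12,25,10,10], [3,2,18,15,2,23],
     [3,2,18,15,23,2]]" |
  "tabo L4B = [
     [9,0,24,6,12,12], [0,17,0,30,8,8], [3,0,33,9,9,9], [1,5,12,25,10,10], [3,2,18,15,2,23],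
     [3,2,18,15,23,2]]" |
  "tabo L4C = [
     [24,6,72,132,72,72], [6,0,216,60,48,48], [9,27,126,108,54,54], [22,10,144,82,60,60],
     [18,12,108,90,138,12], [18,12,108,90,12,138]]" |
  "tabo L6A = [
     [24,0,192,72,108,108], [0,80,48,240,68,68], [24,6,228,90,78,78], [12,40,120,156,88,88],
     [27,17,156,132,128,44], [27,17,156,132,44,128]]" |
  "tabo L7A = [
     [24,24,288,240,144,144], [24,24,288,240,144,144], [36,36,288,216,144,144],
     [40,40,288,208,144,144], [36,36,288,216,72,216], [36,36,288,216,216,72]]" |
  "tabo L7B = [
     [24,24,288,240,144,144], [24,24,288,240,144,144], [36,36,288,216,144,144],
     [40,40,288,208,144,144], [36,36,288,216,72,216], [36,36,288,216,216,72]]" |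
  "tabo L8A = [
     [24,60,216,168,144,144], [60,0,360,96,120,120], [27,45,216,216,126,126],
     [28,16,288,160,132,132], [36,30,252,198,120,120], [36,30,252,198,120,120]]" |
  "tabo L8B = [
     [24,60,216,168,144,144], [60,0,360,96,120,120], [27,45,216,216,126,126],
     [28,16,288,160,132,132], [36,30,252,198,120,120], [36,30,252,198,120,120]]" |
  "tabo L12A = [
     [24,24,192,144,60,60], [24,16,144,120,100,100], [24,18,156,126,90,90], [24,20,168,132,80,80],
     [15,25,180,120,124,40], [15,25,180,120,40,124]]" |
  "tabo L12B = [
     [24,24,192,144,60,60], [24,16,144,120,100,100], [24,18,156,126,90,90], [24,20,168,132,80,80],
     [15,25,180,120,124,40], [15,25,180,120,40,124]]" |
  "tabo L2B = []" |
  "tabo L4D = []" |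
  "tabo L6B = []" |
  "tabo L8C = []" |
  "tabo L12C = []" |
  "tabo L12D = []"

definition nti :: "lab \<Rightarrow> lab \<Rightarrow> lab \<Rightarrow> int" where "nti i k l = look inns (look inns (tabi i) l) k"
definition nto :: "lab \<Rightarrow> lab \<Rightarrow> lab \<Rightarrow> int" where "nto i k l = look outs (look outs (tabo i) l) k"

definition tab_ok :: "lab \<Rightarrow> bool" where
  "tab_ok i \<longleftrightarrow> (\<forall>k\<in>set inns. \<forall>l\<in>set inns. int (nn i k l) = nti i k l) \<and>
     (\<forall>k\<in>set outs. \<forall>l\<in>set outs. int (nn i k l) = nto i k l)"

text \<open>Here \<open>y\<close> runs through the inverses of the first factor, so that
  \<open>hm y r\<close> is the second factor of a factorisation of \<open>r\<close>.\<close>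

definition lprod :: "m9 \<times> bool \<Rightarrow> m9 \<times> bool \<Rightarrow> lab" where "lprod r y = label (hm y r)"
definition gcol :: "(m9 \<times> bool) list \<Rightarrow> lab list \<Rightarrow> lab \<Rightarrow> int list" where
  "gcol L ks l = counts ks (map (lprod (rep l)) L)"

text \<open>The elements are processed in chunks since rewriting takes quadratic time in the length of a list.\<close>

fun vadd :: "int list \<Rightarrow> int list \<Rightarrow> int list" where
  "vadd (x # xs) (y # ys) = (x + y) # vadd xs ys" | "vadd xs ys = []"

primrec gcols :: "(m9 \<times> bool) list list \<Rightarrow> lab list \<Rightarrow> lab \<Rightarrow> int list" where
  "gcols [] ks l = counts ks []" | "gcols (L # Ls) ks l = vadd (gcol L ks l) (gcols Ls ks l)"

lemma gcols_eq: "gcols Ls ks l = gcol (concat Ls) ks l"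
proof -
  have "lcount k (xs @ ys) = lcount k xs + lcount k ys" for k xs ys by (induction xs) auto
  then have "counts ks (xs @ ys) = vadd (counts ks xs) (counts ks ys)" for xs ys by (induction ks) auto
  then show ?thesis by (induction Ls) (simp_all add: gcol_def)
qed

text \<open>The row sums guard the outer labels: if some product had the failure value of
  \<open>label\<close>, its row in \<open>tabo\<close> would fall short of the class size.\<close>

definition gen_check :: "lab \<Rightarrow> (m9 \<times> bool) list list \<Rightarrow> bool" where
  "gen_check i Ls \<longleftrightarrow> map (gcols Ls inns) inns = tabi i \<and> map (gcols Ls outs) outs = tabo i \<and>
     list_all (\<lambda>r. sum_list r = osize i) (tabo i)"

lemma tab_gen:
  assumes i: "i \<in> set inns" and L: "set (concat Ls) = orb (linv i)" "distinct (concat Ls)"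
    and c: "gen_check i Ls"
  shows "tab_ok i"
proof -
  define L where "L = concat Ls"
  note L = L[folded L_def] and c = c[unfolded gen_check_def, unfolded gcols_eq, folded L_def]
  have len: "int (length L) = osize i" using distinct_card[OF L(2)] L(1) card_orb[of "linv i"] by simp
  have n: "int (nn i k l) = lcount k (map (lprod (rep l)) L)"
    if ok: "\<And>y. y \<in> set L \<Longrightarrow> snd (hm y (rep l)) \<longrightarrow> lprod (rep l) y \<noteq> L1A" for k l
  proof -
    have "nn i k l = card {x \<in> orb i. hm (inv\<^bsub>HH\<^esub> x) (rep l) \<in> orb k}"
      unfolding nn_def by (simp add: HH.prod_count_left[OF orb_HH orb_HH rep_HH])
    also have "\<dots> = card (m_inv HH ` {x \<in> orb i. hm (inv\<^bsub>HH\<^esub> x) (rep l) \<in> orb k})"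
      using orb_HH by (intro card_image[symmetric] inj_onI) (metis (no_types, lifting) HH.inv_inv mem_Collect_eq subsetD)
    also have "m_inv HH ` {x \<in> orb i. hm (inv\<^bsub>HH\<^esub> x) (rep l) \<in> orb k} = {y \<in> m_inv HH ` orb i. hm y (rep l) \<in> orb k}"
      by auto
    also have "\<dots> = {y \<in> set L. lprod (rep l) y = k}"
    proof -
      have "hm y (rep l) \<in> orb k \<longleftrightarrow> lprod (rep l) y = k" if y: "y \<in> set L" for y
        using in_orb_iff[OF hm_closed[OF subsetD[OF orb_HH] rep_HH], of y "linv i" l] y L(1) ok[OF y]
        unfolding lprod_def by auto
      then show ?thesis unfolding inv_image_orb L(1) by auto
    qed
    also have "card \<dots> = length (filter (\<lambda>y. lprod (rep l) y = k) L)"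
      using distinct_card[OF distinct_filter[OF L(2)]] by simp
    finally show ?thesis by (simp add: lcount_eq filter_map comp_def)
  qed
  have i1: "i \<notin> set outs" "linv i \<notin> set outs"
    using i by (auto simp: inns_def outs_def)
  have s: "snd (hm y (rep l)) \<longleftrightarrow> l \<in> set outs" if "y \<in> set L" for y l
    using parity[of y "rep l"] snd_orb[of y "linv i"] that L(1) i1 snd_rep by auto
  have "int (nn i k l) = nti i k l" if "k \<in> set inns" "l \<in> set inns" for k l
  proof -
    have "tabi i = map (gcol L inns) inns" using c by simp
    then have "nti i k l = lcount k (map (lprod (rep l)) L)"
      using that by (simp add: nti_def look_map gcol_def counts_eq)
    then show ?thesis using n s that inns_outs by simp
  qed
  moreover have "int (nn i k l) = nto i k l" if "k \<in> set outs" "l \<in> set outs" for k l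
  proof -
    have t: "tabo i = map (gcol L outs) outs" using c by simp
    then have nt: "nto i k l = lcount k (map (lprod (rep l)) L)"
      using that by (simp add: nto_def look_map gcol_def counts_eq)
    have "list_all (\<lambda>r. sum_list r = osize i) (map (gcol L outs) outs)" using c unfolding t by simp
    then have "sum_list (gcol L outs l) = osize i" using that by (auto simp: list_all_iff)
    then have "set (map (lprod (rep l)) L) \<subseteq> set outs"
      using lcount_total(2)[of outs "map (lprod (rep l)) L"] len unfolding gcol_def by (simp add: outs_def)
    then have "lprod (rep l) y \<noteq> L1A" if "y \<in> set L" for y using that by (auto simp: outs_def)
    then show ?thesis using n nt by simp
  qed
  ultimately show ?thesis by (simp add: tab_ok_def)
qed

lemma tab_ok_1A: "tab_ok L1A"
proof -
  have "orb L1A = {(mid, False)}"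
    unfolding orb_def by (auto simp: mid_def[symmetric] su_mct intro!: exI[of _ mid] su_closed)
  then have "set (concat [[(mid, False)]]) = orb (linv L1A)" by simp
  then show ?thesis by (rule tab_gen[rotated]) (simp, code_simp, simp add: inns_def)
qed

definition hcja :: "m9 \<times> bool \<Rightarrow> m9 \<Rightarrow> m9 \<times> bool" where "hcja s t = hcj t s"
definition hcjs :: "m9 list \<Rightarrow> m9 \<times> bool \<Rightarrow> (m9 \<times> bool) list" where "hcjs T s = map (hcja s) T"
definition tconj :: "(m9 \<times> bool) list \<Rightarrow> (m9 \<times> bool) list list" where "tconj S = map (hcjs Tlist) S"

text \<open>Write the conjugating element as t k. The stabiliser moves \<open>rep l\<close> only
  within \<open>S\<close>, so conjugating \<open>S\<close> by the 63 coset representatives reaches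
  the whole orbit, and the length shows that nothing repeats.\<close>

lemma tconj_orb:
  assumes "list_all (\<lambda>k. hcj k (rep l) \<in> set S) Klist" "set S \<subseteq> orb l" "int (length S) * 63 = osize l"
  shows "set (concat (tconj S)) = orb l" "distinct (concat (tconj S))"
proof -
  have "orb l \<subseteq> set (concat (tconj S))"
  proof
    fix x assume "x \<in> orb l"
    then obtain t k where "t \<in> set Tlist" "k \<in> set Klist" "x = hcj t (hcj k (rep l))"
      unfolding orb_def hcj_hcj using su_decomp by blast
    then show "x \<in> set (concat (tconj S))" using assms(1) by (auto simp: tconj_def hcjs_def hcja_def list_all_iff)
  qed
  moreover have "set (concat (tconj S)) \<subseteq> orb l"
    using assms(2) orb_hcj su_TK(1) by (auto simp: tconj_def hcjs_def hcja_def)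
  ultimately show e: "set (concat (tconj S)) = orb l" by blast
  have "length (concat (tconj S)) = length S * length Tlist"
    unfolding tconj_def hcjs_def length_concat by (simp add: comp_def sum_list_triv)
  then have "int (length (concat (tconj S))) = int (card (set (concat (tconj S))))"
    unfolding e card_orb using assms(3) by (simp add: length_Tlist)
  then show "distinct (concat (tconj S))" by (simp add: card_distinct)
qed

lemma code_label_orb: "su A \<Longrightarrow> label (A, False) = l \<Longrightarrow> (A, False) \<in> orb l"
  using in_orb_iff[of "(A, False)"] by simp

definition su9 :: "m9 \<Rightarrow> bool" where "su9 A \<longleftrightarrow> (if mm A (mct A) = mid then mdet A = F10 else False)"
lemma su9_iff: "su9 A \<longleftrightarrow> su A" by (auto simp: su9_def su_iff_mct one_f9_def)

fun has_label :: "lab \<Rightarrow> m9 \<times> bool \<Rightarrow> bool" where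
  "has_label l (A, e) \<longleftrightarrow> (if e then False else if su9 A then label (A, False) = l else False)"

lemma has_label_orb: "has_label l x \<Longrightarrow> x \<in> orb l"
  by (cases x) (auto simp: su9_iff intro: code_label_orb split: if_splits)

lemma tab_ok_central:
  assumes "i \<in> set inns" "list_all (\<lambda>k. hcj k (rep (linv i)) \<in> set S) Klist" "list_all (has_label (linv i)) S"
    "int (length S) * 63 = osize i" "gen_check i (tconj S)"
  shows "tab_ok i"
proof -
  have S: "set S \<subseteq> orb (linv i)" using assms(3) has_label_orb unfolding list_all_iff by blast
  have l: "int (length S) * 63 = osize (linv i)" using assms(4) by simp
  show ?thesis using tab_gen[OF assms(1) tconj_orb[OF assms(2) S l] assms(5)] .
qed

text \<open>The representatives of 2A, 4A and 4B are scalar on the plane orthogonal to the third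
  basis vector. Hence \<open>Klist\<close> commutes with them, and a single element suffices for
  \<open>S\<close>.\<close>

lemma tab_ok_2A: "tab_ok L2A"
  by (rule tab_ok_central[of _ "[rep (linv L2A)]"]) (simp add: inns_def, code_simp, code_simp, simp, code_simp)

lemma tab_ok_4A: "tab_ok L4A"
  by (rule tab_ok_central[of _ "[rep (linv L4A)]"]) (simp add: inns_def, code_simp, code_simp, simp, code_simp)

lemma tab_ok_4B: "tab_ok L4B"
  by (rule tab_ok_central[of _ "[rep (linv L4B)]"]) (simp add: inns_def, code_simp, code_simp, simp, code_simp)

text \<open>The elements that fix the third basis vector and have eigenvalues i and -i on its
  orthogonal plane, which contain all conjugates of the representative under \<open>Klist\<close>.
  There are 6 of them, and 6 times 63 is the class size 378.\<close>

definition S4C :: "(m9 \<times> bool) list" where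
  "S4C = [
    (M F00 F01 F00 F01 F00 F00 F00 F00 F10, False), (M F00 F02 F00 F02 F00 F00 F00 F00 F10, False),
    (M F00 F10 F00 F20 F00 F00 F00 F00 F10, False), (M F00 F20 F00 F10 F00 F00 F00 F00 F10, False),
    (M F01 F00 F00 F00 F02 F00 F00 F00 F10, False), (M F02 F00 F00 F00 F01 F00 F00 F00 F10, False)]"

lemma tab_ok_4C: "tab_ok L4C"
  by (rule tab_ok_central[of _ S4C]) (simp add: inns_def, code_simp, code_simp, simp add: S4C_def, code_simp)

text \<open>One vector for each of the 28 isotropic points, normalised so that its first nonzero
  coordinate is 1.\<close>

definition isos :: "v9 list" where
  "isos = [
    V F00 F10 F12, V F00 F10 F22, V F00 F10 F11, V F00 F10 F21, V F10 F00 F12, V F10 F00 F22,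
    V F10 F00 F11, V F10 F00 F21, V F10 F10 F10, V F10 F10 F20, V F10 F10 F02, V F10 F10 F01,
    V F10 F20 F10, V F10 F20 F20, V F10 F20 F02, V F10 F20 F01, V F10 F02 F10, V F10 F02 F20,
    V F10 F02 F02, V F10 F02 F01, V F10 F12 F00, V F10 F22 F00, V F10 F01 F10, V F10 F01 F20,
    V F10 F01 F02, V F10 F01 F01, V F10 F11 F00, V F10 F21 F00]"

definition transv :: "f9 \<Rightarrow> v9 \<Rightarrow> m9 \<times> bool" where "transv c v = (madd mid (op1 c v), False)"
text \<open>For isotropic nonzero v, the matrix 1 + c v v^H is unitary exactly when c and its
  conjugate add up to 0. The nonzero solutions are i and -i, which gives 2 times 28 transvections,
  the size of class 3A.\<close>

definition transvs :: "(m9 \<times> bool) list" where "transvs = map (transv F01) isos @ map (transv F02) isos"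

lemma transvs_orb: "set transvs = orb L3A" and distinct_transvs: "distinct transvs"
proof -
  show d: "distinct transvs" by code_simp
  have "list_all (has_label L3A) transvs" by code_simp
  then have "set transvs \<subseteq> orb L3A" using has_label_orb by (auto simp: list_all_iff)
  moreover have "int (card (set transvs)) = int (card (orb L3A))"
    unfolding card_orb distinct_card[OF d] by (simp add: transvs_def isos_def)
  ultimately show "set transvs = orb L3A"
    using card_subset_eq finite_subset[OF orb_HH finite_HH] by (metis of_nat_eq_iff)
qed

lemma tab_ok_3A: "tab_ok L3A"
  by (rule tab_gen[of _ "[transvs]"]) (simp add: inns_def, simp add: transvs_orb, simp add: distinct_transvs, code_simp)

text \<open>\<open>Klist\<close> acts on class 7B by conjugation with nine regular orbits.\<close>

definition S7B :: "(m9 \<times> bool) list" where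
  "S7B = [
    (M F00 F12 F22 F00 F12 F11 F10 F00 F00, False), (M F00 F22 F11 F10 F00 F00 F00 F12 F12, False),
    (M F10 F22 F10 F10 F11 F10 F12 F00 F21, False), (M F10 F12 F10 F10 F21 F10 F22 F00 F11, False),
    (M F11 F10 F10 F00 F21 F12 F22 F10 F10, False), (M F00 F21 F12 F12 F10 F10 F11 F02 F02, False),
    (M F01 F11 F10 F01 F22 F10 F21 F00 F22, False), (M F22 F10 F01 F00 F22 F21 F11 F10 F01, False),
    (M F01 F10 F21 F02 F21 F10 F11 F10 F20, False)]"

definition kconj :: "(m9 \<times> bool) list list" where "kconj = map (hcjs Klist) S7B"
definition kregular :: "m9 list \<Rightarrow> m9 \<times> bool \<Rightarrow> m9 \<times> bool \<Rightarrow> bool" where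
  "kregular K s s' \<longleftrightarrow> list_all (\<lambda>k. if meq (fst (hcj k s)) (fst s') then meq k mid else True) K"

lemma kregular_check: "list_all (\<lambda>s. list_all (kregular Klist s) S7B) S7B"
  "list_all (has_label L7B) S7B"
  by code_simp+

lemma Klist_closed: "A \<in> set Klist \<Longrightarrow> B \<in> set Klist \<Longrightarrow> mm (mct A) B \<in> set Klist"
  using su_closed su_TK(2) by (intro on_axis_imp_Klist) (auto simp: Klist_iff zero_f9_def[symmetric])

text \<open>If two of the listed conjugates agree, the quotient of the conjugating elements lies in
  \<open>Klist\<close> and carries one of the nine elements to another, so it is trivial by the
  check. Hence there are 9 times 96 = 864 conjugates, the size of class 7B.\<close>

lemma kconj_orb: "set (concat kconj) = orb L7B" and distinct_kconj: "distinct (concat kconj)"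
proof -
  have S: "set S7B \<subseteq> orb L7B" using kregular_check(2) has_label_orb by (auto simp: list_all_iff)
  have inj: "inj_on (\<lambda>(k, s). hcj k s) (set Klist \<times> set S7B)"
  proof (rule inj_onI)
    fix p p' assume "p \<in> set Klist \<times> set S7B" "p' \<in> set Klist \<times> set S7B"
      and "(case p of (k, s) \<Rightarrow> hcj k s) = (case p' of (k, s) \<Rightarrow> hcj k s)"
    moreover obtain k s k' s' where p: "p = (k, s)" "p' = (k', s')" by (meson surj_pair)
    ultimately have a: "k \<in> set Klist" "k' \<in> set Klist" "s \<in> set S7B" "s' \<in> set S7B"
      and e: "hcj k s = hcj k' s'" by simp_all
    have "hcj (mct k') (hcj k s) = s'" using hcj_inverse(1)[OF su_TK(2)[OF a(2)]] by (simp only: e)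
    then have h: "hcj (mm (mct k') k) s = s'" by (simp only: hcj_hcj)
    then have "fst (hcj (mm (mct k') k) s) = fst s'" by (rule arg_cong)
    then have m: "mm (mct k') k = mid"
      using kregular_check(1) Klist_closed[OF a(2,1)] a(3,4)
      unfolding list_all_iff kregular_def meq_iff by (metis (no_types, lifting))
    have "k = mm (mm k' (mct k')) k" using su_mct(1) su_TK(2) a(2) by simp
    also have "\<dots> = k'" by (simp add: mm_assoc m)
    finally have "k = k'" .
    moreover have "s = s'" using h unfolding m hcj_mid .
    ultimately show "p = p'" using p by simp
  qed
  have "set (concat kconj) = (\<lambda>(k, s). hcj k s) ` (set Klist \<times> set S7B)"
  proof -
    have "(\<lambda>(k, s). h k s) ` (A \<times> B) = (\<Union>s\<in>B. (\<lambda>k. h k s) ` A)"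
      for h :: "m9 \<Rightarrow> m9 \<times> bool \<Rightarrow> m9 \<times> bool" and A B
      by auto
    then show ?thesis by (simp add: kconj_def hcjs_def hcja_def del: hcj.simps)
  qed
  then have "card (set (concat kconj)) = 96 * card (set S7B)"
    using card_image[OF inj] by (simp add: card_cartesian_product distinct_card[OF distinct_Klist] length_Klist)
  moreover have "card (set S7B) = 9" by (simp add: S7B_def)
  ultimately have c: "card (set (concat kconj)) = 864" by simp
  have "set (concat kconj) \<subseteq> orb L7B" using S orb_hcj su_TK(2) by (auto simp: kconj_def hcjs_def hcja_def)
  moreover have "card (orb L7B) = 864" using card_orb[of L7B] by simp
  ultimately show "set (concat kconj) = orb L7B"
    using card_subset_eq finite_subset[OF orb_HH finite_HH] c by metis
  have "length (concat kconj) = 864"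
    unfolding kconj_def hcjs_def length_concat by (simp add: comp_def sum_list_triv length_Klist S7B_def)
  then show "distinct (concat kconj)" using c by (simp add: card_distinct)
qed

text \<open>The list runs through 7B, the class of the inverses of 7A.\<close>

lemma tab_ok_7A: "tab_ok L7A"
  by (rule tab_gen[of _ kconj]) (simp add: inns_def, simp only: kconj_orb linv.simps, rule distinct_kconj, code_simp)

section \<open>Solving for the remaining classes by associativity\<close>

primrec isum :: "(lab \<Rightarrow> int) \<Rightarrow> lab list \<Rightarrow> int" where
  "isum f [] = 0" | "isum f (k # ks) = f k + isum f ks"

lemma isum_eq: "distinct ks \<Longrightarrow> isum f ks = (\<Sum>k\<in>set ks. f k)" by (induction ks) auto

lemma distinct_inns: "distinct inns" and distinct_outs: "distinct outs" by (simp_all add: inns_def outs_def)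

text \<open>The conditional spares the lookup of \<open>T m k l\<close> whenever class
  \<open>m\<close> is absent from the product of \<open>i\<close> and \<open>j\<close>.\<close>

definition lhs_term :: "(lab \<Rightarrow> lab \<Rightarrow> lab \<Rightarrow> int) \<Rightarrow> lab \<Rightarrow> lab \<Rightarrow> lab \<Rightarrow> lab \<Rightarrow> lab \<Rightarrow> int" where
  "lhs_term T i j k l m = (if nti i j m = 0 then 0 else nti i j m * T m k l)"
definition rhs_term :: "(lab \<Rightarrow> lab \<Rightarrow> lab \<Rightarrow> int) \<Rightarrow> lab \<Rightarrow> lab \<Rightarrow> lab \<Rightarrow> lab \<Rightarrow> lab \<Rightarrow> int" where
  "rhs_term T i j k l m = T j k m * T i m l"
definition assoc_at :: "(lab \<Rightarrow> lab \<Rightarrow> lab \<Rightarrow> int) \<Rightarrow> lab list \<Rightarrow> lab \<Rightarrow> lab \<Rightarrow> lab \<Rightarrow> lab \<Rightarrow> bool" where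
  "assoc_at T ks i j k l \<longleftrightarrow> isum (lhs_term T i j k l) inns = isum (rhs_term T i j k l) ks"
definition assoc_row :: "(lab \<Rightarrow> lab \<Rightarrow> lab \<Rightarrow> int) \<Rightarrow> lab list \<Rightarrow> lab \<Rightarrow> lab \<Rightarrow> lab \<Rightarrow> bool" where
  "assoc_row T ks i j k \<longleftrightarrow> list_all (assoc_at T ks i j k) ks"
definition assoc_check :: "lab \<Rightarrow> lab \<Rightarrow> bool" where
  "assoc_check i j \<longleftrightarrow> list_all (assoc_row nti inns i j) inns \<and> list_all (assoc_row nto outs i j) outs"
definition support_check :: "lab list \<Rightarrow> lab \<Rightarrow> lab \<Rightarrow> bool" where
  "support_check ms i j \<longleftrightarrow> list_all (\<lambda>m. if nti i j m = 0 then True else m \<in> set ms) inns"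

lemma sum_inner_outer:
  fixes f :: "lab \<Rightarrow> nat"
  shows "(\<And>m. m \<in> set outs \<Longrightarrow> f m = 0) \<Longrightarrow> (\<Sum>m\<in>UNIV. f m) = (\<Sum>m\<in>set inns. f m)"
    "(\<And>m. m \<in> set inns \<Longrightarrow> f m = 0) \<Longrightarrow> (\<Sum>m\<in>UNIV. f m) = (\<Sum>m\<in>set outs. f m)"
  by (rule sum.mono_neutral_right; auto simp: UNIV_lab)+

text \<open>Associativity of the class algebra: the matrices of two classes determine that of a third class,
  provided that it is the only unknown class in their product.\<close>

lemma tab_ok_step:
  assumes ij: "i \<in> set inns" "j \<in> set inns" "u \<in> set inns" and ok: "tab_ok i" "tab_ok j"
    and ms: "\<forall>m\<in>set ms. tab_ok m" "support_check (u # ms) i j" and u: "u \<notin> set ms" "nti i j u \<noteq> 0"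
    and c: "assoc_check i j"
  shows "tab_ok u"
proof -
  have main: "int (nn u k l) = T u k l"
    if ks: "ks = inns \<and> T = nti \<or> ks = outs \<and> T = nto" and k: "k \<in> set ks" "l \<in> set ks" for ks T k l
  proof -
    have T: "int (nn m k l) = T m k l" if "tab_ok m" "k \<in> set ks" "l \<in> set ks" for m k l
      using that ks unfolding tab_ok_def by blast
    have d: "distinct ks" using ks distinct_inns distinct_outs by auto
    have par: "(k \<in> set outs) = (l \<in> set outs)" using ks k inns_outs by blast
    have ij': "i \<notin> set outs" "j \<notin> set outs" using ij inns_outs by blast+
    have s: "(\<Sum>m\<in>set inns. int (nn i j m) * int (nn m k l)) = (\<Sum>m\<in>set ks. int (nn j k m) * int (nn i m l))"
    proof -
      have "(\<Sum>m\<in>set inns. nn i j m * nn m k l) = (\<Sum>m\<in>UNIV. nn i j m * nn m k l)"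
        using ij' nn_parity by (intro sum_inner_outer(1)[symmetric]) simp
      also have "\<dots> = (\<Sum>m\<in>UNIV. nn j k m * nn i m l)" by (rule nn_assoc)
      also have "\<dots> = (\<Sum>m\<in>set ks. nn j k m * nn i m l)"
      proof (cases "ks = inns")
        case True
        then have "k \<notin> set outs" using k inns_outs by blast
        then show ?thesis unfolding True using ij' nn_parity by (intro sum_inner_outer(1)) simp
      next
        case False
        then have o: "ks = outs" using ks by blast
        show ?thesis unfolding o using ij' k(1) nn_parity inns_outs unfolding o
          by (intro sum_inner_outer(2)) (metis mult_zero_left)
      qed
      finally show ?thesis by (metis (mono_tags, lifting) of_nat_mult of_nat_sum sum.cong)
    qed
    have a: "isum (lhs_term T i j k l) inns = isum (rhs_term T i j k l) ks"
      using c ks k unfolding assoc_check_def assoc_row_def assoc_at_def list_all_iff by blast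
    have r: "(\<Sum>m\<in>set ks. int (nn j k m) * int (nn i m l)) = isum (rhs_term T i j k l) ks"
      unfolding isum_eq[OF d] rhs_term_def using T ok k by (intro sum.cong) auto
    have l: "isum (lhs_term T i j k l) inns = (\<Sum>m\<in>set inns. nti i j m * T m k l)"
      unfolding isum_eq[OF distinct_inns] lhs_term_def by (intro sum.cong) auto
    have nij: "int (nn i j m) = nti i j m" if "m \<in> set inns" for m
      using ok(1) ij(2) that unfolding tab_ok_def by blast
    \<comment> \<open>The true counts and the tabulated ones satisfy the same relation with the same
      right-hand side. In the difference all settled classes drop out, and only \<open>u\<close>
      remains.\<close>
    have "(\<Sum>m\<in>set inns. nti i j m * (int (nn m k l) - T m k l)) = 0"
      using s r a l nij by (simp add: right_diff_distrib sum_subtractf)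
    moreover have "(\<Sum>m\<in>set inns. nti i j m * (int (nn m k l) - T m k l)) =
        (\<Sum>m\<in>{u}. nti i j m * (int (nn m k l) - T m k l))"
    proof (rule sum.mono_neutral_right)
      show "\<forall>m\<in>set inns - {u}. nti i j m * (int (nn m k l) - T m k l) = 0"
        using ms T k unfolding support_check_def list_all_iff by (auto split: if_splits)
    qed (use ij in auto)
    ultimately show ?thesis using u(2) by simp
  qed
  show ?thesis unfolding tab_ok_def using main by blast
qed

text \<open>The pairs in this chain are chosen so that their product involves a single class not yet
  settled. Here 2A times 2A meets 1A, 2A, 4C and the new class 3B.\<close>

lemma tab_ok_3B: "tab_ok L3B"
  by (rule tab_ok_step[of L2A L2A _ "[L1A, L2A, L4C]"], simp add: inns_def, simp add: inns_def, simp add: inns_def,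
     rule tab_ok_2A, rule tab_ok_2A, simp add: tab_ok_1A tab_ok_2A tab_ok_4C, code_simp, simp, code_simp, code_simp)

lemma tab_ok_6A: "tab_ok L6A"
  by (rule tab_ok_step[of L3A L3A _ "[L1A, L3A, L4C]"], simp add: inns_def, simp add: inns_def, simp add: inns_def,
     rule tab_ok_3A, rule tab_ok_3A, simp add: tab_ok_1A tab_ok_3A tab_ok_4C, code_simp, simp, code_simp, code_simp)

lemma tab_ok_12B: "tab_ok L12B"
  by (rule tab_ok_step[of L4A L4A _ "[L2A, L4B, L6A]"], simp add: inns_def, simp add: inns_def, simp add: inns_def,
     rule tab_ok_4A, rule tab_ok_4A, simp add: tab_ok_2A tab_ok_4B tab_ok_6A, code_simp, simp, code_simp, code_simp)

lemma tab_ok_12A: "tab_ok L12A"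
  by (rule tab_ok_step[of L2A L3A _ "[L6A, L12B]"], simp add: inns_def, simp add: inns_def, simp add: inns_def,
     rule tab_ok_2A, rule tab_ok_3A, simp add: tab_ok_6A tab_ok_12B, code_simp, simp, code_simp, code_simp)

lemma tab_ok_8A: "tab_ok L8A"
  by (rule tab_ok_step[of L3A L4A _ "[L4C, L12B]"], simp add: inns_def, simp add: inns_def, simp add: inns_def,
     rule tab_ok_3A, rule tab_ok_4A, simp add: tab_ok_4C tab_ok_12B, code_simp, simp, code_simp, code_simp)

lemma tab_ok_8B: "tab_ok L8B"
  by (rule tab_ok_step[of L3A L4B _ "[L4C, L12A]"], simp add: inns_def, simp add: inns_def, simp add: inns_def,
     rule tab_ok_3A, rule tab_ok_4B, simp add: tab_ok_4C tab_ok_12A, code_simp, simp, code_simp, code_simp)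

definition total_at :: "(lab \<Rightarrow> lab \<Rightarrow> lab \<Rightarrow> int) \<Rightarrow> lab \<Rightarrow> lab \<Rightarrow> bool" where
  "total_at T k l \<longleftrightarrow> isum (\<lambda>m. T m k l) inns = osize k"

lemma total_check: "list_all (\<lambda>k. list_all (total_at nti k) inns) inns"
  "list_all (\<lambda>k. list_all (total_at nto k) outs) outs"
  by code_simp+

text \<open>The last matrix follows because the matrices of all classes add up to a known one.\<close>

lemma tab_ok_7B: "tab_ok L7B"
proof -
  have main: "int (nn L7B k l) = T L7B k l"
    if ks: "ks = inns \<and> T = nti \<or> ks = outs \<and> T = nto" and k: "k \<in> set ks" "l \<in> set ks" for ks T k l
  proof -
    have par: "(k \<in> set outs) = (l \<in> set outs)" using ks k inns_outs by blast
    have "isum (\<lambda>m. T m k l) inns = osize k"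
      using total_check ks k unfolding total_at_def list_all_iff by blast
    then have t: "(\<Sum>m\<in>set inns. T m k l) = osize k" by (simp add: isum_eq[OF distinct_inns])
    have "int (\<Sum>m\<in>set inns. nn m k l) = osize k" unfolding sum_nn_left[OF par] by (rule card_orb)
    then have "(\<Sum>m\<in>set inns. int (nn m k l) - T m k l) = 0" using t by (simp add: sum_subtractf)
    moreover have "(\<Sum>m\<in>set inns. int (nn m k l) - T m k l) = (\<Sum>m\<in>{L7B}. int (nn m k l) - T m k l)"
    proof (rule sum.mono_neutral_right)
      have "tab_ok m" if "m \<in> set inns - {L7B}" for m
        using that by (auto simp: inns_def tab_ok_1A tab_ok_2A tab_ok_3A tab_ok_3B tab_ok_4A tab_ok_4B tab_ok_4C tab_ok_6A tab_ok_7A tab_ok_8A tab_ok_8B tab_ok_12A tab_ok_12B)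
      then have "int (nn m k l) = T m k l" if "m \<in> set inns - {L7B}" for m
        using ks k that unfolding tab_ok_def by blast
      then show "\<forall>m\<in>set inns - {L7B}. int (nn m k l) - T m k l = 0" by simp
    qed (auto simp: inns_def)
    ultimately show ?thesis by simp
  qed
  show ?thesis unfolding tab_ok_def using main by blast
qed

lemma tab_ok_all: "i \<in> set inns \<Longrightarrow> tab_ok i"
  by (auto simp: inns_def tab_ok_7B tab_ok_1A tab_ok_2A tab_ok_3A tab_ok_3B tab_ok_4A tab_ok_4B tab_ok_4C tab_ok_6A tab_ok_7A tab_ok_8A tab_ok_8B tab_ok_12A tab_ok_12B)

section \<open>Generators and centralisers\<close>

definition GG :: "(m9 \<times> bool) monoid" where "GG = HH\<lparr>carrier := Gam\<rparr>"

lemma GG_simps [simp]: "carrier GG = Gam" "mult GG = hm" "one GG = (mid, False)"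
  by (simp_all add: GG_def)

lemma group_GG: "group GG"
  unfolding GG_def by (rule subgroup.subgroup_is_group[OF subgroup_Gam HH.group_axioms])

interpretation GG: group GG by (rule group_GG)

lemma inv_GG: "x \<in> Gam \<Longrightarrow> inv\<^bsub>GG\<^esub> x = inv\<^bsub>HH\<^esub> x"
  unfolding GG_def by (rule HH.m_inv_consistent[OF subgroup_Gam])

lemma generate_GG: "S \<subseteq> Gam \<Longrightarrow> generate GG S = generate HH S"
  unfolding GG_def by (rule HH.generate_consistent[OF _ subgroup_Gam])

text \<open>Only multiplication and unit enter \<open>Sigma_bar\<close>, so the counts made in
  \<open>HH\<close> serve both groups.\<close>

lemma Sigma_bar_GG: "Sigma_bar GG Cs = Sigma_bar HH Cs"
  by (simp add: Sigma_bar_def)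

lemma Gam_HH: "Gam \<subseteq> carrier HH" by (auto simp: Gam_def)

section \<open>Semilinear action and invariant sets of points\<close>

fun vadd3 :: "v9 \<Rightarrow> v9 \<Rightarrow> v9" where "vadd3 (V x y z) (V x' y' z') = V (x + x') (y + y') (z + z')"

fun hact :: "m9 \<times> bool \<Rightarrow> v9 \<Rightarrow> v9" where "hact (A, e) v = mv A (if e then vcj v else v)"

lemma hact_hm: "hact (hm x y) v = hact x (hact y v)"
proof -
  have "vcj (mv B w) = mv (mcj B) (vcj w)" "vcj (vcj w) = w" for B w by (cases B; cases w; simp)+
  then show ?thesis by (cases x; cases y; cases "snd x") (auto simp: mv_mm)
qed

lemma hact_sv: "\<exists>c'. hact x (sv c v) = sv c' (hact x v) \<and> (c \<noteq> 0 \<longrightarrow> c' \<noteq> 0)"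
proof -
  obtain A e where x: "x = (A, e)" by force
  have "mv A (sv c v) = sv c (mv A v)" "vcj (sv c v) = sv (cnj9 c) (vcj v)" for c v
    by (cases A; cases v; simp add: algebra_simps)+
  then show ?thesis unfolding x by (cases e) (auto intro: exI[of _ "cnj9 c"] exI[of _ c])
qed

lemma sv_sv: "sv a (sv b v) = sv (a * b) v" by (cases v) (simp add: mult.assoc)

definition is_mult :: "v9 \<Rightarrow> v9 \<Rightarrow> f9 \<Rightarrow> bool" where "is_mult q p c \<longleftrightarrow> sv c q = p"
definition onl :: "v9 \<Rightarrow> v9 \<Rightarrow> bool" where "onl p q \<longleftrightarrow> list_ex (is_mult q p) f9s"
definition pmaps :: "v9 list \<Rightarrow> m9 \<times> bool \<Rightarrow> v9 \<Rightarrow> bool" where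
  "pmaps ps x p \<longleftrightarrow> list_ex (onl (hact x p)) ps"
definition preserves :: "v9 list \<Rightarrow> m9 \<times> bool \<Rightarrow> bool" where
  "preserves ps x \<longleftrightarrow> list_all (pmaps ps x) ps"

lemma preserves_iff: "preserves ps x \<longleftrightarrow> (\<forall>p\<in>set ps. \<exists>q\<in>set ps. \<exists>c. hact x p = sv c q)"
  unfolding preserves_def pmaps_def onl_def is_mult_def list_all_iff list_ex_iff by (metis f9s)

lemma preserves_hm: "preserves ps x \<Longrightarrow> preserves ps y \<Longrightarrow> preserves ps (hm x y)"
  unfolding preserves_iff hact_hm by (metis hact_sv sv_sv)

lemma generate_preserves:
  assumes "S \<subseteq> carrier HH" "\<And>x. x \<in> S \<Longrightarrow> preserves ps x \<and> preserves ps (hinv x)" "g \<in> generate HH S"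
  shows "preserves ps g"
  using assms(3)
proof induction
  case one
  have "hact (mid, False) p = sv 1 p" for p by (cases p) (simp add: mid_eq)
  then show ?case unfolding preserves_iff HH_simps by metis
next
  case (incl h) then show ?case using assms(2) by blast
next
  case (inv h)
  then have "inv\<^bsub>HH\<^esub> h = hinv h" using assms(1) inv_HH by blast
  then show ?case using assms(2) inv by metis
next
  case (eng h1 h2)
  then show ?case using preserves_hm by simp
qed

text \<open>The two matrices are \<open>sga\<close> and \<open>sgb\<close> below, which generate the
  simple group. A group that contains it cannot preserve a configuration broken by one of
  them.\<close>

definition moved :: "v9 list \<Rightarrow> bool" where
  "moved ps \<longleftrightarrow> (if preserves ps (M F20 F00 F00 F00 F20 F00 F00 F00 F10, False) then \<not> preserves ps (M F21 F00 F12 F10 F21 F10 F02 F22 F02, False) else True)"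

definition point_moved :: "v9 \<Rightarrow> bool" where
  "point_moved p \<longleftrightarrow> (if p = V F00 F00 F00 then True else moved [p])"

lemma all_points_moved: "list_all point_moved vecs" by code_simp

definition sga :: "m9 \<times> bool" where "sga = (M F20 F00 F00 F00 F20 F00 F00 F00 F10, False)"
definition sgb :: "m9 \<times> bool" where "sgb = (M F21 F00 F12 F10 F21 F10 F02 F22 F02, False)"

lemma sgab: "sga \<in> Gam" "sgb \<in> Gam"
proof -
  have "su9 (fst sga) \<and> \<not> snd sga \<and> su9 (fst sgb) \<and> \<not> snd sgb" by code_simp
  then show "sga \<in> Gam" "sgb \<in> Gam" by (auto simp: su9_iff Gam_def sga_def sgb_def)
qed

lemma moved_not_generating:
  assumes "moved ps" "S \<subseteq> carrier HH" "\<And>x. x \<in> S \<Longrightarrow> preserves ps x \<and> preserves ps (hinv x)"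
  shows "\<not> Gam \<subseteq> generate HH S"
proof
  assume "Gam \<subseteq> generate HH S"
  then have "preserves ps sga" "preserves ps sgb" using generate_preserves[OF assms(2,3)] sgab by blast+
  then show False using assms(1) by (simp add: moved_def sga_def sgb_def)
qed

text \<open>By \<open>all_points_moved\<close> no line is fixed by both standard generators, so a
  common eigenvector confines the generated group. For a single line, invariance under inverses
  follows because the scalars do not vanish.\<close>

lemma fixed_line_not_generating:
  assumes "p \<noteq> V 0 0 0" "S \<subseteq> carrier HH" "\<And>x. x \<in> S \<Longrightarrow> \<exists>c. hact x p = sv c p"
  shows "\<not> Gam \<subseteq> generate HH S"
proof -
  have inv: "preserves [p] (hinv x)" if x: "x \<in> S" for x
  proof -
    obtain c where c: "hact x p = sv c p" using assms(3) x by blast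
    have i: "hact (hinv x) (hact x p) = p"
      using hinv_left[of x] x assms(2) by (auto simp: hact_hm[symmetric])
    obtain c' where c': "hact (hinv x) (sv c p) = sv c' (hact (hinv x) p)" "c \<noteq> 0 \<longrightarrow> c' \<noteq> 0" using hact_sv by blast
    have "c' \<noteq> 0"
    proof
      assume "c' = 0"
      then have "p = V 0 0 0" using i c c' by (cases "hact (hinv x) p") auto
      then show False using assms(1) by simp
    qed
    moreover have "p = sv c' (hact (hinv x) p)" using i c c' by simp
    ultimately have "hact (hinv x) p = sv (inverse c') p" by (metis sv_sv left_inverse sv.simps v9.exhaust mult_1)
    then show ?thesis unfolding preserves_iff by auto
  qed
  have "moved [p]" using all_points_moved vecs[of p] assms(1) unfolding list_all_iff point_moved_def
    by (auto simp: zero_f9_def split: if_splits)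
  then show ?thesis
    by (rule moved_not_generating) (use assms inv in \<open>auto simp: preserves_iff\<close>)
qed

section \<open>Words and generation of the simple group\<close>

datatype sym = X1 | X2 | X3 | X4

fun pick :: "'a list \<Rightarrow> sym \<Rightarrow> 'a" where
  "pick xs X1 = hd xs" | "pick xs X2 = hd (tl xs)" | "pick xs X3 = hd (tl (tl xs))" | "pick xs X4 = hd (tl (tl (tl xs)))"

primrec ev :: "(m9 \<times> bool) list \<Rightarrow> sym list \<Rightarrow> m9 \<times> bool" where
  "ev gs [] = (mid, False)" | "ev gs (s # w) = hm (pick gs s) (ev gs w)"

lemma ev_generate:
  assumes "length gs = 4" "set gs \<subseteq> S" "subgroup S HH"
  shows "ev gs w \<in> S"
proof -
  obtain a b c d where gs: "gs = [a, b, c, d]"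
    using assms(1) by (auto simp: length_Suc_conv numeral_eq_Suc)
  have p: "pick gs s \<in> S" for s using assms(2) unfolding gs by (cases s) auto
  show ?thesis using p subgroup.m_closed[OF assms(3)] subgroup.one_closed[OF assms(3)] by (induction w) auto
qed

lemma ev_conj:
  assumes G: "g \<in> carrier HH" and gs: "set gs \<subseteq> carrier HH" "length gs = 4"
  shows "ev (map (\<lambda>x. g \<otimes>\<^bsub>HH\<^esub> x \<otimes>\<^bsub>HH\<^esub> inv\<^bsub>HH\<^esub> g) gs) w = g \<otimes>\<^bsub>HH\<^esub> ev gs w \<otimes>\<^bsub>HH\<^esub> inv\<^bsub>HH\<^esub> g"
proof -
  obtain a b c d where l: "gs = [a, b, c, d]"
    using gs(2) by (auto simp: length_Suc_conv numeral_eq_Suc)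
  let ?c = "\<lambda>x. g \<otimes>\<^bsub>HH\<^esub> x \<otimes>\<^bsub>HH\<^esub> inv\<^bsub>HH\<^esub> g"
  have p: "pick (map ?c gs) s = ?c (pick gs s)" "pick gs s \<in> carrier HH" for s
    using gs(1) unfolding l by (cases s; simp)+
  have e: "ev gs w \<in> carrier HH" for w
    using ev_generate[of gs "carrier HH"] gs HH.subgroup_self by simp
  show ?thesis
  proof (induction w)
    case Nil
    then show ?case using HH.r_inv[OF G] HH.r_one[OF G] by simp
  next
    case (Cons s w)
    then show ?case using HH.conj_mult[OF G p(2) e, of s w] p(1) by simp
  qed
qed

definition kgen :: "m9 \<times> bool" where "kgen = (M F11 F21 F00 F22 F21 F00 F00 F00 F20, False)"

text \<open>Multiplied by the twelve powers of \<open>kgen\<close> these eight elements give all 96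
  elements of \<open>Klist\<close>; \<open>kwords\<close> writes each of them as a word in the
  standard generators.\<close>

definition kreps :: "(m9 \<times> bool) list" where
  "kreps = [
    (M F10 F00 F00 F00 F10 F00 F00 F00 F10, False), (M F00 F20 F00 F02 F00 F00 F00 F00 F01, False),
    (M F12 F12 F00 F21 F12 F00 F00 F00 F01, False), (M F00 F10 F00 F10 F00 F00 F00 F00 F20, False),
    (M F21 F11 F00 F11 F21 F00 F00 F00 F01, False), (M F21 F21 F00 F22 F11 F00 F00 F00 F20, False),
    (M F00 F10 F00 F02 F00 F00 F00 F00 F02, False), (M F10 F00 F00 F00 F20 F00 F00 F00 F20, False)]"

definition kwords :: "sym list list" where
  "kwords = [
    [], [X3, X1, X2, X1, X3], [X2, X2, X1, X3, X3, X1, X2, X2],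
    [X2, X1, X2, X1, X2, X2, X1, X2, X1, X2], [X3, X3, X3, X1, X2, X2, X1, X3, X3, X3],
    [X3, X1, X2, X2, X2, X1, X2, X2, X1, X2], [X3, X1, X3, X3, X3, X1, X3, X3, X3, X1, X3],
    [X2, X1, X2, X2, X2, X1, X3, X3, X3, X1, X3]]"

text \<open>Words are evaluated on lists of length four. The letter \<open>X3\<close> stands for the
  inverse of \<open>sgb\<close>, and repeating \<open>sga\<close> brings the list to that
  length.\<close>

definition sgens :: "(m9 \<times> bool) list" where "sgens = [sga, sgb, hinv sgb, sga]"

primrec powers :: "m9 \<times> bool \<Rightarrow> m9 \<times> bool \<Rightarrow> sym list \<Rightarrow> (m9 \<times> bool) list" where
  "powers x y [] = []" | "powers x y (s # ss) = y # powers x (hm x y) ss"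

text \<open>The twelve powers of \<open>kgen\<close>; the list of letters only serves as a counter.\<close>
definition kpowers :: "(m9 \<times> bool) list" where
  "kpowers = powers kgen (mid, False) [X1, X1, X1, X1, X1, X1, X1, X1, X1, X1, X1, X1]"
definition kprods :: "m9 list" where
  "kprods = concat (map (\<lambda>x. map (\<lambda>y. fst (hm x y)) kreps) kpowers)"
definition mmem :: "m9 list \<Rightarrow> m9 \<Rightarrow> bool" where "mmem Bs A \<longleftrightarrow> list_ex (meq A) Bs"

lemma kwords_check: "map (ev sgens) kwords = kreps" "ev sgens [X2, X1, X2, X2, X1, X2, X2, X2, X1, X3] = kgen"
  "list_all (mmem kprods) Klist"
  by code_simp+

text \<open>\<open>Tlist\<close> is ordered like a search through the orbit of nonisotropic points:
  each point after the first is the image of an earlier one under \<open>sga\<close> or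
  \<open>sgb\<close>, which \<open>chain\<close> verifies.\<close>

definition links :: "m9 \<Rightarrow> m9 \<Rightarrow> bool" where
  "links t t' \<longleftrightarrow> (if on_axis (mv (mct t) (mv (fst sga) (col3 t'))) then True
     else on_axis (mv (mct t) (mv (fst sgb) (col3 t'))))"
primrec chain :: "m9 list \<Rightarrow> m9 list \<Rightarrow> bool" where
  "chain R [] = True" | "chain R (t # ts) = (if list_ex (links t) R then chain (t # R) ts else False)"

lemma chain_check: "chain [mid] (tl Tlist)" "hd Tlist = mid" by code_simp+

context
  fixes S assumes S: "subgroup S HH" and ab: "sga \<in> S" "sgb \<in> S"
begin

lemma ev_sgens: "ev sgens w \<in> S"
proof (rule ev_generate[OF _ _ S])
  have "hinv sgb \<in> S" using subgroup.m_inv_closed[OF S ab(2)] inv_HH[OF subsetD[OF Gam_HH sgab(2)]] by simp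
  then show "set sgens \<subseteq> S" using ab by (simp add: sgens_def)
qed (simp add: sgens_def)

lemma Klist_in: "k \<in> set Klist \<Longrightarrow> (k, False) \<in> S"
proof -
  assume k: "k \<in> set Klist"
  have g: "kgen \<in> S" using ev_sgens kwords_check(2) by metis
  have r: "set kreps \<subseteq> S" using ev_sgens kwords_check(1) by (metis (no_types, lifting) imageE list.set_map subsetI)
  have m: "hm x y \<in> S" if "x \<in> S" "y \<in> S" for x y using subgroup.m_closed[OF S that] by simp
  have "set (powers x y ss) \<subseteq> S" if "x \<in> S" "y \<in> S" for x y ss
    using that(2) by (induction ss arbitrary: y) (auto simp: m that(1))
  then have p: "set kpowers \<subseteq> S" unfolding kpowers_def using g subgroup.one_closed[OF S] by (simp del: powers.simps)
  have "snd x = False" if "x \<in> set kreps" for x using that by (auto simp: kreps_def)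
  moreover have "k \<in> set kprods" using kwords_check(3) k by (auto simp: list_all_iff list_ex_iff mmem_def meq_iff)
  then obtain x y where xy: "x \<in> set kpowers" "y \<in> set kreps" "k = fst (hm x y)" by (auto simp: kprods_def)
  moreover have "snd x = False" if "x \<in> set kpowers" for x
  proof -
    have h: "snd (hm a b) = False" if "snd a = False" "snd b = False" for a b using that by (cases a; cases b) auto
    have "\<forall>z\<in>set (powers a b ss). snd z = False" if "snd a = False" "snd b = False" for a b ss
      using that(2)
    proof (induction ss arbitrary: b)
      case (Cons s ss)
      then show ?case using Cons.IH[OF h[OF that(1) Cons.prems]] by simp
    qed simp
    then show ?thesis using that unfolding kpowers_def kgen_def by (metis snd_conv)
  qed
  ultimately have "snd (hm x y) = False" using parity[OF refl, of x y] by blast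
  then have "hm x y = (k, False)" using xy(3) by (simp add: prod_eq_iff)
  then show ?thesis using m xy p r by (metis subsetD)
qed

text \<open>If g moves the point of t' to that of t, then k = t^-1 g t' stabilises the axis. So k
  lies in \<open>S\<close>, and t = g t' k^-1 lies there too.\<close>

lemma link_in:
  assumes "(t', False) \<in> S" "su t" "su t'" "links t t'"
  shows "(t, False) \<in> S"
proof -
  have c: "col3 (mm B A) = mv B (col3 A)" for A B by (cases A; cases B; simp)
  have e: "sga = (fst sga, False)" "sgb = (fst sgb, False)" "su (fst sga)" "su (fst sgb)"
  proof -
    have "x = (fst x, False) \<and> su (fst x)" if "x \<in> Gam" for x using that by (auto simp: Gam_def)
    then show "sga = (fst sga, False)" "sgb = (fst sgb, False)" "su (fst sga)" "su (fst sgb)" using sgab by blast+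
  qed
  then have "(fst sga, False) \<in> S" "(fst sgb, False) \<in> S" using ab by simp_all
  then obtain g where g: "(g, False) \<in> S" "su g" "on_axis (mv (mct t) (mv g (col3 t')))"
    using assms(4) e(3,4) unfolding links_def by (meson)
  let ?k = "mm (mct t) (mm g t')"
  have k: "?k \<in> set Klist" using g assms by (intro on_axis_imp_Klist) (auto simp: su_closed c)
  have ik: "inv\<^bsub>HH\<^esub> (?k, False) = (mct ?k, False)" using inv_HH su_TK(2)[OF k] by simp
  have "hm (hm (g, False) (t', False)) (mct ?k, False) \<in> S"
    using subgroup.m_closed[OF S subgroup.m_closed[OF S g(1) assms(1)] subgroup.m_inv_closed[OF S Klist_in[OF k]]]
    unfolding ik by simp
  moreover have "mm (mm g t') (mct ?k) = t"
  proof -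
    have "mm (mm g t') (mct ?k) = mm (mm (mm g t') (mct (mm g t'))) t"
      by (simp add: mct_mm mm_assoc)
    then show ?thesis using su_mct(1)[of "mm g t'"] su_closed(1)[OF g(2) assms(3)] by simp
  qed
  ultimately show ?thesis by simp
qed

text \<open>The stabiliser lies in \<open>S\<close> by the words, the coset representatives by the
  chain, and together they give every element.\<close>

lemma Gam_subset: "Gam \<subseteq> S"
proof -
  have C: "(t, False) \<in> S" if "chain R ts" "\<forall>r\<in>set R. (r, False) \<in> S \<and> su r" "\<forall>r\<in>set ts. su r" "t \<in> set ts" for t R ts
    using that
  proof (induction ts arbitrary: R)
    case (Cons u ts)
    then have ch: "chain (u # R) ts" and "\<exists>r\<in>set R. links u r" by (auto simp: list_ex_iff split: if_splits)
    then have u: "(u, False) \<in> S" using link_in Cons.prems by auto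
    then show ?case using Cons.IH[OF ch] Cons.prems by auto
  qed simp
  have sub: "set (tl Tlist) \<subseteq> set Tlist"
    using set_drop_subset[of 1 Tlist] by (simp add: drop_Suc)
  have one: "(mid, False) \<in> S" using subgroup.one_closed[OF S] by simp
  have tT: "(t, False) \<in> S" if "t \<in> set (tl Tlist)" for t
  proof (rule C[OF chain_check(1) _ _ that])
    show "\<forall>r\<in>set [mid]. (r, False) \<in> S \<and> su r" using one su_closed(4) by simp
    show "\<forall>r\<in>set (tl Tlist). su r" using sub su_TK(1) by blast
  qed
  have hT: "(hd Tlist, False) \<in> S" unfolding chain_check(2) by (rule one)
  have "Tlist \<noteq> []" using length_Tlist by auto
  then have T: "(t, False) \<in> S" if "t \<in> set Tlist" for t
    using that tT hT by (metis list.collapse set_ConsD)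
  show ?thesis
  proof
    fix x assume "x \<in> Gam"
    then obtain A where x: "x = (A, False)" "su A" by (auto simp: Gam_def)
    then obtain t k where tk: "t \<in> set Tlist" "k \<in> set Klist" "A = mm t k" using su_decomp by blast
    have "hm (t, False) (k, False) \<in> S"
      using subgroup.m_closed[OF S T[OF tk(1)] Klist_in[OF tk(2)]] by simp
    then show "x \<in> S" by (simp add: x tk)
  qed
qed

end

lemma Gam_subset_generate:
  assumes "set gs \<subseteq> carrier HH" "length gs = 4" "ev gs wa = sga" "ev gs wb = sgb"
  shows "Gam \<subseteq> generate HH (set gs)"
proof -
  have s: "subgroup (generate HH (set gs)) HH" by (rule HH.generate_is_subgroup[OF assms(1)])
  have "set gs \<subseteq> generate HH (set gs)" by (auto intro: generate.incl)
  then have "ev gs w \<in> generate HH (set gs)" for w using ev_generate[OF _ _ s] assms(2) by simp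
  then show ?thesis using Gam_subset[OF s] assms(3,4) by metis
qed

text \<open>An element commuting with the simple group has a one-element orbit, and 1A is the only
  label of size 1.\<close>

lemma centralizer_Gam:
  assumes z: "z \<in> carrier HH" and zc: "\<And>x. x \<in> Gam \<Longrightarrow> hm z x = hm x z"
  shows "z = (mid, False)"
proof -
  obtain l where l: "z \<in> orb l" using z orb_partition by blast
  then obtain G where G: "su G" "z = hcj G (rep l)" by (auto simp: orb_def)
  have "hcj A z = z" if "su A" for A
  proof -
    have A: "(A, False) \<in> carrier HH" "(A, False) \<in> Gam" using that by (simp_all add: Gam_def)
    then have "hm (A, False) z = hm z (A, False)" using zc by simp
    then show ?thesis using hcj_HH[OF that z] HH.conj_eq_self_iff[OF A(1) z] by simp
  qed
  then have fx: "hcj A z = z" if "su A" for A using that .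
  have r: "rep l = z" using hcj_inverse(1)[OF G(1), of "rep l"] fx[OF su_closed(2)[OF G(1)]] G(2) by simp
  have "orb l \<subseteq> {z}" unfolding orb_def r
    by (intro subsetI, elim CollectE exE conjE) (simp only: fx singleton_iff)
  then have "card (orb l) \<le> 1" using card_mono[of "{z}" "orb l"] by simp
  then have "osize l \<le> 1" using card_orb[of l] by simp
  then have "l = L1A" by (cases l) simp_all
  then show ?thesis using r by (simp add: mid_def)
qed

lemma centreless_HH: "centreless HH" and centreless_GG: "centreless GG"
proof -
  show "centreless HH" unfolding centreless_def HH_simps using centralizer_Gam subsetD[OF Gam_HH] by metis
  show "centreless GG" unfolding centreless_def GG_simps using centralizer_Gam subsetD[OF Gam_HH] by metis
qed

section \<open>Scott's criterion for reflections\<close>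

text \<open>Lists of labels describe the classes of the extension, which may consist of two orbits
  of the simple group.\<close>

definition union_orb :: "lab list \<Rightarrow> (m9 \<times> bool) set" where "union_orb ls = (\<Union>l\<in>set ls. orb l)"

definition nnU :: "lab list \<Rightarrow> lab list \<Rightarrow> lab \<Rightarrow> nat" where
  "nnU I K m = (\<Sum>i\<in>set I. \<Sum>k\<in>set K. nn i k m)"

lemma union_orb_HH: "union_orb ls \<subseteq> carrier HH" using orb_HH by (auto simp: union_orb_def)

lemma inv_union_orb: "(m_inv HH) ` union_orb ls = union_orb (map linv ls)"
  unfolding union_orb_def image_UN inv_image_orb by simp

lemma prod_count_union:
  assumes "z \<in> orb m"
  shows "prod_count HH (union_orb I) (union_orb K) z = nnU I K m"
proof -
  let ?S = "\<lambda>i k. {(x, y). x \<in> orb i \<and> y \<in> orb k \<and> hm x y = z}"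
  have f: "finite (?S i k)" for i k
    by (rule finite_subset[of _ "carrier HH \<times> carrier HH"]) (use orb_HH finite_HH in blast, use finite_HH in simp)
  have "{(x, y). x \<in> union_orb I \<and> y \<in> union_orb K \<and> hm x y = z} = (\<Union>p\<in>set I \<times> set K. ?S (fst p) (snd p))"
    unfolding union_orb_def by fastforce
  moreover have "card (\<Union>p\<in>set I \<times> set K. ?S (fst p) (snd p)) = (\<Sum>p\<in>set I \<times> set K. card (?S (fst p) (snd p)))"
  proof (rule card_UN_disjoint)
    show "\<forall>p\<in>set I \<times> set K. \<forall>q\<in>set I \<times> set K. p \<noteq> q \<longrightarrow> ?S (fst p) (snd p) \<inter> ?S (fst q) (snd q) = {}"
    proof (intro ballI impI equals0I)
      fix p q r assume "p \<noteq> q" and r: "r \<in> ?S (fst p) (snd p) \<inter> ?S (fst q) (snd q)"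
      obtain x y where xy: "r = (x, y)" by (cases r)
      have "x \<in> orb (fst p)" "x \<in> orb (fst q)" "y \<in> orb (snd p)" "y \<in> orb (snd q)" using r xy by auto
      then have "fst p = fst q" "snd p = snd q" using orb_disjoint by metis+
      then show False using \<open>p \<noteq> q\<close> by (simp add: prod_eq_iff)
    qed
  qed (use f in simp_all)
  moreover have "card (?S i k) = nn i k m" for i k
    using prod_count_orb[OF assms, of i k] unfolding prod_count_def by simp
  ultimately show ?thesis
    unfolding prod_count_def nnU_def by (simp add: sum.cartesian_product split_def)
qed

lemma card_Sigma_union:
  "card (Sigma_bar HH [union_orb I, union_orb J, union_orb K, union_orb L]) =
    (\<Sum>m\<in>UNIV. card (orb m) * (nnU I J m * nnU (map linv L) (map linv K) m))"
  unfolding HH.card_Sigma_bar_4[OF finite_HH union_orb_HH union_orb_HH union_orb_HH union_orb_HH] inv_union_orb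
  by (rule sum_orbits) (simp add: prod_count_union)

lemma linv_outs: "linv l \<in> set outs \<longleftrightarrow> l \<in> set outs" by (cases l) (simp_all add: outs_def)

lemma nnU_parity_inner:
  assumes "set I \<subseteq> set inns" "set J \<subseteq> set inns" "m \<in> set outs"
  shows "nnU I J m = 0"
  unfolding nnU_def using assms inns_outs by (auto intro!: sum.neutral nn_parity)

lemma nnU_parity_mixed:
  assumes "set I \<subseteq> set inns" "set J \<subseteq> set outs" "m \<in> set inns"
  shows "nnU I J m = 0"
  unfolding nnU_def using assms inns_outs by (auto intro!: sum.neutral nn_parity)

lemma nnU_parity_outer:
  assumes "set I \<subseteq> set outs" "set J \<subseteq> set outs" "m \<in> set outs"
  shows "nnU I J m = 0"
  unfolding nnU_def using assms inns_outs by (auto intro!: sum.neutral nn_parity)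

text \<open>The weights depend on the first two classes only, so they are computed once and reused
  for all choices of the last two; a zero weight skips the table lookup in
  \<open>dotn\<close>.\<close>

primrec weights :: "(lab \<Rightarrow> int) \<Rightarrow> lab list \<Rightarrow> int list" where
  "weights f [] = []" | "weights f (m # ms) = (osize m * f m) # weights f ms"
primrec dotn :: "(lab \<Rightarrow> int) \<Rightarrow> lab list \<Rightarrow> int list \<Rightarrow> int" where
  "dotn f [] ws = 0" | "dotn f (m # ms) ws = (if hd ws = 0 then 0 else hd ws * f m) + dotn f ms (tl ws)"

lemma dotn_weights: "distinct ms \<Longrightarrow> dotn g ms (weights f ms) = (\<Sum>m\<in>set ms. osize m * (f m * g m))"
  by (induction ms) (auto simp: mult.assoc)

text \<open>Numbering the labels lets the enumeration visit each multiset of classes once.\<close>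

definition lidx :: "lab \<Rightarrow> int" where
  "lidx l = (case l of L1A \<Rightarrow> 0 | L2A \<Rightarrow> 1 | L3A \<Rightarrow> 2 | L3B \<Rightarrow> 3 | L4A \<Rightarrow> 4 | L4B \<Rightarrow> 5 | L4C \<Rightarrow> 6 | L6A \<Rightarrow> 7 | L7A \<Rightarrow> 8 | L7B \<Rightarrow> 9 | L8A \<Rightarrow> 10 | L8B \<Rightarrow> 11 | L12A \<Rightarrow> 12 | L12B \<Rightarrow> 13 | L2B \<Rightarrow> 14 | L4D \<Rightarrow> 15 | L6B \<Rightarrow> 16 | L8C \<Rightarrow> 17 | L12C \<Rightarrow> 18 | L12D \<Rightarrow> 19)"

definition ninn :: "lab list" where "ninn = tl inns"

lemma ninn_inns: "l \<in> set ninn \<Longrightarrow> l \<in> set inns" by (simp add: ninn_def inns_def)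

text \<open>\<open>reflc l\<close> is the scalar of an element of class \<open>l\<close> on the hyperplane that it fixes pointwise up to a
  scalar, and 0 if there is no such hyperplane; \<open>evl l\<close> lists the eigenvalues in the field with 9 elements.\<close>

primrec reflc :: "lab \<Rightarrow> f9" where

  "reflc L1A = F00" | "reflc L2A = F20" | "reflc L3A = F10" | "reflc L3B = F00" |
  "reflc L4A = F01" | "reflc L4B = F02" | "reflc L4C = F00" | "reflc L6A = F00" |
  "reflc L7A = F00" | "reflc L7B = F00" | "reflc L8A = F00" | "reflc L8B = F00" |
  "reflc L12A = F00" | "reflc L12B = F00" | "reflc L2B = F00" | "reflc L4D = F00" |
  "reflc L6B = F00" | "reflc L8C = F00" | "reflc L12C = F00" | "reflc L12D = F00"

primrec evl :: "lab \<Rightarrow> f9 list" where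
  "evl L1A = [F10]" | "evl L2A = [F10, F20]" | "evl L3A = [F10]" | "evl L3B = [F10]" |
  "evl L4A = [F01, F20]" | "evl L4B = [F02, F20]" | "evl L4C = [F01, F02, F10]" |
  "evl L6A = [F10, F20]" | "evl L7A = []" | "evl L7B = []" | "evl L8A = [F01, F12, F21]" |
  "evl L8B = [F02, F11, F22]" | "evl L12A = [F02, F20]" | "evl L12B = [F01, F20]" |
  "evl L2B = []" | "evl L4D = []" | "evl L6B = []" | "evl L8C = []" | "evl L12C = []" |
  "evl L12D = []"

text \<open>The centre u of the reflection; with b given by \<open>reflb\<close> and c by
  \<open>reflc\<close>, the representative maps v to c v + b h(v, u) u.\<close>

primrec reflu :: "lab \<Rightarrow> v9" where
  "reflu L1A = V F00 F00 F00" | "reflu L2A = V F00 F00 F01" | "reflu L3A = V F00 F01 F21" |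
  "reflu L3B = V F00 F00 F00" | "reflu L4A = V F00 F00 F01" | "reflu L4B = V F00 F00 F01" |
  "reflu L4C = V F00 F00 F00" | "reflu L6A = V F00 F00 F00" | "reflu L7A = V F00 F00 F00" |
  "reflu L7B = V F00 F00 F00" | "reflu L8A = V F00 F00 F00" | "reflu L8B = V F00 F00 F00" |
  "reflu L12A = V F00 F00 F00" | "reflu L12B = V F00 F00 F00" | "reflu L2B = V F00 F00 F00" |
  "reflu L4D = V F00 F00 F00" | "reflu L6B = V F00 F00 F00" | "reflu L8C = V F00 F00 F00" |
  "reflu L12C = V F00 F00 F00" | "reflu L12D = V F00 F00 F00"

primrec reflb :: "lab \<Rightarrow> f9" where
  "reflb L1A = F00" | "reflb L2A = F20" | "reflb L3A = F01" | "reflb L3B = F00" |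
  "reflb L4A = F22" | "reflb L4B = F21" | "reflb L4C = F00" | "reflb L6A = F00" |
  "reflb L7A = F00" | "reflb L7B = F00" | "reflb L8A = F00" | "reflb L8B = F00" |
  "reflb L12A = F00" | "reflb L12B = F00" | "reflb L2B = F00" | "reflb L4D = F00" |
  "reflb L6B = F00" | "reflb L8C = F00" | "reflb L12C = F00" | "reflb L12D = F00"

text \<open>This covers centres that are not isotropic, as in 2A, 4A and 4B, and isotropic ones, as
  for the transvections in 3A.\<close>

definition is_refl :: "m9 \<Rightarrow> f9 \<Rightarrow> bool" where
  "is_refl A c \<longleftrightarrow> c \<noteq> 0 \<and> (\<exists>u b. u \<noteq> V 0 0 0 \<and> b \<noteq> 0 \<and> (\<forall>v. mv A v = vadd3 (sv c v) (sv (b * hf v u) u)))"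

lemma mv_linear: "mv A (vadd3 v w) = vadd3 (mv A v) (mv A w)" "mv A (sv c v) = sv c (mv A v)"
  by (cases A; cases v; cases w; simp add: algebra_simps)+

lemma hf_mct: "hf (mv A v) w = hf v (mv (mct A) w)"
  by (cases A; cases v; cases w; simp add: algebra_simps)

lemma mv_cancel: "su A \<Longrightarrow> mv A (mv (mct A) v) = v" "su A \<Longrightarrow> mv (mct A) (mv A v) = v"
  by (simp_all add: mv_mm[symmetric] su_mct)

lemma mv_zero: "mv A (V 0 0 0) = V 0 0 0" by (cases A) simp

lemma is_refl_conj:
  assumes "su G" "is_refl A c"
  shows "is_refl (mm (mm G A) (mct G)) c"
proof -
  obtain u b where u: "c \<noteq> 0" "u \<noteq> V 0 0 0" "b \<noteq> 0" "\<forall>v. mv A v = vadd3 (sv c v) (sv (b * hf v u) u)"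
    using assms(2) unfolding is_refl_def by blast
  have "mv G u \<noteq> V 0 0 0" using u(2) mv_cancel(2)[OF assms(1), of u] mv_zero by metis
  moreover have "mv (mm (mm G A) (mct G)) v = vadd3 (sv c v) (sv (b * hf v (mv G u)) (mv G u))" for v
  proof -
    have "hf (mv (mct G) v) u = hf v (mv G u)" by (simp add: hf_mct)
    then show ?thesis by (simp add: mv_mm u(4)[rule_format] mv_linear mv_cancel(1)[OF assms(1)])
  qed
  ultimately show ?thesis unfolding is_refl_def using u by blast
qed

definition refl_at :: "m9 \<Rightarrow> f9 \<Rightarrow> f9 \<Rightarrow> v9 \<Rightarrow> v9 \<Rightarrow> bool" where
  "refl_at A c b u v \<longleftrightarrow> mv A v = vadd3 (sv c v) (sv (b * hf v u) u)"
definition refl_ok :: "lab \<Rightarrow> bool" where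
  "refl_ok l \<longleftrightarrow> (if reflc l = F00 then True else if reflb l = F00 then False else if reflu l = V F00 F00 F00 then False
     else list_all (refl_at (fst (rep l)) (reflc l) (reflb l) (reflu l)) [V F10 F00 F00, V F00 F10 F00, V F00 F00 F10])"
definition is_ev :: "m9 \<Rightarrow> f9 \<Rightarrow> v9 \<Rightarrow> bool" where
  "is_ev A m v \<longleftrightarrow> (if v = V F00 F00 F00 then False else mv A v = sv m v)"
definition ev_ok1 :: "m9 \<Rightarrow> f9 \<Rightarrow> bool" where "ev_ok1 A m \<longleftrightarrow> (if m = F00 then False else list_ex (is_ev A m) vecs)"
definition ev_ok :: "lab \<Rightarrow> bool" where "ev_ok l \<longleftrightarrow> list_all (ev_ok1 (fst (rep l))) (evl l)"

lemma refl_ev_check: "list_all refl_ok (inns @ outs)" "list_all ev_ok (inns @ outs)"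
  by code_simp+

lemma orb_inner:
  assumes "x \<in> orb l" "l \<in> set inns"
  obtains G where "su G" "x = (mm (mm G (fst (rep l))) (mct G), False)"
proof -
  obtain G where "su G" "x = hcj G (rep l)" using assms(1) by (auto simp: orb_def)
  moreover have "rep l = (fst (rep l), False)" using assms(2) snd_rep inns_outs by (metis prod.collapse)
  ultimately show ?thesis using that by (metis hcj.simps)
qed

lemma orb_is_refl:
  assumes "x \<in> orb l" "l \<in> set inns" "reflc l \<noteq> 0"
  shows "is_refl (fst x) (reflc l)"
proof -
  let ?A = "fst (rep l)"
  have "\<forall>v. mv ?A v = vadd3 (sv (reflc l) v) (sv (reflb l * hf v (reflu l)) (reflu l))" "reflb l \<noteq> 0" "reflu l \<noteq> V 0 0 0"
  proof -
    have c: "reflb l \<noteq> 0 \<and> reflu l \<noteq> V 0 0 0 \<and>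
        list_all (refl_at ?A (reflc l) (reflb l) (reflu l)) [V 1 0 0, V 0 1 0, V 0 0 1]"
      using all_labs[OF refl_ev_check(1), of l] assms(3) unfolding refl_ok_def
      by (simp add: zero_f9_def[symmetric] one_f9_def[symmetric] split: if_splits)
    show "reflb l \<noteq> 0" "reflu l \<noteq> V 0 0 0" using c by auto
    show "\<forall>v. mv ?A v = vadd3 (sv (reflc l) v) (sv (reflb l * hf v (reflu l)) (reflu l))"
    proof
      fix v
      obtain x y z where v: "v = V x y z" by (cases v)
      have d: "v = vadd3 (sv x (V 1 0 0)) (vadd3 (sv y (V 0 1 0)) (sv z (V 0 0 1)))" by (simp add: v)
      have "mv ?A v = vadd3 (sv x (mv ?A (V 1 0 0))) (vadd3 (sv y (mv ?A (V 0 1 0))) (sv z (mv ?A (V 0 0 1))))"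
        by (subst d) (simp only: mv_linear)
      also have "\<dots> = vadd3 (sv (reflc l) v) (sv (reflb l * hf v (reflu l)) (reflu l))"
        using c by (cases "reflu l") (simp add: refl_at_def v algebra_simps)
      finally show "mv ?A v = vadd3 (sv (reflc l) v) (sv (reflb l * hf v (reflu l)) (reflu l))" .
    qed
  qed
  then have "is_refl ?A (reflc l)" unfolding is_refl_def using assms(3) by blast
  moreover obtain G where "su G" "x = (mm (mm G ?A) (mct G), False)" using orb_inner assms(1,2) by metis
  ultimately show ?thesis using is_refl_conj by simp
qed

lemma orb_ev:
  assumes "x \<in> orb l" "l \<in> set inns" "m \<in> set (evl l)"
  shows "m \<noteq> 0" "\<exists>v. v \<noteq> V 0 0 0 \<and> mv (fst x) v = sv m v"
proof -
  have c: "m \<noteq> 0 \<and> (\<exists>v. v \<noteq> V 0 0 0 \<and> mv (fst (rep l)) v = sv m v)"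
    using all_labs[OF refl_ev_check(2), of l] assms(3) unfolding ev_ok_def ev_ok1_def is_ev_def list_all_iff list_ex_iff
    by (metis zero_f9_def)
  then show "m \<noteq> 0" by simp
  obtain v where v: "v \<noteq> V 0 0 0" "mv (fst (rep l)) v = sv m v" using c by blast
  obtain G where G: "su G" "x = (mm (mm G (fst (rep l))) (mct G), False)" using orb_inner assms(1,2) by metis
  have "mv G v \<noteq> V 0 0 0" using v(1) mv_cancel(2)[OF G(1), of v] mv_zero by metis
  moreover have "mv (fst x) (mv G v) = sv m (mv G v)" by (simp add: G mv_mm mv_cancel v mv_linear)
  ultimately show "\<exists>v. v \<noteq> V 0 0 0 \<and> mv (fst x) v = sv m v" by blast
qed

lemma finite_v9: "finite (UNIV :: v9 set)"
proof -
  have "(UNIV :: v9 set) = set vecs" using vecs by blast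
  then show ?thesis by (metis List.finite_set)
qed

text \<open>If the three reflection centres \<open>u1, u2, u3\<close> are dependent, then there is a vector orthogonal to all of
  them, hence a common eigenvector. Otherwise an eigenvector of \<open>X\<close> for the critical eigenvalue is
  orthogonal to all three, which is impossible.\<close>

lemma common_eigenvector:
  assumes r: "is_refl A1 c1" "is_refl A2 c2" "is_refl A3 c3"
    and X: "m \<noteq> 0" "v \<noteq> V 0 0 0" "mv X v = sv m v" and mc: "m * (c1 * c2 * c3) = 1"
    and prod: "mm A1 (mm A2 (mm A3 X)) = mid" "mm X (mm A1 (mm A2 A3)) = mid"
  shows "\<exists>p. p \<noteq> V 0 0 0 \<and> (\<exists>c. mv A1 p = sv c p) \<and> (\<exists>c. mv A2 p = sv c p) \<and>
    (\<exists>c. mv A3 p = sv c p) \<and> (\<exists>c. mv X p = sv c p)"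
proof -
  obtain u1 b1 where u1: "c1 \<noteq> 0" "b1 \<noteq> 0" "\<And>v. mv A1 v = vadd3 (sv c1 v) (sv (b1 * hf v u1) u1)"
    using r(1) unfolding is_refl_def by blast
  obtain u2 b2 where u2: "c2 \<noteq> 0" "b2 \<noteq> 0" "\<And>v. mv A2 v = vadd3 (sv c2 v) (sv (b2 * hf v u2) u2)"
    using r(2) unfolding is_refl_def by blast
  obtain u3 b3 where u3: "c3 \<noteq> 0" "b3 \<noteq> 0" "\<And>v. mv A3 v = vadd3 (sv c3 v) (sv (b3 * hf v u3) u3)"
    using r(3) unfolding is_refl_def by blast
  have add0: "vadd3 v (sv 0 w) = v" for v w by (cases v; cases w; simp)
  show ?thesis
  proof (cases "\<exists>p. p \<noteq> V 0 0 0 \<and> hf p u1 = 0 \<and> hf p u2 = 0 \<and> hf p u3 = 0")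
    case True
    then obtain p where p: "p \<noteq> V 0 0 0" "hf p u1 = 0" "hf p u2 = 0" "hf p u3 = 0" by blast
    have e: "mv A1 p = sv c1 p" "mv A2 p = sv c2 p" "mv A3 p = sv c3 p"
      by (simp_all add: u1(3) u2(3) u3(3) p add0)
    have "mv X (mv A1 (mv A2 (mv A3 p))) = p" unfolding mv_mm[symmetric] prod(2) by simp
    then have x: "sv (c1 * c2 * c3) (mv X p) = p" by (simp add: e mv_linear sv_sv mult_ac)
    have "mv X p = sv (m * (c1 * c2 * c3)) (mv X p)" unfolding mc by (cases "mv X p") simp
    also have "\<dots> = sv m p" using x by (simp add: sv_sv[symmetric])
    finally show ?thesis using p(1) e by blast
  next
    case False
    define D where "D p = V (hf p u1) (hf p u2) (hf p u3)" for p
    have hl: "hf (vadd3 a b) w = hf a w + hf b w" "hf (sv k a) w = k * hf a w"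
      "hf w (vadd3 a b) = hf w a + hf w b" "hf w (sv k a) = cnj9 k * hf w a" for a b w k
      by (cases a; cases b; cases w; simp add: algebra_simps)+
    have "inj D"
    proof (rule injI)
      fix p q assume e: "D p = D q"
      let ?d = "vadd3 p (sv (- 1) q)"
      have "hf ?d u1 = 0" "hf ?d u2 = 0" "hf ?d u3 = 0" using e by (simp_all add: D_def hl)
      then have "?d = V 0 0 0" using False by blast
      then show "p = q" by (cases p; cases q; simp)
    qed
    \<comment> \<open>The three forms separate vectors, so by finiteness there is a dual basis, and
      this shows that the three centres are independent.\<close>
    then have "surj D" using finite_v9 finite_UNIV_inj_surj by blast
    then obtain w1 w2 w3 where w: "D w1 = V 1 0 0" "D w2 = V 0 1 0" "D w3 = V 0 0 1" by (metis surjD)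
    have zero: "x1 = 0 \<and> x2 = 0 \<and> x3 = 0" if "vadd3 (sv x1 u1) (vadd3 (sv x2 u2) (sv x3 u3)) = V 0 0 0" for x1 x2 x3
    proof -
      have "hf p (vadd3 (sv x1 u1) (vadd3 (sv x2 u2) (sv x3 u3))) = 0" for p unfolding that by (cases p) simp
      then have "cnj9 x1 * hf p u1 + (cnj9 x2 * hf p u2 + cnj9 x3 * hf p u3) = 0" for p by (simp add: hl)
      from this[of w1] this[of w2] this[of w3] show ?thesis using w by (simp add: D_def)
    qed
    \<comment> \<open>The increments along the three centres. For the critical eigenvalue the
      product of the reflections maps \<open>v\<close> to c1 c2 c3 times \<open>v\<close>, so all
      multiples of \<open>v\<close> cancel and a linear relation between the centres remains, with
      coefficients that are nonzero multiples of the increments.\<close>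
    define a3 where "a3 = b3 * hf v u3"
    define a2 where "a2 = b2 * hf (mv A3 v) u2"
    define a1 where "a1 = b1 * hf (mv A2 (mv A3 v)) u1"
    have "mv A1 (mv A2 (mv A3 (mv X v))) = v" unfolding mv_mm[symmetric] prod(1) by simp
    then have "sv m (mv A1 (mv A2 (mv A3 v))) = v" unfolding X(3) mv_linear .
    then have "sv (c1 * c2 * c3) (sv m (mv A1 (mv A2 (mv A3 v)))) = sv (c1 * c2 * c3) v" by simp
    then have l: "mv A1 (mv A2 (mv A3 v)) = sv (c1 * c2 * c3) v"
      using mc unfolding sv_sv by (cases "mv A1 (mv A2 (mv A3 v))") (simp add: mult.commute)
    have m3: "mv A3 v = vadd3 (sv c3 v) (sv a3 u3)" by (simp add: u3(3) a3_def)
    have m2: "mv A2 (mv A3 v) = vadd3 (sv c2 (mv A3 v)) (sv a2 u2)" by (simp add: u2(3) a2_def)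
    have m1: "mv A1 (mv A2 (mv A3 v)) = vadd3 (sv c1 (mv A2 (mv A3 v))) (sv a1 u1)" by (simp add: u1(3) a1_def)
    have "vadd3 (sv a1 u1) (vadd3 (sv (c1 * a2) u2) (sv (c1 * c2 * a3) u3)) = V 0 0 0"
      using l[unfolded m1, unfolded m2, unfolded m3] by (cases v; cases u1; cases u2; cases u3; simp add: algebra_simps)
    then have "a1 = 0" "c1 * a2 = 0" "c1 * c2 * a3 = 0" using zero by blast+
    then have a: "a1 = 0" "a2 = 0" "a3 = 0" using u1(1) u2(1) by auto
    have n3: "hf v u3 = 0" using a(3) u3(2) by (simp add: a3_def)
    have e3: "mv A3 v = sv c3 v" unfolding m3 a by (rule add0)
    have n2: "hf v u2 = 0" using a(2) u2(2) u3(1) by (simp add: a2_def e3 hl)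
    have e2: "mv A2 (mv A3 v) = sv (c2 * c3) v" unfolding m2 a add0 unfolding e3 by (simp add: sv_sv)
    have n1: "hf v u1 = 0" using a(1) u1(2) u2(1) u3(1) by (simp add: a1_def e2 hl)
    show ?thesis using False X(2) n1 n2 n3 by blast
  qed
qed

text \<open>Scalars with product 1 turn the three reflections into maps fixing a plane pointwise and
  the fourth element into one fixing a vector. The codimensions of the fixed spaces then add up to
  at most 1 + 1 + 1 + 2 = 5, below the 2 times 3 that Scott's lemma demands of an irreducible
  group.\<close>

definition scott3 :: "lab \<Rightarrow> lab \<Rightarrow> lab \<Rightarrow> lab \<Rightarrow> bool" where
  "scott3 a b c x \<longleftrightarrow> (if reflc a * reflc b * reflc c = F00 then False
     else inverse (reflc a * reflc b * reflc c) \<in> set (evl x))"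

lemma scott3_not_generating:
  assumes "scott3 a b c x" "set [a, b, c, x] \<subseteq> set inns"
  shows "Sigma_gen GG [orb a, orb b, orb c, orb x] = {}"
proof (rule ccontr)
  assume "Sigma_gen GG [orb a, orb b, orb c, orb x] \<noteq> {}"
  then obtain gs where gs: "gs \<in> Sigma_gen GG [orb a, orb b, orb c, orb x]" by blast
  then obtain g1 g2 g3 g4 where g: "gs = [g1, g2, g3, g4]" "g1 \<in> orb a" "g2 \<in> orb b" "g3 \<in> orb c" "g4 \<in> orb x"
    and pr: "hm g1 (hm g2 (hm g3 (hm g4 (mid, False)))) = (mid, False)"
    and gen: "generate GG (set gs) = Gam"
    by (auto simp: Sigma_gen_def Sigma_bar_def list_all2_Cons2)
  have "snd g1 = False" "snd g2 = False" "snd g3 = False" "snd g4 = False"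
    using g assms(2) snd_orb inns_outs by auto
  then obtain A1 A2 A3 X where A: "g1 = (A1, False)" "g2 = (A2, False)" "g3 = (A3, False)" "g4 = (X, False)"
    by (metis prod.collapse)
  have sub: "set gs \<subseteq> carrier HH" using g orb_HH by auto
  have su: "su A1" "su A2" "su A3" "su X" using sub g(1) A by auto
  have p1: "mm A1 (mm A2 (mm A3 X)) = mid" using pr by (simp add: A)
  let ?B = "mm A1 (mm A2 A3)"
  have "su ?B" using su su_closed by simp
  have "mm ?B X = mid" using p1 by (simp add: mm_assoc)
  then have "X = mct ?B" using mm_left_cancel[OF \<open>su ?B\<close>, of X "mct ?B"] su_mct(1)[OF \<open>su ?B\<close>] by simp
  then have p2: "mm X ?B = mid" using su_mct(2)[OF \<open>su ?B\<close>] by simp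
  have nz: "reflc a \<noteq> 0" "reflc b \<noteq> 0" "reflc c \<noteq> 0" and m: "inverse (reflc a * reflc b * reflc c) \<in> set (evl x)"
    using assms(1) by (auto simp: scott3_def zero_f9_def[symmetric] split: if_splits)
  have r: "is_refl A1 (reflc a)" "is_refl A2 (reflc b)" "is_refl A3 (reflc c)"
    using orb_is_refl[OF g(2) _ nz(1)] orb_is_refl[OF g(3) _ nz(2)] orb_is_refl[OF g(4) _ nz(3)] assms(2) A by auto
  have "reflc a * reflc b * reflc c \<noteq> 0" using nz by simp
  then have k: "inverse (reflc a * reflc b * reflc c) * (reflc a * reflc b * reflc c) = 1"
    "inverse (reflc a * reflc b * reflc c) \<noteq> 0" by (rule left_inverse, rule nonzero_imp_inverse_nonzero)
  obtain v where v: "v \<noteq> V 0 0 0" "mv X v = sv (inverse (reflc a * reflc b * reflc c)) v"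
    using orb_ev(2)[OF g(5) _ m] assms(2) A by auto
  obtain p where p: "p \<noteq> V 0 0 0" "\<exists>c. mv A1 p = sv c p" "\<exists>c. mv A2 p = sv c p" "\<exists>c. mv A3 p = sv c p" "\<exists>c. mv X p = sv c p"
    using common_eigenvector[OF r k(2) v k(1) p1 p2] by blast
  have "\<exists>c. hact y p = sv c p" if "y \<in> set gs" for y using that p unfolding g A by auto
  then have "\<not> Gam \<subseteq> generate HH (set gs)" using fixed_line_not_generating[OF p(1) sub] by blast
  moreover have "set gs \<subseteq> Gam" using su unfolding g A by (auto simp: Gam_def)
  ultimately show False using gen generate_GG by auto
qed

definition scott :: "lab \<Rightarrow> lab \<Rightarrow> lab \<Rightarrow> lab \<Rightarrow> bool" where
  "scott a b c d \<longleftrightarrow> (if scott3 b c d a then True else if scott3 a c d b then True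
     else if scott3 a b d c then True else scott3 a b c d)"

text \<open>A pair of generating quadruples is certified by words that express the standard generators, and by a
  word whose values lie in different classes.\<close>

type_synonym tuple_cert = "(m9 \<times> bool) list \<times> sym list \<times> sym list"

text \<open>The five quadruples of the theorem and their images under the outer involution, each
  sorted by \<open>lidx\<close>.\<close>

definition targets :: "lab list list" where
  "targets = [[L3A, L3A, L3A, L4B], [L3A, L3A, L3A, L4A], [L4A, L4A, L4A, L4B], [L4A, L4B, L4B, L4B], [L2A, L2A, L3A, L4A], [L2A, L2A, L3A, L4B], [L2A, L4A, L4A, L4A], [L2A, L4B, L4B, L4B], [L3A, L3A, L4A, L4A], [L3A, L3A, L4B, L4B]]"

definition pair_certs :: "(lab list \<times> tuple_cert \<times> tuple_cert \<times> sym list) list" where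
  "pair_certs = [
  ([L2A, L4A, L4B, L4C],
    ([(M F10 F10 F11 F10 F10 F22 F12 F21 F00, False), (M F20 F20 F11 F02 F12 F01 F11 F10 F20, False), (M F02 F00 F00 F00 F02 F00 F00 F00 F20, False), (M F12 F02 F20 F01 F12 F02 F01 F10 F22, False)], [X3, X3], [X4, X3, X1]),
    ([(M F20 F00 F00 F00 F20 F00 F00 F00 F10, False), (M F12 F00 F21 F00 F01 F00 F12 F00 F12, False), (M F02 F00 F00 F00 F11 F21 F00 F21 F11, False), (M F12 F00 F21 F01 F11 F01 F20 F12 F20, False)], [X1], [X3, X3, X4]), [X1, X2]),
  ([L3A, L4A, L4A, L4C],
    ([(M F11 F20 F20 F10 F11 F01 F10 F01 F11, False), (M F01 F00 F00 F00 F01 F00 F00 F00 F20, False), (M F12 F20 F02 F02 F20 F12 F20 F21 F20, False), (M F11 F20 F20 F02 F21 F01 F20 F10 F11, False)], [X2, X2], [X1, X1, X3, X4, X3]),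
    ([(M F11 F20 F10 F10 F11 F02 F20 F02 F11, False), (M F01 F00 F00 F00 F01 F00 F00 F00 F20, False), (M F01 F00 F00 F00 F20 F00 F00 F00 F01, False), (M F21 F20 F10 F02 F11 F20 F01 F20 F11, False)], [X2, X2], [X1, X4, X3, X1]), [X1, X4]),
  ([L3A, L4B, L4B, L4C],
    ([(M F11 F00 F21 F00 F10 F00 F11 F00 F12, False), (M F02 F00 F00 F00 F02 F00 F00 F00 F20, False), (M F20 F01 F21 F20 F11 F20 F21 F01 F20, False), (M F20 F02 F21 F21 F11 F00 F20 F02 F12, False)], [X2, X2], [X4, X3, X1]),
    ([(M F12 F10 F02 F20 F12 F20 F02 F10 F12, False), (M F11 F10 F02 F02 F20 F11 F10 F22 F20, False), (M F20 F01 F21 F20 F11 F20 F21 F01 F20, False), (M F12 F01 F02 F02 F12 F20 F10 F01 F22, False)], [X1, X4, X1, X4], [X2, X4, X4, X1]), [X1, X4]),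
  ([L2A, L2A, L4A, L6A],
    ([(M F20 F00 F00 F00 F20 F00 F00 F00 F10, False), (M F10 F11 F20 F12 F00 F12 F20 F11 F10, False), (M F20 F22 F02 F22 F20 F02 F20 F20 F12, False), (M F01 F22 F02 F11 F01 F20 F02 F10 F21, False)], [X1], [X3, X1, X4, X3]),
    ([(M F20 F00 F00 F00 F20 F00 F00 F00 F10, False), (M F00 F21 F21 F22 F10 F20 F22 F20 F10, False), (M F20 F02 F11 F20 F12 F10 F11 F01 F20, False), (M F12 F10 F01 F11 F02 F10 F00 F11 F12, False)], [X1], [X2, X4, X3]), [X1, X3]),
  ([L2A, L2A, L4B, L6A],
    ([(M F00 F22 F22 F21 F10 F20 F21 F20 F10, False), (M F20 F00 F00 F00 F20 F00 F00 F00 F10, False), (M F11 F20 F01 F01 F20 F11 F20 F22 F20, False), (M F01 F01 F12 F22 F11 F00 F10 F10 F11, False)], [X2], [X4, X3, X1]),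
    ([(M F20 F00 F00 F00 F20 F00 F00 F00 F10, False), (M F00 F22 F22 F21 F10 F20 F21 F20 F10, False), (M F20 F12 F10 F12 F20 F20 F02 F01 F11, False), (M F01 F12 F01 F10 F11 F10 F22 F00 F11, False)], [X1], [X2, X4, X3]), [X1, X4]),
  ([L2A, L3A, L4A, L12A],
    ([(M F20 F00 F00 F00 F20 F00 F00 F00 F10, False), (M F12 F20 F20 F10 F12 F02 F10 F02 F12, False), (M F20 F11 F02 F11 F20 F01 F20 F10 F12, False), (M F10 F21 F20 F10 F01 F22 F22 F02 F10, False)], [X1], [X3, X4, X3, X3]),
    ([(M F20 F00 F00 F00 F20 F00 F00 F00 F10, False), (M F11 F00 F21 F00 F10 F00 F11 F00 F12, False), (M F12 F02 F20 F20 F20 F21 F02 F12 F20, False), (M F01 F10 F11 F21 F10 F10 F01 F11 F10, False)], [X1], [X3, X2, X4]), [X1, X3]),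
  ([L2A, L3A, L4B, L12B],
    ([(M F20 F00 F00 F00 F20 F00 F00 F00 F10, False), (M F11 F20 F02 F10 F11 F20 F02 F10 F11, False), (M F20 F12 F20 F12 F20 F10 F01 F02 F11, False), (M F10 F22 F02 F10 F02 F22 F11 F10 F10, False)], [X1], [X3, X2, X4]),
    ([(M F00 F00 F01 F00 F20 F00 F02 F00 F00, False), (M F12 F00 F21 F00 F10 F00 F11 F00 F11, False), (M F20 F12 F10 F12 F20 F20 F02 F01 F11, False), (M F20 F22 F20 F22 F10 F02 F02 F10 F22, False)], [X3, X4, X2], [X4, X3, X3]), [X1, X3]),
  ([L2A, L4B, L4B, L12A],
    ([(M F20 F00 F00 F00 F20 F00 F00 F00 F10, False), (M F20 F11 F01 F22 F20 F20 F20 F01 F11, False), (M F20 F12 F02 F12 F20 F01 F10 F20 F11, False), (M F01 F12 F01 F22 F00 F11 F20 F22 F20, False)], [X1], [X2, X2, X4, X2]),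
    ([(M F10 F01 F12 F02 F10 F11 F11 F12 F00, False), (M F02 F00 F00 F00 F02 F00 F00 F00 F20, False), (M F20 F01 F21 F20 F11 F20 F21 F01 F20, False), (M F21 F02 F01 F10 F20 F11 F10 F22 F10, False)], [X2, X2], [X4, X2, X1]), [X1, X4]),
  ([L2A, L4A, L4A, L12B],
    ([(M F20 F00 F00 F00 F00 F02 F00 F01 F00, False), (M F01 F00 F00 F00 F12 F22 F00 F22 F12, False), (M F20 F21 F10 F12 F20 F01 F01 F10 F12, False), (M F02 F12 F02 F12 F02 F02 F01 F01 F21, False)], [X3, X4, X2], [X1, X4, X3, X3]),
    ([(M F20 F00 F00 F00 F20 F00 F00 F00 F10, False), (M F12 F00 F22 F00 F01 F00 F22 F00 F12, False), (M F20 F22 F02 F22 F20 F02 F20 F20 F12, False), (M F02 F22 F01 F11 F02 F20 F02 F20 F21, False)], [X1], [X2, X4, X3, X2]), [X1, X4]),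
  ([L2A, L3A, L4A, L6A],
    ([(M F20 F00 F00 F00 F20 F00 F00 F00 F10, False), (M F11 F10 F01 F20 F11 F20 F01 F10 F11, False), (M F01 F00 F00 F00 F12 F22 F00 F22 F12, False), (M F11 F02 F20 F11 F01 F10 F00 F12 F11, False)], [X1], [X4, X3, X2, X2]),
    ([(M F10 F02 F12 F01 F10 F22 F11 F21 F00, False), (M F11 F01 F10 F01 F11 F10 F20 F20 F11, False), (M F01 F00 F00 F00 F01 F00 F00 F00 F20, False), (M F12 F00 F21 F20 F12 F20 F02 F22 F02, False)], [X3, X3], [X3, X3, X4]), [X1, X2]),
  ([L2A, L3A, L4B, L6A],
    ([(M F20 F00 F00 F00 F20 F00 F00 F00 F10, False), (M F12 F20 F20 F10 F12 F02 F10 F02 F12, False), (M F20 F12 F01 F12 F20 F02 F20 F10 F11, False), (M F12 F12 F00 F01 F02 F21 F01 F02 F12, False)], [X1], [X3, X1, X4]),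
    ([(M F20 F00 F00 F00 F20 F00 F00 F00 F10, False), (M F11 F22 F00 F12 F12 F00 F00 F00 F10, False), (M F20 F12 F01 F12 F20 F02 F20 F10 F11, False), (M F02 F12 F20 F01 F12 F10 F22 F00 F12, False)], [X1], [X1, X4, X3]), [X1, X2]),
  ([L3A, L3B, L4A, L4A],
    ([(M F11 F01 F10 F01 F11 F10 F20 F20 F11, False), (M F02 F22 F01 F10 F02 F22 F21 F10 F02, False), (M F20 F12 F01 F21 F20 F10 F10 F01 F12, False), (M F01 F00 F00 F00 F01 F00 F00 F00 F20, False)], [X4, X4], [X3, X2, X2, X1]),
    ([(M F11 F01 F10 F01 F11 F10 F20 F20 F11, False), (M F02 F22 F01 F10 F02 F22 F21 F10 F02, False), (M F01 F00 F00 F00 F01 F00 F00 F00 F20, False), (M F20 F12 F20 F21 F20 F01 F02 F10 F12, False)], [X3, X3], [X2, X2, X1, X4]), [X1, X4]),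
  ([L3A, L3B, L4B, L4B],
    ([(M F12 F02 F01 F02 F12 F01 F01 F01 F12, False), (M F01 F10 F22 F21 F01 F10 F02 F21 F01, False), (M F20 F22 F01 F11 F20 F10 F20 F02 F11, False), (M F02 F00 F00 F00 F02 F00 F00 F00 F20, False)], [X4, X4], [X2, X4, X2]),
    ([(M F12 F02 F01 F02 F12 F01 F01 F01 F12, False), (M F01 F10 F22 F21 F01 F10 F02 F21 F01, False), (M F02 F00 F00 F00 F02 F00 F00 F00 F20, False), (M F20 F22 F10 F11 F20 F02 F02 F10 F11, False)], [X3, X3], [X2, X3, X2]), [X1, X4]),
  ([L3A, L3A, L3B, L4A],
    ([(M F12 F00 F12 F00 F10 F00 F22 F00 F11, False), (M F11 F02 F01 F02 F11 F02 F01 F02 F11, False), (M F20 F10 F12 F22 F22 F00 F20 F10 F21, False), (M F01 F00 F00 F00 F01 F00 F00 F00 F20, False)], [X4, X4], [X1, X1, X4, X2]),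
    ([(M F11 F11 F00 F21 F12 F00 F00 F00 F10, False), (M F11 F02 F10 F02 F11 F20 F20 F10 F11, False), (M F22 F10 F10 F22 F20 F20 F00 F12 F21, False), (M F01 F00 F00 F00 F01 F00 F00 F00 F20, False)], [X4, X4], [X2, X1, X4, X3, X4]), [X1, X3]),
  ([L3A, L3A, L3B, L4B],
    ([(M F12 F10 F02 F20 F12 F20 F02 F10 F12, False), (M F11 F22 F00 F12 F12 F00 F00 F00 F10, False), (M F20 F02 F11 F22 F21 F00 F20 F02 F22, False), (M F02 F00 F00 F00 F02 F00 F00 F00 F20, False)], [X4, X4], [X3, X1, X4, X3]),
    ([(M F12 F22 F00 F12 F11 F00 F00 F00 F10, False), (M F10 F00 F00 F00 F11 F21 F00 F11 F12, False), (M F21 F21 F00 F10 F20 F21 F02 F01 F22, False), (M F02 F00 F00 F00 F02 F00 F00 F00 F20, False)], [X4, X4], [X1, X3, X2]), [X1, X4]),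
  ([L3A, L4A, L4B, L12A],
    ([(M F11 F02 F02 F02 F11 F01 F02 F01 F11, False), (M F01 F00 F00 F00 F01 F00 F00 F00 F20, False), (M F11 F10 F10 F02 F20 F21 F02 F21 F20, False), (M F21 F11 F00 F00 F00 F10 F12 F11 F00, False)], [X2, X2], [X1, X4, X3, X3]),
    ([(M F11 F01 F20 F01 F11 F20 F10 F10 F11, False), (M F01 F00 F00 F00 F01 F00 F00 F00 F20, False), (M F20 F01 F21 F20 F11 F20 F21 F01 F20, False), (M F10 F10 F22 F11 F10 F20 F02 F12 F01, False)], [X2, X2], [X2, X2, X4, X4]), [X1, X3]),
  ([L3A, L4A, L4B, L12B],
    ([(M F11 F20 F01 F10 F11 F10 F01 F20 F11, False), (M F01 F00 F00 F00 F01 F00 F00 F00 F20, False), (M F20 F10 F21 F02 F11 F02 F21 F10 F20, False), (M F10 F21 F20 F01 F02 F22 F21 F10 F10, False)], [X2, X2], [X1, X1, X4]),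
    ([(M F11 F20 F02 F10 F11 F20 F02 F10 F11, False), (M F01 F00 F00 F00 F01 F00 F00 F00 F20, False), (M F11 F10 F20 F02 F20 F12 F01 F12 F20, False), (M F20 F00 F00 F00 F21 F21 F00 F22 F11, False)], [X2, X2], [X1, X1, X4]), [X1, X3]),
  ([L3A, L3A, L4B, L12A],
    ([(M F10 F00 F00 F00 F11 F21 F00 F11 F12, False), (M F12 F01 F02 F01 F12 F01 F02 F01 F12, False), (M F02 F00 F00 F00 F02 F00 F00 F00 F20, False), (M F21 F20 F01 F10 F21 F10 F02 F10 F12, False)], [X3, X3], [X4, X1, X1]),
    ([(M F11 F00 F21 F00 F10 F00 F11 F00 F12, False), (M F12 F01 F02 F01 F12 F01 F02 F01 F12, False), (M F02 F00 F00 F00 F02 F00 F00 F00 F20, False), (M F10 F10 F21 F01 F21 F20 F21 F01 F20, False)], [X3, X3], [X1, X4, X1]), [X1, X2]),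
  ([L3A, L3A, L4A, L12B],
    ([(M F12 F00 F22 F00 F10 F00 F12 F00 F11, False), (M F11 F10 F01 F20 F11 F20 F01 F10 F11, False), (M F01 F00 F00 F00 F01 F00 F00 F00 F20, False), (M F10 F01 F22 F20 F22 F01 F22 F10 F20, False)], [X3, X3], [X1, X4, X3, X2]),
    ([(M F12 F00 F12 F00 F10 F00 F22 F00 F11, False), (M F11 F02 F10 F02 F11 F20 F20 F10 F11, False), (M F01 F00 F00 F00 F01 F00 F00 F00 F20, False), (M F22 F10 F01 F20 F22 F10 F02 F10 F11, False)], [X3, X3], [X1, X1, X2, X3]), [X1, X2]),
  ([L3A, L3A, L4A, L6A],
    ([(M F11 F02 F10 F02 F11 F20 F20 F10 F11, False), (M F11 F00 F21 F00 F10 F00 F11 F00 F12, False), (M F01 F00 F00 F00 F01 F00 F00 F00 F20, False), (M F02 F20 F21 F10 F22 F02 F12 F02 F02, False)], [X3, X3], [X2, X1, X3]),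
    ([(M F12 F00 F11 F00 F10 F00 F21 F00 F11, False), (M F10 F00 F00 F00 F12 F12 F00 F22 F11, False), (M F01 F00 F00 F00 F01 F00 F00 F00 F20, False), (M F12 F00 F21 F20 F12 F20 F02 F22 F02, False)], [X3, X3], [X3, X3, X4]), [X1, X4]),
  ([L3A, L3A, L4B, L6A],
    ([(M F12 F02 F01 F02 F12 F01 F01 F01 F12, False), (M F11 F20 F10 F10 F11 F02 F20 F02 F11, False), (M F02 F00 F00 F00 F02 F00 F00 F00 F20, False), (M F12 F02 F01 F01 F10 F21 F10 F22 F01, False)], [X3, X3], [X1, X2, X3, X2]),
    ([(M F11 F02 F02 F02 F11 F01 F02 F01 F11, False), (M F12 F10 F01 F20 F12 F10 F01 F20 F12, False), (M F02 F00 F00 F00 F02 F00 F00 F00 F20, False), (M F10 F10 F21 F10 F12 F20 F22 F02 F01, False)], [X3, X3], [X1, X1, X4, X3]), [X1, X3])]"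

definition target_certs :: "(lab list \<times> tuple_cert) list" where
  "target_certs = [
  ([L3A, L3A, L3A, L4B],
    ([(M F11 F20 F10 F10 F11 F02 F20 F02 F11, False), (M F12 F00 F11 F00 F10 F00 F21 F00 F11, False), (M F11 F02 F01 F02 F11 F02 F01 F02 F11, False), (M F02 F00 F00 F00 F02 F00 F00 F00 F20, False)], [X4, X4], [X1, X3, X2, X2])),
  ([L4A, L4A, L4A, L4B],
    ([(M F01 F00 F00 F00 F01 F00 F00 F00 F20, False), (M F12 F02 F01 F20 F20 F11 F10 F11 F20, False), (M F20 F02 F22 F20 F12 F20 F22 F02 F20, False), (M F20 F21 F10 F21 F20 F10 F02 F02 F11, False)], [X1, X1], [X1, X3, X2])),
  ([L2A, L2A, L3A, L4A],
    ([(M F10 F20 F12 F20 F10 F12 F11 F11 F00, False), (M F20 F00 F00 F00 F20 F00 F00 F00 F10, False), (M F10 F00 F00 F00 F12 F21 F00 F11 F11, False), (M F20 F10 F21 F01 F12 F10 F12 F01 F20, False)], [X2], [X4, X3, X1, X4])),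
  ([L4A, L4A, L4A, L2A],
    ([(M F12 F10 F20 F01 F20 F11 F02 F11 F20, False), (M F12 F20 F01 F02 F20 F21 F10 F12 F20, False), (M F20 F01 F21 F10 F12 F02 F12 F20 F20, False), (M F10 F12 F20 F11 F00 F11 F20 F12 F10, False)], [X2, X3, X1], [X2, X1, X1, X4, X2])),
  ([L4A, L4A, L3A, L3A],
    ([(M F01 F00 F00 F00 F01 F00 F00 F00 F20, False), (M F20 F20 F12 F02 F12 F10 F21 F01 F20, False), (M F11 F00 F21 F00 F10 F00 F11 F00 F12, False), (M F12 F01 F02 F01 F12 F01 F02 F01 F12, False)], [X1, X1], [X3, X1, X4, X4]))]"

section \<open>Rigid quadruples of the simple group\<close>

text \<open>The label \<open>L1A\<close> is rejected because it doubles as the failure value of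
  \<open>label\<close>.\<close>

fun hlab :: "lab \<Rightarrow> m9 \<times> bool \<Rightarrow> bool" where
  "hlab l (A, e) \<longleftrightarrow> (if l = L1A then False else if su9 A then label (A, e) = l else False)"

lemma hlab_orb: "hlab l x \<Longrightarrow> x \<in> orb l"
proof -
  assume h: "hlab l x"
  obtain A e where x: "x = (A, e)" by force
  have "su A" "label (A, e) = l" "l \<noteq> L1A" using h unfolding x by (auto simp: su9_iff split: if_splits)
  then show "x \<in> orb l" using in_orb_iff[of "(A, e)" l l] unfolding x by simp
qed

fun tuple_ok :: "lab list \<Rightarrow> tuple_cert \<Rightarrow> bool" where
  "tuple_ok q (gs, wa, wb) \<longleftrightarrow> length gs = 4 \<and> list_all2 hlab q gs \<and> foldr hm gs (mid, False) = (mid, False) \<and>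
     ev gs wa = sga \<and> ev gs wb = sgb"

lemma list_all2_orb: "list_all2 hlab q gs \<Longrightarrow> list_all2 (\<in>) gs (map orb q)"
  by (induction rule: list_all2_induct) (auto intro: hlab_orb)

lemma list_all2_carrier: "list_all2 (\<in>) gs (map orb q) \<Longrightarrow> set gs \<subseteq> (\<Union>l\<in>set q. orb l)"
proof (induction gs arbitrary: q)
  case (Cons g gs) then show ?case by (cases q) force+
qed simp

lemma tuple_ok_GG:
  assumes "tuple_ok q (gs, wa, wb)" "set q \<subseteq> set inns"
  shows "gs \<in> Sigma_gen GG (map orb q)"
proof -
  have g: "list_all2 (\<in>) gs (map orb q)" "foldr hm gs (mid, False) = (mid, False)" "length gs = 4"
    "ev gs wa = sga" "ev gs wb = sgb" using assms(1) list_all2_orb by auto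
  have "orb l \<subseteq> Gam" if "l \<in> set inns" for l
    using snd_orb[of _ l] orb_HH[of l] inns_outs that by (fastforce simp: Gam_def)
  then have sub: "set gs \<subseteq> Gam" using list_all2_carrier[OF g(1)] assms(2) by blast
  have "Gam \<subseteq> generate HH (set gs)"
    using Gam_subset_generate[OF _ g(3,4,5)] sub Gam_HH by blast
  moreover have "generate GG (set gs) \<subseteq> Gam" using GG.generate_incl[of "set gs"] sub by simp
  ultimately have "generate GG (set gs) = Gam" using generate_GG[OF sub] by blast
  then show ?thesis using g by (simp add: Sigma_gen_def Sigma_bar_def)
qed

text \<open>The words yield the simple group. An entry from an outer class yields the rest, since
  every outer element is an inner one times that entry.\<close>

lemma tuple_ok_HH:
  assumes "tuple_ok q (gs, wa, wb)" "l \<in> set q" "l \<in> set outs"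
  shows "generate HH (set gs) = carrier HH" "list_all2 (\<in>) gs (map orb q)"
    "foldr hm gs (mid, False) = (mid, False)" "set gs \<subseteq> carrier HH" "length gs = 4"
proof -
  have g: "list_all2 (\<in>) gs (map orb q)" "foldr hm gs (mid, False) = (mid, False)" "length gs = 4"
    "ev gs wa = sga" "ev gs wb = sgb" using assms(1) list_all2_orb by auto
  show "list_all2 (\<in>) gs (map orb q)" "foldr hm gs (mid, False) = (mid, False)" "length gs = 4" by fact+
  show sub: "set gs \<subseteq> carrier HH" using list_all2_carrier[OF g(1)] orb_HH by blast
  have s: "subgroup (generate HH (set gs)) HH" by (rule HH.generate_is_subgroup[OF sub])
  obtain x where x: "x \<in> set gs" "x \<in> orb l"
  proof -
    obtain n where "n < length q" "q ! n = l" using assms(2) by (meson in_set_conv_nth)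
    then have "gs ! n \<in> orb l" "n < length gs" using list_all2_nthD2[OF g(1), of n] list_all2_lengthD[OF g(1)] by auto
    then show ?thesis using that by (meson nth_mem)
  qed
  have G: "Gam \<subseteq> generate HH (set gs)" using Gam_subset_generate[OF sub g(3,4,5)] .
  have xg: "x \<in> generate HH (set gs)" using x(1) by (rule generate.incl)
  have "y \<in> generate HH (set gs)" if y: "y \<in> carrier HH" for y
  proof (cases "snd y")
    case False
    then have "y \<in> Gam" using y by (cases y) (simp add: Gam_iff)
    then show ?thesis using G by blast
  next
    case True
    have xc: "x \<in> carrier HH" "snd x" using x sub snd_orb[OF x(2)] assms(3) by auto
    let ?z = "hm y (inv\<^bsub>HH\<^esub> x)"
    have z: "?z \<in> carrier HH" using hm_closed[OF y HH.inv_closed[OF xc(1)]] .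
    have e: "hm ?z x = y"
      using HH.m_assoc[OF y HH.inv_closed[OF xc(1)] xc(1)] HH.l_inv[OF xc(1)] HH.r_one[OF y] by simp
    then have "snd ?z = False" using parity[OF e] True xc(2) by simp
    then have "?z \<in> Gam" using z by (cases "?z") (simp add: Gam_iff)
    then show ?thesis using subgroup.m_closed[OF s _ xg, of ?z] G e by auto
  qed
  then show "generate HH (set gs) = carrier HH" using HH.generate_incl[OF sub] by blast
qed

section \<open>The Frobenius map and the classes of the two groups\<close>

definition frob :: "m9 \<times> bool" where "frob = (mid, True)"

lemma frob_conj: "hm (hm frob x) frob = (mcj (fst x), snd x)"
  by (cases x; cases "snd x") (auto simp: frob_def)

lemma inv_frob: "inv\<^bsub>HH\<^esub> frob = frob" and frob_HH: "frob \<in> carrier HH"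
  by (simp_all add: frob_def inv_HH su_closed)

lemma rep_frob: "hm (hm frob (rep l)) frob \<in> orb (lsig l)"
proof -
  have "snd (hm (hm frob (rep l)) frob) \<longrightarrow> lsig l \<noteq> L1A" unfolding frob_conj by (cases l) simp_all
  then show ?thesis
    using in_orb_iff[OF hm_closed[OF hm_closed[OF frob_HH rep_HH] frob_HH], of l "lsig l"] label_frob_rep[of l]
    by (simp add: frob_def)
qed

lemma orb_frob: "x \<in> orb l \<Longrightarrow> hm (hm frob x) frob \<in> orb (lsig l)"
proof -
  assume "x \<in> orb l"
  then obtain G where G: "su G" "x = hcj G (rep l)" by (auto simp: orb_def)
  have "hm (hm frob (hcj G y)) frob = hcj (mcj G) (hm (hm frob y) frob)" for y
    unfolding frob_conj by (cases y) (simp add: mcj_mm mct_mcj)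
  then show ?thesis using orb_hcj[OF su_closed(3)[OF G(1)] rep_frob[of l]] G(2) by simp
qed

lemma orb_HH_conj:
  assumes "g \<in> carrier HH" "x \<in> orb l"
  shows "g \<otimes>\<^bsub>HH\<^esub> x \<otimes>\<^bsub>HH\<^esub> inv\<^bsub>HH\<^esub> g \<in> orb l \<union> orb (lsig l)"
proof -
  obtain A e where g: "g = (A, e)" by force
  have A: "su A" "(A, False) \<in> carrier HH" using assms(1) g by auto
  have xc: "x \<in> carrier HH" using assms(2) orb_HH by auto
  show ?thesis
  proof (cases e)
    case False
    then show ?thesis using orb_hcj[OF A(1) assms(2)] hcj_HH[OF A(1) xc] g by simp
  next
    case True
    have e: "g = (A, False) \<otimes>\<^bsub>HH\<^esub> frob" using True g by (simp add: frob_def)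
    have fx: "hm (hm frob x) frob \<in> carrier HH" using hm_closed xc frob_HH by simp
    have "g \<otimes>\<^bsub>HH\<^esub> x \<otimes>\<^bsub>HH\<^esub> inv\<^bsub>HH\<^esub> g = hm (hm (A, False) (hm (hm frob x) frob)) (inv\<^bsub>HH\<^esub> (A, False))"
      unfolding e HH.conj_conj[OF A(2) frob_HH xc, symmetric] inv_frob by simp
    also have "\<dots> = hcj A (hm (hm frob x) frob)" using hcj_HH[OF A(1) fx] by simp
    finally show ?thesis using orb_hcj[OF A(1) orb_frob[OF assms(2)]] by simp
  qed
qed

text \<open>The orbits that make up one class of the extension.\<close>

definition hl :: "lab \<Rightarrow> lab list" where "hl l = (if lsig l = l then [l] else [l, lsig l])"

lemma set_hl: "set (hl l) = {l, lsig l}" by (auto simp: hl_def)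

lemma conj_invariant_GG: "l \<in> set inns \<Longrightarrow> conj_invariant GG (orb l)"
proof -
  assume l: "l \<in> set inns"
  have "orb l \<subseteq> Gam" using snd_orb[of _ l] orb_HH[of l] inns_outs l by (fastforce simp: Gam_def)
  moreover have "g \<otimes>\<^bsub>GG\<^esub> x \<otimes>\<^bsub>GG\<^esub> inv\<^bsub>GG\<^esub> g \<in> orb l" if gx: "g \<in> Gam" "x \<in> orb l" for g x
  proof -
    obtain A where A: "g = (A, False)" "su A" using gx(1) by (auto simp: Gam_def)
    have xc: "x \<in> carrier HH" using gx(2) orb_HH by blast
    show ?thesis using orb_hcj[OF A(2) gx(2), unfolded hcj_HH[OF A(2) xc], folded A(1)]
      by (simp only: inv_GG[OF gx(1)] GG_simps)
  qed
  ultimately show ?thesis by (simp add: conj_invariant_def)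
qed

lemma conj_invariant_HH: "conj_invariant HH (union_orb (hl l))"
proof -
  have "g \<otimes>\<^bsub>HH\<^esub> x \<otimes>\<^bsub>HH\<^esub> inv\<^bsub>HH\<^esub> g \<in> union_orb (hl l)" if gx: "g \<in> carrier HH" "x \<in> union_orb (hl l)" for g x
  proof -
    obtain k where k: "x \<in> orb k" "k = l \<or> k = lsig l" using gx(2) by (auto simp: union_orb_def set_hl)
    have "g \<otimes>\<^bsub>HH\<^esub> x \<otimes>\<^bsub>HH\<^esub> inv\<^bsub>HH\<^esub> g \<in> orb k \<union> orb (lsig k)" by (rule orb_HH_conj[OF gx(1) k(1)])
    then show ?thesis using k(2) lsig_lsig unfolding union_orb_def set_hl by auto
  qed
  then show ?thesis using union_orb_HH unfolding conj_invariant_def by blast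
qed

lemma class_GG:
  assumes "x \<in> orb l" "l \<in> set inns"
  shows "conjugacy_class GG x = orb l"
proof
  have xG: "x \<in> Gam" using conj_invariant_GG[OF assms(2)] assms(1) by (auto simp: conj_invariant_def)
  show "conjugacy_class GG x \<subseteq> orb l"
    using conj_invariant_GG[OF assms(2)] assms(1) by (auto simp: conjugacy_class_def conj_invariant_def)
  obtain G where G: "su G" "x = hcj G (rep l)" using assms(1) by (auto simp: orb_def)
  show "orb l \<subseteq> conjugacy_class GG x"
  proof
    fix y assume "y \<in> orb l"
    then obtain H where H: "su H" "y = hcj H (rep l)" by (auto simp: orb_def)
    let ?K = "mm H (mct G)"
    have K: "su ?K" "(?K, False) \<in> Gam" using G H su_closed by (auto simp: Gam_def)
    have "y = hcj ?K x" unfolding G(2) H(2) hcj_hcj mm_assoc su_mct(2)[OF G(1)] by simp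
    also have "\<dots> = hm (hm (?K, False) x) (inv\<^bsub>GG\<^esub> (?K, False))"
      by (simp only: hcj_HH[OF K(1) subsetD[OF Gam_HH xG]] inv_GG[OF K(2)])
    finally show "y \<in> conjugacy_class GG x" using K(2) by (auto simp: conjugacy_class_def)
  qed
qed

lemma class_HH:
  assumes "x \<in> orb l"
  shows "conjugacy_class HH x = union_orb (hl l)"
proof
  have xc: "x \<in> carrier HH" using assms orb_HH by auto
  show "conjugacy_class HH x \<subseteq> union_orb (hl l)"
  proof
    fix z assume "z \<in> conjugacy_class HH x"
    then obtain g where "g \<in> carrier HH" "z = g \<otimes>\<^bsub>HH\<^esub> x \<otimes>\<^bsub>HH\<^esub> inv\<^bsub>HH\<^esub> g" unfolding conjugacy_class_def by blast
    then have "z \<in> orb l \<union> orb (lsig l)" using orb_HH_conj[OF _ assms] by metis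
    then show "z \<in> union_orb (hl l)" by (simp add: union_orb_def set_hl)
  qed
  obtain G where G: "su G" "x = hcj G (rep l)" using assms by (auto simp: orb_def)
  have o: "orb l \<subseteq> conjugacy_class HH x"
  proof
    fix y assume "y \<in> orb l"
    then obtain H where H: "su H" "y = hcj H (rep l)" by (auto simp: orb_def)
    let ?K = "mm H (mct G)"
    have K: "su ?K" "(?K, False) \<in> carrier HH" using G H su_closed by auto
    have "y = hcj ?K x" unfolding G(2) H(2) hcj_hcj mm_assoc su_mct(2)[OF G(1)] by simp
    also have "\<dots> = hm (hm (?K, False) x) (inv\<^bsub>HH\<^esub> (?K, False))" using hcj_HH[OF K(1) xc] .
    finally show "y \<in> conjugacy_class HH x" using K(2) by (auto simp: conjugacy_class_def)
  qed
  have "orb (lsig l) \<subseteq> conjugacy_class HH x"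
  proof
    fix y assume y: "y \<in> orb (lsig l)"
    have yc: "y \<in> carrier HH" using y orb_HH by auto
    have "hm (hm frob y) frob \<in> conjugacy_class HH x" using o orb_frob[OF y] by auto
    then have "frob \<otimes>\<^bsub>HH\<^esub> (hm (hm frob y) frob) \<otimes>\<^bsub>HH\<^esub> inv\<^bsub>HH\<^esub> frob \<in> conjugacy_class HH x"
      using HH.conjugacy_class_conj_invariant[OF xc] frob_HH unfolding conj_invariant_def by blast
    moreover have "frob \<otimes>\<^bsub>HH\<^esub> (hm (hm frob y) frob) \<otimes>\<^bsub>HH\<^esub> inv\<^bsub>HH\<^esub> frob = y"
      unfolding inv_frob HH_simps frob_conj by simp
    ultimately show "y \<in> conjugacy_class HH x" by simp
  qed
  then show "union_orb (hl l) \<subseteq> conjugacy_class HH x" using o by (auto simp: union_orb_def set_hl)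
qed

text \<open>An element that conjugates one tuple to another conjugates the values of every word, and
  conjugation in the extension preserves labels up to \<open>lsig\<close>.\<close>

lemma sep_HH:
  assumes "g \<in> carrier HH" "set gs \<subseteq> carrier HH" "length gs = 4"
    and "map (\<lambda>x. g \<otimes>\<^bsub>HH\<^esub> x \<otimes>\<^bsub>HH\<^esub> inv\<^bsub>HH\<^esub> g) gs = hs"
    and "ev gs w \<in> orb l" "ev hs w \<in> orb k"
  shows "k = l \<or> k = lsig l"
proof -
  have "ev hs w \<in> orb l \<union> orb (lsig l)"
    using ev_conj[OF assms(1-3), of w] orb_HH_conj[OF assms(1,5)] unfolding assms(4) by simp
  then show ?thesis using assms(6) orb_disjoint by blast
qed

lemma sep_GG:
  assumes "g \<in> Gam" "set gs \<subseteq> Gam" "length gs = 4"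
    and "map (\<lambda>x. g \<otimes>\<^bsub>GG\<^esub> x \<otimes>\<^bsub>GG\<^esub> inv\<^bsub>GG\<^esub> g) gs = hs"
    and "ev gs w \<in> orb l" "ev hs w \<in> orb k"
  shows "k = l"
proof -
  have g: "g \<in> carrier HH" "set gs \<subseteq> carrier HH" using assms(1,2) Gam_HH by auto
  have "map (\<lambda>x. g \<otimes>\<^bsub>HH\<^esub> x \<otimes>\<^bsub>HH\<^esub> inv\<^bsub>HH\<^esub> g) gs = hs" using assms(4) inv_GG[OF assms(1)] by simp
  then have e: "ev hs w = g \<otimes>\<^bsub>HH\<^esub> ev gs w \<otimes>\<^bsub>HH\<^esub> inv\<^bsub>HH\<^esub> g" using ev_conj[OF g assms(3), of w] by simp
  obtain A where A: "g = (A, False)" "su A" using assms(1) by (auto simp: Gam_def)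
  have "ev gs w \<in> carrier HH" using assms(5) orb_HH by auto
  then have "ev hs w = hcj A (ev gs w)" using e hcj_HH[OF A(2)] A(1) by simp
  then have "ev hs w \<in> orb l" using orb_hcj[OF A(2) assms(5)] by simp
  then show ?thesis using assms(6) orb_disjoint by blast
qed

text \<open>Only inner word values are compared, because on them \<open>label\<close> cannot fail.
  This test separates classes of the extension, while \<open>sep_ok'\<close> separates classes of
  the simple group.\<close>

fun sep_ok :: "m9 \<times> bool \<Rightarrow> m9 \<times> bool \<Rightarrow> bool" where
  "sep_ok (A, e) (B, f) \<longleftrightarrow> (if e then False else if f then False else
     if label (B, False) = label (A, False) then False else label (B, False) \<noteq> lsig (label (A, False)))"
fun sep_ok' :: "m9 \<times> bool \<Rightarrow> m9 \<times> bool \<Rightarrow> bool" where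
  "sep_ok' (A, e) (B, f) \<longleftrightarrow> (if e then False else if f then False else label (B, False) \<noteq> label (A, False))"

fun pair_ok :: "lab list \<times> tuple_cert \<times> tuple_cert \<times> sym list \<Rightarrow> bool" where
  "pair_ok (q, t, t', w) \<longleftrightarrow> tuple_ok q t \<and> tuple_ok q t' \<and> sep_ok' (ev (fst t) w) (ev (fst t') w)"
fun pair_ok_HH :: "lab list \<times> tuple_cert \<times> tuple_cert \<times> sym list \<Rightarrow> bool" where
  "pair_ok_HH (q, t, t', w) \<longleftrightarrow> tuple_ok q t \<and> tuple_ok q t' \<and> sep_ok (ev (fst t) w) (ev (fst t') w)"

lemma ev_HH: "set gs \<subseteq> carrier HH \<Longrightarrow> length gs = 4 \<Longrightarrow> ev gs w \<in> carrier HH"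
  using ev_generate[of gs "carrier HH"] HH.subgroup_self by simp

lemma in_own_orb: "(A, False) \<in> carrier HH \<Longrightarrow> (A, False) \<in> orb (label (A, False))"
  using in_orb_iff[of "(A, False)"] by simp

lemma pair_ok_not_rigid:
  assumes "pair_ok (q, t, t', w)" "set q \<subseteq> set inns"
  shows "\<not> rigid GG (map orb q)"
proof -
  obtain gs wa wb hs va vb where t: "t = (gs, wa, wb)" "t' = (hs, va, vb)" by (metis prod.collapse)
  have ci: "\<forall>C\<in>set (map orb q). conj_invariant GG C" using conj_invariant_GG assms(2) by auto
  have g: "gs \<in> Sigma_gen GG (map orb q)" "hs \<in> Sigma_gen GG (map orb q)"
    using tuple_ok_GG assms unfolding t by auto
  have l: "length gs = 4" "length hs = 4" using assms(1) unfolding t by auto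
  have sub: "set gs \<subseteq> Gam" "set hs \<subseteq> Gam" using GG.Sigma_gen_carrier[OF _ ci] g by auto
  show ?thesis
  proof (rule GG.two_orbits_not_rigid[OF _ g ci centreless_GG])
    show "finite (carrier GG)" by (simp add: finite_Gam)
    fix k assume k: "k \<in> carrier GG"
    show "map (\<lambda>x. k \<otimes>\<^bsub>GG\<^esub> x \<otimes>\<^bsub>GG\<^esub> inv\<^bsub>GG\<^esub> k) gs \<noteq> hs"
    proof
      assume m: "map (\<lambda>x. k \<otimes>\<^bsub>GG\<^esub> x \<otimes>\<^bsub>GG\<^esub> inv\<^bsub>GG\<^esub> k) gs = hs"
      obtain X e Y f where e: "ev gs w = (X, e)" "ev hs w = (Y, f)" by (metis prod.collapse)
      have s: "\<not> e" "\<not> f" "label (Y, False) \<noteq> label (X, False)"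
        using assms(1) unfolding t by (auto simp: e split: if_splits)
      have "ev gs w \<in> carrier HH" "ev hs w \<in> carrier HH" using ev_HH sub l Gam_HH by auto
      then have "ev gs w \<in> orb (label (X, False))" "ev hs w \<in> orb (label (Y, False))"
        using in_own_orb s unfolding e by auto
      then show False using sep_GG[OF _ sub(1) l(1) m] k s(3) by auto
    qed
  qed
qed

lemma pair_ok_HH_not_rigid:
  assumes "pair_ok_HH (q, t, t', w)" "l \<in> set q" "l \<in> set outs"
  shows "\<not> rigid HH (map (union_orb \<circ> hl) q)"
proof -
  obtain gs wa wb hs va vb where t: "t = (gs, wa, wb)" "t' = (hs, va, vb)" by (metis prod.collapse)
  have ci: "\<forall>C\<in>set (map (union_orb \<circ> hl) q). conj_invariant HH C" using conj_invariant_HH by auto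
  have mono: "list_all2 (\<in>) ks (map orb q) \<Longrightarrow> list_all2 (\<in>) ks (map (union_orb \<circ> hl) q)" for ks
    by (auto simp: list_all2_conv_all_nth union_orb_def set_hl)
  have g: "gs \<in> Sigma_gen HH (map (union_orb \<circ> hl) q)" "hs \<in> Sigma_gen HH (map (union_orb \<circ> hl) q)"
  proof -
    have a: "tuple_ok q (gs, wa, wb)" "tuple_ok q (hs, va, vb)" using assms(1) unfolding t by auto
    note h = tuple_ok_HH[OF a(1) assms(2,3)] tuple_ok_HH[OF a(2) assms(2,3)]
    show "gs \<in> Sigma_gen HH (map (union_orb \<circ> hl) q)" "hs \<in> Sigma_gen HH (map (union_orb \<circ> hl) q)"
      unfolding Sigma_gen_def Sigma_bar_def
      using h(1,3) mono[OF h(2)] h(6,8) mono[OF h(7)] by simp_all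
  qed
  have l: "length gs = 4" "length hs = 4" using assms(1) unfolding t by auto
  have sub: "set gs \<subseteq> carrier HH" "set hs \<subseteq> carrier HH" using HH.Sigma_gen_carrier[OF _ ci] g by auto
  show ?thesis
  proof (rule HH.two_orbits_not_rigid[OF finite_HH g ci centreless_HH])
    fix k assume k: "k \<in> carrier HH"
    show "map (\<lambda>x. k \<otimes>\<^bsub>HH\<^esub> x \<otimes>\<^bsub>HH\<^esub> inv\<^bsub>HH\<^esub> k) gs \<noteq> hs"
    proof
      assume m: "map (\<lambda>x. k \<otimes>\<^bsub>HH\<^esub> x \<otimes>\<^bsub>HH\<^esub> inv\<^bsub>HH\<^esub> k) gs = hs"
      obtain X e Y f where e: "ev gs w = (X, e)" "ev hs w = (Y, f)" by (metis prod.collapse)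
      have s: "\<not> e" "\<not> f" "label (Y, False) \<noteq> label (X, False)" "label (Y, False) \<noteq> lsig (label (X, False))"
        using assms(1) unfolding t by (auto simp: e split: if_splits)
      have "ev gs w \<in> carrier HH" "ev hs w \<in> carrier HH" using ev_HH sub l by auto
      then have "ev gs w \<in> orb (label (X, False))" "ev hs w \<in> orb (label (Y, False))"
        using in_own_orb s unfolding e by auto
      then show False using sep_HH[OF k sub(1) l(1) m] s(3,4) by blast
    qed
  qed
qed

text \<open>As in \<open>card_Sigma_bar_4\<close>, the last two classes enter inverted and in
  reverse order.\<close>

definition quad_count :: "lab \<Rightarrow> lab \<Rightarrow> lab \<Rightarrow> lab \<Rightarrow> int" where
  "quad_count a b c d = dotn (nti (linv d) (linv c)) inns (weights (nti a b) inns)"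

lemma linv_inns: "linv l \<in> set inns \<longleftrightarrow> l \<in> set inns" using linv_outs inns_outs by metis

lemma nti_eq: "i \<in> set inns \<Longrightarrow> k \<in> set inns \<Longrightarrow> l \<in> set inns \<Longrightarrow> int (nn i k l) = nti i k l"
  using tab_ok_all unfolding tab_ok_def by blast

lemma nto_eq: "i \<in> set inns \<Longrightarrow> k \<in> set outs \<Longrightarrow> l \<in> set outs \<Longrightarrow> int (nn i k l) = nto i k l"
  using tab_ok_all unfolding tab_ok_def by blast

lemma card_Sigma_inner:
  assumes "a \<in> set inns" "b \<in> set inns" "c \<in> set inns" "d \<in> set inns"
  shows "int (card (Sigma_bar HH (map orb [a, b, c, d]))) = quad_count a b c d"
proof -
  have u: "orb l = union_orb [l]" for l by (simp add: union_orb_def)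
  have "card (Sigma_bar HH (map orb [a, b, c, d])) =
      (\<Sum>m\<in>UNIV. card (orb m) * (nnU [a] [b] m * nnU [linv d] [linv c] m))"
    using card_Sigma_union[of "[a]" "[b]" "[c]" "[d]"] by (simp add: u)
  also have "\<dots> = (\<Sum>m\<in>set inns. card (orb m) * (nnU [a] [b] m * nnU [linv d] [linv c] m))"
    using nnU_parity_inner[of "[a]" "[b]"] assms by (intro sum_inner_outer(1)) simp
  also have "\<dots> = (\<Sum>m\<in>set inns. card (orb m) * (nn a b m * nn (linv d) (linv c) m))"
    by (simp add: nnU_def)
  finally have "int (card (Sigma_bar HH (map orb [a, b, c, d]))) =
      (\<Sum>m\<in>set inns. int (card (orb m)) * (int (nn a b m) * int (nn (linv d) (linv c) m)))" by simp
  also have "\<dots> = quad_count a b c d"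
    unfolding quad_count_def dotn_weights[OF distinct_inns]
    using assms by (intro sum.cong) (simp_all add: card_orb nti_eq linv_inns)
  finally show ?thesis .
qed

text \<open>The three frames of pairwise orthogonal points through the third basis vector, whose
  stabilisers consist of monomial matrices in the frame. The representative of 4A preserves all of
  them, as it is scalar on the orthogonal plane.\<close>

definition configs4 :: "v9 list list" where
  "configs4 = [
    [V F00 F00 F01, V F00 F01 F00, V F01 F00 F00], [V F00 F00 F01, V F01 F01 F00, V F01 F02 F00],
    [V F00 F00 F01, V F01 F10 F00, V F01 F20 F00]]"

definition configs5 :: "v9 list list" where
  "configs5 = [
    [V F00 F00 F01, V F00 F01 F00, V F01 F00 F00], [V F00 F00 F01, V F01 F01 F00, V F01 F02 F00],
    [V F00 F00 F01, V F01 F10 F00, V F01 F20 F00]]"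

definition cfg_ok :: "m9 \<times> bool \<Rightarrow> m9 \<times> bool \<Rightarrow> m9 \<times> bool \<Rightarrow> v9 list \<Rightarrow> bool" where
  "cfg_ok x a b ps \<longleftrightarrow> (if preserves ps x then if preserves ps a then if preserves ps b then
     preserves ps (hinv x) \<and> preserves ps (hinv a) \<and> preserves ps (hinv b) else False else False else False)"
text \<open>The product \<open>xa\<close> is passed on from \<open>brute2\<close>, so each pair
  costs one further multiplication. Testing \<open>lab0\<close> instead of \<open>label\<close> can
  only enlarge the set of pairs that is checked.\<close>

definition brute3 :: "v9 list list \<Rightarrow> lab \<Rightarrow> m9 \<times> bool \<Rightarrow> m9 \<times> bool \<Rightarrow> m9 \<times> bool \<Rightarrow> m9 \<times> bool \<Rightarrow> bool" where
  "brute3 cs y x a xa b \<longleftrightarrow> (if lab0 (hm xa b) = y then list_ex (cfg_ok x a b) cs else True)"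
definition brute2 :: "v9 list list \<Rightarrow> lab \<Rightarrow> m9 \<times> bool \<Rightarrow> (m9 \<times> bool) list \<Rightarrow> m9 \<times> bool \<Rightarrow> bool" where
  "brute2 cs y x LB a \<longleftrightarrow> list_all (brute3 cs y x a (hm x a)) LB"

lemma hcj_hm: "su G \<Longrightarrow> x \<in> carrier HH \<Longrightarrow> y \<in> carrier HH \<Longrightarrow> hcj G (hm x y) = hm (hcj G x) (hcj G y)"
  using HH.conj_mult[of "(G, False)" x y] hcj_HH[of G] hm_closed[of x y] by simp

lemma generate_hcj:
  assumes "su G" "S \<subseteq> carrier HH"
  shows "generate HH (hcj G ` S) = hcj G ` generate HH S"
proof -
  have "hcj G \<in> hom HH HH"
    by (rule homI) (simp_all only: hcj_closed[OF assms(1)] hcj_hm[OF assms(1)] HH_simps)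
  then have "group_hom HH HH (hcj G)" using HH.group_axioms by (simp add: group_hom_def group_hom_axioms_def)
  then show ?thesis by (rule group_hom.generate_img[OF _ assms(2)])
qed

lemma union_orb_hcj: "su G \<Longrightarrow> x \<in> union_orb ls \<Longrightarrow> hcj G x \<in> union_orb ls"
  unfolding union_orb_def using orb_hcj by blast

text \<open>Conjugation turns the first element into the representative. The fourth is the inverse
  of the product of the others, so it lies in the group that these generate and preserves their
  configuration as well.\<close>

lemma brute_core:
  assumes chk: "list_all (brute2 cs (base (linv y)) (rep l) LB) LA"
    and LA: "set LA = union_orb as" and LB: "set LB = union_orb bs" and cs: "list_all moved cs"
    and g: "g1 \<in> orb l" "g2 \<in> union_orb as" "g3 \<in> union_orb bs" "g4 \<in> orb y"
    and pr: "hm g1 (hm g2 (hm g3 (hm g4 (mid, False)))) = (mid, False)"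
  shows "\<not> Gam \<subseteq> generate HH {g1, g2, g3, g4}"
proof
  assume gen: "Gam \<subseteq> generate HH {g1, g2, g3, g4}"
  obtain G where G: "su G" "g1 = hcj G (rep l)" using g(1) by (auto simp: orb_def)
  have iG: "su (mct G)" using su_closed(2) G by simp
  define p q r where "p = hcj (mct G) g2" and "q = hcj (mct G) g3" and "r = hcj (mct G) g4"
  have gc: "g1 \<in> carrier HH" "g2 \<in> carrier HH" "g3 \<in> carrier HH" "g4 \<in> carrier HH"
    using g orb_HH union_orb_HH by blast+
  have car: "p \<in> carrier HH" "q \<in> carrier HH" "r \<in> carrier HH"
    unfolding p_def q_def r_def using hcj_closed[OF iG] gc by blast+
  have h1: "hcj (mct G) g1 = rep l" unfolding G(2) by (rule hcj_inverse(1)[OF G(1)])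
  have "hcj (mct G) ` {g1, g2, g3, g4} = {rep l, p, q, r}" unfolding p_def q_def r_def h1[symmetric] by simp
  then have gi: "generate HH {rep l, p, q, r} = hcj (mct G) ` generate HH {g1, g2, g3, g4}"
    using generate_hcj[OF iG, of "{g1, g2, g3, g4}"] gc by simp
  have "Gam \<subseteq> hcj (mct G) ` Gam"
  proof
    fix x assume x: "x \<in> Gam"
    then obtain X where "x = (X, False)" "su X" by (auto simp: Gam_def)
    then have "hcj G x \<in> Gam" using G(1) su_closed by (simp add: Gam_def)
    moreover have "x = hcj (mct G) (hcj G x)" by (rule hcj_inverse(1)[OF G(1), symmetric])
    ultimately show "x \<in> hcj (mct G) ` Gam" by (rule rev_image_eqI)
  qed
  then have gen': "Gam \<subseteq> generate HH {rep l, p, q, r}" unfolding gi using gen by blast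
  have "g1 \<otimes>\<^bsub>HH\<^esub> (g2 \<otimes>\<^bsub>HH\<^esub> (g3 \<otimes>\<^bsub>HH\<^esub> g4)) = \<one>\<^bsub>HH\<^esub>" using pr HH.r_one[OF gc(4)] by simp
  then have "hcj (mct G) (hm g1 (hm g2 (hm g3 g4))) = (mid, False)"
    using G(1) by (simp add: su_mct)
  then have "hm (rep l) (hm p (hm q r)) = (mid, False)"
    using gc hm_closed iG by (simp only: hcj_hm h1 p_def q_def r_def)
  then have xr: "hm (hm (hm (rep l) p) q) r = (mid, False)" by (simp add: hm_assoc)
  let ?xpq = "hm (hm (rep l) p) q"
  have cx: "?xpq \<in> carrier HH" using car rep_HH hm_closed by simp
  have inv: "?xpq = inv\<^bsub>HH\<^esub> r" using HH.inv_equality[of ?xpq r] cx car(3) xr by simp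
  have inv': "r = inv\<^bsub>HH\<^esub> ?xpq" unfolding inv by (rule HH.inv_inv[OF car(3), symmetric])
  have "r \<in> orb y" unfolding r_def by (rule orb_hcj[OF iG g(4)])
  then have "?xpq \<in> orb (linv y)" unfolding inv using inv_image_orb by blast
  then have lb: "lab0 ?xpq = base (linv y)" by (rule orb_invariants(1))
  have "p \<in> set LA" "q \<in> set LB" unfolding LA LB p_def q_def using union_orb_hcj[OF iG] g by blast+
  then have "brute3 cs (base (linv y)) (rep l) p (hm (rep l) p) q"
    using chk unfolding list_all_iff brute2_def by blast
  then have "list_ex (cfg_ok (rep l) p q) cs" using lb by (simp add: brute3_def)
  then obtain ps where ps: "ps \<in> set cs" "cfg_ok (rep l) p q ps" by (auto simp: list_ex_iff)
  let ?S = "{rep l, p, q}"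
  have sub: "?S \<subseteq> carrier HH" using car rep_HH by simp
  have pres: "preserves ps x \<and> preserves ps (hinv x)" if "x \<in> ?S" for x
    using ps(2) that unfolding cfg_ok_def by (auto split: if_splits)
  have "moved ps" using cs ps(1) by (auto simp: list_all_iff)
  then have n: "\<not> Gam \<subseteq> generate HH ?S" by (rule moved_not_generating[OF _ sub pres])
  have "generate HH {rep l, p, q, r} \<subseteq> generate HH ?S"
  proof (rule HH.generate_subgroup_incl[OF _ HH.generate_is_subgroup[OF sub]])
    have s: "subgroup (generate HH ?S) HH" by (rule HH.generate_is_subgroup[OF sub])
    have i: "x \<in> generate HH ?S" if "x \<in> ?S" for x using that by (rule generate.incl)
    have "?xpq \<in> generate HH ?S"
      using subgroup.m_closed[OF s subgroup.m_closed[OF s i[of "rep l"] i[of p]] i[of q]] by simp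
    then have "inv\<^bsub>HH\<^esub> ?xpq \<in> generate HH ?S" by (rule subgroup.m_inv_closed[OF s])
    then have "r \<in> generate HH ?S" using inv' by simp
    then show "{rep l, p, q, r} \<subseteq> generate HH ?S" using i by auto
  qed
  then show False using n gen' by blast
qed

lemma central_orbits: "set (concat (tconj [rep L2A])) = orb L2A"
  "set (concat (tconj [rep L4A])) = orb L4A" "set (concat (tconj [rep L4B])) = orb L4B"
proof -
  have c: "list_all (\<lambda>k. hcj k (rep L2A) \<in> set [rep L2A]) Klist"
    "list_all (\<lambda>k. hcj k (rep L4A) \<in> set [rep L4A]) Klist" "list_all (\<lambda>k. hcj k (rep L4B) \<in> set [rep L4B]) Klist"
    by code_simp+
  show "set (concat (tconj [rep L2A])) = orb L2A"
    by (rule tconj_orb(1)[OF c(1)]) (simp_all add: rep_in_orb del: rep.simps)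
  show "set (concat (tconj [rep L4A])) = orb L4A"
    by (rule tconj_orb(1)[OF c(2)]) (simp_all add: rep_in_orb del: rep.simps)
  show "set (concat (tconj [rep L4B])) = orb L4B"
    by (rule tconj_orb(1)[OF c(3)]) (simp_all add: rep_in_orb del: rep.simps)
qed

text \<open>Every quadruple with product 1 in these classes preserves a configuration of points, so it does not
  generate.\<close>

lemma monomial_check:
  "list_all (brute2 configs4 L3B (rep L4A) (concat (tconj [rep L2A]))) (concat (tconj [rep L2A]))"
  "list_all (brute2 configs5 L3B (rep L4B) (concat (tconj [rep L2A]))) (concat (tconj [rep L2A]))"
  "list_all moved (configs4 @ configs5)"
  by code_simp+

lemma monomial_not_generating:
  "Sigma_gen GG (map orb [L4A, L2A, L2A, L3B]) = {}" "Sigma_gen GG (map orb [L4B, L2A, L2A, L3B]) = {}"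
proof -
  have u: "set (concat (tconj [rep L2A])) = union_orb [L2A]" by (simp only: central_orbits) (simp add: union_orb_def)
  have b: "base (linv L3B) = L3B" by (simp add: base_def)
  have m: "list_all moved configs4" "list_all moved configs5" using monomial_check(3) by simp_all
  have main: "Sigma_gen GG (map orb [l, L2A, L2A, L3B]) = {}"
    if l: "l \<in> set inns" and chk: "list_all (brute2 cs (base (linv L3B)) (rep l) (concat (tconj [rep L2A]))) (concat (tconj [rep L2A]))"
      and cs: "list_all moved cs" for l cs
  proof (rule ccontr)
    assume "Sigma_gen GG (map orb [l, L2A, L2A, L3B]) \<noteq> {}"
    then obtain gs where gs: "gs \<in> Sigma_gen GG (map orb [l, L2A, L2A, L3B])" by blast
    then obtain g1 g2 g3 g4 where g: "gs = [g1, g2, g3, g4]" "g1 \<in> orb l" "g2 \<in> orb L2A" "g3 \<in> orb L2A"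
        "g4 \<in> orb L3B" "hm g1 (hm g2 (hm g3 (hm g4 (mid, False)))) = (mid, False)"
        "generate GG (set gs) = Gam"
      by (auto simp: Sigma_gen_def Sigma_bar_def list_all2_Cons2)
    have "conj_invariant GG (orb k)" if "k \<in> set [l, L2A, L2A, L3B]" for k
      by (rule conj_invariant_GG) (use that l in \<open>auto simp: inns_def\<close>)
    then have "set gs \<subseteq> Gam" using GG.Sigma_gen_carrier[OF gs] by simp
    then have "generate HH (set gs) = Gam" using generate_GG g(7) by simp
    moreover have "g2 \<in> union_orb [L2A]" "g3 \<in> union_orb [L2A]" using g by (simp_all add: union_orb_def)
    ultimately show False
      using brute_core[OF chk u u cs g(2) _ _ g(5,6)] by (simp add: g(1))
  qed
  show "Sigma_gen GG (map orb [L4A, L2A, L2A, L3B]) = {}"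
    by (rule main[OF _ _ m(1)]) (simp add: inns_def, unfold b, rule monomial_check(1))
  show "Sigma_gen GG (map orb [L4B, L2A, L2A, L3B]) = {}"
    by (rule main[OF _ _ m(2)]) (simp add: inns_def, unfold b, rule monomial_check(2))
qed

definition monomial_cases :: "lab list list" where
  "monomial_cases = [[L2A, L2A, L3B, L4A], [L2A, L2A, L3B, L4B]]"

text \<open>The keys of \<open>pair_certs\<close>, listed separately to keep the certificates out of
  the enumeration of all quadruples.\<close>

definition pair_quads :: "lab list list" where
  "pair_quads = [
    [L2A, L4A, L4B, L4C], [L3A, L4A, L4A, L4C], [L3A, L4B, L4B, L4C], [L2A, L2A, L4A, L6A],
    [L2A, L2A, L4B, L6A], [L2A, L3A, L4A, L12A], [L2A, L3A, L4B, L12B], [L2A, L4B, L4B, L12A],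
    [L2A, L4A, L4A, L12B], [L2A, L3A, L4A, L6A], [L2A, L3A, L4B, L6A], [L3A, L3B, L4A, L4A],
    [L3A, L3B, L4B, L4B], [L3A, L3A, L3B, L4A], [L3A, L3A, L3B, L4B], [L3A, L4A, L4B, L12A],
    [L3A, L4A, L4B, L12B], [L3A, L3A, L4B, L12A], [L3A, L3A, L4A, L12B], [L3A, L3A, L4A, L6A],
    [L3A, L3A, L4B, L6A]]"

lemma pair_quads: "pair_quads = map fst pair_certs" by (simp add: pair_quads_def pair_certs_def)

definition excluded :: "lab \<Rightarrow> lab \<Rightarrow> lab \<Rightarrow> lab \<Rightarrow> bool" where
  "excluded a b c d \<longleftrightarrow> (if scott a b c d then True else
     [a, b, c, d] \<in> set targets \<or> [a, b, c, d] \<in> set pair_quads \<or> [a, b, c, d] \<in> set monomial_cases)"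
text \<open>The group order is 6048, and 24192 is four times as much: these are the bounds 1 and 4
  for \<open>mu_bar\<close>.\<close>

definition verdict :: "lab \<Rightarrow> lab \<Rightarrow> lab \<Rightarrow> lab \<Rightarrow> int \<Rightarrow> bool" where
  "verdict a b c d n \<longleftrightarrow> (if n < 6048 then True else if 24192 \<le> n then True else excluded a b c d)"
definition chk4 :: "lab \<Rightarrow> lab \<Rightarrow> int list \<Rightarrow> lab \<Rightarrow> lab \<Rightarrow> bool" where
  "chk4 a b ws c d \<longleftrightarrow> (if lidx d < lidx c then True else verdict a b c d (dotn (nti (linv d) (linv c)) inns ws))"
definition chk3 :: "lab \<Rightarrow> lab \<Rightarrow> int list \<Rightarrow> lab \<Rightarrow> bool" where
  "chk3 a b ws c \<longleftrightarrow> (if lidx c < lidx b then True else list_all (chk4 a b ws c) ninn)"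
definition chk2 :: "lab \<Rightarrow> lab \<Rightarrow> bool" where
  "chk2 a b \<longleftrightarrow> (if lidx b < lidx a then True else list_all (chk3 a b (weights (nti a b) inns)) ninn)"
definition chk1 :: "lab \<Rightarrow> bool" where "chk1 a \<longleftrightarrow> list_all (chk2 a) ninn"

lemma GG_check: "list_all chk1 ninn" "list_all pair_ok pair_certs"
  "list_all (\<lambda>c. tuple_ok (fst c) (snd c)) target_certs"
  by code_simp+

lemma GG_verdict:
  assumes "set [a, b, c, d] \<subseteq> set ninn" "lidx a \<le> lidx b" "lidx b \<le> lidx c" "lidx c \<le> lidx d"
  shows "quad_count a b c d < 6048 \<or> 24192 \<le> quad_count a b c d \<or> excluded a b c d"
  using GG_check(1) assms
  unfolding quad_count_def list_all_iff chk1_def chk2_def chk3_def chk4_def verdict_def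
  by (metis insert_subset linorder_not_le list.simps(15))

lemma sort4:
  fixes f :: "'a \<Rightarrow> int"
  assumes "length ls = 4"
  obtains a b c d where "mset ls = mset [a, b, c, d]" "f a \<le> f b" "f b \<le> f c" "f c \<le> f d"
proof -
  have "\<exists>a b c d. xs = [a, b, c, d]" if "length xs = 4" for xs :: "'a list"
    using that by (auto simp: length_Suc_conv numeral_eq_Suc)
  moreover have "length (sort_key f ls) = 4" using assms by simp
  ultimately obtain a b c d where s: "sort_key f ls = [a, b, c, d]" by blast
  have "sorted (map f (sort_key f ls))" by simp
  moreover have "mset ls = mset (sort_key f ls)" by simp
  ultimately show ?thesis using that unfolding s by auto
qed

lemma mset_map_orb: "mset ls = mset ks \<Longrightarrow> mset (map f ls) = mset (map f ks)"
  by simp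

theorem GG_rigid:
  assumes "length ls = 4" "set ls \<subseteq> set ninn" "rigid GG (map orb ls)" "mu_bar GG (map orb ls) < 4"
  shows "\<exists>t\<in>set targets. mset ls = mset t"
proof -
  obtain a b c d where s: "mset ls = mset [a, b, c, d]" "lidx a \<le> lidx b" "lidx b \<le> lidx c" "lidx c \<le> lidx d"
    using sort4[OF assms(1)] by metis
  have sub: "set [a, b, c, d] \<subseteq> set ninn" using assms(2) mset_eq_setD[OF s(1)] by simp
  then have inn: "set [a, b, c, d] \<subseteq> set inns" using ninn_inns by blast
  have ci: "\<forall>C\<in>set (map orb ls). conj_invariant GG C" using conj_invariant_GG ninn_inns assms(2) by auto
  have fin: "finite (carrier GG)" by (simp add: finite_Gam)
  have mu: "mu GG (map orb ls) = mu GG (map orb ks)" "mu_bar GG (map orb ls) = mu_bar GG (map orb ks)"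
    if "mset ls = mset ks" for ks
    using GG.mu_mset[OF fin mset_map_orb[OF that] ci] .
  have r: "rigid GG (map orb ks)" if "mset ls = mset ks" for ks
    using assms(3) mu(1)[OF that] by (simp add: rigid_def)
  have q: "int (card (Sigma_bar GG (map orb [a, b, c, d]))) = quad_count a b c d"
    unfolding Sigma_bar_GG using inn by (intro card_Sigma_inner) auto
  have fS: "finite (Sigma_bar GG (map orb [a, b, c, d]))"
    by (rule finite_Sigma_bar) (use finite_subset[OF orb_HH finite_HH] in auto)
  have "card (Sigma_gen GG (map orb [a, b, c, d])) = 6048"
    using r[OF s(1)] by (simp add: rigid_def mu_def card_Gam)
  then have "6048 \<le> card (Sigma_bar GG (map orb [a, b, c, d]))"
    using card_mono[OF fS Sigma_gen_subset] by simp
  then have ge: "\<not> quad_count a b c d < 6048" using q by simp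
  have "mu_bar GG (map orb [a, b, c, d]) < 4" using assms(4) mu(2)[OF s(1)] by metis
  then have "real (card (Sigma_bar GG (map orb [a, b, c, d]))) < 4 * 6048"
    unfolding mu_bar_def by (simp only: card_Gam GG_simps)
  then have lt: "\<not> 24192 \<le> quad_count a b c d" using q by linarith
  have ns: "\<not> scott3 p1 p2 p3 x" if "mset [a, b, c, d] = mset [p1, p2, p3, x]" for p1 p2 p3 x
  proof
    assume sc: "scott3 p1 p2 p3 x"
    have "set [p1, p2, p3, x] \<subseteq> set inns" using mset_eq_setD[OF that] inn by simp
    then have "Sigma_gen GG (map orb [p1, p2, p3, x]) = {}" using scott3_not_generating[OF sc] by simp
    then show False using r[of "[p1, p2, p3, x]"] s(1) that by (simp add: rigid_def mu_def)
  qed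
  have "\<not> scott a b c d" unfolding scott_def using ns[of b c d a] ns[of a c d b] ns[of a b d c] ns[of a b c d]
    by (auto split: if_splits)
  then have "[a, b, c, d] \<in> set targets \<or> [a, b, c, d] \<in> set (map fst pair_certs) \<or> [a, b, c, d] \<in> set monomial_cases"
    using GG_verdict[OF sub s(2-4)] ge lt by (auto simp: excluded_def pair_quads)
  moreover have "[a, b, c, d] \<notin> set (map fst pair_certs)"
  proof
    assume "[a, b, c, d] \<in> set (map fst pair_certs)"
    then obtain t t' w where "([a, b, c, d], t, t', w) \<in> set pair_certs" by auto
    then have "pair_ok ([a, b, c, d], t, t', w)" using GG_check(2) by (simp only: list_all_iff)
    then show False using pair_ok_not_rigid[OF _ inn] r[OF s(1)] by blast
  qed
  moreover have "[a, b, c, d] \<notin> set monomial_cases"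
  proof
    assume "[a, b, c, d] \<in> set monomial_cases"
    then have "mset ls = mset [L4A, L2A, L2A, L3B] \<or> mset ls = mset [L4B, L2A, L2A, L3B]"
      using s(1) by (auto simp: monomial_cases_def)
    then show False
    proof
      assume "mset ls = mset [L4A, L2A, L2A, L3B]"
      from r[OF this] show False unfolding rigid_def mu_def monomial_not_generating by simp
    next
      assume "mset ls = mset [L4B, L2A, L2A, L3B]"
      from r[OF this] show False unfolding rigid_def mu_def monomial_not_generating by simp
    qed
  qed
  ultimately show ?thesis using s(1) by blast
qed

lemma target_counts: "list_all (\<lambda>c. case fst c of [a, b, c, d] \<Rightarrow> quad_count a b c d = 6048) target_certs"
  by code_simp

theorem GG_strictly_rigid:
  assumes "(q, t) \<in> set target_certs"
  shows "strictly_rigid GG (map orb q)" "set q \<subseteq> set ninn"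
proof -
  have "\<forall>c\<in>set target_certs. set (fst c) \<subseteq> set ninn \<and> length (fst c) = 4"
    by (simp add: target_certs_def ninn_def inns_def)
  then have q: "set q \<subseteq> set ninn" "length q = 4" using assms by fastforce+
  then show "set q \<subseteq> set ninn" by simp
  have inn: "set q \<subseteq> set inns" using q ninn_inns by blast
  obtain a b c d where l: "q = [a, b, c, d]" using q(2) by (auto simp: length_Suc_conv numeral_eq_Suc)
  obtain gs wa wb where t: "t = (gs, wa, wb)" by (metis prod.collapse)
  have "tuple_ok q t" using GG_check(3) assms unfolding list_all_iff by fastforce
  then have g: "gs \<in> Sigma_gen GG (map orb q)" using tuple_ok_GG inn t by blast
  have "quad_count a b c d = 6048" using target_counts assms unfolding list_all_iff l by fastforce
  then have "int (card (Sigma_bar GG (map orb q))) = 6048"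
    unfolding Sigma_bar_GG l using inn l card_Sigma_inner[of a b c d] by simp
  then have c: "card (Sigma_bar GG (map orb q)) = card (carrier GG)" by (simp add: card_Gam)
  show "strictly_rigid GG (map orb q)"
    by (rule GG.strictly_rigidI[OF _ g _ centreless_GG c]) (use conj_invariant_GG inn finite_Gam in auto)
qed

section \<open>Rigid quadruples of the extension\<close>

definition hU :: "lab list \<Rightarrow> lab \<Rightarrow> lab \<Rightarrow> int" where "hU ls k m = isum (\<lambda>i. nto i k m) ls"

text \<open>The outer classes stand in the middle, so that each half of the product is an inner
  class times an outer one, for which \<open>tabo\<close> is available.\<close>

definition quad_count2 :: "lab \<Rightarrow> lab \<Rightarrow> lab \<Rightarrow> lab \<Rightarrow> int" where
  "quad_count2 c1 o1 o2 c2 = dotn (hU (map linv (hl c2)) (linv o2)) outs (weights (hU (hl c1) o1) outs)"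

text \<open>Outer times outer, obtained from inner times outer by \<open>nn_rotate\<close>;
  \<open>noo_eq\<close> shows that the division is exact for the arguments that occur.\<close>

definition noo :: "lab \<Rightarrow> lab \<Rightarrow> lab \<Rightarrow> int" where "noo i k m = (osize i * nto m (linv k) i) div osize m"

definition quad_count4 :: "lab \<Rightarrow> lab \<Rightarrow> lab \<Rightarrow> lab \<Rightarrow> int" where
  "quad_count4 o1 o2 o3 o4 = dotn (noo (linv o4) (linv o3)) inns (weights (noo o1 o2) inns)"

lemma distinct_hl: "distinct (hl l)" by (auto simp: hl_def)
lemma distinct_linv_hl: "distinct (map linv (hl l))" by (cases l) (simp_all add: hl_def)
lemma hl_outs: "l \<in> set outs \<Longrightarrow> hl l = [l]" by (cases l) (simp_all add: hl_def outs_def)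
lemma hl_inns: "l \<in> set inns \<Longrightarrow> set (hl l) \<subseteq> set inns" by (cases l) (simp_all add: hl_def inns_def)
lemma linv_hl_inns: "l \<in> set inns \<Longrightarrow> set (map linv (hl l)) \<subseteq> set inns"
  by (cases l) (simp_all add: hl_def inns_def)

lemma nnU_hU:
  assumes "distinct I" "set I \<subseteq> set inns" "k \<in> set outs" "m \<in> set outs"
  shows "int (nnU I [k] m) = hU I k m"
  unfolding hU_def isum_eq[OF assms(1)] nnU_def using assms(2-4) by (auto simp: nto_eq intro!: sum.cong)

lemma card_Sigma_mixed:
  assumes "c1 \<in> set inns" "o1 \<in> set outs" "o2 \<in> set outs" "c2 \<in> set inns"
  shows "int (card (Sigma_bar HH (map (union_orb \<circ> hl) [c1, o1, o2, c2]))) = quad_count2 c1 o1 o2 c2"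
proof -
  have l: "linv o2 \<in> set outs" using linv_outs assms(3) by simp
  have "card (Sigma_bar HH (map (union_orb \<circ> hl) [c1, o1, o2, c2])) =
      (\<Sum>m\<in>UNIV. card (orb m) * (nnU (hl c1) [o1] m * nnU (map linv (hl c2)) [linv o2] m))"
    using card_Sigma_union[of "hl c1" "hl o1" "hl o2" "hl c2"] by (simp add: hl_outs assms(2,3))
  also have "\<dots> = (\<Sum>m\<in>set outs. card (orb m) * (nnU (hl c1) [o1] m * nnU (map linv (hl c2)) [linv o2] m))"
    using nnU_parity_mixed[OF hl_inns[OF assms(1)], of "[o1]"] assms(2) by (intro sum_inner_outer(2)) simp
  finally have "int (card (Sigma_bar HH (map (union_orb \<circ> hl) [c1, o1, o2, c2]))) =
      (\<Sum>m\<in>set outs. int (card (orb m)) * (int (nnU (hl c1) [o1] m) * int (nnU (map linv (hl c2)) [linv o2] m)))" by simp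
  also have "\<dots> = quad_count2 c1 o1 o2 c2"
    unfolding quad_count2_def dotn_weights[OF distinct_outs]
    using nnU_hU[OF distinct_hl hl_inns[OF assms(1)] assms(2)] nnU_hU[OF distinct_linv_hl linv_hl_inns[OF assms(4)] l]
    by (intro sum.cong) (simp_all add: card_orb)
  finally show ?thesis .
qed

lemma card_triples:
  "card {(x, y). x \<in> orb i \<and> y \<in> orb k \<and> hm x y \<in> orb m} = card (orb m) * nn i k m"
proof -
  let ?S = "\<lambda>z. {(x, y). x \<in> orb i \<and> y \<in> orb k \<and> hm x y = z}"
  have f: "finite (?S z)" for z
    by (rule finite_subset[of _ "carrier HH \<times> carrier HH"]) (use orb_HH finite_HH in blast, use finite_HH in simp)
  have "{(x, y). x \<in> orb i \<and> y \<in> orb k \<and> hm x y \<in> orb m} = (\<Union>z\<in>orb m. ?S z)" by auto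
  also have "card \<dots> = (\<Sum>z\<in>orb m. card (?S z))"
    by (rule card_UN_disjoint) (use f finite_subset[OF orb_HH finite_HH] in auto)
  also have "\<dots> = (\<Sum>z\<in>orb m. nn i k m)"
    using prod_count_orb[of _ m i k] unfolding prod_count_def by (intro sum.cong) simp_all
  finally show ?thesis by simp
qed

text \<open>The bijection from (x, y) to (x y, y^-1) exchanges the roles of the first factor and the
  product.\<close>

lemma nn_rotate: "card (orb m) * nn i k m = card (orb i) * nn m (linv k) i"
proof -
  let ?S = "{(x, y). x \<in> orb i \<and> y \<in> orb k \<and> hm x y \<in> orb m}"
  let ?T = "{(z, w). z \<in> orb m \<and> w \<in> orb (linv k) \<and> hm z w \<in> orb i}"
  have c: "x \<in> carrier HH" if "x \<in> orb l" for x l using that orb_HH by auto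
  have e: "hm (hm x y) (inv\<^bsub>HH\<^esub> y) = x" if "x \<in> carrier HH" "y \<in> carrier HH" for x y
    using HH.m_assoc[OF that HH.inv_closed[OF that(2)]] HH.r_inv[OF that(2)] HH.r_one[OF that(1)] by simp
  have io: "inv\<^bsub>HH\<^esub> y \<in> orb (linv l)" if "y \<in> orb l" for y l using inv_image_orb that by blast
  have "bij_betw (\<lambda>(x, y). (hm x y, inv\<^bsub>HH\<^esub> y)) ?S ?T"
  proof (rule bij_betwI[where g = "\<lambda>(z, w). (hm z w, inv\<^bsub>HH\<^esub> w)"])
    show "(\<lambda>(x, y). (hm x y, inv\<^bsub>HH\<^esub> y)) \<in> ?S \<rightarrow> ?T" using e c io by fastforce
    show "(\<lambda>(z, w). (hm z w, inv\<^bsub>HH\<^esub> w)) \<in> ?T \<rightarrow> ?S" using e c io[of _ "linv k"] by fastforce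
  qed (use e c HH.inv_inv in fastforce)+
  then have "card ?S = card ?T" by (rule bij_betw_same_card)
  then show ?thesis by (simp add: card_triples)
qed

lemma noo_eq:
  assumes "i \<in> set outs" "k \<in> set outs" "m \<in> set inns"
  shows "int (nn i k m) = noo i k m"
proof -
  have "osize m * int (nn i k m) = osize i * nto m (linv k) i"
    using nn_rotate[of m i k] nto_eq[of m "linv k" i] assms linv_outs
    unfolding card_orb[symmetric] by (metis of_nat_mult)
  then show ?thesis unfolding noo_def using osize_pos[of m] by (metis less_irrefl nonzero_mult_div_cancel_left)
qed

lemma card_Sigma_outer:
  assumes "o1 \<in> set outs" "o2 \<in> set outs" "o3 \<in> set outs" "o4 \<in> set outs"
  shows "int (card (Sigma_bar HH (map (union_orb \<circ> hl) [o1, o2, o3, o4]))) = quad_count4 o1 o2 o3 o4"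
proof -
  have "card (Sigma_bar HH (map (union_orb \<circ> hl) [o1, o2, o3, o4])) =
      (\<Sum>m\<in>UNIV. card (orb m) * (nnU [o1] [o2] m * nnU [linv o4] [linv o3] m))"
    using card_Sigma_union[of "[o1]" "[o2]" "[o3]" "[o4]"] assms by (simp add: hl_outs)
  also have "\<dots> = (\<Sum>m\<in>set inns. card (orb m) * (nnU [o1] [o2] m * nnU [linv o4] [linv o3] m))"
    using nnU_parity_outer[of "[o1]" "[o2]"] assms by (intro sum_inner_outer(1)) simp
  also have "\<dots> = (\<Sum>m\<in>set inns. card (orb m) * (nn o1 o2 m * nn (linv o4) (linv o3) m))"
    by (simp add: nnU_def)
  finally have "int (card (Sigma_bar HH (map (union_orb \<circ> hl) [o1, o2, o3, o4]))) =
      (\<Sum>m\<in>set inns. int (card (orb m)) * (int (nn o1 o2 m) * int (nn (linv o4) (linv o3) m)))" by simp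
  also have "\<dots> = quad_count4 o1 o2 o3 o4"
    unfolding quad_count4_def dotn_weights[OF distinct_inns]
    using assms by (intro sum.cong) (simp_all add: card_orb noo_eq linv_outs)
  finally show ?thesis .
qed

text \<open>The inner classes of the extension other than the identity, with one label from each
  pair exchanged by the outer involution.\<close>

definition hinn :: "lab list" where "hinn = [L2A, L3A, L3B, L4A, L4C, L6A, L7A, L8A, L12A]"

definition pair_certs_HH :: "(lab list \<times> tuple_cert \<times> tuple_cert \<times> sym list) list" where
  "pair_certs_HH = [
  ([L2B, L4D, L2A, L3A],
    ([(M F02 F01 F22 F01 F12 F10 F22 F10 F01, True), (M F01 F02 F22 F02 F01 F22 F11 F11 F00, True), (M F20 F00 F00 F00 F00 F20 F00 F20 F00, False), (M F10 F00 F00 F00 F11 F21 F00 F11 F12, False)], [X1, X2, X4], [X1, X4, X2]),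
    ([(M F02 F00 F00 F00 F11 F21 F00 F21 F11, True), (M F00 F01 F00 F02 F00 F00 F00 F00 F20, True), (M F00 F20 F00 F20 F00 F00 F00 F00 F20, False), (M F10 F00 F00 F00 F11 F12 F00 F22 F12, False)], [X2, X2], [X1, X3, X4, X2]), [X1, X4, X2]),
  ([L4D, L4D, L2A, L3A],
    ([(M F00 F02 F00 F01 F00 F00 F00 F00 F20, True), (M F02 F01 F12 F11 F20 F10 F10 F22 F10, True), (M F10 F20 F21 F20 F10 F21 F22 F22 F00, False), (M F11 F00 F21 F00 F10 F00 F11 F00 F12, False)], [X1, X1], [X4, X2, X1, X4]),
    ([(M F20 F12 F20 F01 F20 F21 F21 F20 F01, True), (M F02 F11 F10 F22 F00 F21 F10 F12 F01, True), (M F20 F00 F00 F00 F20 F00 F00 F00 F10, False), (M F11 F10 F02 F20 F11 F10 F02 F20 F11, False)], [X3], [X4, X2, X1]), [X1, X3, X2])]"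

text \<open>These are orthogonal frames, whereas \<open>configs2\<close> consists of single
  nonisotropic points and \<open>configs3\<close> of single isotropic points. Each list serves one
  of the quadruples in \<open>brute_cases\<close>.\<close>

definition configs1 :: "v9 list list" where
  "configs1 = [
    [V F00 F00 F01, V F01 F10 F00, V F01 F20 F00], [V F00 F01 F00, V F01 F00 F10, V F01 F00 F20],
    [V F00 F01 F10, V F00 F01 F20, V F01 F00 F00]]"

definition configs2 :: "v9 list list" where
  "configs2 = [
    [V F00 F01 F01], [V F00 F01 F02], [V F01 F00 F01], [V F01 F00 F02], [V F01 F01 F00],
    [V F01 F02 F00]]"

definition configs3 :: "v9 list list" where
  "configs3 = [
    [V F01 F00 F11], [V F01 F00 F12], [V F01 F00 F21], [V F01 F00 F22]]"

definition brute_cases :: "lab list list" where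
  "brute_cases = [[L2B, L4D, L2A, L2A], [L2B, L2B, L2A, L3A], [L4D, L4D, L2A, L4A]]"

text \<open>The order of the extension is 12096, and 48384 is four times as much.\<close>

definition excluded2 :: "lab \<Rightarrow> lab \<Rightarrow> lab \<Rightarrow> lab \<Rightarrow> int \<Rightarrow> bool" where
  "excluded2 o1 o2 c1 c2 n \<longleftrightarrow> (if n < 12096 then True else if 48384 \<le> n then True else
     [o1, o2, c1, c2] \<in> set (brute_cases @ map fst pair_certs_HH))"
definition hchk4 :: "lab \<Rightarrow> lab \<Rightarrow> lab \<Rightarrow> int list \<Rightarrow> lab \<Rightarrow> bool" where
  "hchk4 o1 o2 c1 ws c2 \<longleftrightarrow> (if lidx c2 < lidx c1 then True
     else excluded2 o1 o2 c1 c2 (dotn (hU (map linv (hl c2)) (linv o2)) outs ws))"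
definition hchk3 :: "lab \<Rightarrow> lab \<Rightarrow> lab \<Rightarrow> bool" where
  "hchk3 o1 o2 c1 \<longleftrightarrow> list_all (hchk4 o1 o2 c1 (weights (hU (hl c1) o1) outs)) hinn"
definition hchk2 :: "lab \<Rightarrow> lab \<Rightarrow> bool" where
  "hchk2 o1 o2 \<longleftrightarrow> (if lidx o2 < lidx o1 then True else list_all (hchk3 o1 o2) hinn)"
definition hchk1 :: "lab \<Rightarrow> bool" where "hchk1 o1 \<longleftrightarrow> list_all (hchk2 o1) outs"

text \<open>For four outer classes the counts alone decide: none of them falls between the two
  bounds, so there is no list of exceptions.\<close>

definition large4 :: "int \<Rightarrow> bool" where "large4 n \<longleftrightarrow> (if n < 12096 then True else 48384 \<le> n)"
definition ochk4 :: "int list \<Rightarrow> lab \<Rightarrow> lab \<Rightarrow> bool" where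
  "ochk4 ws o3 o4 \<longleftrightarrow> (if lidx o4 < lidx o3 then True else large4 (dotn (noo (linv o4) (linv o3)) inns ws))"
definition ochk3 :: "lab \<Rightarrow> int list \<Rightarrow> lab \<Rightarrow> bool" where
  "ochk3 o2 ws o3 \<longleftrightarrow> (if lidx o3 < lidx o2 then True else list_all (ochk4 ws o3) outs)"
definition ochk2 :: "lab \<Rightarrow> lab \<Rightarrow> bool" where
  "ochk2 o1 o2 \<longleftrightarrow> (if lidx o2 < lidx o1 then True else list_all (ochk3 o2 (weights (noo o1 o2) inns)) outs)"
definition ochk1 :: "lab \<Rightarrow> bool" where "ochk1 o1 \<longleftrightarrow> list_all (ochk2 o1) outs"

lemma HH_check: "list_all hchk1 outs" "list_all ochk1 outs" "list_all pair_ok_HH pair_certs_HH"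
  by code_simp+

lemma brute_not_generating:
  assumes o: "l \<in> set outs" and chk: "list_all (brute2 cs (base (linv y)) (rep l) LB) LA"
    and LA: "set LA = union_orb (hl a)" and LB: "set LB = union_orb (hl b)" and y: "y \<in> set outs"
    and cs: "list_all moved cs"
  shows "Sigma_gen HH (map (union_orb \<circ> hl) [l, a, b, y]) = {}"
proof (rule ccontr)
  assume "Sigma_gen HH (map (union_orb \<circ> hl) [l, a, b, y]) \<noteq> {}"
  then obtain g1 g2 g3 g4 where g: "g1 \<in> union_orb (hl l)" "g2 \<in> union_orb (hl a)" "g3 \<in> union_orb (hl b)"
      "g4 \<in> union_orb (hl y)" "hm g1 (hm g2 (hm g3 (hm g4 (mid, False)))) = (mid, False)"
      "generate HH {g1, g2, g3, g4} = carrier HH"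
    by (auto simp: Sigma_gen_def Sigma_bar_def list_all2_Cons2)
  have "g1 \<in> orb l" "g4 \<in> orb y" using g(1,4) hl_outs[OF o] hl_outs[OF y] by (simp_all add: union_orb_def)
  then have "\<not> Gam \<subseteq> generate HH {g1, g2, g3, g4}"
    using brute_core[OF chk LA LB cs _ g(2,3) _ g(5)] by blast
  then show False using g(6) Gam_HH by blast
qed

lemma brute_check:
  "list_all (brute2 configs1 L4D (rep L2B) (concat (tconj [rep L2A]))) (concat (tconj [rep L2A]))"
  "list_all (brute2 configs2 L2B (rep L2B) transvs) (concat (tconj [rep L2A]))"
  "list_all (brute2 configs3 L4D (rep L4D) (concat (tconj [rep L2A]))) (concat (tconj [rep L4A]))"
  "list_all (brute2 configs3 L4D (rep L4D) (concat (tconj [rep L2A]))) (concat (tconj [rep L4B]))"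
  "list_all moved (configs1 @ configs2 @ configs3)"
  by code_simp+

lemma brute_results:
  "Sigma_gen HH (map (union_orb \<circ> hl) [L2B, L2A, L2A, L4D]) = {}"
  "Sigma_gen HH (map (union_orb \<circ> hl) [L2B, L2A, L3A, L2B]) = {}"
  "Sigma_gen HH (map (union_orb \<circ> hl) [L4D, L4A, L2A, L4D]) = {}"
proof -
  have u: "union_orb (hl L2A) = orb L2A" "union_orb (hl L3A) = orb L3A" "union_orb (hl L4A) = orb L4A \<union> orb L4B"
    by (simp_all add: union_orb_def hl_def)
  have o: "L2B \<in> set outs" "L4D \<in> set outs" by (simp_all add: outs_def)
  have b: "base (linv L4D) = L4D" "base (linv L2B) = L2B" by (simp_all add: base_def)
  have m: "list_all moved configs1" "list_all moved configs2" "list_all moved configs3"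
    using brute_check(5) by simp_all
  show "Sigma_gen HH (map (union_orb \<circ> hl) [L2B, L2A, L2A, L4D]) = {}"
    by (rule brute_not_generating[OF o(1) _ _ _ o(2) m(1), unfolded b, OF brute_check(1)])
       (simp_all only: central_orbits u)
  show "Sigma_gen HH (map (union_orb \<circ> hl) [L2B, L2A, L3A, L2B]) = {}"
    by (rule brute_not_generating[OF o(1) _ _ _ o(1) m(2), unfolded b, OF brute_check(2)])
       (simp_all only: central_orbits u transvs_orb)
  have "list_all (brute2 configs3 L4D (rep L4D) (concat (tconj [rep L2A])))
      (concat (tconj [rep L4A]) @ concat (tconj [rep L4B]))"
    using brute_check(3,4) by (simp only: list_all_append)
  then show "Sigma_gen HH (map (union_orb \<circ> hl) [L4D, L4A, L2A, L4D]) = {}"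
    by (rule brute_not_generating[OF o(2) _ _ _ o(2) m(3), unfolded b])
       (simp_all only: set_append central_orbits u)
qed

text \<open>Sorting by this index puts outer labels before inner ones and agrees with
  \<open>lidx\<close> within each kind.\<close>

definition hidx :: "lab \<Rightarrow> int" where "hidx l = (if lidx l < 14 then lidx l + 6 else lidx l - 14)"

lemma hidx_outs: "l \<in> set outs \<longleftrightarrow> hidx l < 6" by (cases l) (simp_all add: hidx_def lidx_def outs_def)
lemma hidx_mono: "l \<in> set outs \<longleftrightarrow> k \<in> set outs \<Longrightarrow> hidx l \<le> hidx k \<Longrightarrow> lidx l \<le> lidx k"
  by (cases l; cases k; simp add: hidx_def lidx_def outs_def)

theorem HH_not_rigid:
  assumes "length ls = 4" "set ls \<subseteq> set hinn \<union> set outs" "rigid HH (map (union_orb \<circ> hl) ls)"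
    "mu_bar HH (map (union_orb \<circ> hl) ls) < 4"
  shows False
proof -
  let ?m = "map (union_orb \<circ> hl)"
  obtain a b c d where s: "mset ls = mset [a, b, c, d]" "hidx a \<le> hidx b" "hidx b \<le> hidx c" "hidx c \<le> hidx d"
    using sort4[OF assms(1)] by metis
  have sub: "set [a, b, c, d] \<subseteq> set hinn \<union> set outs" using assms(2) mset_eq_setD[OF s(1)] by simp
  have hi: "l \<in> set hinn \<longleftrightarrow> l \<notin> set outs" if "l \<in> set hinn \<union> set outs" for l
    using that by (auto simp: hinn_def outs_def)
  have ci: "\<forall>C\<in>set (?m ks). conj_invariant HH C" for ks using conj_invariant_HH by auto
  have mu: "mu HH (?m ls) = mu HH (?m ks)" "mu_bar HH (?m ls) = mu_bar HH (?m ks)" if "mset ls = mset ks" for ks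
    using HH.mu_mset[OF finite_HH mset_map_orb[OF that] ci] .
  have fS: "finite (Sigma_bar HH (?m ks))" for ks
    by (rule finite_Sigma_bar) (use finite_subset[OF union_orb_HH finite_HH] in auto)
  have g: "card (Sigma_gen HH (?m ks)) = 12096" if "mset ls = mset ks" for ks
    using assms(3) mu(1)[OF that] by (simp add: rigid_def mu_def card_HH)
  have ne: "Sigma_gen HH (?m ks) \<noteq> {}" if "mset ls = mset ks" for ks using g[OF that] by auto
  have ge: "\<not> int (card (Sigma_bar HH (?m ks))) < 12096" if "mset ls = mset ks" for ks
    using card_mono[OF fS Sigma_gen_subset, of ks] g[OF that] by simp
  have lt: "\<not> 48384 \<le> int (card (Sigma_bar HH (?m ks)))" if "mset ls = mset ks" for ks
  proof -
    have "mu_bar HH (?m ks) < 4" using assms(4) mu(2)[OF that] by metis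
    then have "real (card (Sigma_bar HH (?m ks))) < 4 * 12096"
      unfolding mu_bar_def by (simp only: card_HH)
    then show ?thesis by linarith
  qed
  obtain gs where gs: "gs \<in> Sigma_gen HH (?m [a, b, c, d])" using ne[OF s(1)] by blast
  then obtain g1 g2 g3 g4 where g4: "gs = [g1, g2, g3, g4]" "g1 \<in> union_orb (hl a)" "g2 \<in> union_orb (hl b)"
      "g3 \<in> union_orb (hl c)" "g4 \<in> union_orb (hl d)"
    and pr: "hm g1 (hm g2 (hm g3 (hm g4 (mid, False)))) = (mid, False)" and gen: "generate HH (set gs) = carrier HH"
    by (auto simp: Sigma_gen_def Sigma_bar_def list_all2_Cons2)
  have so: "snd x \<longleftrightarrow> l \<in> set outs" if x: "x \<in> union_orb (hl l)" for x l
  proof -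
    obtain k where "x \<in> orb k" "k = l \<or> k = lsig l" using x by (auto simp: union_orb_def set_hl)
    moreover have "lsig l \<in> set outs \<longleftrightarrow> l \<in> set outs" by (cases l) (simp_all add: outs_def)
    ultimately show ?thesis using snd_orb by auto
  qed
  have par: "(a \<in> set outs) = ((b \<in> set outs) = ((c \<in> set outs) = (d \<in> set outs)))"
    using parity[OF pr] parity[OF refl, of g2 "hm g3 (hm g4 (mid, False))"] parity[OF refl, of g3 "hm g4 (mid, False)"]
      parity[OF refl, of g4 "(mid, False)"] so[OF g4(2)] so[OF g4(3)] so[OF g4(4)] so[OF g4(5)] by auto
  \<comment> \<open>The product is inner, so the number of outer entries is even. As outer labels
    come first, there are four of them, two or none, according to the tests on \<open>d\<close> and
    \<open>b\<close>.\<close>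
  consider "d \<in> set outs" | "d \<notin> set outs" "b \<in> set outs" | "d \<notin> set outs" "b \<notin> set outs" by blast
  then show False
  proof cases
    case 1
    then have o: "a \<in> set outs" "b \<in> set outs" "c \<in> set outs" using s(2-4) unfolding hidx_outs by linarith+
    then have x: "lidx a \<le> lidx b" "lidx b \<le> lidx c" "lidx c \<le> lidx d" using hidx_mono s(2-4) 1 by blast+
    have "large4 (quad_count4 a b c d)"
      using HH_check(2) o 1 x unfolding quad_count4_def list_all_iff ochk1_def ochk2_def ochk3_def ochk4_def
      by (metis linorder_not_le)
    then show False using ge[OF s(1)] lt[OF s(1)] card_Sigma_outer[OF o 1] by (auto simp: large4_def split: if_splits)
  next
    case 2
    then have a: "a \<in> set outs" using s(2) unfolding hidx_outs by linarith
    have c: "c \<notin> set outs" using par 2 a by blast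
    have cd: "c \<in> set hinn" "d \<in> set hinn" using hi sub c 2 by auto
    then have i: "c \<in> set inns" "d \<in> set inns" by (auto simp: hinn_def inns_def)
    have x: "lidx a \<le> lidx b" "lidx c \<le> lidx d" using hidx_mono s(2,4) a c 2 by blast+
    \<comment> \<open>Moving an inner class to the front gives the order of factors required by
      \<open>quad_count2\<close>.\<close>
    have ms: "mset ls = mset [c, a, b, d]" using s(1) by simp
    have "excluded2 a b c d (quad_count2 c a b d)"
      using HH_check(1) a 2 cd x unfolding quad_count2_def list_all_iff hchk1_def hchk2_def hchk3_def hchk4_def
      by (metis linorder_not_le)
    then have "[a, b, c, d] \<in> set (brute_cases @ map fst pair_certs_HH)"
      using ge[OF ms] lt[OF ms] card_Sigma_mixed[OF i(1) a 2(2) i(2)] by (auto simp: excluded2_def split: if_splits)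
    then consider "[a, b, c, d] \<in> set brute_cases" | "[a, b, c, d] \<in> set (map fst pair_certs_HH)" by auto
    then show False
    proof cases
      case 1
      then have "mset ls = mset [L2B, L2A, L2A, L4D] \<or> mset ls = mset [L2B, L2A, L3A, L2B] \<or> mset ls = mset [L4D, L4A, L2A, L4D]"
        using s(1) by (auto simp: brute_cases_def)
      then show False using ne brute_results by blast
    next
      case c: 2
      then obtain t t' w where t: "([a, b, c, d], t, t', w) \<in> set pair_certs_HH" by auto
      then have "pair_ok_HH ([a, b, c, d], t, t', w)" using HH_check(3) by (simp only: list_all_iff)
      then have "\<not> rigid HH (?m [a, b, c, d])" using pair_ok_HH_not_rigid a by (metis list.set_intros(1))
      then show False using assms(3) mu(1)[OF s(1)] by (simp add: rigid_def)
    qed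
  next
    case 3
    then have c: "c \<notin> set outs" using s(3) unfolding hidx_outs by linarith
    have a: "a \<notin> set outs" using par 3 c by blast
    \<comment> \<open>Without outer entries the tuple stays inside the simple group and cannot
      generate the extension.\<close>
    have "set gs \<subseteq> Gam"
    proof
      fix x assume "x \<in> set gs"
      then have "snd x = False" "x \<in> carrier HH"
        using so[OF g4(2)] so[OF g4(3)] so[OF g4(4)] so[OF g4(5)] a c 3 g4 union_orb_HH by auto
      then show "x \<in> Gam" by (cases x) (simp add: Gam_iff)
    qed
    then have "carrier HH \<subseteq> Gam" using HH.generate_subgroup_incl[OF _ subgroup_Gam] gen by metis
    then show False using card_mono[OF finite_Gam, of "carrier HH"] card_Gam card_HH by simp
  qed
qed

section \<open>The automorphism group\<close>

lemma list_all2_image: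
  "list_all2 (\<in>) hs (map ((`) f) Cs) \<longleftrightarrow> (\<exists>gs. hs = map f gs \<and> list_all2 (\<in>) gs Cs)"
proof
  show "list_all2 (\<in>) hs (map ((`) f) Cs) \<Longrightarrow> \<exists>gs. hs = map f gs \<and> list_all2 (\<in>) gs Cs"
  proof (induction Cs arbitrary: hs)
    case (Cons C Cs)
    from Cons.prems obtain y zs where h: "hs = y # zs" "y \<in> f ` C" "list_all2 (\<in>) zs (map ((`) f) Cs)"
      unfolding list.map list_all2_Cons2 by blast
    from Cons.IH[OF h(3)] obtain gs where "zs = map f gs" "list_all2 (\<in>) gs Cs" by blast
    moreover obtain x where "x \<in> C" "y = f x" using h(2) by blast
    ultimately show ?case using h(1) by (intro exI[of _ "x # gs"]) simp
  qed simp
  show "\<exists>gs. hs = map f gs \<and> list_all2 (\<in>) gs Cs \<Longrightarrow> list_all2 (\<in>) hs (map ((`) f) Cs)"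
    by (auto simp: list_all2_conv_all_nth)
qed

lemma list_all2_subset:
  "list_all2 (\<in>) gs Cs \<Longrightarrow> \<forall>C\<in>set Cs. C \<subseteq> S \<Longrightarrow> set gs \<subseteq> S"
  by (induction rule: list_all2_induct) auto

context
  fixes G (structure) and H and f
  assumes G: "group G" and H: "group H" and f: "f \<in> iso G H"
begin

lemma iso_hom: "group_hom G H f"
  using G H f by (simp add: group_hom_def group_hom_axioms_def iso_def)

lemma iso_inj: "inj_on f (carrier G)" and iso_image: "f ` carrier G = carrier H"
  using f by (auto simp: iso_def bij_betw_def)

lemma iso_foldr:
  "set gs \<subseteq> carrier G \<Longrightarrow> f (foldr (\<otimes>\<^bsub>G\<^esub>) gs \<one>\<^bsub>G\<^esub>) = foldr (\<otimes>\<^bsub>H\<^esub>) (map f gs) \<one>\<^bsub>H\<^esub> \<and>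
     foldr (\<otimes>\<^bsub>G\<^esub>) gs \<one>\<^bsub>G\<^esub> \<in> carrier G"
proof (induction gs)
  case Nil
  then show ?case using group_hom.hom_one[OF iso_hom] monoid.one_closed[OF group.is_monoid[OF G]] by simp
next
  case (Cons g gs)
  then show ?case using group_hom.hom_mult[OF iso_hom, of g] monoid.m_closed[OF group.is_monoid[OF G], of g] by simp
qed

lemma iso_Sigma:
  assumes "\<forall>C\<in>set Cs. C \<subseteq> carrier G"
  shows "Sigma_bar H (map ((`) f) Cs) = map f ` Sigma_bar G Cs"
    "Sigma_gen H (map ((`) f) Cs) = map f ` Sigma_gen G Cs"
proof -
  have sub: "set gs \<subseteq> carrier G" if "list_all2 (\<in>) gs Cs" for gs using list_all2_subset[OF that assms] .
  have one: "\<one>\<^bsub>G\<^esub> \<in> carrier G" "f \<one>\<^bsub>G\<^esub> = \<one>\<^bsub>H\<^esub>"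
    using group_hom.hom_one[OF iso_hom] monoid.one_closed[OF group.is_monoid[OF G]] by auto
  have fold: "foldr (\<otimes>\<^bsub>H\<^esub>) (map f gs) \<one>\<^bsub>H\<^esub> = \<one>\<^bsub>H\<^esub> \<longleftrightarrow> foldr (\<otimes>\<^bsub>G\<^esub>) gs \<one>\<^bsub>G\<^esub> = \<one>\<^bsub>G\<^esub>"
    if "list_all2 (\<in>) gs Cs" for gs
    using iso_foldr[OF sub[OF that]] one inj_onD[OF iso_inj] by metis
  show b: "Sigma_bar H (map ((`) f) Cs) = map f ` Sigma_bar G Cs"
    unfolding Sigma_bar_def list_all2_image using fold by blast
  have gen: "generate H (set (map f gs)) = carrier H \<longleftrightarrow> generate G (set gs) = carrier G"
    if "list_all2 (\<in>) gs Cs" for gs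
  proof -
    have "generate H (f ` set gs) = f ` generate G (set gs)"
      by (rule group_hom.generate_img[OF iso_hom sub[OF that]])
    moreover have "generate G (set gs) \<subseteq> carrier G" by (rule group.generate_incl[OF G sub[OF that]])
    ultimately show ?thesis using iso_image iso_inj by (metis image_set inj_on_image_eq_iff order_refl)
  qed
  show "Sigma_gen H (map ((`) f) Cs) = map f ` Sigma_gen G Cs"
  proof -
    have "{hs \<in> map f ` S. P hs} = map f ` {gs \<in> S. Q gs}" if "\<forall>gs\<in>S. P (map f gs) = Q gs" for S P Q
      using that by blast
    from this[of "Sigma_bar G Cs" "\<lambda>hs. generate H (set hs) = carrier H" "\<lambda>gs. generate G (set gs) = carrier G"]
    show ?thesis unfolding Sigma_gen_def b using gen unfolding Sigma_bar_def by blast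
  qed
qed

lemma iso_mu:
  assumes "\<forall>C\<in>set Cs. C \<subseteq> carrier G"
  shows "mu H (map ((`) f) Cs) = mu G Cs" "mu_bar H (map ((`) f) Cs) = mu_bar G Cs"
proof -
  have sub: "set gs \<subseteq> carrier G" if "gs \<in> Sigma_bar G Cs" for gs
    using that list_all2_subset[OF _ assms] by (auto simp: Sigma_bar_def)
  have inj: "inj_on (map f) (Sigma_bar G Cs)"
  proof (rule inj_onI)
    fix x y assume "x \<in> Sigma_bar G Cs" "y \<in> Sigma_bar G Cs" "map f x = map f y"
    then show "x = y" using map_inj_on[of f x y] sub inj_on_subset[OF iso_inj] by (metis Un_least)
  qed
  have "card (carrier H) = card (carrier G)" using card_image[OF iso_inj] iso_image by simp
  then show "mu H (map ((`) f) Cs) = mu G Cs" "mu_bar H (map ((`) f) Cs) = mu_bar G Cs"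
    unfolding mu_def mu_bar_def iso_Sigma[OF assms]
    using card_image[OF inj] card_image[OF inj_on_subset[OF inj Sigma_gen_subset]] by simp_all
qed

lemma iso_conjugacy_class:
  assumes "x \<in> carrier G"
  shows "conjugacy_class H (f x) = f ` conjugacy_class G x"
proof -
  have e: "f (h \<otimes>\<^bsub>G\<^esub> x \<otimes>\<^bsub>G\<^esub> inv\<^bsub>G\<^esub> h) = f h \<otimes>\<^bsub>H\<^esub> f x \<otimes>\<^bsub>H\<^esub> inv\<^bsub>H\<^esub> (f h)" if "h \<in> carrier G" for h
  proof -
    have "h \<otimes>\<^bsub>G\<^esub> x \<in> carrier G" "inv\<^bsub>G\<^esub> h \<in> carrier G"
      using that assms monoid.m_closed[OF group.is_monoid[OF G]] group.inv_closed[OF G] by auto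
    then show ?thesis
      using that assms group_hom.hom_mult[OF iso_hom] group_hom.hom_inv[OF iso_hom] by simp
  qed
  have "conjugacy_class H (f x) = (\<lambda>h. f h \<otimes>\<^bsub>H\<^esub> f x \<otimes>\<^bsub>H\<^esub> inv\<^bsub>H\<^esub> (f h)) ` carrier G"
    unfolding conjugacy_class_def iso_image[symmetric] by blast
  also have "\<dots> = (\<lambda>h. f (h \<otimes>\<^bsub>G\<^esub> x \<otimes>\<^bsub>G\<^esub> inv\<^bsub>G\<^esub> h)) ` carrier G" using e by (intro image_cong) simp_all
  also have "\<dots> = f ` conjugacy_class G x" unfolding conjugacy_class_def by blast
  finally show ?thesis .
qed

lemma conj_class_subset: "x \<in> carrier G \<Longrightarrow> conjugacy_class G x \<subseteq> carrier G"
  using group.conjugacy_class_conj_invariant[OF G] by (simp add: conj_invariant_def)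

lemma iso_class_quadruple: "class_quadruple G Cs \<Longrightarrow> class_quadruple H (map ((`) f) Cs)"
proof -
  assume q: "class_quadruple G Cs"
  have "\<exists>y\<in>carrier H. y \<noteq> \<one>\<^bsub>H\<^esub> \<and> f ` C = conjugacy_class H y" if C: "C \<in> set Cs" for C
  proof -
    obtain x where x: "x \<in> carrier G" "x \<noteq> \<one>\<^bsub>G\<^esub>" "C = conjugacy_class G x"
      using q C unfolding class_quadruple_def by blast
    have "f x \<noteq> \<one>\<^bsub>H\<^esub>"
      using x group_hom.hom_one[OF iso_hom] inj_onD[OF iso_inj, of x "\<one>\<^bsub>G\<^esub>"] monoid.one_closed[OF group.is_monoid[OF G]] by auto
    then show ?thesis using x iso_conjugacy_class iso_image by blast
  qed
  then show ?thesis using q by (auto simp: class_quadruple_def)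
qed

lemma iso_class_quadrupleE:
  assumes "class_quadruple H Ds"
  obtains Cs where "class_quadruple G Cs" "Ds = map ((`) f) Cs" "\<forall>C\<in>set Cs. C \<subseteq> carrier G"
proof -
  have "\<exists>C. (\<exists>x\<in>carrier G. x \<noteq> \<one>\<^bsub>G\<^esub> \<and> C = conjugacy_class G x) \<and> D = f ` C" if D: "D \<in> set Ds" for D
  proof -
    obtain y where y: "y \<in> carrier H" "y \<noteq> \<one>\<^bsub>H\<^esub>" "D = conjugacy_class H y"
      using assms D unfolding class_quadruple_def by blast
    then obtain x where x: "x \<in> carrier G" "y = f x" using iso_image by blast
    moreover have "x \<noteq> \<one>\<^bsub>G\<^esub>" using y(2) x(2) group_hom.hom_one[OF iso_hom] by auto
    ultimately show ?thesis using y(3) iso_conjugacy_class by blast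
  qed
  then obtain c where c: "\<forall>D\<in>set Ds. (\<exists>x\<in>carrier G. x \<noteq> \<one>\<^bsub>G\<^esub> \<and> c D = conjugacy_class G x) \<and> D = f ` c D" by metis
  have "class_quadruple G (map c Ds)" using assms c by (auto simp: class_quadruple_def)
  moreover have "Ds = map ((`) f) (map c Ds)" using c by (simp add: map_idI)
  moreover have "\<forall>C\<in>set (map c Ds). C \<subseteq> carrier G"
  proof
    fix C assume "C \<in> set (map c Ds)"
    then obtain x where "x \<in> carrier G" "C = conjugacy_class G x" using c by auto
    then show "C \<subseteq> carrier G" using conj_class_subset by simp
  qed
  ultimately show ?thesis using that by blast
qed

text \<open>Transport of structure: \<open>a\<close> goes to f a f^-1. The restriction to the
  carrier is there because \<open>auto\<close> consists of extensional functions.\<close>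

lemma iso_AutoGroup:
  "(\<lambda>a. \<lambda>y\<in>carrier H. f (a (inv_into (carrier G) f y))) \<in> iso (AutoGroup G) (AutoGroup H)"
proof -
  let ?g = "inv_into (carrier G) f"
  let ?F = "\<lambda>a. \<lambda>y\<in>carrier H. f (a (?g y))"
  let ?F' = "\<lambda>b. \<lambda>x\<in>carrier G. ?g (b (f x))"
  have gf: "?g (f x) = x" if "x \<in> carrier G" for x using inv_into_f_f[OF iso_inj that] .
  have fg: "f (?g y) = y" "?g y \<in> carrier G" if "y \<in> carrier H" for y
    using that iso_image by (auto simp: f_inv_into_f inv_into_into)
  have gh: "?g \<in> iso H G" using group.iso_set_sym[OF G f] .
  have fh: "f (x \<otimes>\<^bsub>G\<^esub> y) = f x \<otimes>\<^bsub>H\<^esub> f y" "f x \<in> carrier H" if "x \<in> carrier G" "y \<in> carrier G" for x y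
    using that group_hom.hom_mult[OF iso_hom] iso_image by auto
  have fc: "f x \<in> carrier H" if "x \<in> carrier G" for x using fh(2)[OF that that] .
  have ghm: "?g (x \<otimes>\<^bsub>H\<^esub> y) = ?g x \<otimes>\<^bsub>G\<^esub> ?g y" if "x \<in> carrier H" "y \<in> carrier H" for x y
    using gh that by (simp add: iso_def hom_def)
  have mG: "x \<otimes>\<^bsub>G\<^esub> y \<in> carrier G" if "x \<in> carrier G" "y \<in> carrier G" for x y
    using monoid.m_closed[OF group.is_monoid[OF G] that] .
  have mH: "x \<otimes>\<^bsub>H\<^esub> y \<in> carrier H" if "x \<in> carrier H" "y \<in> carrier H" for x y
    using monoid.m_closed[OF group.is_monoid[OF H] that] .
  have FA: "?F a \<in> auto H" if a: "a \<in> auto G" for a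
  proof -
    have ag: "a x \<in> carrier G" if "x \<in> carrier G" for x using a that by (auto simp: auto_def hom_def)
    have ah: "a (x \<otimes>\<^bsub>G\<^esub> y) = a x \<otimes>\<^bsub>G\<^esub> a y" if "x \<in> carrier G" "y \<in> carrier G" for x y
      using a that by (auto simp: auto_def hom_def)
    have ab: "bij_betw a (carrier G) (carrier G)" using a by (auto simp: auto_def Bij_def)
    have "?F a \<in> hom H H"
      by (rule homI) (simp_all add: fh(1) fg ag ah ghm mH fc)
    moreover have "bij_betw (?F a) (carrier H) (carrier H)"
    proof -
      have b1: "bij_betw ?g (carrier H) (carrier G)" using gh by (simp add: iso_def)
      have b2: "bij_betw f (carrier G) (carrier H)" using f by (simp add: iso_def)
      have "bij_betw (f \<circ> (a \<circ> ?g)) (carrier H) (carrier H)"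
        by (rule bij_betw_trans[OF bij_betw_trans[OF b1 ab] b2])
      then show ?thesis by (rule bij_betw_cong[THEN iffD1, rotated]) simp
    qed
    ultimately show ?thesis by (simp add: auto_def Bij_def)
  qed
  have F'A: "?F' b \<in> auto G" if b: "b \<in> auto H" for b
  proof -
    have bg: "b x \<in> carrier H" if "x \<in> carrier H" for x using b that by (auto simp: auto_def hom_def)
    have bh: "b (x \<otimes>\<^bsub>H\<^esub> y) = b x \<otimes>\<^bsub>H\<^esub> b y" if "x \<in> carrier H" "y \<in> carrier H" for x y
      using b that by (auto simp: auto_def hom_def)
    have bb: "bij_betw b (carrier H) (carrier H)" using b by (auto simp: auto_def Bij_def)
    have "?F' b \<in> hom G G"
      by (rule homI) (simp_all add: fh(1) fg bg bh ghm mG fc)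
    moreover have "bij_betw (?F' b) (carrier G) (carrier G)"
    proof -
      have b1: "bij_betw ?g (carrier H) (carrier G)" using gh by (simp add: iso_def)
      have b2: "bij_betw f (carrier G) (carrier H)" using f by (simp add: iso_def)
      have "bij_betw (?g \<circ> (b \<circ> f)) (carrier G) (carrier G)"
        by (rule bij_betw_trans[OF bij_betw_trans[OF b2 bb] b1])
      then show ?thesis by (rule bij_betw_cong[THEN iffD1, rotated]) simp
    qed
    ultimately show ?thesis by (simp add: auto_def Bij_def)
  qed
  have autoG: "a x \<in> carrier G" if "a \<in> auto G" "x \<in> carrier G" for a x
    using that by (auto simp: auto_def hom_def)
  have autoH: "a x \<in> carrier H" if "a \<in> auto H" "x \<in> carrier H" for a x
    using that by (auto simp: auto_def hom_def)
  have F'F: "?F' (?F a) = a" if a: "a \<in> auto G" for a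
  proof (rule extensionalityI[of _ "carrier G"])
    show "a \<in> extensional (carrier G)" using a by (auto simp: auto_def Bij_def)
  qed (use fc gf autoG[OF a] in auto)
  have FF': "?F (?F' b) = b" if b: "b \<in> auto H" for b
  proof (rule extensionalityI[of _ "carrier H"])
    show "b \<in> extensional (carrier H)" using b by (auto simp: auto_def Bij_def)
  qed (use fg autoH[OF b] in auto)
  have bij: "bij_betw ?F (auto G) (auto H)"
    by (rule bij_betw_byWitness[of _ ?F']) (use FA F'A F'F FF' in auto)
  have mult: "a \<otimes>\<^bsub>AutoGroup K\<^esub> b = compose (carrier K) a b" if "a \<in> auto K" "b \<in> auto K"
    for a b and K :: "('x, 'y) monoid_scheme"
    using that by (simp add: AutoGroup_def BijGroup_def auto_def)
  have "?F (compose (carrier G) a b) = compose (carrier H) (?F a) (?F b)" if "a \<in> auto G" "b \<in> auto G" for a b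
    by (rule extensionalityI[of _ "carrier H"])
      (use fg gf fc autoG that in \<open>auto simp: compose_def\<close>)
  moreover have "compose (carrier G) a b \<in> auto G" if "a \<in> auto G" "b \<in> auto G" for a b
    using monoid.m_closed[OF group.is_monoid[OF group.AutoGroup[OF G]], of a b] that
    by (simp add: mult[OF that, symmetric]) (simp add: AutoGroup_def)
  ultimately have "?F \<in> hom (AutoGroup G) (AutoGroup H)"
    using FA by (intro homI) (simp_all add: AutoGroup_def BijGroup_def auto_def)
  then show ?thesis using bij by (simp add: iso_def AutoGroup_def)
qed

end

lemma iso_compose: "f \<in> iso G H \<Longrightarrow> g \<in> iso H K \<Longrightarrow> (\<lambda>x. g (f x)) \<in> iso G K"
  using iso_set_trans[of f G H g K] by (simp add: compose_def) (auto simp: iso_def hom_def bij_betw_def inj_on_def image_iff)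

section \<open>Counting automorphisms by images of generators\<close>

fun is_one :: "m9 \<times> bool \<Rightarrow> bool" where "is_one (A, e) \<longleftrightarrow> (if e then False else A = mid)"

lemma is_one_iff: "is_one x \<longleftrightarrow> x = (mid, False)" by (cases x) auto

definition order2 :: "m9 \<times> bool \<Rightarrow> bool" where "order2 x \<longleftrightarrow> (if is_one x then False else is_one (hm x x))"
definition order7 :: "m9 \<times> bool \<Rightarrow> bool" where
  "order7 x \<longleftrightarrow> (if is_one x then False else is_one (hm x (hm x (hm x (hm x (hm x (hm x x)))))))"
definition order6 :: "m9 \<times> bool \<Rightarrow> bool" where
  "order6 x \<longleftrightarrow> (if is_one (hm x x) then False else if is_one (hm x (hm x x)) then False
     else is_one (hm x (hm x (hm x (hm x (hm x x))))))"
definition order_check :: "lab \<Rightarrow> bool" where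
  "order_check l \<longleftrightarrow> order2 (rep l) = (l = L2A) \<and> order7 (rep l) = (if l = L7A then True else l = L7B) \<and>
     order6 (rep l) = (l = L6A)"

lemma orders_check: "list_all order_check inns" by code_simp

lemma orders_hom:
  assumes "\<And>x y. x \<in> Gam \<Longrightarrow> y \<in> Gam \<Longrightarrow> f (hm x y) = hm (f x) (f y)" "inj_on f Gam" "f (mid, False) = (mid, False)"
    and x: "x \<in> Gam"
  shows "order2 (f x) = order2 x" "order7 (f x) = order7 x" "order6 (f x) = order6 x"
proof -
  have one: "(mid, False) \<in> Gam" by (simp add: Gam_iff su_closed)
  have m: "hm a b \<in> Gam" if "a \<in> Gam" "b \<in> Gam" for a b using subgroup.m_closed[OF subgroup_Gam that] by simp
  have i: "is_one (f y) = is_one y" if "y \<in> Gam" for y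
    unfolding is_one_iff using assms(2,3) that one by (metis inj_onD)
  show "order2 (f x) = order2 x" "order7 (f x) = order7 x" "order6 (f x) = order6 x"
    unfolding order2_def order7_def order6_def using x by (simp_all only: assms(1)[symmetric] m i)
qed

lemma orders_orb:
  assumes "x \<in> Gam"
  shows "order2 x \<longleftrightarrow> x \<in> orb L2A" "order7 x \<longleftrightarrow> x \<in> orb L7A \<union> orb L7B" "order6 x \<longleftrightarrow> x \<in> orb L6A"
proof -
  obtain l where l: "x \<in> orb l" using assms Gam_HH orb_partition by blast
  have li: "l \<in> set inns" using snd_orb[OF l] assms inns_outs by (cases x) (auto simp: Gam_iff)
  obtain G where G: "su G" "x = hcj G (rep l)" using l by (auto simp: orb_def)
  have r: "rep l \<in> Gam" using rep_HH[of l] snd_rep[of l] li inns_outs by (cases "rep l") (auto simp: Gam_iff)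
  have inj: "inj_on (hcj G) Gam" by (rule inj_on_inverseI[of _ "hcj (mct G)"]) (simp add: hcj_inverse(1)[OF G(1)])
  have hom: "hcj G (hm a b) = hm (hcj G a) (hcj G b)" if "a \<in> Gam" "b \<in> Gam" for a b
    using hcj_hm[OF G(1)] that Gam_HH by blast
  have one: "hcj G (mid, False) = (mid, False)" using G(1) by (simp add: su_mct)
  have o: "order2 x = order2 (rep l)" "order7 x = order7 (rep l)" "order6 x = order6 (rep l)"
    using orders_hom[OF hom inj one r] G(2) by simp_all
  have c: "order_check l" using orders_check li by (simp add: list_all_iff)
  have u: "x \<in> orb k \<longleftrightarrow> k = l" for k using l orb_disjoint by blast
  show "order2 x \<longleftrightarrow> x \<in> orb L2A" "order7 x \<longleftrightarrow> x \<in> orb L7A \<union> orb L7B" "order6 x \<longleftrightarrow> x \<in> orb L6A"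
    unfolding o Un_iff u using c unfolding order_check_def by (auto split: if_splits)
qed

lemma sgab_orders: "order2 sga" "order7 sgb" "order6 (hm sga sgb)"
  by code_simp+

text \<open>The candidates for the image of (\<open>sga\<close>, \<open>sgb\<close>), as
  automorphisms preserve the orders of elements.\<close>

definition aut_pairs :: "((m9 \<times> bool) \<times> (m9 \<times> bool)) set" where
  "aut_pairs = {(x, y). x \<in> Gam \<and> y \<in> Gam \<and> order2 x \<and> order7 y \<and> order6 (hm x y)}"

lemma nti_values: "nti L2A L7A L6A = 12" "nti L2A L7B L6A = 12" by code_simp+

text \<open>The orders 2, 7 and 6 single out 2A, the union of 7A and 7B, and 6A. Each of the 504
  elements of 6A has 12 factorisations with second factor in 7A and 12 with second factor in 7B, and
  504 times 24 is 12096.\<close>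

lemma card_aut_pairs: "card aut_pairs = 12096" and finite_aut_pairs: "finite aut_pairs"
proof -
  let ?S = "\<lambda>k. {(x, y). x \<in> orb L2A \<and> y \<in> orb k \<and> hm x y \<in> orb L6A}"
  have i: "L2A \<in> set inns" "L7A \<in> set inns" "L7B \<in> set inns" "L6A \<in> set inns" by (simp_all add: inns_def)
  have sub: "orb l \<subseteq> Gam" if "l \<in> set inns" for l using conj_invariant_GG[OF that] by (simp add: conj_invariant_def)
  have m: "hm x y \<in> Gam" if "x \<in> Gam" "y \<in> Gam" for x y using subgroup.m_closed[OF subgroup_Gam that] by simp
  have au: "aut_pairs = ?S L7A \<union> ?S L7B"
  proof (intro subset_antisym subsetI)
    fix p assume "p \<in> aut_pairs"
    then obtain x y where p: "p = (x, y)" "x \<in> Gam" "y \<in> Gam" "order2 x" "order7 y" "order6 (hm x y)"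
      unfolding aut_pairs_def by blast
    then have "x \<in> orb L2A" "y \<in> orb L7A \<union> orb L7B" "hm x y \<in> orb L6A"
      using orders_orb m by blast+
    then show "p \<in> ?S L7A \<union> ?S L7B" using p(1) by blast
  next
    fix p assume "p \<in> ?S L7A \<union> ?S L7B"
    then obtain x y where p: "p = (x, y)" "x \<in> orb L2A" "y \<in> orb L7A \<union> orb L7B" "hm x y \<in> orb L6A" by blast
    then have "x \<in> Gam" "y \<in> Gam" using sub i by blast+
    then show "p \<in> aut_pairs" unfolding aut_pairs_def using p orders_orb m by blast
  qed
  have fin: "finite (?S k)" for k
    by (rule finite_subset[of _ "carrier HH \<times> carrier HH"]) (use orb_HH finite_HH in blast, use finite_HH in simp)
  have disj: "?S L7A \<inter> ?S L7B = {}" using orb_disjoint[of _ L7A L7B] by blast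
  have "card aut_pairs = card (?S L7A) + card (?S L7B)"
    unfolding au by (rule card_Un_disjoint[OF fin fin disj])
  also have "int \<dots> = 12096"
    using nti_eq[OF i(1,2,4)] nti_eq[OF i(1,3,4)] by (simp add: card_triples card_orb nti_values)
  finally show "card aut_pairs = 12096" by simp
  show "finite aut_pairs" unfolding au using fin by simp
qed

lemma auto_GG_D:
  assumes "f \<in> auto GG"
  shows "\<And>x y. x \<in> Gam \<Longrightarrow> y \<in> Gam \<Longrightarrow> f (hm x y) = hm (f x) (f y)" "\<And>x. x \<in> Gam \<Longrightarrow> f x \<in> Gam"
    "inj_on f Gam" "f (mid, False) = (mid, False)" "f \<in> extensional Gam"
proof -
  show "f (hm x y) = hm (f x) (f y)" if "x \<in> Gam" "y \<in> Gam" for x y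
    using assms that by (simp add: auto_def hom_def)
  show "f x \<in> Gam" if "x \<in> Gam" for x using assms that by (auto simp: auto_def hom_def)
  show "inj_on f Gam" "f \<in> extensional Gam" using assms by (auto simp: auto_def Bij_def bij_betw_def)
  have "group_hom GG GG f" using assms group_GG by (simp add: auto_def group_hom_def group_hom_axioms_def)
  then show "f (mid, False) = (mid, False)" using group_hom.hom_one by fastforce
qed

lemma card_auto_le: "finite (auto GG)" "card (auto GG) \<le> 12096"
proof -
  let ?F = "\<lambda>f. (f sga, f sgb)"
  have "?F ` auto GG \<subseteq> aut_pairs"
  proof
    fix p assume "p \<in> ?F ` auto GG"
    then obtain f where f: "f \<in> auto GG" "p = (f sga, f sgb)" by blast
    note d = auto_GG_D[OF f(1)]
    have m: "hm sga sgb \<in> Gam" using subgroup.m_closed[OF subgroup_Gam sgab] by simp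
    have "order2 (f sga)" "order7 (f sgb)" "order6 (f (hm sga sgb))"
      using orders_hom[OF d(1,3,4)] sgab m sgab_orders by blast+
    then show "p \<in> aut_pairs" unfolding aut_pairs_def f(2) using d(1)[OF sgab] d(2) sgab by simp
  qed
  moreover have "inj_on ?F (auto GG)"
  proof (rule inj_onI)
    fix f g assume f: "f \<in> auto GG" and g: "g \<in> auto GG" and e: "?F f = ?F g"
    note df = auto_GG_D[OF f] and dg = auto_GG_D[OF g]
    let ?S = "{x \<in> Gam. f x = g x}"
    have "subgroup ?S HH"
    proof (rule HH.subgroupI)
      show "?S \<subseteq> carrier HH" using Gam_HH by blast
      have "(mid, False) \<in> Gam" using subgroup.one_closed[OF subgroup_Gam] by simp
      then have "(mid, False) \<in> ?S" using df(4) dg(4) by simp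
      then show "?S \<noteq> {}" by blast
      show "a \<otimes>\<^bsub>HH\<^esub> b \<in> ?S" if "a \<in> ?S" "b \<in> ?S" for a b
        using that df(1) dg(1) subgroup.m_closed[OF subgroup_Gam, of a b] by simp
      show "inv\<^bsub>HH\<^esub> a \<in> ?S" if a: "a \<in> ?S" for a
      proof -
        have i: "inv\<^bsub>HH\<^esub> a \<in> Gam" using subgroup.m_inv_closed[OF subgroup_Gam] a by blast
        have "hm (inv\<^bsub>HH\<^esub> a) a = (mid, False)" using HH.l_inv[of a] a Gam_HH by auto
        then have "hm (f (inv\<^bsub>HH\<^esub> a)) (f a) = hm (g (inv\<^bsub>HH\<^esub> a)) (f a)"
          using df(1)[OF i, of a] dg(1)[OF i, of a] df(4) dg(4) a by auto
        then have "f (inv\<^bsub>HH\<^esub> a) = g (inv\<^bsub>HH\<^esub> a)"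
          using HH.right_cancel[of "f a" "f (inv\<^bsub>HH\<^esub> a)" "g (inv\<^bsub>HH\<^esub> a)"] df(2) dg(2) i a Gam_HH
          by (metis (no_types, lifting) HH_simps(1) mem_Collect_eq subsetD)
        then show ?thesis using i by simp
      qed
    qed
    moreover have "sga \<in> ?S" "sgb \<in> ?S" using e sgab by auto
    ultimately have "Gam \<subseteq> ?S" by (rule Gam_subset)
    then show "f = g" using df(5) dg(5) by (intro extensionalityI[of _ Gam]) auto
  qed
  ultimately show "finite (auto GG)" "card (auto GG) \<le> 12096"
    using finite_aut_pairs card_inj_on_le[of ?F "auto GG" aut_pairs] card_aut_pairs inj_on_finite by auto
qed

definition conj_aut :: "m9 \<times> bool \<Rightarrow> m9 \<times> bool \<Rightarrow> m9 \<times> bool" where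
  "conj_aut h = (\<lambda>x\<in>Gam. h \<otimes>\<^bsub>HH\<^esub> x \<otimes>\<^bsub>HH\<^esub> inv\<^bsub>HH\<^esub> h)"

text \<open>Injectivity holds because the simple group has trivial centraliser in the extension.
  Surjectivity follows by counting: the bound on the number of automorphisms equals the order of
  \<open>HH\<close>.\<close>

theorem conj_aut_iso: "conj_aut \<in> iso HH (AutoGroup GG)"
proof -
  have cl: "h \<otimes>\<^bsub>HH\<^esub> x \<otimes>\<^bsub>HH\<^esub> inv\<^bsub>HH\<^esub> h \<in> Gam" if "h \<in> carrier HH" "x \<in> Gam" for h x
  proof -
    have xc: "x \<in> carrier HH" using that Gam_HH by blast
    have c: "h \<otimes>\<^bsub>HH\<^esub> x \<otimes>\<^bsub>HH\<^esub> inv\<^bsub>HH\<^esub> h \<in> carrier HH"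
      using HH.m_closed[OF HH.m_closed[OF that(1) xc] HH.inv_closed[OF that(1)]] .
    obtain l where l: "x \<in> orb l" using xc orb_partition by blast
    have "l \<notin> set outs" using snd_orb[OF l] that(2) by (cases x) (auto simp: Gam_iff)
    then have "lsig l \<notin> set outs" by (cases l) (simp_all add: outs_def)
    then have "snd (h \<otimes>\<^bsub>HH\<^esub> x \<otimes>\<^bsub>HH\<^esub> inv\<^bsub>HH\<^esub> h) = False"
      using orb_HH_conj[OF that(1) l] snd_orb \<open>l \<notin> set outs\<close> by blast
    then show ?thesis using c by (cases "h \<otimes>\<^bsub>HH\<^esub> x \<otimes>\<^bsub>HH\<^esub> inv\<^bsub>HH\<^esub> h") (simp add: Gam_iff)
  qed
  have A: "conj_aut h \<in> auto GG" if h: "h \<in> carrier HH" for h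
  proof -
    have hi: "inv\<^bsub>HH\<^esub> h \<in> carrier HH" using HH.inv_closed[OF h] .
    have "conj_aut h \<in> hom GG GG"
    proof (rule homI)
      show "conj_aut h x \<in> carrier GG" if "x \<in> carrier GG" for x using cl[OF h] that by (simp add: conj_aut_def)
      show "conj_aut h (x \<otimes>\<^bsub>GG\<^esub> y) = conj_aut h x \<otimes>\<^bsub>GG\<^esub> conj_aut h y" if "x \<in> carrier GG" "y \<in> carrier GG" for x y
      proof -
        have "x \<in> carrier HH" "y \<in> carrier HH" using that Gam_HH unfolding GG_simps by blast+
        then show ?thesis
          using HH.conj_mult[OF h, of x y] that subgroup.m_closed[OF subgroup_Gam, of x y]
          by (simp add: conj_aut_def)
      qed
    qed
    moreover have "bij_betw (conj_aut h) Gam Gam"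
    proof (rule bij_betwI[where g = "\<lambda>x. inv\<^bsub>HH\<^esub> h \<otimes>\<^bsub>HH\<^esub> x \<otimes>\<^bsub>HH\<^esub> inv\<^bsub>HH\<^esub> (inv\<^bsub>HH\<^esub> h)"])
      show "conj_aut h \<in> Gam \<rightarrow> Gam" using cl[OF h] by (simp add: conj_aut_def)
      show "(\<lambda>x. inv\<^bsub>HH\<^esub> h \<otimes>\<^bsub>HH\<^esub> x \<otimes>\<^bsub>HH\<^esub> inv\<^bsub>HH\<^esub> (inv\<^bsub>HH\<^esub> h)) \<in> Gam \<rightarrow> Gam" using cl[OF hi] by blast
      fix x assume x: "x \<in> Gam"
      have xc: "x \<in> carrier HH" using x Gam_HH by blast
      show "inv\<^bsub>HH\<^esub> h \<otimes>\<^bsub>HH\<^esub> conj_aut h x \<otimes>\<^bsub>HH\<^esub> inv\<^bsub>HH\<^esub> (inv\<^bsub>HH\<^esub> h) = x"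
        using HH.conj_cancel[OF h xc] HH.inv_inv[OF h] x by (simp add: conj_aut_def)
      show "conj_aut h (inv\<^bsub>HH\<^esub> h \<otimes>\<^bsub>HH\<^esub> x \<otimes>\<^bsub>HH\<^esub> inv\<^bsub>HH\<^esub> (inv\<^bsub>HH\<^esub> h)) = x"
        using HH.conj_cancel[OF hi xc] cl[OF hi x] unfolding HH.inv_inv[OF h] by (simp add: conj_aut_def)
    qed
    ultimately show ?thesis by (simp add: auto_def Bij_def conj_aut_def)
  qed
  have hom: "conj_aut \<in> hom HH (AutoGroup GG)"
  proof (rule homI)
    show "conj_aut h \<in> carrier (AutoGroup GG)" if "h \<in> carrier HH" for h using A[OF that] by (simp add: AutoGroup_def)
    fix g h assume g: "g \<in> carrier HH" and h: "h \<in> carrier HH"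
    have "conj_aut (g \<otimes>\<^bsub>HH\<^esub> h) = compose Gam (conj_aut g) (conj_aut h)"
    proof (rule extensionalityI[of _ Gam])
      fix x assume x: "x \<in> Gam"
      then show "conj_aut (g \<otimes>\<^bsub>HH\<^esub> h) x = compose Gam (conj_aut g) (conj_aut h) x"
        using HH.conj_conj[OF g h, of x] cl[OF h x] Gam_HH by (auto simp: conj_aut_def compose_def)
    qed (simp_all add: conj_aut_def)
    then show "conj_aut (g \<otimes>\<^bsub>HH\<^esub> h) = conj_aut g \<otimes>\<^bsub>AutoGroup GG\<^esub> conj_aut h"
      using A[OF g] A[OF h] by (simp add: AutoGroup_def BijGroup_def auto_def)
  qed
  have inj: "inj_on conj_aut (carrier HH)"
  proof (rule inj_onI)
    fix g h assume g: "g \<in> carrier HH" and h: "h \<in> carrier HH" and e: "conj_aut g = conj_aut h"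
    have eq: "g \<otimes>\<^bsub>HH\<^esub> x \<otimes>\<^bsub>HH\<^esub> inv\<^bsub>HH\<^esub> g = h \<otimes>\<^bsub>HH\<^esub> x \<otimes>\<^bsub>HH\<^esub> inv\<^bsub>HH\<^esub> h" if "x \<in> Gam" for x
      using fun_cong[OF e, of x] that by (simp add: conj_aut_def)
    let ?z = "inv\<^bsub>HH\<^esub> h \<otimes>\<^bsub>HH\<^esub> g"
    have z: "?z \<in> carrier HH" using HH.m_closed[OF HH.inv_closed[OF h] g] .
    have "?z \<otimes>\<^bsub>HH\<^esub> x = x \<otimes>\<^bsub>HH\<^esub> ?z" if x: "x \<in> Gam" for x
    proof -
      have xc: "x \<in> carrier HH" using x Gam_HH by blast
      have "g \<otimes>\<^bsub>HH\<^esub> x = h \<otimes>\<^bsub>HH\<^esub> x \<otimes>\<^bsub>HH\<^esub> inv\<^bsub>HH\<^esub> h \<otimes>\<^bsub>HH\<^esub> g"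
        using eq[OF x] HH.inv_solve_right'[of "h \<otimes>\<^bsub>HH\<^esub> x \<otimes>\<^bsub>HH\<^esub> inv\<^bsub>HH\<^esub> h" "g \<otimes>\<^bsub>HH\<^esub> x" g]
          HH.m_closed HH.inv_closed g h xc by metis
      then have "inv\<^bsub>HH\<^esub> h \<otimes>\<^bsub>HH\<^esub> (g \<otimes>\<^bsub>HH\<^esub> x) = inv\<^bsub>HH\<^esub> h \<otimes>\<^bsub>HH\<^esub> (h \<otimes>\<^bsub>HH\<^esub> (x \<otimes>\<^bsub>HH\<^esub> (inv\<^bsub>HH\<^esub> h \<otimes>\<^bsub>HH\<^esub> g)))"
        using HH.m_assoc HH.m_closed HH.inv_closed g h xc by metis
      then show ?thesis
        using HH.inv_mult_cancel[OF h HH.m_closed[OF xc z]] HH.m_assoc[OF HH.inv_closed[OF h] g xc] by simp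
    qed
    then have "?z = \<one>\<^bsub>HH\<^esub>" using centralizer_Gam[OF z] by simp
    then show "g = h" using HH.inv_equality[of "inv\<^bsub>HH\<^esub> h" g] HH.inv_inv[OF h] g HH.inv_closed[OF h]
      by (metis HH.inv_equality HH.inv_inv)
  qed
  have "conj_aut ` carrier HH \<subseteq> auto GG" using A by blast
  moreover have "card (conj_aut ` carrier HH) = 12096" using card_image[OF inj] card_HH by simp
  ultimately have "conj_aut ` carrier HH = auto GG" using card_auto_le by (simp add: card_seteq)
  then show ?thesis using hom inj by (simp add: iso_def bij_betw_def AutoGroup_def)
qed

section \<open>Transfer to an arbitrary field with 9 elements\<close>

fun phi :: "'k::field \<Rightarrow> f9 \<Rightarrow> 'k" where
  "phi i F00 = 0" | "phi i F01 = i" | "phi i F02 = - i" | "phi i F10 = 1" | "phi i F11 = 1 + i" |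
  "phi i F12 = 1 - i" | "phi i F20 = - 1" | "phi i F21 = i - 1" | "phi i F22 = - 1 - i"

fun vphi :: "'k::field \<Rightarrow> v9 \<Rightarrow> 'k ^ 3" where
  "vphi i (V x y z) = vector [phi i x, phi i y, phi i z]"

fun mphi :: "'k::field \<Rightarrow> m9 \<Rightarrow> 'k ^ 3 ^ 3" where
  "mphi i (M a11 a12 a13 a21 a22 a23 a31 a32 a33) =
     vector [vector [phi i a11, phi i a12, phi i a13], vector [phi i a21, phi i a22, phi i a23],
       vector [phi i a31, phi i a32, phi i a33]]"

definition theta :: "'k::field \<Rightarrow> m9 \<times> bool \<Rightarrow> 'k ^ 3 ^ 3" where "theta i x = mphi i (fst x)"

definition line :: "'k::field \<Rightarrow> v9 \<Rightarrow> ('k ^ 3) set" where "line i v = vec.span {vphi i v}"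

lemma orbit_eq_cycle:
  assumes p: "\<forall>j<length cs. p (f (cs ! j)) = f (cs ! (Suc j mod length cs))" and i: "i < length cs"
  shows "orbit p (f (cs ! i)) = f ` set cs"
proof -
  let ?n = "length cs"
  have n: "?n > 0" using i by linarith
  have it: "(p ^^ k) (f (cs ! i)) = f (cs ! ((i + k) mod ?n))" for k
    by (induction k) (use p n i in \<open>simp_all add: mod_Suc_eq\<close>)
  show ?thesis
  proof (intro subset_antisym subsetI)
    show "y \<in> f ` set cs" if "y \<in> orbit p (f (cs ! i))" for y
      using that n unfolding orbit_altdef it by auto
    fix y assume "y \<in> f ` set cs"
    then obtain j where j: "j < ?n" "y = f (cs ! j)" by (auto simp: in_set_conv_nth)
    \<comment> \<open>Adding the length of the cycle keeps the exponent positive, since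
      \<open>orbit\<close> consists of images under at least one application.\<close>
    have "(p ^^ (j + ?n - i)) (f (cs ! i)) = y" unfolding it j(2) using i j(1) by simp
    moreover have "0 < j + ?n - i" using i by simp
    ultimately show "y \<in> orbit p (f (cs ! i))" unfolding orbit_altdef by blast
  qed
qed

lemma image_Collect_conj: "{y \<in> f ` S. P y} = f ` {x \<in> S. P (f x)}" by blast

lemma orb_Gam: "l \<in> set inns \<Longrightarrow> orb l \<subseteq> Gam"
  using conj_invariant_GG by (simp add: conj_invariant_def)

lemma rep_Gam: "l \<in> set inns \<Longrightarrow> rep l \<in> Gam" using orb_Gam rep_in_orb by blast

lemma phi_0: "phi i 0 = 0" and phi_1: "phi i 1 = 1" by (simp_all add: zero_f9_def one_f9_def)

lemma vphi_0: "vphi i (V 0 0 0) = 0" by (simp add: vec_eq_iff forall_3 phi_0)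

context
  fixes ii :: "'k::field"
  assumes card9: "CARD('k) = 9" and ii: "ii ^ 2 = -1"
begin

text \<open>Translation by 1 permutes the field, so the sum of all elements is unchanged when 1 is
  added to each of the nine. Hence 9 = 3 times 3 vanishes.\<close>

lemma char3: "(3 :: 'k) = 0"
proof -
  have fin: "finite (UNIV :: 'k set)" using card9 by (intro card_ge_0_finite) simp
  have "bij (\<lambda>x::'k. x + 1)" by (rule bij_betw_byWitness[of _ "\<lambda>x. x - 1"]) auto
  then have "(\<Sum>x\<in>UNIV. x + 1) = (\<Sum>x\<in>UNIV. x :: 'k)"
    using sum.reindex_bij_betw[of "\<lambda>x::'k. x + 1" UNIV UNIV "\<lambda>x. x"] by simp
  then have "(of_nat 9 :: 'k) = 0" unfolding sum.distrib using card9 by simp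
  then have "(3 :: 'k) * 3 = 0" by simp
  then show ?thesis unfolding mult_eq_0_iff by blast
qed

lemma phi_add: "phi ii (x + y) = phi ii x + phi ii y"
  using char3 ii by (cases x; cases y; simp; algebra)

lemma phi_mult: "phi ii (x * y) = phi ii x * phi ii y"
proof -
  have d: "a + a = - a" "a + (a + b) = b - a" for a b :: 'k
  proof -
    have "a + a + a = 3 * a" by simp
    then have "a + a + a = 0" using char3 by simp
    then show "a + a = - a" "a + (a + b) = b - a" by (simp_all add: eq_neg_iff_add_eq_0 algebra_simps)
  qed
  have "ii * ii = - 1" using ii by (simp add: power2_eq_square)
  then show ?thesis by (cases x; cases y; simp only: times_f9.simps phi.simps; simp add: algebra_simps d char3)
qed

lemma phi_uminus: "phi ii (- x) = - phi ii x"
  by (cases x) simp_all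

lemma phi_diff: "phi ii (x - y) = phi ii x - phi ii y"
  by (simp only: diff_conv_add_uminus phi_add phi_uminus)

lemma phi_cnj9: "phi ii (cnj9 x) = phi ii x ^ 3"
  unfolding cnj9_power3 power3_eq_cube phi_mult ..

lemma phi_eq_0: "phi ii x = 0 \<longleftrightarrow> x = 0"
proof
  assume "phi ii x = 0"
  then have "phi ii (x * inverse x) = 0" by (simp add: phi_mult)
  then show "x = 0" by (cases "x = 0") (simp_all add: phi_1)
qed (simp add: phi_0)

lemma phi_eq: "phi ii x = phi ii y \<longleftrightarrow> x = y"
  using phi_eq_0[of "x - y"] by (simp add: phi_diff)

lemma phi_surj: "\<exists>x. phi ii x = a"
proof -
  have fin: "finite (UNIV :: 'k set)" using card9 by (intro card_ge_0_finite) simp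
  have "UNIV = set f9s" by auto
  moreover have "distinct f9s" by (simp add: f9s_def)
  ultimately have "card (UNIV :: f9 set) = 9" using distinct_card[of f9s] by (simp add: f9s_def)
  moreover have "inj (phi ii)" by (rule injI) (simp add: phi_eq)
  ultimately have "card (range (phi ii)) = 9" by (simp add: card_image)
  then have "range (phi ii) = UNIV" using card_subset_eq[OF fin, of "range (phi ii)"] card9 by simp
  then show ?thesis by (metis UNIV_I image_iff)
qed

lemma vphi_surj: "\<exists>v. vphi ii v = w"
proof -
  obtain x y z where "phi ii x = w $ 1" "phi ii y = w $ 2" "phi ii z = w $ 3" using phi_surj by metis
  then have "vphi ii (V x y z) = w" by (simp add: vec_eq_iff forall_3)
  then show ?thesis ..
qed

lemma mphi_surj: "\<exists>A. mphi ii A = B"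
proof -
  have "\<forall>r s. \<exists>x. phi ii x = B $ r $ s" using phi_surj by blast
  then obtain a where "\<forall>r s. phi ii (a r s) = B $ r $ s" by metis
  then have "mphi ii (M (a 1 1) (a 1 2) (a 1 3) (a 2 1) (a 2 2) (a 2 3) (a 3 1) (a 3 2) (a 3 3)) = B"
    by (simp add: vec_eq_iff forall_3)
  then show ?thesis ..
qed

lemma vphi_eq: "vphi ii v = vphi ii w \<longleftrightarrow> v = w"
  by (cases v; cases w) (simp add: vec_eq_iff forall_3 phi_eq)

lemma mphi_eq: "mphi ii A = mphi ii B \<longleftrightarrow> A = B"
  by (cases A; cases B) (auto simp add: vec_eq_iff forall_3 phi_eq)

lemma mphi_mm: "mphi ii (mm A B) = mphi ii A ** mphi ii B"
  by (cases A; cases B) (simp add: vec_eq_iff forall_3 matrix_matrix_mult_def sum_3 phi_add phi_mult)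

lemma mphi_mid: "mphi ii mid = mat 1"
  by (simp add: mid_eq vec_eq_iff forall_3 mat_def phi_0 phi_1)

lemma mphi_mv: "mphi ii A *v vphi ii v = vphi ii (mv A v)"
  by (cases A; cases v) (simp add: vec_eq_iff forall_3 matrix_vector_mult_def sum_3 phi_add phi_mult)

lemma det_mphi: "det (mphi ii A) = phi ii (mdet A)"
  by (cases A) (simp add: det_3 phi_add phi_diff phi_mult algebra_simps)

lemma hermitian_vphi: "hermitian_form (vphi ii v) (vphi ii w) = phi ii (hf v w)"
  by (cases v; cases w) (simp add: hermitian_form_def sum_3 phi_add phi_mult phi_cnj9)

lemma vphi_sv: "vphi ii (sv c v) = phi ii c *s vphi ii v"
  by (cases v) (simp add: vec_eq_iff forall_3 phi_mult)

lemma vphi_nonzero: "v \<noteq> V 0 0 0 \<Longrightarrow> vphi ii v \<noteq> 0"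
  using vphi_eq[of v "V 0 0 0"] unfolding vphi_0 by blast

lemma mphi_outer: "outer_involution (mphi ii A) = mphi ii (mcj A)"
  by (cases A) (simp add: outer_involution_def vec_eq_iff forall_3 phi_cnj9)

text \<open>If the form is preserved, then h(v, B w) = h(v, w) for the matrix B = A^H A, and
  inserting basis vectors forces B to be the identity.\<close>

lemma carrier_SU3_iff: "mphi ii A \<in> carrier SU3 \<longleftrightarrow> su A"
proof
  assume "mphi ii A \<in> carrier SU3"
  then have d: "mdet A = 1" and h: "hermitian_form (mphi ii A *v v) (mphi ii A *v w) = hermitian_form v w" for v w
    using phi_eq[of "mdet A" 1] by (auto simp: SU3_def det_mphi phi_1)
  have "hf (mv A v) (mv A w) = hf v w" for v w
    using h[of "vphi ii v" "vphi ii w"] by (simp add: mphi_mv hermitian_vphi phi_eq)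
  then have "hf v (mv (mm (mct A) A) w) = hf v w" for v w by (simp add: mv_mm hf_mct)
  then have "mm (mct A) A = mid" (is "?B = _")
  proof -
    assume B: "\<And>v w. hf v (mv ?B w) = hf v w"
    obtain b11 b12 b13 b21 b22 b23 b31 b32 b33 where e: "?B = M b11 b12 b13 b21 b22 b23 b31 b32 b33" by (cases ?B)
    have "cnj9 x = 1 \<longleftrightarrow> x = 1" for x using cnj9_inj[of x 1] by simp
    then show ?thesis
      using B[of "V 1 0 0" "V 1 0 0"] B[of "V 1 0 0" "V 0 1 0"] B[of "V 1 0 0" "V 0 0 1"]
        B[of "V 0 1 0" "V 1 0 0"] B[of "V 0 1 0" "V 0 1 0"] B[of "V 0 1 0" "V 0 0 1"]
        B[of "V 0 0 1" "V 1 0 0"] B[of "V 0 0 1" "V 0 1 0"] B[of "V 0 0 1" "V 0 0 1"]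
      unfolding e mid_eq by simp
  qed
  then have "su (mct A)" using d by (simp add: su_iff_mct mdet_mct)
  then show "su A" using su_closed(2)[of "mct A"] by simp
next
  assume A: "su A"
  then have d: "det (mphi ii A) = 1" by (simp add: det_mphi su_def phi_1)
  have "hermitian_form (mphi ii A *v x) (mphi ii A *v y) = hermitian_form x y" for x y
  proof -
    obtain v w where vw: "x = vphi ii v" "y = vphi ii w" using vphi_surj by metis
    have "hf (mv A v) (mv A w) = hf v w" by (simp add: hf_mct mv_cancel[OF A])
    then show ?thesis by (simp add: vw mphi_mv hermitian_vphi)
  qed
  then show "mphi ii A \<in> carrier SU3" using d by (simp add: SU3_def)
qed

lemma carrier_SU3: "carrier SU3 = theta ii ` Gam"
proof (intro subset_antisym subsetI)
  fix B :: "'k ^ 3 ^ 3" assume B: "B \<in> carrier SU3"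
  obtain A where "B = mphi ii A" using mphi_surj by metis
  then show "B \<in> theta ii ` Gam" using B carrier_SU3_iff[of A] by (auto simp: theta_def Gam_def image_iff)
next
  fix B assume "B \<in> theta ii ` Gam"
  then obtain A where A: "su A" "B = mphi ii A" by (auto simp: theta_def Gam_def)
  show "B \<in> carrier SU3" unfolding A(2) carrier_SU3_iff by (rule A(1))
qed

lemma SU3_simps: "mult SU3 = (**)" "one SU3 = mat 1" by (simp_all add: SU3_def)

lemma theta_hm: "x \<in> Gam \<Longrightarrow> y \<in> Gam \<Longrightarrow> theta ii (hm x y) = theta ii x ** theta ii y"
  by (auto simp: theta_def Gam_def mphi_mm)

lemma theta_inj: "inj_on (theta ii) Gam"
  by (rule inj_onI) (auto simp: theta_def Gam_def mphi_eq)

lemma theta_one: "theta ii (mid, False) = mat 1" by (simp add: theta_def mphi_mid)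

lemma group_SU3: "group (SU3 :: ('k ^ 3 ^ 3) monoid)"
proof (rule groupI)
  have one: "(mid, False) \<in> Gam" by (simp add: Gam_iff su_closed)
  then show "\<one>\<^bsub>SU3\<^esub> \<in> carrier (SU3 :: ('k ^ 3 ^ 3) monoid)"
    unfolding SU3_simps carrier_SU3 theta_one[symmetric] by blast
  fix x :: "'k ^ 3 ^ 3" assume "x \<in> carrier SU3"
  then obtain A where A: "su A" "x = mphi ii A" unfolding carrier_SU3 by (auto simp: theta_def Gam_def)
  have "mphi ii (mct A) \<otimes>\<^bsub>SU3\<^esub> x = \<one>\<^bsub>SU3\<^esub>"
    unfolding SU3_simps A(2) mphi_mm[symmetric] by (simp add: su_mct[OF A(1)] mphi_mid)
  moreover have "mphi ii (mct A) \<in> carrier SU3" using carrier_SU3_iff su_closed(2)[OF A(1)] by simp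
  ultimately show "\<exists>y\<in>carrier SU3. y \<otimes>\<^bsub>SU3\<^esub> x = \<one>\<^bsub>SU3\<^esub>" by blast
next
  fix x y :: "'k ^ 3 ^ 3" assume "x \<in> carrier SU3" "y \<in> carrier SU3"
  then obtain A B where "su A" "x = mphi ii A" "su B" "y = mphi ii B"
    unfolding carrier_SU3 by (auto simp: theta_def Gam_def)
  then show "x \<otimes>\<^bsub>SU3\<^esub> y \<in> carrier SU3"
    using carrier_SU3_iff[of "mm A B"] by (simp add: SU3_simps mphi_mm su_closed)
qed (simp_all add: SU3_simps matrix_mul_assoc)

lemma theta_iso: "theta ii \<in> iso GG SU3"
  using theta_inj theta_hm carrier_SU3 by (auto simp: iso_def hom_def bij_betw_def SU3_simps)

lemma theta_class: "l \<in> set inns \<Longrightarrow> conjugacy_class SU3 (theta ii (rep l)) = theta ii ` orb l"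
  using iso_conjugacy_class[OF group_GG group_SU3 theta_iso, of "rep l"] rep_Gam class_GG[OF rep_in_orb] by simp

lemma class_4: "class_4A ii = theta ii ` orb L4A" "class_4B ii = theta ii ` orb L4B"
proof -
  have "theta ii (rep L4A) = diag3 ii ii (-1)" "theta ii (rep L4B) = diag3 (- ii) (- ii) (-1)"
    by (simp_all add: theta_def diag3_def)
  then show "class_4A ii = theta ii ` orb L4A" "class_4B ii = theta ii ` orb L4B"
    using theta_class[of L4A] theta_class[of L4B]
    by (simp_all add: class_4A_def class_4B_def inns_def del: rep.simps)
qed

lemma class_2: "class_2A = theta ii ` orb L2A"
proof -
  have m: "hm x x \<in> Gam" if "x \<in> Gam" for x using subgroup.m_closed[OF subgroup_Gam that that] by simp
  have one: "(mid, False) \<in> Gam" by (simp add: Gam_iff su_closed)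
  have "order2 x \<longleftrightarrow> theta ii x \<noteq> mat 1 \<and> theta ii x ** theta ii x = mat 1" if x: "x \<in> Gam" for x
    unfolding order2_def is_one_iff theta_one[symmetric] theta_hm[OF x x, symmetric]
    using inj_on_eq_iff[OF theta_inj m[OF x] one] inj_on_eq_iff[OF theta_inj x one] by simp
  then have "{x \<in> Gam. order2 x} = {x \<in> Gam. theta ii x \<noteq> mat 1 \<and> theta ii x ** theta ii x = mat 1}"
    by (rule Collect_cong[OF conj_cong[OF refl]])
  moreover have "class_2A = theta ii ` {x \<in> Gam. theta ii x \<noteq> mat 1 \<and> theta ii x ** theta ii x = mat 1}"
    unfolding class_2A_def carrier_SU3 by (rule image_Collect_conj)
  ultimately have "class_2A = theta ii ` {x \<in> Gam. order2 x}" by simp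
  also have "{x \<in> Gam. order2 x} = orb L2A" using orders_orb(1) orb_Gam[of L2A] by (auto simp: inns_def)
  finally show ?thesis .
qed

text \<open>The matrix 1 + u w^T has trace 3 = 0 and satisfies (A - 1)^2 = 0 because w annihilates
  u. In characteristic 3 this reads A^2 = -(A + 1), the relation by which \<open>ilab\<close>
  recognises 3A.\<close>

lemma transvection_label:
  assumes A: "A = M (1 + u1 * w1) (u1 * w2) (u1 * w3) (u2 * w1) (1 + u2 * w2) (u2 * w3)
      (u3 * w1) (u3 * w2) (1 + u3 * w3)"
    and su: "su A" and s: "w1 * u1 + w2 * u2 + w3 * u3 = 0" and ne: "A \<noteq> mid"
  shows "(A, False) \<in> orb L3A"
proof -
  have three: "(3 :: f9) = 0"
  proof -
    have "(3 :: f9) = 1 + 1 + 1" by simp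
    also have "\<dots> = 0" unfolding zero_f9_def one_f9_def by simp
    finally show ?thesis .
  qed
  have "mtr A = 3 + (w1 * u1 + w2 * u2 + w3 * u3)" unfolding A by (simp add: algebra_simps)
  then have "mtr A = 0" using s three by simp
  moreover have "mm A A = mneg (madd A mid)"
  proof -
    \<comment> \<open>Entrywise the difference of the two sides is 3 times A plus (w u) times u w^T;
      \<open>a\<close> and \<open>b\<close> stand for the corresponding entries of A and of u
      w^T.\<close>
    have k: "x = y" if "x - y = 3 * a + b * (w1 * u1 + w2 * u2 + w3 * u3)" for x y a b
      using that s three by simp
    show ?thesis unfolding A mid_eq mm.simps madd.simps mneg.simps m9.inject
      by (intro conjI; (rule k[of _ _ "1 + u1 * w1" "u1 * w1"] k[of _ _ "1 + u2 * w2" "u2 * w2"]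
        k[of _ _ "1 + u3 * w3" "u3 * w3"] k[of _ _ "u1 * w2" "u1 * w2"] k[of _ _ "u1 * w3" "u1 * w3"]
        k[of _ _ "u2 * w1" "u2 * w1"] k[of _ _ "u2 * w3" "u2 * w3"] k[of _ _ "u3 * w1" "u3 * w1"]
        k[of _ _ "u3 * w2" "u3 * w2"], algebra))
  qed
  ultimately have "label (A, False) = L3A" using ne by (simp add: ilab_def zero_f9_def)
  then show ?thesis using in_orb_iff[of "(A, False)" L3A L3A] su by (simp del: label.simps)
qed

lemma transv_mv: "mv (madd mid (op1 c v)) w = vadd3 w (sv (c * hf w v) v)"
  by (cases v; cases w; simp add: mid_eq algebra_simps)

lemma class_3: "class_3A = theta ii ` orb L3A"
proof (intro subset_antisym subsetI)
  fix B :: "'k ^ 3 ^ 3" assume B: "B \<in> class_3A"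
  obtain A where A: "su A" "B = mphi ii A" using B unfolding class_3A_def carrier_SU3 by (auto simp: theta_def Gam_def)
  obtain u w where t: "u \<noteq> 0" "w \<noteq> 0" "(\<Sum>j\<in>UNIV. w $ j * u $ j) = 0"
      "\<And>v. B *v v = v + (\<Sum>j\<in>UNIV. w $ j * v $ j) *s u"
    using B unfolding class_3A_def transvection_def by blast
  obtain u' where u': "vphi ii u' = u" using vphi_surj by blast
  obtain w' where w': "vphi ii w' = w" using vphi_surj by blast
  obtain u1 u2 u3 where u: "u' = V u1 u2 u3" by (cases u')
  obtain w1 w2 w3 where w: "w' = V w1 w2 w3" by (cases w')
  let ?A = "M (1 + u1 * w1) (u1 * w2) (u1 * w3) (u2 * w1) (1 + u2 * w2) (u2 * w3) (u3 * w1) (u3 * w2) (1 + u3 * w3)"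
  have "B *v v = mphi ii ?A *v v" for v
    unfolding t(4) u'[symmetric] w'[symmetric] u w
    by (simp add: vec_eq_iff forall_3 matrix_vector_mult_def sum_3 phi_add phi_mult phi_1 algebra_simps)
  then have "B = mphi ii ?A" by (simp add: matrix_eq)
  then have Ae: "A = ?A" using A(2) by (simp only: mphi_eq)
  have "phi ii (w1 * u1 + w2 * u2 + w3 * u3) = 0"
    using t(3) unfolding u'[symmetric] w'[symmetric] u w by (simp add: sum_3 phi_add phi_mult)
  then have s: "w1 * u1 + w2 * u2 + w3 * u3 = 0" by (simp only: phi_eq_0)
  have "u' \<noteq> V 0 0 0" "w' \<noteq> V 0 0 0" using t(1,2) unfolding u'[symmetric] w'[symmetric] using vphi_0 by metis+
  then have "?A \<noteq> mid" unfolding u w mid_eq by auto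
  then have "(A, False) \<in> orb L3A" using transvection_label[OF Ae A(1) s] Ae by simp
  then show "B \<in> theta ii ` orb L3A" unfolding A(2) by (force simp: theta_def)
next
  fix B assume "B \<in> theta ii ` orb L3A"
  then obtain x where x: "x \<in> orb L3A" "B = theta ii x" by blast
  have xG: "x \<in> Gam" using x(1) orb_Gam[of L3A] by (auto simp: inns_def)
  obtain c v where cv: "x = (madd mid (op1 c v), False)" "c \<noteq> 0" "v \<in> set isos"
    using x(1) unfolding transvs_orb[symmetric] transvs_def
    by (auto simp: transv_def zero_f9_def simp del: madd.simps op1.simps)
  have i: "\<forall>v\<in>set isos. hf v v = 0 \<and> v \<noteq> V 0 0 0" by (simp add: isos_def zero_f9_def)
  obtain x1 x2 x3 where v: "v = V x1 x2 x3" by (cases v)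
  let ?w = "vphi ii (V (c * cnj9 x1) (c * cnj9 x2) (c * cnj9 x3))"
  have vn: "v \<noteq> V 0 0 0" using i cv(3) by blast
  then have "vphi ii v \<noteq> 0" by (rule vphi_nonzero)
  moreover have "V (c * cnj9 x1) (c * cnj9 x2) (c * cnj9 x3) \<noteq> V 0 0 0" using vn cv(2) unfolding v by simp
  then have "?w \<noteq> 0" by (rule vphi_nonzero)
  moreover have "(\<Sum>j\<in>UNIV. ?w $ j * vphi ii v $ j) = phi ii (c * hf v v)"
    unfolding v by (simp add: sum_3 phi_add phi_mult algebra_simps)
  then have "(\<Sum>j\<in>UNIV. ?w $ j * vphi ii v $ j) = 0" using i cv(3) phi_0 by simp
  moreover have "B *v y = y + (\<Sum>j\<in>UNIV. ?w $ j * y $ j) *s vphi ii v" for y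
  proof -
    obtain y' where y: "y = vphi ii y'" using vphi_surj by metis
    have "B *v y = vphi ii (vadd3 y' (sv (c * hf y' v) v))"
      unfolding x(2) cv(1) y theta_def fst_conv mphi_mv transv_mv ..
    also have "\<dots> = y + (\<Sum>j\<in>UNIV. ?w $ j * y $ j) *s vphi ii v"
      unfolding y v by (cases y') (simp add: vec_eq_iff forall_3 sum_3 phi_add phi_mult algebra_simps)
    finally show ?thesis .
  qed
  ultimately have "transvection B" unfolding transvection_def by blast
  then show "B \<in> class_3A" using xG x(2) unfolding class_3A_def carrier_SU3 by blast
qed

lemma outer_orb: "l \<in> set inns \<Longrightarrow> outer_involution ` theta ii ` orb l = theta ii ` orb (lsig l)"
proof -
  have o: "outer_involution (theta ii x) = theta ii (hm (hm frob x) frob)" for x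
    unfolding theta_def mphi_outer frob_conj by simp
  have sub: "outer_involution ` theta ii ` orb l \<subseteq> theta ii ` orb (lsig l)" for l
    using o orb_frob by blast
  have "x \<in> outer_involution ` theta ii ` orb l" if x: "x \<in> theta ii ` orb (lsig l)" for x
  proof -
    obtain y where y: "y \<in> orb (lsig l)" "x = theta ii y" using x by blast
    have "hm (hm frob (hm (hm frob y) frob)) frob = y" unfolding frob_conj by simp
    moreover have "hm (hm frob y) frob \<in> orb l" using orb_frob[OF y(1)] by simp
    ultimately show ?thesis using y(2) o by (metis imageI)
  qed
  then show ?thesis using sub by blast
qed

lemma line_eq_range: "line ii v = range (\<lambda>c. vphi ii (sv c v))"
proof -
  have "line ii v = range (\<lambda>k. k *s vphi ii v)" unfolding line_def by (rule vec.span_singleton)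
  also have "\<dots> = range (\<lambda>c. phi ii c *s vphi ii v)"
  proof (intro subset_antisym subsetI)
    fix y assume "y \<in> range (\<lambda>k. k *s vphi ii v)"
    then obtain k where k: "y = k *s vphi ii v" by blast
    obtain c where "phi ii c = k" using phi_surj by blast
    then show "y \<in> range (\<lambda>c. phi ii c *s vphi ii v)" unfolding k by blast
  qed blast
  finally show ?thesis by (simp add: vphi_sv)
qed

lemma point_action_line: "point_action (mphi ii A) (line ii v) = line ii (mv A v)"
  unfolding point_action_def line_eq_range image_image mphi_mv mv_linear ..

lemma line_sv: "c \<noteq> 0 \<Longrightarrow> line ii (sv c v) = line ii v"
proof -
  assume c: "c \<noteq> 0"
  have "vphi ii (sv a v) \<in> range (\<lambda>a. vphi ii (sv (a * c) v))" for a
    by (rule range_eqI[of _ _ "a * inverse c"]) (simp add: c mult.assoc)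
  then show ?thesis unfolding line_eq_range sv_sv by blast
qed

lemma line_eqD: "line ii v = line ii w \<Longrightarrow> \<exists>c. v = sv c w"
proof -
  assume e: "line ii v = line ii w"
  have "vphi ii v \<in> line ii v" unfolding line_def by (rule vec.span_base) simp
  then have "vphi ii v \<in> line ii w" by (simp only: e)
  then show ?thesis unfolding line_eq_range by (auto simp: vphi_eq)
qed

end

section \<open>Cycle types and genus\<close>

text \<open>The cycles of the representatives on the 28 isotropic points: 16 for 2A (type 2^12 1^4),
  10 for 3A (type 3^9 1) and 10 each for 4A and 4B (type 4^6 1^4).\<close>

fun cycs :: "lab \<Rightarrow> v9 list list" where
  "cycs L2A = [[V F00 F10 F12, V F00 F10 F21], [V F00 F10 F22, V F00 F10 F11], [V F10 F00 F12, V F10 F00 F21], [V F10 F00 F22, V F10 F00 F11], [V F10 F10 F10, V F10 F10 F20], [V F10 F10 F02, V F10 F10 F01], [V F10 F20 F10, V F10 F20 F20], [V F10 F20 F02, V F10 F20 F01], [V F10 F02 F10, V F10 F02 F20], [V F10 F02 F02, V F10 F02 F01], [V F10 F12 F00], [V F10 F22 F00], [V F10 F01 F10, V F10 F01 F20], [V F10 F01 F02, V F10 F01 F01], [V F10 F11 F00], [V F10 F21 F00]]" |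
  "cycs L3A = [[V F00 F10 F12, V F00 F10 F21, V F00 F10 F22], [V F00 F10 F11], [V F10 F00 F12, V F10 F20 F01, V F10 F10 F20], [V F10 F00 F22, V F10 F01 F10, V F10 F02 F01], [V F10 F00 F11, V F10 F02 F20, V F10 F01 F02], [V F10 F00 F21, V F10 F10 F02, V F10 F20 F10], [V F10 F10 F10, V F10 F22 F00, V F10 F01 F20], [V F10 F10 F01, V F10 F02 F02, V F10 F21 F00], [V F10 F20 F20, V F10 F11 F00, V F10 F02 F10], [V F10 F20 F02, V F10 F01 F01, V F10 F12 F00]]" |
  "cycs L4A = [[V F00 F10 F12, V F00 F10 F11, V F00 F10 F21, V F00 F10 F22], [V F10 F00 F12, V F10 F00 F11, V F10 F00 F21, V F10 F00 F22], [V F10 F10 F10, V F10 F10 F01, V F10 F10 F20, V F10 F10 F02], [V F10 F20 F10, V F10 F20 F01, V F10 F20 F20, V F10 F20 F02], [V F10 F02 F10, V F10 F02 F01, V F10 F02 F20, V F10 F02 F02], [V F10 F12 F00], [V F10 F22 F00], [V F10 F01 F10, V F10 F01 F01, V F10 F01 F20, V F10 F01 F02], [V F10 F11 F00], [V F10 F21 F00]]" |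
  "cycs L4B = [[V F00 F10 F12, V F00 F10 F22, V F00 F10 F21, V F00 F10 F11], [V F10 F00 F12, V F10 F00 F22, V F10 F00 F21, V F10 F00 F11], [V F10 F10 F10, V F10 F10 F02, V F10 F10 F20, V F10 F10 F01], [V F10 F20 F10, V F10 F20 F02, V F10 F20 F20, V F10 F20 F01], [V F10 F02 F10, V F10 F02 F02, V F10 F02 F20, V F10 F02 F01], [V F10 F12 F00], [V F10 F22 F00], [V F10 F01 F10, V F10 F01 F02, V F10 F01 F20, V F10 F01 F01], [V F10 F11 F00], [V F10 F21 F00]]" |
  "cycs _ = []"

definition iso_cov :: "v9 \<Rightarrow> bool" where
  "iso_cov v \<longleftrightarrow> (if hf v v = F00 then if v = V F00 F00 F00 then True else list_ex (onl v) isos else True)"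
definition eq_if_onl :: "v9 \<Rightarrow> v9 \<Rightarrow> bool" where "eq_if_onl v w \<longleftrightarrow> (if onl v w then v = w else True)"
definition iso_normal :: "v9 \<Rightarrow> bool" where "iso_normal v \<longleftrightarrow> list_all (eq_if_onl v) isos"
definition maps_onl :: "m9 \<Rightarrow> v9 \<Rightarrow> v9 \<Rightarrow> bool" where "maps_onl A v w \<longleftrightarrow> onl (mv A v) w"
definition is_cycle :: "m9 \<Rightarrow> v9 list \<Rightarrow> bool" where "is_cycle A cs \<longleftrightarrow> list_all2 (maps_onl A) cs (rotate1 cs)"
definition cycs_ok :: "lab \<Rightarrow> bool" where
  "cycs_ok l \<longleftrightarrow> list_all (is_cycle (fst (rep l))) (cycs l)"

lemma iso_checks: "list_all iso_cov vecs" "list_all iso_normal isos" by code_simp+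
lemma cycs_checks: "list_all cycs_ok [L2A, L3A, L4A, L4B]" by code_simp
lemma distinct_isos: "distinct isos" by code_simp

lemma cycs_partition:
  assumes "l \<in> {L2A, L3A, L4A, L4B}"
  shows "distinct (concat (cycs l))" "set (concat (cycs l)) = set isos" "[] \<notin> set (cycs l)"
  using assms by (auto simp: isos_def)

lemma onl_iff: "onl p q \<longleftrightarrow> (\<exists>c. p = sv c q)"
  unfolding onl_def is_mult_def list_ex_iff by (metis f9s)

lemma sv_0: "sv 0 v = V 0 0 0" by (cases v) simp

lemma isos_cover: "hf v v = 0 \<Longrightarrow> v \<noteq> V 0 0 0 \<Longrightarrow> \<exists>w\<in>set isos. \<exists>c. c \<noteq> 0 \<and> v = sv c w"
proof -
  assume h: "hf v v = 0" and n: "v \<noteq> V 0 0 0"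
  have "iso_cov v" using iso_checks(1) vecs[of v] by (simp only: list_all_iff)
  then have "\<exists>w\<in>set isos. onl v w" using h n unfolding iso_cov_def zero_f9_def by (simp add: list_ex_iff)
  then obtain w c where w: "w \<in> set isos" "v = sv c w" unfolding onl_iff by blast
  moreover have "c \<noteq> 0" using n w(2) sv_0 by auto
  ultimately show ?thesis by blast
qed

lemma isos_normal: "v \<in> set isos \<Longrightarrow> w \<in> set isos \<Longrightarrow> v = sv c w \<Longrightarrow> v = w"
proof -
  assume v: "v \<in> set isos" and w: "w \<in> set isos" and e: "v = sv c w"
  have "eq_if_onl v w" using iso_checks(2) v w unfolding iso_normal_def by (simp only: list_all_iff)
  then show ?thesis using e onl_iff unfolding eq_if_onl_def by metis
qed

lemma isos_isotropic: "v \<in> set isos \<Longrightarrow> hf v v = 0 \<and> v \<noteq> V 0 0 0"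
proof -
  have "\<forall>v\<in>set isos. hf v v = 0 \<and> v \<noteq> V 0 0 0" by (simp add: isos_def zero_f9_def)
  then show "v \<in> set isos \<Longrightarrow> hf v v = 0 \<and> v \<noteq> V 0 0 0" by blast
qed

definition quad_labs :: "lab list list" where
  "quad_labs = [[L3A, L3A, L3A, L4B], [L4A, L4A, L4A, L4B], [L2A, L2A, L3A, L4A], [L4A, L4A, L4A, L2A], [L4A, L4A, L3A, L3A]]"

lemma quad_labs_certs: "map fst target_certs = quad_labs"
  by (simp add: target_certs_def quad_labs_def)

text \<open>Equality of multisets in a form that rewriting can evaluate.\<close>

definition same_counts :: "lab list \<Rightarrow> lab list \<Rightarrow> bool" where
  "same_counts p q \<longleftrightarrow> list_all (\<lambda>x. count_list p x = count_list q x) (inns @ outs)"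
definition quad_of :: "lab list \<Rightarrow> lab list \<Rightarrow> bool" where
  "quad_of t q \<longleftrightarrow> (if same_counts t q then True else same_counts (map lsig t) q)"

lemma same_counts_mset: "same_counts p q \<Longrightarrow> mset p = mset q"
  unfolding same_counts_def by (rule multiset_eqI) (use all_labs in \<open>force simp: count_mset\<close>)

lemma targets_quads_check: "list_all (\<lambda>t. list_ex (quad_of t) quad_labs) targets" by code_simp

lemma targets_quads:
  assumes "t \<in> set targets"
  shows "\<exists>q\<in>set quad_labs. mset t = mset q \<or> mset (map lsig t) = mset q"
proof -
  have "\<exists>q\<in>set quad_labs. quad_of t q" using targets_quads_check assms by (simp only: list_all_iff list_ex_iff)
  then show ?thesis using same_counts_mset unfolding quad_of_def by meson
qed

text \<open>The numbers of entries 2A and 3A are unchanged by \<open>lsig\<close> and already tell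
  the five lists apart: (0, 3), (0, 0), (2, 1), (1, 0) and (0, 2).\<close>

lemma quad_labs_distinct:
  assumes "j < 5" "k < 5"
    "mset (quad_labs ! j) = mset (quad_labs ! k) \<or> mset (map lsig (quad_labs ! j)) = mset (quad_labs ! k)"
  shows "j = k"
proof -
  define f where "f q = (count (mset q) L2A, count (mset q) L3A)" for q
  have "lsig l = L2A \<longleftrightarrow> l = L2A" "lsig l = L3A \<longleftrightarrow> l = L3A" for l by (cases l; simp)+
  then have "f (map lsig q) = f q" for q unfolding f_def by (induction q) auto
  moreover have "f p = f q" if "mset p = mset q" for p q using that by (simp only: f_def)
  ultimately have "f (quad_labs ! j) = f (quad_labs ! k)" using assms(3) by metis
  moreover have "j = 0 \<or> j = 1 \<or> j = 2 \<or> j = 3 \<or> j = 4" "k = 0 \<or> k = 1 \<or> k = 2 \<or> k = 3 \<or> k = 4"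
    using assms(1,2) by linarith+
  ultimately show ?thesis by (elim disjE) (simp_all add: quad_labs_def f_def)
qed

lemma orb_L1A: "orb L1A = {(mid, False)}"
proof -
  have h: "hcj G (rep L1A) = (mid, False)" if "su G" for G using that by (simp add: mid_def[symmetric] su_mct)
  have "orb L1A \<subseteq> {(mid, False)}" unfolding orb_def by (auto simp: h simp del: rep.simps hcj.simps)
  moreover have "rep L1A = (mid, False)" by (simp add: mid_def)
  ultimately show ?thesis using rep_in_orb[of L1A] by (simp del: rep.simps) blast
qed

lemma nontrivial_orb:
  assumes "x \<in> orb l"
  shows "x \<noteq> (mid, False) \<longleftrightarrow> l \<noteq> L1A"
proof (cases "l = L1A")
  case True
  then show ?thesis using assms orb_L1A by simp
next
  case False
  then show ?thesis using orb_disjoint[OF assms, of L1A] orb_L1A by auto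
qed

section \<open>Class quadruples as lists of labels\<close>

lemma class_quadruple_GG:
  assumes "class_quadruple GG Cs"
  obtains ls where "length ls = 4" "set ls \<subseteq> set ninn" "Cs = map orb ls"
proof -
  have "\<exists>l. l \<in> set ninn \<and> C = orb l" if hC: "C \<in> set Cs" for C
  proof -
    obtain x where x: "x \<in> Gam" "x \<noteq> (mid, False)" "C = conjugacy_class GG x"
      using assms hC unfolding class_quadruple_def GG_simps by blast
    obtain l where l: "x \<in> orb l" using x(1) Gam_HH orb_partition by blast
    have li: "l \<in> set inns" using snd_orb[OF l] x(1) inns_outs by (cases x) (auto simp: Gam_iff)
    moreover have "l \<noteq> L1A" using x(2) nontrivial_orb[OF l] by blast
    ultimately have "l \<in> set ninn" by (auto simp: ninn_def inns_def)
    then show ?thesis using class_GG[OF l li] x(3) by blast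
  qed
  then obtain c where c: "\<forall>C\<in>set Cs. c C \<in> set ninn \<and> C = orb (c C)" by metis
  have "length (map c Cs) = 4" using assms by (simp add: class_quadruple_def)
  moreover have "set (map c Cs) \<subseteq> set ninn" using c by auto
  moreover have "Cs = map orb (map c Cs)" using c by (simp add: map_idI)
  ultimately show thesis by (rule that)
qed

lemma class_quadruple_HH:
  assumes "class_quadruple HH Cs"
  obtains ls where "length ls = 4" "set ls \<subseteq> set hinn \<union> set outs" "Cs = map (union_orb \<circ> hl) ls"
proof -
  have "\<exists>l. l \<in> set hinn \<union> set outs \<and> C = (union_orb \<circ> hl) l" if hC: "C \<in> set Cs" for C
  proof -
    obtain x where x: "x \<in> carrier HH" "x \<noteq> (mid, False)" "C = conjugacy_class HH x"
      using assms hC unfolding class_quadruple_def HH_simps(2) by blast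
    obtain l where l: "x \<in> orb l" using x(1) orb_partition by blast
    have "l \<noteq> L1A" using x(2) nontrivial_orb[OF l] by blast
    then have "l \<in> set hinn \<union> set outs \<or> lsig l \<in> set hinn \<union> set outs" by (cases l) (simp_all add: hinn_def outs_def)
    moreover have "C = union_orb (hl l)" using class_HH[OF l] x(3) by simp
    moreover have "union_orb (hl (lsig l)) = union_orb (hl l)" by (simp add: union_orb_def set_hl Un_commute)
    ultimately show ?thesis by auto
  qed
  then obtain c where c: "\<forall>C\<in>set Cs. c C \<in> set hinn \<union> set outs \<and> C = (union_orb \<circ> hl) (c C)" by metis
  have "length (map c Cs) = 4" using assms by (simp add: class_quadruple_def)
  moreover have "set (map c Cs) \<subseteq> set hinn \<union> set outs" using c by auto
  moreover have "map (union_orb \<circ> hl) (map c Cs) = Cs" unfolding map_map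
    by (rule map_idI) (use c in simp)
  ultimately show thesis using that by metis
qed

context
  fixes ii :: "'k::field"
  assumes card9: "CARD('k) = 9" and ii: "ii ^ 2 = -1"
begin

abbreviation (input) "cls \<equiv> \<lambda>l. theta ii ` orb l"

lemmas iso_facts = theta_iso[OF card9 ii]
lemmas SU3_group = group_SU3[OF card9 ii]

lemma isotropic_points_eq: "isotropic_points = line ii ` set isos"
proof (intro subset_antisym subsetI)
  fix P :: "('k ^ 3) set" assume "P \<in> isotropic_points"
  then obtain u where u: "P = vec.span {u}" "u \<noteq> 0" "hermitian_form u u = 0" unfolding isotropic_points_def by blast
  obtain v where v: "vphi ii v = u" using vphi_surj[OF card9 ii] by blast
  have "hf v v = 0" using u(3) hermitian_vphi[OF card9 ii, of v v] phi_eq_0[OF card9 ii] v by simp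
  moreover have "v \<noteq> V 0 0 0" using u(2) v by (auto simp: vphi_0 simp del: vphi.simps)
  ultimately obtain w c where w: "w \<in> set isos" "c \<noteq> 0" "v = sv c w" using isos_cover by blast
  have "P = line ii w" using line_sv[OF card9 ii w(2), of w] unfolding u(1) line_def w(3)[symmetric] v by simp
  then show "P \<in> line ii ` set isos" using w(1) by blast
next
  fix P assume "P \<in> line ii ` set isos"
  then obtain v where v: "v \<in> set isos" "P = line ii v" by blast
  have "hermitian_form (vphi ii v) (vphi ii v) = 0" "vphi ii v \<noteq> 0"
    using isos_isotropic[OF v(1)] vphi_nonzero[OF card9 ii] hermitian_vphi[OF card9 ii] by (auto simp: phi_0)
  then show "P \<in> isotropic_points" unfolding isotropic_points_def v(2) line_def by blast
qed

text \<open>A unitary matrix preserves isotropy and acts injectively on lines, hence bijectively on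
  the finite set of isotropic points.\<close>

lemma moved_isos:
  assumes G: "su G"
  shows "inj_on (\<lambda>v. line ii (mv G v)) (set isos)" "(\<lambda>v. line ii (mv G v)) ` set isos = isotropic_points"
proof -
  have inj: "inj_on (\<lambda>v. line ii (mv G v)) (set isos)" if G: "su G" for G
  proof (rule inj_onI)
    fix v w assume v: "v \<in> set isos" and w: "w \<in> set isos" and "line ii (mv G v) = line ii (mv G w)"
    then obtain c where c: "mv G v = sv c (mv G w)" using line_eqD[OF card9 ii] by blast
    have "v = mv (mct G) (mv G v)" using mv_cancel(2)[OF G] by simp
    also have "\<dots> = sv c w" unfolding c mv_linear(2) mv_cancel(2)[OF G] ..
    finally show "v = w" using isos_normal[OF v w] by blast
  qed
  have "inj_on (line ii) (set isos)" using inj[OF su_closed(4)] by simp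
  then have c: "card (isotropic_points :: ('k ^ 3) set set) = card (set isos)"
    unfolding isotropic_points_eq by (rule card_image)
  have "(\<lambda>v. line ii (mv G v)) ` set isos \<subseteq> isotropic_points"
  proof (intro image_subsetI)
    fix v assume v: "v \<in> set isos"
    have n: "mv G v \<noteq> V 0 0 0" using isos_isotropic[OF v] mv_cancel(2)[OF G, of v] mv_zero[of "mct G"] by metis
    have "hf (mv G v) (mv G v) = 0" using isos_isotropic[OF v] by (simp add: hf_mct mv_cancel[OF G])
    then obtain w c where w: "w \<in> set isos" "c \<noteq> 0" "mv G v = sv c w" using isos_cover n by blast
    then show "line ii (mv G v) \<in> isotropic_points" unfolding isotropic_points_eq w(3) line_sv[OF card9 ii w(2)] by blast
  qed
  moreover have "finite (isotropic_points :: ('k ^ 3) set set)" unfolding isotropic_points_eq by simp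
  ultimately show "(\<lambda>v. line ii (mv G v)) ` set isos = isotropic_points"
    using card_subset_eq card_image[OF inj[OF G]] c by metis
  show "inj_on (\<lambda>v. line ii (mv G v)) (set isos)" using inj[OF G] .
qed

lemma card_isotropic_points: "card (isotropic_points :: ('k ^ 3) set set) = 28"
proof -
  have "card (isotropic_points :: ('k ^ 3) set set) = card (set isos)"
    using card_image[OF moved_isos(1)[OF su_closed(4)]] moved_isos(2)[OF su_closed(4)] by simp
  also have "\<dots> = 28" unfolding distinct_card[OF distinct_isos] by (simp add: isos_def)
  finally show ?thesis .
qed

text \<open>Conjugation by \<open>G\<close> carries the cycles of the representative to those of
  \<open>x\<close>, so the listed cycles give the number for the whole class.\<close>

lemma num_cycles_orb:
  assumes x: "x \<in> orb l" and l: "l \<in> {L2A, L3A, L4A, L4B}"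
  shows "num_cycles isotropic_points (point_action (theta ii x)) = length (cycs l)"
proof -
  note part = cycs_partition[OF l]
  obtain G where G: "su G" "x = hcj G (rep l)" using x unfolding orb_def by blast
  obtain A where A: "rep l = (A, False)" using l by auto
  have sA: "su A" using rep_HH[of l] unfolding A by simp
  let ?f = "\<lambda>v. line ii (mv G v)" and ?p = "point_action (theta ii x)"
  note f = moved_isos[OF G(1)]
  have step: "?p (?f v) = line ii (mv G (mv A v))" for v
    unfolding G(2) A theta_def by (simp add: point_action_line[OF card9 ii] mv_mm mv_cancel[OF G(1)])
  have cyc: "\<forall>j<length cs. ?p (?f (cs ! j)) = ?f (cs ! (Suc j mod length cs))" if cs: "cs \<in> set (cycs l)" for cs
  proof (intro allI impI)
    fix j assume j: "j < length cs"
    have "cycs_ok l" using cycs_checks l by (auto simp: list_all_iff)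
    then have "is_cycle A cs" using cs unfolding cycs_ok_def A by (simp add: list_all_iff)
    then have "maps_onl A (cs ! j) (rotate1 cs ! j)" using j unfolding is_cycle_def by (simp add: list_all2_conv_all_nth)
    then obtain c where c: "mv A (cs ! j) = sv c (cs ! (Suc j mod length cs))"
      unfolding maps_onl_def onl_iff nth_rotate1[OF j] by blast
    have "cs ! j \<in> set isos" using part(2) cs nth_mem[OF j] by auto
    then have "mv A (cs ! j) \<noteq> V 0 0 0"
      using isos_isotropic mv_cancel(2)[OF sA, of "cs ! j"] mv_zero[of "mct A"] by metis
    then have "c \<noteq> 0" using c sv_0 by auto
    then show "?p (?f (cs ! j)) = ?f (cs ! (Suc j mod length cs))"
      unfolding step c mv_linear(2) by (rule line_sv[OF card9 ii])
  qed
  have orbit: "orbit ?p (?f v) = ?f ` set cs" if cs: "cs \<in> set (cycs l)" and v: "v \<in> set cs" for v cs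
  proof -
    obtain i where "i < length cs" "v = cs ! i" using v by (metis in_set_conv_nth)
    then show ?thesis using orbit_eq_cycle[where f = ?f and p = ?p, OF cyc[OF cs]] by simp
  qed
  have "orbit ?p ` isotropic_points = (\<lambda>cs. ?f ` set cs) ` set (cycs l)"
  proof (intro subset_antisym subsetI)
    fix S assume "S \<in> orbit ?p ` isotropic_points"
    then obtain v where v: "v \<in> set isos" "S = orbit ?p (?f v)" unfolding f(2)[symmetric] by blast
    obtain cs where "cs \<in> set (cycs l)" "v \<in> set cs" using v(1) part(2) by auto
    then show "S \<in> (\<lambda>cs. ?f ` set cs) ` set (cycs l)" using orbit v(2) by blast
  next
    fix S assume "S \<in> (\<lambda>cs. ?f ` set cs) ` set (cycs l)"
    then obtain cs where cs: "cs \<in> set (cycs l)" "S = ?f ` set cs" by blast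
    then have "cs \<noteq> []" using part(3) by blast
    then have v: "hd cs \<in> set cs" by simp
    have "hd cs \<in> set isos" using v cs(1) part(2) by auto
    then show "S \<in> orbit ?p ` isotropic_points" using orbit[OF cs(1) v] cs(2) unfolding f(2)[symmetric] by blast
  qed
  moreover have "inj_on (\<lambda>cs. ?f ` set cs) (set (cycs l))"
  proof (rule inj_onI)
    fix cs ds assume c: "cs \<in> set (cycs l)" and d: "ds \<in> set (cycs l)" and e: "?f ` set cs = ?f ` set ds"
    have s: "set cs \<subseteq> set isos" "set ds \<subseteq> set isos" using c d part(2) by auto
    have eq: "set cs = set ds" using e unfolding inj_on_image_eq_iff[OF f(1) s] .
    have "cs \<noteq> []" using c part(3) by blast
    then have "set cs \<inter> set ds \<noteq> {}" unfolding eq[symmetric] by simp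
    moreover have "cs \<noteq> ds \<Longrightarrow> set cs \<inter> set ds = {}" using part(1) c d unfolding distinct_concat_iff by simp
    ultimately show "cs = ds" by (rule contrapos_np)
  qed
  moreover have "distinct (cycs l)" using part(1,3) unfolding distinct_concat_iff by (simp add: removeAll_id)
  ultimately show ?thesis unfolding num_cycles_def by (simp add: card_image distinct_card)
qed

lemma quads_eq:
  "[[class_3A, class_3A, class_3A, class_4B ii], [class_4A ii, class_4A ii, class_4A ii, class_4B ii],
    [class_2A, class_2A, class_3A, class_4A ii], [class_4A ii, class_4A ii, class_4A ii, class_2A],
    [class_4A ii, class_4A ii, class_3A, class_3A]] = map (map cls) quad_labs"
  unfolding class_2[OF card9 ii] class_3[OF card9 ii] class_4[OF card9 ii] quad_labs_def by simp

lemma quads_ninn: "q \<in> set quad_labs \<Longrightarrow> length q = 4 \<and> set q \<subseteq> {L2A, L3A, L4A, L4B}"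
  by (auto simp: quad_labs_def)

lemma map_cls: "map cls ls = map ((`) (theta ii)) (map orb ls)" by simp

lemma SU3_mu:
  assumes "set ls \<subseteq> set inns"
  shows "mu SU3 (map cls ls) = mu GG (map orb ls)" "mu_bar SU3 (map cls ls) = mu_bar GG (map orb ls)"
proof -
  have c: "\<forall>C\<in>set (map orb ls). C \<subseteq> carrier GG"
  proof
    fix C assume "C \<in> set (map orb ls)"
    then obtain l where "l \<in> set ls" "C = orb l" by auto
    then show "C \<subseteq> carrier GG" using assms orb_Gam by simp blast
  qed
  show "mu SU3 (map cls ls) = mu GG (map orb ls)" "mu_bar SU3 (map cls ls) = mu_bar GG (map orb ls)"
    unfolding map_cls by (rule iso_mu[OF group_GG SU3_group iso_facts c])+
qed

lemma SU3_strictly_rigid: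
  assumes q: "q \<in> set quad_labs"
  shows "class_quadruple SU3 (map cls q)" "strictly_rigid SU3 (map cls q)"
proof -
  obtain t where "(q, t) \<in> set target_certs" using q unfolding quad_labs_certs[symmetric] by auto
  then have r: "strictly_rigid GG (map orb q)" "set q \<subseteq> set ninn" by (rule GG_strictly_rigid)+
  then have i: "set q \<subseteq> set inns" using ninn_inns by blast
  then show "strictly_rigid SU3 (map cls q)" using r(1) by (simp add: strictly_rigid_def rigid_def SU3_mu)
  have "\<exists>x\<in>carrier GG. x \<noteq> \<one>\<^bsub>GG\<^esub> \<and> orb l = conjugacy_class GG x" if "l \<in> set q" for l
  proof (intro bexI conjI)
    have l: "l \<in> set inns" using i that by blast
    show "orb l = conjugacy_class GG (rep l)" using class_GG[OF rep_in_orb l] by simp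
    show "rep l \<in> carrier GG" using rep_Gam[OF l] by (simp del: rep.simps)
    have "l \<noteq> L1A" using r(2) that by (auto simp: ninn_def inns_def)
    then show "rep l \<noteq> \<one>\<^bsub>GG\<^esub>" using nontrivial_orb[OF rep_in_orb] by simp
  qed
  then have "class_quadruple GG (map orb q)" using quads_ninn[OF q] by (auto simp: class_quadruple_def)
  then show "class_quadruple SU3 (map cls q)"
    unfolding map_cls by (rule iso_class_quadruple[OF group_GG SU3_group iso_facts])
qed

lemma outer_map:
  assumes "set ls \<subseteq> set inns"
  shows "map ((`) outer_involution) (map cls ls) = map cls (map lsig ls)"
  unfolding map_map comp_def by (rule map_cong[OF refl], rule outer_orb[OF card9 ii]) (use assms in blast)

lemma SU3_rigid:
  assumes "class_quadruple SU3 C" "rigid SU3 C" "mu_bar SU3 C < 4"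
  shows "\<exists>q\<in>set quad_labs. same_up_to_outer C (map cls q)"
proof -
  obtain Cs where Cs: "class_quadruple GG Cs" "C = map ((`) (theta ii)) Cs"
    using iso_class_quadrupleE[OF group_GG SU3_group iso_facts assms(1)] by metis
  obtain ls where ls: "length ls = 4" "set ls \<subseteq> set ninn" "Cs = map orb ls" using class_quadruple_GG[OF Cs(1)] by metis
  have C: "C = map cls ls" unfolding Cs(2) ls(3) by simp
  have i: "set ls \<subseteq> set inns" using ls(2) ninn_inns by blast
  obtain t where "t \<in> set targets" "mset ls = mset t"
    using GG_rigid[OF ls(1,2)] assms(2,3) unfolding C rigid_def SU3_mu[OF i] by blast
  then obtain q where q: "q \<in> set quad_labs" "mset ls = mset q \<or> mset (map lsig ls) = mset q"
    using targets_quads by (metis mset_map)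
  have o: "map ((`) outer_involution) C = map cls (map lsig ls)" unfolding C by (rule outer_map[OF i])
  have "mset C = mset (map cls q) \<or> mset (map ((`) outer_involution) C) = mset (map cls q)"
    unfolding o unfolding C using q(2) by (metis mset_map)
  then show ?thesis using q(1) unfolding same_up_to_outer_def by blast
qed

lemma cls_inj: "inj_on cls (set inns)"
proof (rule inj_onI)
  fix k l assume k: "k \<in> set inns" and l: "l \<in> set inns" and "theta ii ` orb k = theta ii ` orb l"
  then have "orb k = orb l" using inj_on_image_eq_iff[OF theta_inj[OF card9 ii] orb_Gam orb_Gam] by blast
  then show "k = l" using rep_in_orb[of k] orb_disjoint by metis
qed

lemma mset_cls:
  assumes "set p \<subseteq> set inns" "set q \<subseteq> set inns" "mset (map cls p) = mset (map cls q)"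
  shows "mset p = mset q"
proof -
  have "map (inv_into (set inns) cls) (map cls r) = r" if "set r \<subseteq> set inns" for r
    unfolding map_map comp_def by (rule map_idI, rule inv_into_f_f[OF cls_inj]) (use that in blast)
  then have "mset r = image_mset (inv_into (set inns) cls) (mset (map cls r))" if "set r \<subseteq> set inns" for r
    unfolding mset_map[symmetric] using that by simp
  from this[OF assms(1)] this[OF assms(2)] show ?thesis unfolding assms(3) by (simp only:)
qed

lemma quads_distinct:
  assumes j: "j < 5" and k: "k < 5"
    and s: "same_up_to_outer (map cls (quad_labs ! j)) (map cls (quad_labs ! k))"
  shows "j = k"
proof -
  let ?p = "quad_labs ! j" and ?q = "quad_labs ! k"
  have "?p \<in> set quad_labs" "?q \<in> set quad_labs"
    using j k by (intro nth_mem, simp add: quad_labs_def)+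
  then have sub: "set ?p \<subseteq> {L2A, L3A, L4A, L4B}" "set ?q \<subseteq> {L2A, L3A, L4A, L4B}" using quads_ninn by blast+
  have l: "l \<in> set inns" "lsig l \<in> set inns" if "l \<in> {L2A, L3A, L4A, L4B}" for l
    using that by (auto simp: inns_def)
  have i: "set ?p \<subseteq> set inns" "set ?q \<subseteq> set inns" "set (map lsig ?p) \<subseteq> set inns"
    unfolding set_map using sub l by blast+
  have o: "map ((`) outer_involution) (map cls ?p) = map cls (map lsig ?p)" by (rule outer_map[OF i(1)])
  have "mset ?p = mset ?q \<or> mset (map lsig ?p) = mset ?q"
    using s mset_cls[OF i(1,2)] mset_cls[OF i(3,2)] unfolding same_up_to_outer_def o by blast
  then show ?thesis by (rule quad_labs_distinct[OF j k])
qed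

lemma genus_quads:
  assumes j: "j < 5" and gs: "gs \<in> Sigma_gen SU3 (map cls (quad_labs ! j))"
  shows "cover_has_genus (isotropic_points :: ('k ^ 3) set set) (map point_action gs) ([9, 9, 3, 6, 9] ! j)"
proof -
  let ?q = "quad_labs ! j"
  have q: "?q \<in> set quad_labs" using j by (intro nth_mem) (simp add: quad_labs_def)
  have l2: "list_all2 (\<in>) gs (map cls ?q)" using gs by (simp add: Sigma_gen_def Sigma_bar_def)
  have "map (\<lambda>g. num_cycles isotropic_points (point_action g)) gs = map (\<lambda>l. length (cycs l)) ?q"
  proof (rule nth_equalityI)
    show "length (map (\<lambda>g. num_cycles isotropic_points (point_action g)) gs) = length (map (\<lambda>l. length (cycs l)) ?q)"
      using list_all2_lengthD[OF l2] by simp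
    fix i assume "i < length (map (\<lambda>g. num_cycles isotropic_points (point_action g)) gs)"
    then have i: "i < length gs" "i < length ?q" using list_all2_lengthD[OF l2] by simp_all
    then have "gs ! i \<in> theta ii ` orb (?q ! i)" using list_all2_nthD[OF l2 i(1)] by simp
    then obtain x where x: "x \<in> orb (?q ! i)" "gs ! i = theta ii x" by blast
    have "?q ! i \<in> {L2A, L3A, L4A, L4B}" using quads_ninn[OF q] nth_mem[OF i(2)] by blast
    then show "map (\<lambda>g. num_cycles isotropic_points (point_action g)) gs ! i = map (\<lambda>l. length (cycs l)) ?q ! i"
      using num_cycles_orb[OF x(1)] x(2) i by simp
  qed
  then have "map (\<lambda>p. int (num_cycles isotropic_points p)) (map point_action gs) = map (\<lambda>l. int (length (cycs l))) ?q"
    by (metis (no_types, lifting) list.map_comp comp_apply map_eq_conv)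
  moreover have "length gs = 4" using list_all2_lengthD[OF l2] quads_ninn[OF q] by simp
  moreover have "j = 0 \<or> j = 1 \<or> j = 2 \<or> j = 3 \<or> j = 4" using j by linarith
  ultimately show ?thesis unfolding cover_has_genus_def card_isotropic_points
    by (elim disjE) (simp_all add: quad_labs_def)
qed

text \<open>Following \<open>conj_aut\<close> by transport along \<open>theta\<close> identifies the
  model of the extension with the automorphism group, so \<open>HH_not_rigid\<close>
  applies.\<close>

lemma AutoGroup_not_rigid:
  assumes "class_quadruple (AutoGroup (SU3 :: ('k ^ 3 ^ 3) monoid)) C" "rigid (AutoGroup (SU3 :: ('k ^ 3 ^ 3) monoid)) C"
  shows "\<not> mu_bar (AutoGroup (SU3 :: ('k ^ 3 ^ 3) monoid)) C < 4"
proof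
  let ?A = "AutoGroup (SU3 :: ('k ^ 3 ^ 3) monoid)"
  assume m: "mu_bar ?A C < 4"
  obtain f where f: "f \<in> iso HH ?A"
    using iso_compose[OF conj_aut_iso iso_AutoGroup[OF group_GG SU3_group iso_facts]] by blast
  have A: "group ?A" by (rule group.AutoGroup[OF SU3_group])
  note H = HH.group_axioms
  obtain Cs where Cs: "class_quadruple HH Cs" "C = map ((`) f) Cs" "\<forall>C\<in>set Cs. C \<subseteq> carrier HH"
    using iso_class_quadrupleE[OF H A f assms(1)] by metis
  obtain ls where ls: "length ls = 4" "set ls \<subseteq> set hinn \<union> set outs" "Cs = map (union_orb \<circ> hl) ls"
    using class_quadruple_HH[OF Cs(1)] by metis
  have "rigid HH Cs" "mu_bar HH Cs < 4"
    using assms(2) m iso_mu[OF H A f Cs(3)] unfolding Cs(2) rigid_def by simp_all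
  then show False using HH_not_rigid[OF ls(1,2)] unfolding ls(3) by blast
qed

end

theorem proposition3p1:
  fixes ii :: "'k::field"
  assumes "CARD('k) = 9"
    and "ii ^ 2 = -1"
  shows
    "let \<Gamma> = (SU3 :: ('k ^ 3 ^ 3) monoid);
         \<Gamma>2 = AutoGroup \<Gamma>;
         points = (isotropic_points :: ('k ^ 3) set set);
         quads = [[class_3A, class_3A, class_3A, class_4B ii],
                  [class_4A ii, class_4A ii, class_4A ii, class_4B ii],
                  [class_2A, class_2A, class_3A, class_4A ii],
                  [class_4A ii, class_4A ii, class_4A ii, class_2A],
                  [class_4A ii, class_4A ii, class_3A, class_3A]];
         genera = [9, 9, 3, 6, 9]
     in
       (\<not> (\<exists>C. class_quadruple \<Gamma>2 C \<and> strictly_rigid \<Gamma>2 C)) \<and>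

       (\<forall>D\<in>set quads. class_quadruple \<Gamma> D \<and> strictly_rigid \<Gamma> D) \<and>
       (\<forall>C. class_quadruple \<Gamma> C \<and> strictly_rigid \<Gamma> C \<longrightarrow>
            (\<exists>D\<in>set quads. same_up_to_outer C D)) \<and>
       (\<forall>j<5. \<forall>k<5. same_up_to_outer (quads ! j) (quads ! k) \<longrightarrow> j = k) \<and>
       card points = 28 \<and>
       (\<forall>j<5. \<forall>gs\<in>Sigma_gen \<Gamma> (quads ! j).
            cover_has_genus points (map point_action gs) (genera ! j)) \<and>

       (\<forall>C. class_quadruple \<Gamma> C \<and> rigid \<Gamma> C \<and> mu_bar \<Gamma> C < 4 \<longrightarrow>
            (\<exists>D\<in>set quads. same_up_to_outer C D)) \<and>
       (\<not> (\<exists>C. class_quadruple \<Gamma>2 C \<and> rigid \<Gamma>2 C \<and> mu_bar \<Gamma>2 C < 4))"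
proof -
  let ?c = "\<lambda>l. theta ii ` orb l"
  have nth: "map (map ?c) quad_labs ! j = map ?c (quad_labs ! j)" if "j < 5" for j
    using that by (intro nth_map) (simp add: quad_labs_def)
  \<comment> \<open>Strict rigidity means that \<open>mu_bar\<close> is 1, which is below 4. So the
    results with the bound 4 also settle the strictly rigid quadruples.\<close>
  have sr: "rigid K C \<and> mu_bar K C < 4" if "strictly_rigid K C" for K :: "('z, 'y) monoid_scheme" and C
    using that by (simp add: strictly_rigid_def)
  have r: "\<exists>D\<in>set (map (map ?c) quad_labs). same_up_to_outer C D"
    if "class_quadruple SU3 C" "rigid SU3 C" "mu_bar SU3 C < 4" for C
    using SU3_rigid[OF assms that] by simp
  show ?thesis unfolding Let_def quads_eq[OF assms]
  proof (intro conjI allI ballI impI notI)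
    show "False" if "\<exists>C. class_quadruple (AutoGroup (SU3 :: ('k ^ 3 ^ 3) monoid)) C \<and> strictly_rigid (AutoGroup (SU3 :: ('k ^ 3 ^ 3) monoid)) C"
      using that AutoGroup_not_rigid[OF assms] sr by blast
    show "False" if "\<exists>C. class_quadruple (AutoGroup (SU3 :: ('k ^ 3 ^ 3) monoid)) C \<and> rigid (AutoGroup (SU3 :: ('k ^ 3 ^ 3) monoid)) C
        \<and> mu_bar (AutoGroup (SU3 :: ('k ^ 3 ^ 3) monoid)) C < 4"
      using that AutoGroup_not_rigid[OF assms] by blast
    show "class_quadruple SU3 D" "strictly_rigid SU3 D" if "D \<in> set (map (map ?c) quad_labs)" for D
      using that SU3_strictly_rigid[OF assms] by auto
    show "\<exists>D\<in>set (map (map ?c) quad_labs). same_up_to_outer C D"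
      if "class_quadruple SU3 C \<and> strictly_rigid SU3 C" for C
      using that r sr by blast
    show "\<exists>D\<in>set (map (map ?c) quad_labs). same_up_to_outer C D"
      if "class_quadruple SU3 C \<and> rigid SU3 C \<and> mu_bar SU3 C < 4" for C
      using that r by blast
    show "j = k" if "j < 5" "k < 5" "same_up_to_outer (map (map ?c) quad_labs ! j) (map (map ?c) quad_labs ! k)" for j k
      using quads_distinct[OF assms that(1,2)] that(3) unfolding nth[OF that(1)] nth[OF that(2)] by blast
    show "card (isotropic_points :: ('k ^ 3) set set) = 28" by (rule card_isotropic_points[OF assms])
    show "cover_has_genus (isotropic_points :: ('k ^ 3) set set) (map point_action gs) ([9, 9, 3, 6, 9] ! j)"
      if "j < 5" "gs \<in> Sigma_gen SU3 (map (map ?c) quad_labs ! j)" for j gs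
      using genus_quads[OF assms that(1)] that(2) unfolding nth[OF that(1)] by blast
  qed
qed

end
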